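(* Let $k$ be an even number and not divisible by $4$, and let $C$ be a free and LCD code over $\mathbb{Z}/k\mathbb{Z}$ with length $n$. For any $i\in\{1,2\}$, let $O_i$ be an orthonormal matrix of size $n$ and define $L_i=O_i(C+k\mathbb{Z}^n)$. Then the lattice isomorphism problem (LIP) of $L_1$ and $L_2$ can be reduced to $\mathbb{Z}$LIP and the graph isomorphism problem (GI) for graphs with vertex size $3n$.
   Context: Codes. A linear code of length $n$ over a finite ring $R$ is a submodule $C$ of $R^n$. When $C=\{cG : c\in R^m\}$, where $G$ is an $m\times n$ matrix over $R$ and no row of $G$ is a linear combination of the other rows, $G$ is called the generator matrix of $C$. A linear code $C$ over $R$ with generator matrix $G$ is called free if all the row vectors of $G$ are linearly independent over $R$. The dual code is $C^\perp=\{x\in R^n : x\cdot c=0 \text{ for all } c\in C\}$, and $C$ is LCD if $C\cap C^\perp=\{0\}$. Construction A. For a code $C$ over $\mathbb{Z}/k\mathbb{Z}$ of length $n$, $C+k\mathbb{Z}^n=\{x\in\mathbb{Z}^n : (x \bmod k)\in C\}$, with reduction mod $k$ taken coordinatewise. Lattice problems. A lattice is a discrete subgroup of $\mathbb{R}^n$ consisting of the integer linear combinations of some vectors $v_1,\dots,v_m$. Lattices $L_1,L_2$ are isomorphic if there is an orthonormal (i.e. real orthogonal) matrix $O$ with $L_1=OL_2$. LIP means the search version: find the orthonormal matrix that transforms $L_1$ into $L_2$. When $L_2=\mathbb{Z}^n$ the problem is called $\mathbb{Z}$LIP. Graph problem. A graph $(V,E)$ consists of a finite vertex set $V$ and a set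 $E$ of edges, each a 2-element subset of $V$; with a map $w:E\to\mathbb{R}$ it is a weighted graph $(V,E,w)$. Its adjacency matrix is the $|V|\times|V|$ matrix with $A_{ij}=w(\{i,j\})$ if $\{i,j\}\in E$ and $A_{ij}=0$ otherwise. Weighted graphs with adjacency matrices $A_1,A_2$ are isomorphic if $A_1=P^\top A_2P$ for some permutation matrix $P$. GI: distinguish whether two given graphs are isomorphic and, if they are, determine the permutation matrix $P$. *)

theory Defs
  imports
    Complex_Main
    "HOL-Number_Theory.Residues"
    "HOL-Combinatorics.Permutations"
    "Jordan_Normal_Form.Matrix"
begin

section \<open>Codes over the ring of integers modulo k\<close>

definition vec_mod :: "nat \<Rightarrow> int vec \<Rightarrow> int vec" where
  "vec_mod k v = map_vec (\<lambda>a. a mod int k) v"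

text \<open>The module of vectors of length n over the ring \<open>residue_ring (int k)\<close>, whose elements are
  the representatives \<open>0, \<dots>, k - 1\<close>.  The fields \<open>mult\<close> and \<open>one\<close> of the record play no role in
  a module.\<close>

definition Zk_module :: "nat \<Rightarrow> nat \<Rightarrow> (int, int vec) module" where
  "Zk_module k n =
     \<lparr>carrier = {v \<in> carrier_vec n. \<forall>i<n. v $ i \<in> carrier (residue_ring (int k))},
      monoid.mult = (\<lambda>u v. undefined), one = undefined,
      zero = 0\<^sub>v n, add = (\<lambda>u v. vec_mod k (u + v)),
      smult = (\<lambda>a v. vec_mod k (a \<cdot>\<^sub>v v))\<rparr>"

abbreviation Zk_vec :: "nat \<Rightarrow> nat \<Rightarrow> int vec set" where
  "Zk_vec k n \<equiv> carrier (Zk_module k n)"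

definition linear_code :: "nat \<Rightarrow> nat \<Rightarrow> int vec set \<Rightarrow> bool" where
  "linear_code k n C \<longleftrightarrow> submodule C (residue_ring (int k)) (Zk_module k n)"

text \<open>The row vector \<open>c G\<close> over the integers modulo k.\<close>

definition row_comb :: "nat \<Rightarrow> int vec \<Rightarrow> int mat \<Rightarrow> int vec" where
  "row_comb k c G = vec_mod k (transpose_mat G *\<^sub>v c)"

definition generator_matrix :: "nat \<Rightarrow> nat \<Rightarrow> nat \<Rightarrow> int mat \<Rightarrow> int vec set \<Rightarrow> bool" where
  "generator_matrix k m n G C \<longleftrightarrow>
     G \<in> carrier_mat m n \<and> (\<forall>i<m. row G i \<in> Zk_vec k n) \<and>
     C = {row_comb k c G | c. c \<in> Zk_vec k m} \<and>
     (\<forall>i<m. \<not> (\<exists>c \<in> Zk_vec k m. c $ i = 0 \<and> row_comb k c G = row G i))"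

definition rows_independent :: "nat \<Rightarrow> nat \<Rightarrow> nat \<Rightarrow> int mat \<Rightarrow> bool" where
  "rows_independent k m n G \<longleftrightarrow> (\<forall>c \<in> Zk_vec k m. row_comb k c G = 0\<^sub>v n \<longrightarrow> c = 0\<^sub>v m)"

text \<open>Over \<open>\<int>/k\<close> one code can have generator matrices of different sizes (over \<open>\<int>/6\<close> the code of
  length 1 consisting of everything has the generator matrices with rows \<open>1\<close> and with rows
  \<open>2, 3\<close>), so a code is free when some generator matrix has independent rows.\<close>

definition free_code :: "nat \<Rightarrow> nat \<Rightarrow> int vec set \<Rightarrow> bool" where
  "free_code k n C \<longleftrightarrow> linear_code k n C \<and>
     (\<exists>m G. generator_matrix k m n G C \<and> rows_independent k m n G)"

definition dual_code :: "nat \<Rightarrow> nat \<Rightarrow> int vec set \<Rightarrow> int vec set" where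
  "dual_code k n C = {x \<in> Zk_vec k n. \<forall>c\<in>C. (x \<bullet> c) mod int k = 0}"

definition LCD_code :: "nat \<Rightarrow> nat \<Rightarrow> int vec set \<Rightarrow> bool" where
  "LCD_code k n C \<longleftrightarrow> linear_code k n C \<and> C \<inter> dual_code k n C = {0\<^sub>v n}"

definition construction_A :: "nat \<Rightarrow> nat \<Rightarrow> int vec set \<Rightarrow> real vec set" where
  "construction_A k n C = {map_vec real_of_int x | x. x \<in> carrier_vec n \<and> vec_mod k x \<in> C}"

section \<open>The lattice isomorphism problem\<close>

definition orthonormal_mat :: "nat \<Rightarrow> real mat \<Rightarrow> bool" where
  "orthonormal_mat n Q \<longleftrightarrow> Q \<in> carrier_mat n n \<and> transpose_mat Q * Q = 1\<^sub>m n"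

definition mat_image :: "real mat \<Rightarrow> real vec set \<Rightarrow> real vec set" where
  "mat_image Q L = (\<lambda>v. Q *\<^sub>v v) ` L"

definition column_lattice :: "real mat \<Rightarrow> real vec set" where
  "column_lattice B = {B *\<^sub>v map_vec real_of_int x | x. x \<in> carrier_vec (dim_col B)}"

definition int_lattice :: "nat \<Rightarrow> real vec set" where
  "int_lattice n = {map_vec real_of_int x | x. x \<in> carrier_vec n}"

definition LIP_solution :: "nat \<Rightarrow> real vec set \<Rightarrow> real vec set \<Rightarrow> real mat \<Rightarrow> bool" where
  "LIP_solution n L1 L2 Q \<longleftrightarrow> orthonormal_mat n Q \<and> L1 = mat_image Q L2"

definition lattice_isomorphic :: "nat \<Rightarrow> real vec set \<Rightarrow> real vec set \<Rightarrow> bool" where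
  "lattice_isomorphic n L1 L2 \<longleftrightarrow> (\<exists>Q. LIP_solution n L1 L2 Q)"

text \<open>Nothing is assumed about the answer on inputs that do not generate a lattice isomorphic to
  \<open>\<int>\<^sup>n\<close>.\<close>

definition ZLIP_oracle :: "nat \<Rightarrow> (real mat \<Rightarrow> real mat) \<Rightarrow> bool" where
  "ZLIP_oracle n zo \<longleftrightarrow>
     (\<forall>B \<in> carrier_mat n n. lattice_isomorphic n (column_lattice B) (int_lattice n) \<longrightarrow>
        LIP_solution n (column_lattice B) (int_lattice n) (zo B))"

section \<open>The graph isomorphism problem\<close>

definition is_graph :: "nat set \<Rightarrow> nat set set \<Rightarrow> bool" where
  "is_graph V E \<longleftrightarrow> finite V \<and> (\<forall>e\<in>E. e \<subseteq> V \<and> card e = 2)"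

definition adjacency_mat :: "nat \<Rightarrow> nat set set \<Rightarrow> (nat set \<Rightarrow> real) \<Rightarrow> real mat" where
  "adjacency_mat N E w = mat N N (\<lambda>(i, j). if {i, j} \<in> E then w {i, j} else 0)"

definition permutation_mat :: "nat \<Rightarrow> real mat \<Rightarrow> bool" where
  "permutation_mat N P \<longleftrightarrow>
     (\<exists>\<pi>. \<pi> permutes {0..<N} \<and> P = mat N N (\<lambda>(i, j). if i = \<pi> j then 1 else 0))"

definition graph_iso_by :: "nat \<Rightarrow> real mat \<Rightarrow> real mat \<Rightarrow> real mat \<Rightarrow> bool" where
  "graph_iso_by N A1 A2 P \<longleftrightarrow> permutation_mat N P \<and> A1 = transpose_mat P * A2 * P"

text \<open>A solver for GI on weighted graphs with vertex set \<open>{0..<N}\<close>, given by their adjacency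
  matrices.  Nothing is assumed about the answer on other inputs.\<close>

definition GI_oracle :: "nat \<Rightarrow> (real mat \<Rightarrow> real mat \<Rightarrow> real mat option) \<Rightarrow> bool" where
  "GI_oracle N go \<longleftrightarrow>
     (\<forall>E1 w1 E2 w2. is_graph {0..<N} E1 \<longrightarrow> is_graph {0..<N} E2 \<longrightarrow>
        (let A1 = adjacency_mat N E1 w1; A2 = adjacency_mat N E2 w2 in
         case go A1 A2 of
           None \<Rightarrow> \<not> (\<exists>P. graph_iso_by N A1 A2 P)
         | Some P \<Rightarrow> graph_iso_by N A1 A2 P))"

section \<open>Oracle programs over the reals\<close>

text \<open>Reductions are uniform while-programs of a real RAM (exact real arithmetic and comparisons,
  at unit cost; no rounding) with natural-number variables, used as indices and counters, and
  two-dimensional arrays of reals.  Neither integer division nor rounding is a primitive operation,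
  because at unit cost they would make the machine unrealistically powerful.  Division of reals by
  \<open>0\<close> gives \<open>0\<close>.\<close>

datatype nexp = NConst nat | NVar string | NAdd nexp nexp | NSub nexp nexp

datatype rexp =
    RNat nexp
  | RCell string nexp nexp
  | RAdd rexp rexp | RSub rexp rexp | RMul rexp rexp | RDiv rexp rexp

datatype bexp = NLess nexp nexp | RLess rexp rexp | BNot bexp | BAnd bexp bexp

datatype com =
    SKIP
  | NAssign string nexp
  | RAssign string nexp nexp rexp
  | Seq com com
  | Cond bexp com com
  | Loop bexp com
  | ZLIP_Call string string nexp
      \<comment> \<open>result array, array with the basis, dimension\<close>
  | GI_Call string string string string nexp
      \<comment> \<open>result variable, result array, two arrays with adjacency matrices, number of vertices\<close>

type_synonym nstore = "string \<Rightarrow> nat"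
type_synonym rstore = "string \<Rightarrow> nat \<Rightarrow> nat \<Rightarrow> real"
type_synonym state = "nstore \<times> rstore"

fun nval :: "nexp \<Rightarrow> nstore \<Rightarrow> nat" where
  "nval (NConst a) \<nu> = a"
| "nval (NVar x) \<nu> = \<nu> x"
| "nval (NAdd a b) \<nu> = nval a \<nu> + nval b \<nu>"
| "nval (NSub a b) \<nu> = nval a \<nu> - nval b \<nu>"

fun rval :: "rexp \<Rightarrow> state \<Rightarrow> real" where
  "rval (RNat a) s = real (nval a (fst s))"
| "rval (RCell X a b) s = snd s X (nval a (fst s)) (nval b (fst s))"
| "rval (RAdd a b) s = rval a s + rval b s"
| "rval (RSub a b) s = rval a s - rval b s"
| "rval (RMul a b) s = rval a s * rval b s"
| "rval (RDiv a b) s = rval a s / rval b s"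

fun bval :: "bexp \<Rightarrow> state \<Rightarrow> bool" where
  "bval (NLess a b) s = (nval a (fst s) < nval b (fst s))"
| "bval (RLess a b) s = (rval a s < rval b s)"
| "bval (BNot b) s = (\<not> bval b s)"
| "bval (BAnd b c) s = (bval b s \<and> bval c s)"

definition read_mat :: "nat \<Rightarrow> (nat \<Rightarrow> nat \<Rightarrow> real) \<Rightarrow> real mat" where
  "read_mat d a = mat d d (\<lambda>(i, j). a i j)"

definition write_mat :: "nat \<Rightarrow> real mat \<Rightarrow> (nat \<Rightarrow> nat \<Rightarrow> real) \<Rightarrow> (nat \<Rightarrow> nat \<Rightarrow> real)" where
  "write_mat d M a = (\<lambda>i j. if i < d \<and> j < d then M $$ (i, j) else a i j)"

definition mat_size :: "real mat \<Rightarrow> real" where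
  "mat_size A = (\<Sum>i<dim_row A. \<Sum>j<dim_col A. 1 + log 2 (1 + \<bar>A $$ (i, j)\<bar>))"

text \<open>\<open>exec zo go c s t s'\<close>: started in \<open>s\<close>, the program \<open>c\<close> stops in \<open>s'\<close> after time \<open>t\<close>, where \<open>zo\<close>
  and \<open>go\<close> answer the oracle calls.  An oracle call costs the size of its query, so a polynomial
  time bound also bounds the number and the sizes of the queries polynomially.\<close>

inductive exec ::
  "(real mat \<Rightarrow> real mat) \<Rightarrow> (real mat \<Rightarrow> real mat \<Rightarrow> real mat option) \<Rightarrow>
   com \<Rightarrow> state \<Rightarrow> nat \<Rightarrow> state \<Rightarrow> bool"
  for zo :: "real mat \<Rightarrow> real mat" and go :: "real mat \<Rightarrow> real mat \<Rightarrow> real mat option"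
where
  exec_SKIP: "exec zo go SKIP s 1 s"
| exec_NAssign: "exec zo go (NAssign x a) (\<nu>, \<rho>) 1 (\<nu>(x := nval a \<nu>), \<rho>)"
| exec_RAssign:
    "exec zo go (RAssign X a b e) (\<nu>, \<rho>) 1
       (\<nu>, \<rho>(X := (\<rho> X)(nval a \<nu> := (\<rho> X (nval a \<nu>))(nval b \<nu> := rval e (\<nu>, \<rho>)))))"
| exec_Seq:
    "exec zo go c1 s1 t1 s2 \<Longrightarrow> exec zo go c2 s2 t2 s3 \<Longrightarrow>
     exec zo go (Seq c1 c2) s1 (t1 + t2) s3"
| exec_CondTrue:
    "bval b s \<Longrightarrow> exec zo go c1 s t s' \<Longrightarrow> exec zo go (Cond b c1 c2) s (t + 1) s'"
| exec_CondFalse: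
    "\<not> bval b s \<Longrightarrow> exec zo go c2 s t s' \<Longrightarrow> exec zo go (Cond b c1 c2) s (t + 1) s'"
| exec_LoopFalse: "\<not> bval b s \<Longrightarrow> exec zo go (Loop b c) s 1 s"
| exec_LoopTrue:
    "bval b s1 \<Longrightarrow> exec zo go c s1 t1 s2 \<Longrightarrow> exec zo go (Loop b c) s2 t2 s3 \<Longrightarrow>
     exec zo go (Loop b c) s1 (t1 + t2 + 1) s3"
| exec_ZLIP:
    "d = nval a \<nu> \<Longrightarrow> M = read_mat d (\<rho> X) \<Longrightarrow>
     exec zo go (ZLIP_Call Y X a) (\<nu>, \<rho>) (nat \<lceil>mat_size M\<rceil> + 1)
       (\<nu>, \<rho>(Y := write_mat d (zo M) (\<rho> Y)))"
| exec_GI_None: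
    "N = nval a \<nu> \<Longrightarrow> A1 = read_mat N (\<rho> X1) \<Longrightarrow> A2 = read_mat N (\<rho> X2) \<Longrightarrow> go A1 A2 = None \<Longrightarrow>
     exec zo go (GI_Call x Y X1 X2 a) (\<nu>, \<rho>) (nat \<lceil>mat_size A1 + mat_size A2\<rceil> + 1)
       (\<nu>(x := 0), \<rho>)"
| exec_GI_Some:
    "N = nval a \<nu> \<Longrightarrow> A1 = read_mat N (\<rho> X1) \<Longrightarrow> A2 = read_mat N (\<rho> X2) \<Longrightarrow> go A1 A2 = Some P \<Longrightarrow>
     exec zo go (GI_Call x Y X1 X2 a) (\<nu>, \<rho>) (nat \<lceil>mat_size A1 + mat_size A2\<rceil> + 1)
       (\<nu>(x := 1), \<rho>(Y := write_mat N P (\<rho> Y)))"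

inductive_cases exec_SKIP_E: "exec zo go SKIP s t s'"
inductive_cases exec_NAssign_E: "exec zo go (NAssign x a) s t s'"
inductive_cases exec_RAssign_E: "exec zo go (RAssign X a b e) s t s'"
inductive_cases exec_Seq_E: "exec zo go (Seq c1 c2) s t s'"
inductive_cases exec_Cond_E: "exec zo go (Cond b c1 c2) s t s'"
inductive_cases exec_Loop_E: "exec zo go (Loop b c) s t s'"
inductive_cases exec_ZLIP_E: "exec zo go (ZLIP_Call Y X a) s t s'"
inductive_cases exec_GI_E: "exec zo go (GI_Call x Y X1 X2 a) s t s'"

lemma exec_determ:
  "exec zo go c s t s' \<Longrightarrow> exec zo go c s u s'' \<Longrightarrow> t = u \<and> s' = s''"
proof (induction arbitrary: u s'' rule: exec.induct)
  case exec_SKIP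
  from exec_SKIP.prems show ?case by (rule exec_SKIP_E) simp
next
  case exec_NAssign
  from exec_NAssign.prems show ?case by (rule exec_NAssign_E) simp
next
  case exec_RAssign
  from exec_RAssign.prems show ?case by (rule exec_RAssign_E) simp
next
  case exec_Seq
  from exec_Seq.prems show ?case by (rule exec_Seq_E) (metis exec_Seq.IH)
next
  case exec_CondTrue
  from exec_CondTrue.prems show ?case
    by (rule exec_Cond_E) (use exec_CondTrue.hyps exec_CondTrue.IH in \<open>metis Suc_eq_plus1\<close>)+
next
  case exec_CondFalse
  from exec_CondFalse.prems show ?case
    by (rule exec_Cond_E) (use exec_CondFalse.hyps exec_CondFalse.IH in \<open>metis Suc_eq_plus1\<close>)+
next
  case exec_LoopFalse
  from exec_LoopFalse.prems show ?case
    by (rule exec_Loop_E) (use exec_LoopFalse.hyps in simp_all)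
next
  case exec_LoopTrue
  from exec_LoopTrue.prems show ?case
    by (rule exec_Loop_E) (use exec_LoopTrue.hyps exec_LoopTrue.IH in \<open>metis Suc_eq_plus1\<close>)+
next
  case exec_ZLIP
  from exec_ZLIP.prems show ?case by (rule exec_ZLIP_E) (simp add: exec_ZLIP.hyps)
next
  case exec_GI_None
  from exec_GI_None.prems show ?case
    by (rule exec_GI_E) (use exec_GI_None.hyps in simp_all)
next
  case exec_GI_Some
  from exec_GI_Some.prems show ?case
    by (rule exec_GI_E) (use exec_GI_Some.hyps in simp_all)
qed

text \<open>The program is started with the dimension, the modulus and bases of the two lattices (as
  columns), all other variables and cells being \<open>0\<close>; the code is not part of the input.  The answer
  is read off from the array \<open>O\<close>.\<close>

definition init_state :: "nat \<Rightarrow> nat \<Rightarrow> real mat \<Rightarrow> real mat \<Rightarrow> state" where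
  "init_state n k B1 B2 =
     ((\<lambda>x. 0)(''n'' := n, ''k'' := k),
      (\<lambda>X i j. 0)(''B1'' := write_mat n B1 (\<lambda>i j. 0), ''B2'' := write_mat n B2 (\<lambda>i j. 0)))"

definition result_mat :: "nat \<Rightarrow> state \<Rightarrow> real mat" where
  "result_mat n s = read_mat n (snd s ''O'')"

definition input_size :: "nat \<Rightarrow> real mat \<Rightarrow> real mat \<Rightarrow> real" where
  "input_size k B1 B2 = log 2 (real k) + mat_size B1 + mat_size B2"

end

theory Submission
  imports Defs "Jordan_Normal_Form.Determinant"
begin

text \<open>
  Put \<open>\<Lambda> = C + k \<int>\<^sup>n\<close> and let \<open>\<Lambda>\<^sup>*\<close> be its dual.  A free LCD code has an invertible Gram matrix,
  so \<open>\<int>\<^sup>n\<close> is \<open>\<Lambda> + k \<Lambda>\<^sup>*\<close>, with \<open>\<Lambda> \<inter> k \<Lambda>\<^sup>* = k \<int>\<^sup>n\<close>.  From a basis \<open>B\<close> of \<open>L = O \<Lambda>\<close> one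
  therefore computes a basis of \<open>L + k L\<^sup>* = O \<int>\<^sup>n\<close>, and the oracle for \<open>\<int>\<close>LIP returns an orthonormal
  \<open>Q\<close> with \<open>O = Q S\<close> for a signed permutation \<open>S\<close>.  This reduces the problem to finding a signed
  permutation between the two integral lattices \<open>S\<^sub>1 \<Lambda>\<close> and \<open>S\<^sub>2 \<Lambda>\<close>.

  Modulo \<open>k\<close>, the decomposition of \<open>\<int>\<^sup>n\<close> gives each of these lattices an orthogonal projector, a symmetric
  matrix \<open>P\<close> that determines the lattice; a signed permutation maps one lattice to the other iff it
  conjugates the projectors.  The vertices \<open>\<plusminus>e\<^sub>i\<close> with weights \<open>\<plusminus>P\<^sub>i\<^sub>j mod k\<close>, where larger weights tie
  \<open>e\<^sub>i\<close> to \<open>-e\<^sub>i\<close>, turn this into isomorphism of graphs on \<open>2 n\<close> vertices; \<open>n\<close> isolated vertices are added.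

  The running time is polynomial because the integral column operations are done modulo \<open>k\<close>, Euclid's
  algorithm on entries below \<open>k\<close> takes logarithmically many steps, and quotients are rounded by bisection.
\<close>

section \<open>Time-bounded Hoare rules\<close>

text \<open>The program sees neither the code nor the rotation, only a real basis \<open>B\<close>.
  The rotation cancels in \<open>B^T B = H^T H\<close>, so the Gram matrix is integral, and all work
  modulo \<open>k\<close> starts from it: in the basis dual to \<open>B\<close>, the sum of
  \<open>L\<close> and \<open>k L*\<close> is spanned by the columns of the Gram matrix and of
  \<open>k I\<close>. Since \<open>\<int>/k\<close> need not be a field, Gaussian elimination is
  replaced by Euclid's algorithm on a triangular integral basis whose lattice contains
  \<open>k \<int>^n\<close>. Additional rows record how each column arises from the Gram matrix
  modulo \<open>k\<close>, so one tableau serves both to form the oracle query and to solve the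
  linear systems for the projector. The graph has two vertices for each coordinate because a vertex
  permutation cannot carry signs. Both lattices come from the same code, hence some signed
  permutation relates the two integral lattices; this only guarantees that the graphs are
  isomorphic. The isomorphism that is returned may be another one, and it still solves the problem
  because the projector determines the lattice.\<close>

context
  fixes zo :: "real mat \<Rightarrow> real mat" and go :: "real mat \<Rightarrow> real mat \<Rightarrow> real mat option"
begin

text \<open>Total correctness within a budget: \<open>T\<close> bounds the cost from above, so that
  branches and loops of different exact cost compose.\<close>

definition runs :: "com \<Rightarrow> state \<Rightarrow> nat \<Rightarrow> (state \<Rightarrow> bool) \<Rightarrow> bool" where
  "runs c s T Q \<longleftrightarrow> (\<exists>t s'. exec zo go c s t s' \<and> t \<le> T \<and> Q s')"

lemma runs_SKIP: "Q s \<Longrightarrow> runs SKIP s 1 Q"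
  unfolding runs_def by (blast intro: exec_SKIP)

lemma runs_NAssign: "Q (\<nu>(x := nval a \<nu>), \<rho>) \<Longrightarrow> runs (NAssign x a) (\<nu>, \<rho>) 1 Q"
  unfolding runs_def by (blast intro: exec_NAssign)

lemma runs_RAssign:
  "Q (\<nu>, \<rho>(X := (\<rho> X)(nval a \<nu> := (\<rho> X (nval a \<nu>))(nval b \<nu> := rval e (\<nu>, \<rho>))))) \<Longrightarrow>
   runs (RAssign X a b e) (\<nu>, \<rho>) 1 Q"
  unfolding runs_def by (blast intro: exec_RAssign)

lemma runs_Seq:
  assumes "runs c1 s T1 (\<lambda>s'. runs c2 s' T2 Q)"
  shows "runs (Seq c1 c2) s (T1 + T2) Q"
proof -
  obtain t1 s' t2 s'' where "exec zo go c1 s t1 s'" "t1 \<le> T1" "exec zo go c2 s' t2 s''" "t2 \<le> T2" "Q s''"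
    using assms unfolding runs_def by blast
  then show ?thesis unfolding runs_def by (meson exec_Seq add_mono)
qed

lemma runs_Cond:
  assumes "bval b s \<Longrightarrow> runs c1 s T Q" "\<not> bval b s \<Longrightarrow> runs c2 s T Q"
  shows "runs (Cond b c1 c2) s (T + 1) Q"
  using assms unfolding runs_def
  by (cases "bval b s") (meson exec_CondTrue exec_CondFalse add_le_mono1)+

lemma runs_conseq:
  assumes "runs c s T Q" "T \<le> T'" "\<And>s'. Q s' \<Longrightarrow> Q' s'"
  shows "runs c s T' Q'"
  using assms unfolding runs_def by (meson le_trans)

lemma runs_time_mono: "runs c s T Q \<Longrightarrow> T \<le> T' \<Longrightarrow> runs c s T' Q"
  by (rule runs_conseq)

lemma runs_Seq_post:
  assumes "runs c1 s T1 P" "\<And>s'. P s' \<Longrightarrow> runs c2 s' T2 Q"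
  shows "runs (Seq c1 c2) s (T1 + T2) Q"
  by (rule runs_Seq) (rule runs_conseq[OF assms(1) order_refl assms(2)])

text \<open>The index \<open>m\<close> is a budget of remaining iterations. An invariant must make
  budget \<open>0\<close> incompatible with the guard, since \<open>step\<close> demands a
  predecessor; this gives termination. A round costs \<open>T + 1\<close> with its test, and the
  last \<open>1\<close> is the failing test.\<close>

lemma runs_Loop:
  assumes "I m s"
    and step: "\<And>m s. I m s \<Longrightarrow> bval b s \<Longrightarrow> \<exists>m'. m = Suc m' \<and> runs c s T (I m')"
    and post: "\<And>m s. I m s \<Longrightarrow> \<not> bval b s \<Longrightarrow> Q s"
  shows "runs (Loop b c) s (m * (T + 1) + 1) Q"
  using assms(1)
proof (induction m arbitrary: s rule: less_induct)
  case (less m)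
  show ?case
  proof (cases "bval b s")
    case False
    then have "exec zo go (Loop b c) s 1 s" by (rule exec_LoopFalse)
    then show ?thesis using post[OF less.prems False] unfolding runs_def by (intro exI[of _ "1::nat"] exI[of _ s]) simp
  next
    case True
    obtain m' where m': "m = Suc m'" "runs c s T (I m')" using step[OF less.prems True] by blast
    then obtain t1 s1 where 1: "exec zo go c s t1 s1" "t1 \<le> T" "I m' s1" unfolding runs_def by blast
    have "runs (Loop b c) s1 (m' * (T + 1) + 1) Q" using less.IH[of m' s1] m' 1 by simp
    then obtain t2 s2 where 2: "exec zo go (Loop b c) s1 t2 s2" "t2 \<le> m' * (T + 1) + 1" "Q s2"
      unfolding runs_def by blast
    have "exec zo go (Loop b c) s (t1 + t2 + 1) s2" by (rule exec_LoopTrue[OF True 1(1) 2(1)])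
    moreover have "t1 + t2 + 1 \<le> m * (T + 1) + 1" using 1 2 m' by simp
    ultimately show ?thesis using 2 unfolding runs_def by blast
  qed
qed

definition For :: "string \<Rightarrow> nexp \<Rightarrow> com \<Rightarrow> com" where
  "For x a c = Seq (NAssign x (NConst 0))
     (Loop (NLess (NVar x) a) (Seq c (NAssign x (NAdd (NVar x) (NConst 1)))))"

text \<open>The loop bound is evaluated anew in every round, hence the premise \<open>bound\<close>.
  The time is stated with \<open>N\<close> instead of \<open>m\<close>, so that it depends on the
  size parameter alone. \<open>T + 2\<close> includes test and increment, the final \<open>2\<close>
  initialisation and failing test.\<close>

lemma runs_For:
  assumes start: "I 0 (\<nu>(x := 0)) \<rho>"
    and step: "\<And>i \<nu> \<rho>. i < m \<Longrightarrow> \<nu> x = i \<Longrightarrow> I i \<nu> \<rho> \<Longrightarrow>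
        runs c (\<nu>, \<rho>) T (\<lambda>(\<nu>', \<rho>'). \<nu>' x = i \<and> I (Suc i) (\<nu>'(x := Suc i)) \<rho>')"
    and bound: "\<And>i \<nu> \<rho>. I i \<nu> \<rho> \<Longrightarrow> nval a \<nu> = m"
    and post: "\<And>\<nu> \<rho>. I m \<nu> \<rho> \<Longrightarrow> Q (\<nu>, \<rho>)"
    and N: "m \<le> N"
  shows "runs (For x a c) (\<nu>, \<rho>) (N * (T + 2) + 2) Q"
proof -
  define J where "J = (\<lambda>d (s :: state). \<exists>i. i + d = m \<and> fst s x = i \<and> I i (fst s) (snd s))"
  have "runs (For x a c) (\<nu>, \<rho>) (1 + (m * ((T + 1) + 1) + 1)) Q"
    unfolding For_def
  proof (rule runs_Seq, rule runs_NAssign, rule runs_Loop[where I = J])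
    show "J m (\<nu>(x := nval (NConst 0) \<nu>), \<rho>)" using start by (auto simp: J_def)
  next
    fix d s assume J: "J d s" and b: "bval (NLess (NVar x) a) s"
    obtain \<nu>1 \<rho>1 where s: "s = (\<nu>1, \<rho>1)" by force
    from J obtain i where i: "i + d = m" "\<nu>1 x = i" "I i \<nu>1 \<rho>1" by (auto simp: J_def s)
    have "i < m" using b bound[OF i(3)] i(2) by (simp add: s)
    then obtain d' where d: "d = Suc d'" using i(1) by (cases d) auto
    have "runs (Seq c (NAssign x (NAdd (NVar x) (NConst 1)))) (\<nu>1, \<rho>1) (T + 1) (J d')"
      by (rule runs_Seq_post[OF step[OF \<open>i < m\<close> i(2,3)]], clarify, rule runs_NAssign)
        (use i d in \<open>auto simp: J_def\<close>)
    then show "\<exists>m'. d = Suc m' \<and> runs (Seq c (NAssign x (NAdd (NVar x) (NConst 1)))) s (T + 1) (J m')"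
      using d s by blast
  next
    fix d s assume J: "J d s" and b: "\<not> bval (NLess (NVar x) a) s"
    obtain \<nu>1 \<rho>1 where s: "s = (\<nu>1, \<rho>1)" by force
    from J obtain i where i: "i + d = m" "\<nu>1 x = i" "I i \<nu>1 \<rho>1" by (auto simp: J_def s)
    have "i = m" using b bound[OF i(3)] i(1,2) by (simp add: s)
    then show "Q s" using post i s by simp
  qed
  moreover have "m * (T + 2) \<le> N * (T + 2)" using N by (rule mult_le_mono1)
  ultimately show ?thesis by (elim runs_time_mono) simp
qed

text \<open>The frame condition for stores: effects are confined to the names in
  \<open>V\<close>.\<close>

definition eq_off :: "string set \<Rightarrow> (string \<Rightarrow> 'a) \<Rightarrow> (string \<Rightarrow> 'a) \<Rightarrow> bool" where
  "eq_off V f g \<longleftrightarrow> (\<forall>y. y \<notin> V \<longrightarrow> f y = g y)"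

lemma eq_offD: "eq_off V f g \<Longrightarrow> y \<notin> V \<Longrightarrow> f y = g y" by (simp add: eq_off_def)

lemma eq_off_refl [simp]: "eq_off V f f" by (simp add: eq_off_def)

lemma eq_off_trans: "eq_off V f g \<Longrightarrow> eq_off W g h \<Longrightarrow> V \<union> W \<subseteq> U \<Longrightarrow> eq_off U f h"
  by (simp add: eq_off_def) (metis subset_eq)

lemma eq_off_mono: "eq_off V f g \<Longrightarrow> V \<subseteq> U \<Longrightarrow> eq_off U f g"
  by (auto simp: eq_off_def)

lemma eq_off_upd [simp]: "x \<in> V \<Longrightarrow> eq_off V (f(x := a)) g = eq_off V f g"
  by (auto simp: eq_off_def)

lemma eq_off_upd_right [simp]: "x \<in> V \<Longrightarrow> eq_off V f (g(x := a)) = eq_off V f g"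
  by (auto simp: eq_off_def)

section \<open>Programs that fill rectangular blocks of an array\<close>

definition Cells :: "nexp \<Rightarrow> nexp \<Rightarrow> com \<Rightarrow> com" where
  "Cells a b c = For ''r'' a (For ''s'' b c)"

text \<open>The name \<open>''l''\<close> is the summation index of \<open>MatMul\<close>; with it
  included, one frame set serves all cellwise programs.\<close>

abbreviation "LoopVars \<equiv> {''r'', ''s'', ''l''}"

text \<open>The body may assume that its own cell and everything outside the rectangle still have
  their old contents. This permits in-place updates and reading from other columns of the same
  array. \<open>S\<close> collects scratch arrays such as those of \<open>Floor\<close>.\<close>

lemma runs_Cells:
  assumes a: "\<And>\<nu>. eq_off LoopVars \<nu> \<nu>0 \<Longrightarrow> nval a \<nu> = a'"
    and b: "\<And>\<nu>. eq_off LoopVars \<nu> \<nu>0 \<Longrightarrow> nval b \<nu> = b'"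
    and body: "\<And>i j \<nu> \<rho>. i < a' \<Longrightarrow> j < b' \<Longrightarrow> \<nu> ''r'' = i \<Longrightarrow> \<nu> ''s'' = j \<Longrightarrow>
        eq_off LoopVars \<nu> \<nu>0 \<Longrightarrow> eq_off (insert Z S) \<rho> \<rho>0 \<Longrightarrow> \<rho> Z (p + i) (q + j) = \<rho>0 Z (p + i) (q + j) \<Longrightarrow>
        (\<And>x y. \<not> (p \<le> x \<and> x < p + a' \<and> q \<le> y \<and> y < q + b') \<Longrightarrow> \<rho> Z x y = \<rho>0 Z x y) \<Longrightarrow>
        runs c (\<nu>, \<rho>) T (\<lambda>(\<nu>', \<rho>'). eq_off {''l''} \<nu>' \<nu> \<and> eq_off (insert Z S) \<rho>' \<rho> \<and>
          \<rho>' Z = (\<rho> Z)(p + i := (\<rho> Z (p + i))(q + j := val i j)))"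
    and N: "a' \<le> N" "b' \<le> M"
  shows "runs (Cells a b c) (\<nu>0, \<rho>0) (N * (M * (T + 2) + 4) + 2) (\<lambda>(\<nu>', \<rho>').
     eq_off LoopVars \<nu>' \<nu>0 \<and> eq_off (insert Z S) \<rho>' \<rho>0 \<and>
     \<rho>' Z = (\<lambda>x y. if p \<le> x \<and> x < p + a' \<and> q \<le> y \<and> y < q + b' then val (x - p) (y - q) else \<rho>0 Z x y))"
proof -
  define I where "I = (\<lambda>i (\<nu> :: nstore) (\<rho> :: rstore). eq_off LoopVars \<nu> \<nu>0 \<and> eq_off (insert Z S) \<rho> \<rho>0 \<and>
     \<rho> Z = (\<lambda>x y. if p \<le> x \<and> x < p + i \<and> q \<le> y \<and> y < q + b' then val (x - p) (y - q) else \<rho>0 Z x y))"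
  \<comment> \<open>Row-major progress: rows before \<open>i\<close> are finished, and row
    \<open>i\<close> is finished up to column \<open>j\<close>.\<close>
  define J where "J = (\<lambda>i j (\<nu> :: nstore) (\<rho> :: rstore). \<nu> ''r'' = i \<and> eq_off LoopVars \<nu> \<nu>0 \<and> eq_off (insert Z S) \<rho> \<rho>0 \<and>
     \<rho> Z = (\<lambda>x y. if p \<le> x \<and> q \<le> y \<and> (x < p + i \<and> y < q + b' \<or> x = p + i \<and> y < q + j)
       then val (x - p) (y - q) else \<rho>0 Z x y))"
  have inner: "runs (For ''s'' b c) (\<nu>, \<rho>) (M * (T + 2) + 2)
      (\<lambda>(\<nu>', \<rho>'). \<nu>' ''r'' = i \<and> I (Suc i) (\<nu>'(''r'' := Suc i)) \<rho>')"
    if i: "i < a'" "\<nu> ''r'' = i" "I i \<nu> \<rho>" for i \<nu> \<rho>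
  proof (rule runs_For[where I = "J i" and m = b'])
    have 1: "(\<lambda>x y. if p \<le> x \<and> x < p + i \<and> q \<le> y \<and> y < q + b' then val (x - p) (y - q) else \<rho>0 Z x y) =
       (\<lambda>x y. if p \<le> x \<and> q \<le> y \<and> (x < p + i \<and> y < q + b' \<or> x = p + i \<and> y < q + 0)
       then val (x - p) (y - q) else \<rho>0 Z x y)"
      by (intro ext) auto
    show "J i 0 (\<nu>(''s'' := 0)) \<rho>" using i unfolding I_def J_def 1 by simp
  next
    fix j \<nu> \<rho> assume j: "j < b'" "\<nu> ''s'' = j" "J i j \<nu> \<rho>"
    have "runs c (\<nu>, \<rho>) T (\<lambda>(\<nu>', \<rho>'). eq_off {''l''} \<nu>' \<nu> \<and> eq_off (insert Z S) \<rho>' \<rho> \<and>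
          \<rho>' Z = (\<rho> Z)(p + i := (\<rho> Z (p + i))(q + j := val i j)))"
      by (rule body) (use i(1) j in \<open>auto simp: J_def\<close>)
    then show "runs c (\<nu>, \<rho>) T (\<lambda>(\<nu>', \<rho>'). \<nu>' ''s'' = j \<and> J i (Suc j) (\<nu>'(''s'' := Suc j)) \<rho>')"
    proof (rule runs_conseq, goal_cases)
      case (2 s')
      obtain \<nu>' \<rho>' where s': "s' = (\<nu>', \<rho>')" by force
      from 2 have 3: "eq_off {''l''} \<nu>' \<nu>" "eq_off (insert Z S) \<rho>' \<rho>"
          "\<rho>' Z = (\<rho> Z)(p + i := (\<rho> Z (p + i))(q + j := val i j))" by (auto simp: s')
      have "\<rho>' Z = (\<lambda>x y. if p \<le> x \<and> q \<le> y \<and> (x < p + i \<and> y < q + b' \<or> x = p + i \<and> y < q + Suc j)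
       then val (x - p) (y - q) else \<rho>0 Z x y)"
        unfolding 3(3) using j(3) by (intro ext) (auto simp: J_def)
      moreover have "\<nu>' ''s'' = j" "\<nu>' ''r'' = i" using eq_offD[OF 3(1)] j by (auto simp: J_def)
      moreover have "eq_off LoopVars \<nu>' \<nu>0" using eq_off_trans[OF 3(1), of LoopVars \<nu>0 LoopVars] j by (auto simp: J_def)
      moreover have "eq_off (insert Z S) \<rho>' \<rho>0"
        using eq_off_trans[OF 3(2), of "insert Z S" \<rho>0 "insert Z S"] j by (simp add: J_def)
      ultimately show ?case by (simp add: s' J_def)
    qed simp
  next
    fix j \<nu> \<rho> assume "J i j \<nu> \<rho>" then show "nval b \<nu> = b'" using b by (simp add: J_def)
  next
    fix \<nu> \<rho> assume J: "J i b' \<nu> \<rho>"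
    have 1: "(\<lambda>x y. if p \<le> x \<and> x < p + Suc i \<and> q \<le> y \<and> y < q + b' then val (x - p) (y - q) else \<rho>0 Z x y) =
       (\<lambda>x y. if p \<le> x \<and> q \<le> y \<and> (x < p + i \<and> y < q + b' \<or> x = p + i \<and> y < q + b')
       then val (x - p) (y - q) else \<rho>0 Z x y)"
      by (intro ext) auto
    show "case (\<nu>, \<rho>) of (\<nu>', \<rho>') \<Rightarrow> \<nu>' ''r'' = i \<and> I (Suc i) (\<nu>'(''r'' := Suc i)) \<rho>'"
      using J unfolding I_def J_def 1 by simp
  qed (use N in simp)
  have "runs (Cells a b c) (\<nu>0, \<rho>0) (N * ((M * (T + 2) + 2) + 2) + 2) (\<lambda>(\<nu>', \<rho>'). I a' \<nu>' \<rho>')"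
    unfolding Cells_def
  proof (rule runs_For[where I = I and m = a'])
    show "I 0 (\<nu>0(''r'' := 0)) \<rho>0" by (auto simp: I_def fun_eq_iff)
  next
    fix i \<nu> \<rho> assume "I i \<nu> \<rho>" then show "nval a \<nu> = a'" using a by (simp add: I_def)
  qed (use N inner in auto)
  then show ?thesis by (rule runs_conseq) (auto simp: I_def algebra_simps)
qed

definition Put :: "string \<Rightarrow> nexp \<Rightarrow> nexp \<Rightarrow> nexp \<Rightarrow> nexp \<Rightarrow> rexp \<Rightarrow> com" where
  "Put Z a b p q e = Cells a b (RAssign Z (NAdd p (NVar ''r'')) (NAdd q (NVar ''s'')) e)"

lemma runs_Put:
  assumes dims: "\<And>\<nu>. eq_off LoopVars \<nu> \<nu>0 \<Longrightarrow> nval a \<nu> = a' \<and> nval b \<nu> = b' \<and> nval p \<nu> = p' \<and> nval q \<nu> = q'"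
    and e: "\<And>i j \<nu> \<rho>. i < a' \<Longrightarrow> j < b' \<Longrightarrow> \<nu> ''r'' = i \<Longrightarrow> \<nu> ''s'' = j \<Longrightarrow>
        eq_off LoopVars \<nu> \<nu>0 \<Longrightarrow> eq_off {Z} \<rho> \<rho>0 \<Longrightarrow> \<rho> Z (p' + i) (q' + j) = \<rho>0 Z (p' + i) (q' + j) \<Longrightarrow>
        (\<And>x y. \<not> (p' \<le> x \<and> x < p' + a' \<and> q' \<le> y \<and> y < q' + b') \<Longrightarrow> \<rho> Z x y = \<rho>0 Z x y) \<Longrightarrow>
        rval e (\<nu>, \<rho>) = val i j"
    and N: "a' \<le> N" "b' \<le> M"
  shows "runs (Put Z a b p q e) (\<nu>0, \<rho>0) (N * (M * 3 + 4) + 2) (\<lambda>(\<nu>', \<rho>').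
     eq_off LoopVars \<nu>' \<nu>0 \<and> eq_off {Z} \<rho>' \<rho>0 \<and>
     \<rho>' Z = (\<lambda>x y. if p' \<le> x \<and> x < p' + a' \<and> q' \<le> y \<and> y < q' + b' then val (x - p') (y - q') else \<rho>0 Z x y))"
proof -
  have "runs (Put Z a b p q e) (\<nu>0, \<rho>0) (N * (M * (1 + 2) + 4) + 2) (\<lambda>(\<nu>', \<rho>').
     eq_off LoopVars \<nu>' \<nu>0 \<and> eq_off (insert Z {}) \<rho>' \<rho>0 \<and>
     \<rho>' Z = (\<lambda>x y. if p' \<le> x \<and> x < p' + a' \<and> q' \<le> y \<and> y < q' + b' then val (x - p') (y - q') else \<rho>0 Z x y))"
    unfolding Put_def
  proof (rule runs_Cells, goal_cases)
    case (3 i j \<nu> \<rho>)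
    show ?case by (rule runs_RAssign) (use 3 e[OF 3] dims[OF 3(5)] in simp)
  qed (use dims N in auto)
  then show ?thesis by (simp add: mult.commute)
qed

text \<open>The language can compare reals but not round them: \<open>c\<close> is doubled until \<open>- c < x < c\<close>, and then
  \<open>f \<le> x < f + 2 c\<close> is bisected.\<close>

definition Floor :: com where
  "Floor = Seq (RAssign ''c'' (NConst 0) (NConst 0) (RNat (NConst 1)))
    (Seq (Loop (BNot (BAnd (RLess (RCell ''x'' (NConst 0) (NConst 0)) (RCell ''c'' (NConst 0) (NConst 0)))
                (RLess (RSub (RNat (NConst 0)) (RCell ''c'' (NConst 0) (NConst 0))) (RCell ''x'' (NConst 0) (NConst 0)))))
            (RAssign ''c'' (NConst 0) (NConst 0) (RAdd (RCell ''c'' (NConst 0) (NConst 0)) (RCell ''c'' (NConst 0) (NConst 0)))))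
    (Seq (RAssign ''f'' (NConst 0) (NConst 0) (RSub (RNat (NConst 0)) (RCell ''c'' (NConst 0) (NConst 0))))
      (Loop (BNot (RLess (RCell ''c'' (NConst 0) (NConst 0)) (RNat (NConst 1))))
        (Seq (Cond (RLess (RCell ''x'' (NConst 0) (NConst 0))
                     (RAdd (RCell ''f'' (NConst 0) (NConst 0)) (RCell ''c'' (NConst 0) (NConst 0))))
                SKIP
                (RAssign ''f'' (NConst 0) (NConst 0) (RAdd (RCell ''f'' (NConst 0) (NConst 0)) (RCell ''c'' (NConst 0) (NConst 0)))))
          (RAssign ''c'' (NConst 0) (NConst 0) (RDiv (RCell ''c'' (NConst 0) (NConst 0)) (RNat (NConst 2))))))))"

text \<open>While the doubling continues, \<open>c = 2 ^ j\<close> is at most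
  \<open>\<bar>x\<bar>\<close> and hence at most \<open>2 ^ L\<close>. So \<open>L\<close> controls
  the number of rounds of both loops.\<close>

lemma runs_Floor:
  assumes x: "\<rho> ''x'' 0 0 = x" "\<bar>x\<bar> \<le> 2 ^ L"
  shows "runs Floor (\<nu>, \<rho>) (6 * L + 15)
    (\<lambda>(\<nu>', \<rho>'). \<nu>' = \<nu> \<and> eq_off {''f'', ''c''} \<rho>' \<rho> \<and> \<rho>' ''f'' 0 0 = of_int \<lfloor>x\<rfloor>)"
proof -
  define I where "I = (\<lambda>m (s :: state). \<exists>j. fst s = \<nu> \<and> eq_off {''f'', ''c''} (snd s) \<rho> \<and>
     snd s ''c'' 0 0 = 2 ^ j \<and> j + m = Suc L)"
  \<comment> \<open>The interval starts at the integer \<open>z\<close> and has width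
    \<open>2 ^ m\<close>, and \<open>c\<close> is half of it. The loop therefore stops at
    \<open>c = 1/2\<close> and width 1, where \<open>z\<close> is the floor.\<close>
  define J where "J = (\<lambda>m (s :: state). \<exists>z :: int. m \<le> Suc (Suc L) \<and> fst s = \<nu> \<and> eq_off {''f'', ''c''} (snd s) \<rho> \<and>
     snd s ''c'' 0 0 = 2 ^ m / 2 \<and> snd s ''f'' 0 0 = of_int z \<and> (real_of_int z) \<le> x \<and> x < of_int z + 2 ^ m)"
  have loop2: "runs (Loop (BNot (RLess (RCell ''c'' (NConst 0) (NConst 0)) (RNat (NConst 1))))
        (Seq (Cond (RLess (RCell ''x'' (NConst 0) (NConst 0))
                     (RAdd (RCell ''f'' (NConst 0) (NConst 0)) (RCell ''c'' (NConst 0) (NConst 0))))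
                SKIP
                (RAssign ''f'' (NConst 0) (NConst 0) (RAdd (RCell ''f'' (NConst 0) (NConst 0)) (RCell ''c'' (NConst 0) (NConst 0)))))
          (RAssign ''c'' (NConst 0) (NConst 0) (RDiv (RCell ''c'' (NConst 0) (NConst 0)) (RNat (NConst 2)))))) s
       ((L + 2) * (3 + 1) + 1) (\<lambda>(\<nu>', \<rho>'). \<nu>' = \<nu> \<and> eq_off {''f'', ''c''} \<rho>' \<rho> \<and> \<rho>' ''f'' 0 0 = of_int \<lfloor>x\<rfloor>)"
    if s: "J m s" for m s
  proof -
    have "runs (Loop (BNot (RLess (RCell ''c'' (NConst 0) (NConst 0)) (RNat (NConst 1))))
        (Seq (Cond (RLess (RCell ''x'' (NConst 0) (NConst 0))
                     (RAdd (RCell ''f'' (NConst 0) (NConst 0)) (RCell ''c'' (NConst 0) (NConst 0))))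
                SKIP
                (RAssign ''f'' (NConst 0) (NConst 0) (RAdd (RCell ''f'' (NConst 0) (NConst 0)) (RCell ''c'' (NConst 0) (NConst 0)))))
          (RAssign ''c'' (NConst 0) (NConst 0) (RDiv (RCell ''c'' (NConst 0) (NConst 0)) (RNat (NConst 2)))))) s
       (m * (((1 + 1) + 1) + 1) + 1) (\<lambda>(\<nu>', \<rho>'). \<nu>' = \<nu> \<and> eq_off {''f'', ''c''} \<rho>' \<rho> \<and> \<rho>' ''f'' 0 0 = of_int \<lfloor>x\<rfloor>)"
    proof (rule runs_Loop[where I = J, OF s], goal_cases)
      case (1 m s)
      obtain \<nu>1 \<rho>1 where s: "s = (\<nu>1, \<rho>1)" by force
      from 1 obtain z :: int where J: "m \<le> Suc (Suc L)" "\<nu>1 = \<nu>" "eq_off {''f'', ''c''} \<rho>1 \<rho>" "\<rho>1 ''c'' 0 0 = 2 ^ m / 2"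
        "\<rho>1 ''f'' 0 0 = of_int z" "real_of_int z \<le> x" "x < of_int z + 2 ^ m"
        by (auto simp: J_def s)
      have "m \<noteq> 0" using 1(2) J(4) by (cases m) (auto simp: s)
      then obtain m' where m: "m = Suc m'" by (cases m) auto
      have x1: "\<rho>1 ''x'' 0 0 = x" using eq_offD[OF J(3), of "''x''"] x by simp
      show ?case
      proof (intro exI[of _ m'] conjI m runs_Seq runs_Cond, goal_cases)
        case 1
        show ?case unfolding s
          by (rule runs_SKIP, rule runs_RAssign) (use J m 1 x1 in \<open>auto simp: J_def s intro!: exI[of _ z]\<close>)
      next
        case 2
        show ?case unfolding s
          by (rule runs_RAssign, rule runs_RAssign)
            (use J m 2 x1 in \<open>auto simp: J_def s intro!: exI[of _ "z + 2 ^ m'"]\<close>)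
      qed
    next
      case (2 m s)
      from 2 obtain z :: int where J: "fst s = \<nu>" "eq_off {''f'', ''c''} (snd s) \<rho>" "snd s ''c'' 0 0 = 2 ^ m / 2"
        "snd s ''f'' 0 0 = of_int z" "real_of_int z \<le> x" "x < of_int z + 2 ^ m"
        by (auto simp: J_def)
      have "m = 0"
      proof (cases m)
        case (Suc m')
        then show ?thesis using J(3) 2(2) one_le_power[of "2 :: real" m'] by (simp del: one_le_power)
      qed
      then have "\<lfloor>x\<rfloor> = z" using J by (intro floor_unique) auto
      then show ?case using J by (cases s) auto
    qed
    moreover have "m * 4 \<le> (L + 2) * 4" using s by (auto simp: J_def)
    ultimately show ?thesis by (elim runs_time_mono) simp
  qed
  have "runs Floor (\<nu>, \<rho>) (1 + ((Suc L * (1 + 1) + 1) + (1 + ((L + 2) * (3 + 1) + 1))))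
    (\<lambda>(\<nu>', \<rho>'). \<nu>' = \<nu> \<and> eq_off {''f'', ''c''} \<rho>' \<rho> \<and> \<rho>' ''f'' 0 0 = of_int \<lfloor>x\<rfloor>)"
    unfolding Floor_def
  proof (rule runs_Seq, rule runs_RAssign, rule runs_Seq, rule runs_Loop[where I = I], goal_cases)
    case 1
    show ?case by (auto simp: I_def intro!: exI[of _ 0])
  next
    case (2 m s)
    obtain \<nu>1 \<rho>1 where s: "s = (\<nu>1, \<rho>1)" by force
    from 2 obtain j where I: "\<nu>1 = \<nu>" "eq_off {''f'', ''c''} \<rho>1 \<rho>" "\<rho>1 ''c'' 0 0 = 2 ^ j" "j + m = Suc L"
      by (auto simp: I_def s)
    have x1: "\<rho>1 ''x'' 0 0 = x" using eq_offD[OF I(2), of "''x''"] x by simp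
    have "2 ^ j \<le> \<bar>x\<bar>" using 2(2) I x1 by (auto simp: s)
    then have "(2 :: real) ^ j \<le> 2 ^ L" using x(2) by (rule order_trans)
    then have "j \<le> L" by simp
    then obtain m' where m: "m = Suc m'" using I(4) by (cases m) auto
    show ?case unfolding s
      by (intro exI[of _ m'] conjI m runs_RAssign) (use I m in \<open>auto simp: I_def intro!: exI[of _ "Suc j"]\<close>)
  next
    case (3 m s)
    obtain \<nu>1 \<rho>1 where s: "s = (\<nu>1, \<rho>1)" by force
    from 3 obtain j where I: "\<nu>1 = \<nu>" "eq_off {''f'', ''c''} \<rho>1 \<rho>" "\<rho>1 ''c'' 0 0 = 2 ^ j" "j + m = Suc L"
      by (auto simp: I_def s)
    have x1: "\<rho>1 ''x'' 0 0 = x" using eq_offD[OF I(2), of "''x''"] x by simp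
    have "x < 2 ^ j" "- (2 ^ j) < x" using 3(2) I x1 by (auto simp: s)
    then show ?case unfolding s
      by (intro runs_Seq runs_RAssign loop2[of "Suc j"])
        (use I in \<open>auto simp: J_def intro!: exI[of _ "- (2 ^ j)"]\<close>)
  qed
  then show ?thesis by (rule runs_time_mono) simp
qed

definition ModCell :: "string \<Rightarrow> nexp \<Rightarrow> nexp \<Rightarrow> com" where
  "ModCell Z a b = Seq (RAssign ''x'' (NConst 0) (NConst 0) (RDiv (RCell Z a b) (RNat (NVar ''k''))))
     (Seq Floor (RAssign Z a b (RSub (RCell Z a b) (RMul (RNat (NVar ''k'')) (RCell ''f'' (NConst 0) (NConst 0))))))"

abbreviation "FloorVars \<equiv> {''x'', ''f'', ''c''}"

text \<open>Since \<open>k\<close> is at least 1, the bound on \<open>z\<close> is also one on the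
  quotient \<open>z / k\<close>, which is the number that gets rounded.\<close>

lemma runs_ModCell:
  assumes Z: "Z \<notin> FloorVars" and z: "\<rho> Z (nval a \<nu>) (nval b \<nu>) = of_int z"
    and k: "\<nu> ''k'' = k" "0 < k" and L: "\<bar>real_of_int z\<bar> \<le> 2 ^ L"
  shows "runs (ModCell Z a b) (\<nu>, \<rho>) (6 * L + 17)
    (\<lambda>(\<nu>', \<rho>'). \<nu>' = \<nu> \<and> eq_off (insert Z FloorVars) \<rho>' \<rho> \<and>
      \<rho>' Z = (\<rho> Z)(nval a \<nu> := (\<rho> Z (nval a \<nu>))(nval b \<nu> := of_int (z mod int k))))"
proof -
  let ?\<rho> = "\<rho>(''x'' := (\<rho> ''x'')(0 := (\<rho> ''x'' 0)(0 := real_of_int z / real k)))"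
  have "\<bar>real_of_int z / real k\<bar> \<le> \<bar>real_of_int z\<bar>"
  proof -
    have "\<bar>real_of_int z\<bar> * 1 \<le> \<bar>real_of_int z\<bar> * real k" using k(2) by (intro mult_left_mono) simp_all
    then show ?thesis using k(2) by (simp only: abs_divide abs_of_nat pos_divide_le_eq of_nat_0_less_iff mult_1_right)
  qed
  then have L': "\<bar>real_of_int z / real k\<bar> \<le> 2 ^ L" using L by linarith
  have fl: "\<lfloor>real_of_int z / real k\<rfloor> = z div int k"
    by (metis floor_divide_of_int_eq of_int_of_nat_eq)
  have md: "real_of_int z - real k * real_of_int (z div int k) = of_int (z mod int k)"
    by (metis of_int_diff of_int_mult of_int_of_nat_eq minus_mult_div_eq_mod)
  have "runs (ModCell Z a b) (\<nu>, \<rho>) (1 + ((6 * L + 15) + 1)) (\<lambda>(\<nu>', \<rho>'). \<nu>' = \<nu> \<and> eq_off (insert Z FloorVars) \<rho>' \<rho> \<and>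
      \<rho>' Z = (\<rho> Z)(nval a \<nu> := (\<rho> Z (nval a \<nu>))(nval b \<nu> := of_int (z mod int k))))"
    unfolding ModCell_def
  proof (rule runs_Seq, rule runs_RAssign, rule runs_Seq_post[OF runs_Floor[OF _ L']], goal_cases)
    case 1
    show ?case using z k by simp
  next
    case (2 s)
    obtain \<rho>1 where s: "s = (\<nu>, \<rho>1)" and e: "eq_off {''f'', ''c''} \<rho>1 ?\<rho>"
      and f: "\<rho>1 ''f'' 0 0 = real_of_int (z div int k)" using 2 z k by (cases s) (auto simp: fl)
    have \<rho>1: "\<rho>1 Z = \<rho> Z" using eq_offD[OF e, of Z] Z by simp
    have "eq_off FloorVars \<rho>1 \<rho>" using eq_off_trans[OF e, of FloorVars \<rho> FloorVars] by simp
    then have "eq_off (insert Z FloorVars) \<rho>1 \<rho>" by (rule eq_off_mono) auto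
    then show ?case unfolding s by (intro runs_RAssign) (use \<rho>1 z k f md in simp)
  qed
  then show ?thesis by (rule runs_time_mono) simp
qed

definition PutMod :: "string \<Rightarrow> nexp \<Rightarrow> nexp \<Rightarrow> nexp \<Rightarrow> nexp \<Rightarrow> rexp \<Rightarrow> com" where
  "PutMod Z a b p q e = Cells a b (Seq (RAssign Z (NAdd p (NVar ''r'')) (NAdd q (NVar ''s'')) e)
     (ModCell Z (NAdd p (NVar ''r'')) (NAdd q (NVar ''s''))))"

lemma runs_PutMod:
  assumes dims: "\<And>\<nu>. eq_off LoopVars \<nu> \<nu>0 \<Longrightarrow> nval a \<nu> = a' \<and> nval b \<nu> = b' \<and> nval p \<nu> = p' \<and> nval q \<nu> = q'"
    and e: "\<And>i j \<nu> \<rho>. i < a' \<Longrightarrow> j < b' \<Longrightarrow> \<nu> ''r'' = i \<Longrightarrow> \<nu> ''s'' = j \<Longrightarrow>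
        eq_off LoopVars \<nu> \<nu>0 \<Longrightarrow> eq_off (insert Z FloorVars) \<rho> \<rho>0 \<Longrightarrow> \<rho> Z (p' + i) (q' + j) = \<rho>0 Z (p' + i) (q' + j) \<Longrightarrow>
        (\<And>x y. \<not> (p' \<le> x \<and> x < p' + a' \<and> q' \<le> y \<and> y < q' + b') \<Longrightarrow> \<rho> Z x y = \<rho>0 Z x y) \<Longrightarrow>
        rval e (\<nu>, \<rho>) = of_int (val i j)"
    and L: "\<And>i j. i < a' \<Longrightarrow> j < b' \<Longrightarrow> \<bar>real_of_int (val i j)\<bar> \<le> 2 ^ L"
    and Z: "Z \<notin> FloorVars" and k: "\<nu>0 ''k'' = k" "0 < k"
    and N: "a' \<le> N" "b' \<le> M"
  shows "runs (PutMod Z a b p q e) (\<nu>0, \<rho>0) (N * (M * (6 * L + 20) + 4) + 2) (\<lambda>(\<nu>', \<rho>').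
     eq_off LoopVars \<nu>' \<nu>0 \<and> eq_off (insert Z FloorVars) \<rho>' \<rho>0 \<and>
     \<rho>' Z = (\<lambda>x y. if p' \<le> x \<and> x < p' + a' \<and> q' \<le> y \<and> y < q' + b'
        then of_int (val (x - p') (y - q') mod int k) else \<rho>0 Z x y))"
proof -
  have "runs (PutMod Z a b p q e) (\<nu>0, \<rho>0) (N * (M * ((1 + (6 * L + 17)) + 2) + 4) + 2) (\<lambda>(\<nu>', \<rho>').
     eq_off LoopVars \<nu>' \<nu>0 \<and> eq_off (insert Z FloorVars) \<rho>' \<rho>0 \<and>
     \<rho>' Z = (\<lambda>x y. if p' \<le> x \<and> x < p' + a' \<and> q' \<le> y \<and> y < q' + b'
        then of_int (val (x - p') (y - q') mod int k) else \<rho>0 Z x y))"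
    unfolding PutMod_def
  proof (rule runs_Cells, goal_cases)
    case (3 i j \<nu> \<rho>)
    have k1: "\<nu> ''k'' = k" using eq_offD[OF 3(5), of "''k''"] k by simp
    note L' = L[OF 3(1,2)]
    show ?case
      by (rule runs_Seq, rule runs_RAssign, rule runs_conseq[OF runs_ModCell[where \<nu> = \<nu>, OF Z _ k1 k(2) L']])
        (use 3 e[OF 3] dims[OF 3(5)] in auto)
  qed (use dims N in auto)
  then show ?thesis by (rule runs_time_mono) (simp add: algebra_simps)
qed

definition MatMul :: "string \<Rightarrow> string \<Rightarrow> string \<Rightarrow> com" where
  "MatMul Z X Y = Cells (NVar ''n'') (NVar ''n'')
     (Seq (RAssign Z (NVar ''r'') (NVar ''s'') (RNat (NConst 0)))
        (For ''l'' (NVar ''n'') (RAssign Z (NVar ''r'') (NVar ''s'')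
          (RAdd (RCell Z (NVar ''r'') (NVar ''s''))
             (RMul (RCell X (NVar ''r'') (NVar ''l'')) (RCell Y (NVar ''l'') (NVar ''s'')))))))"

lemma runs_MatMul:
  assumes n: "\<nu>0 ''n'' = n" "n \<le> N" and Z: "Z \<noteq> X" "Z \<noteq> Y"
  shows "runs (MatMul Z X Y) (\<nu>0, \<rho>0) (N * (N * (N * 3 + 5) + 4) + 2) (\<lambda>(\<nu>', \<rho>').
     eq_off LoopVars \<nu>' \<nu>0 \<and> eq_off {Z} \<rho>' \<rho>0 \<and>
     \<rho>' Z = (\<lambda>x y. if x < n \<and> y < n then \<Sum>l<n. \<rho>0 X x l * \<rho>0 Y l y else \<rho>0 Z x y))"
proof -
  have nn: "\<nu> ''n'' = n" if "eq_off LoopVars \<nu> \<nu>0" for \<nu> using eq_offD[OF that, of "''n''"] n by simp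
  have "runs (MatMul Z X Y) (\<nu>0, \<rho>0) (N * (N * ((1 + (N * (1 + 2) + 2)) + 2) + 4) + 2) (\<lambda>(\<nu>', \<rho>').
     eq_off LoopVars \<nu>' \<nu>0 \<and> eq_off (insert Z {}) \<rho>' \<rho>0 \<and>
     \<rho>' Z = (\<lambda>x y. if 0 \<le> x \<and> x < 0 + n \<and> 0 \<le> y \<and> y < 0 + n then \<Sum>l<n. \<rho>0 X (x - 0) l * \<rho>0 Y l (y - 0) else \<rho>0 Z x y))"
    unfolding MatMul_def
  proof (rule runs_Cells[where p = 0 and q = 0 and val = "\<lambda>x y. \<Sum>l<n. \<rho>0 X x l * \<rho>0 Y l y"], goal_cases)
    case (3 i j \<nu> \<rho>)
    have XY: "\<rho>1 X = \<rho>0 X" "\<rho>1 Y = \<rho>0 Y" if "eq_off {Z} \<rho>1 \<rho>" for \<rho>1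
      using eq_offD[OF that, of X] eq_offD[OF that, of Y] eq_offD[OF 3(6), of X] eq_offD[OF 3(6), of Y] Z by simp_all
    show ?case
    proof (rule runs_Seq, rule runs_RAssign, rule runs_For[where m = n and
        I = "\<lambda>m \<nu>1 \<rho>1. eq_off {''l''} \<nu>1 \<nu> \<and> eq_off {Z} \<rho>1 \<rho> \<and>
          \<rho>1 Z = (\<rho> Z)(i := (\<rho> Z i)(j := \<Sum>l<m. \<rho>0 X i l * \<rho>0 Y l j))"], goal_cases)
      case 1
      show ?case using 3(3,4) by simp
    next
      case (2 m \<nu>1 \<rho>1)
      have "\<nu>1 ''r'' = i" "\<nu>1 ''s'' = j"
        using eq_offD[of "{''l''}" \<nu>1 \<nu> "''r''"] eq_offD[of "{''l''}" \<nu>1 \<nu> "''s''"] 2(3) 3(3,4) by simp_all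
      then show ?case by (intro runs_RAssign) (use 2 XY[of \<rho>1] in simp)
    next
      case (3 m \<nu>1 \<rho>1)
      then have "eq_off LoopVars \<nu>1 \<nu>0" using eq_off_trans[of "{''l''}" \<nu>1 \<nu> LoopVars \<nu>0] \<open>eq_off LoopVars \<nu> \<nu>0\<close> by auto
      then show ?case using nn by simp
    next
      case (4 \<nu>1 \<rho>1)
      then show ?case by simp
    next
      case 5
      show ?case by (rule n(2))
    qed
  qed (simp_all add: nn n)
  moreover have "(\<lambda>x y. if 0 \<le> x \<and> x < 0 + n \<and> 0 \<le> y \<and> y < 0 + n then \<Sum>l<n. \<rho>0 X (x - 0) l * \<rho>0 Y l (y - 0) else \<rho>0 Z x y)
     = (\<lambda>x y. if x < n \<and> y < n then \<Sum>l<n. \<rho>0 X x l * \<rho>0 Y l y else \<rho>0 Z x y)"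
    by (intro ext) simp
  moreover have "1 + (N * (1 + 2) + 2) + 2 = N * 3 + 5" by simp
  ultimately show ?thesis by (simp only:)
qed

definition Transp :: "string \<Rightarrow> string \<Rightarrow> com" where
  "Transp Z X = Put Z (NVar ''n'') (NVar ''n'') (NConst 0) (NConst 0) (RCell X (NVar ''s'') (NVar ''r''))"

lemma runs_Transp:
  assumes n: "\<nu>0 ''n'' = n" "n \<le> N" and Z: "Z \<noteq> X"
  shows "runs (Transp Z X) (\<nu>0, \<rho>0) (N * (N * 3 + 4) + 2) (\<lambda>(\<nu>', \<rho>').
     eq_off LoopVars \<nu>' \<nu>0 \<and> eq_off {Z} \<rho>' \<rho>0 \<and>
     \<rho>' Z = (\<lambda>x y. if x < n \<and> y < n then \<rho>0 X y x else \<rho>0 Z x y))"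
proof -
  have nn: "\<nu> ''n'' = n" if "eq_off LoopVars \<nu> \<nu>0" for \<nu> using eq_offD[OF that, of "''n''"] n by simp
  have X: "\<rho> X = \<rho>0 X" if "eq_off {Z} \<rho> \<rho>0" for \<rho> using eq_offD[OF that, of X] Z by auto
  have "runs (Transp Z X) (\<nu>0, \<rho>0) (N * (N * 3 + 4) + 2) (\<lambda>(\<nu>', \<rho>').
     eq_off LoopVars \<nu>' \<nu>0 \<and> eq_off {Z} \<rho>' \<rho>0 \<and>
     \<rho>' Z = (\<lambda>x y. if 0 \<le> x \<and> x < 0 + n \<and> 0 \<le> y \<and> y < 0 + n then \<rho>0 X (y - 0) (x - 0) else \<rho>0 Z x y))"
    unfolding Transp_def
  proof (rule runs_Put[where p' = 0 and q' = 0 and val = "\<lambda>x y. \<rho>0 X y x"], goal_cases)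
    case (2 i j \<nu> \<rho>)
    then show ?case using X[of \<rho>] by simp
  qed (simp_all add: nn n)
  moreover have "(\<lambda>x y. if 0 \<le> x \<and> x < 0 + n \<and> 0 \<le> y \<and> y < 0 + n then \<rho>0 X (y - 0) (x - 0) else \<rho>0 Z x y)
     = (\<lambda>x y. if x < n \<and> y < n then \<rho>0 X y x else \<rho>0 Z x y)"
    by (intro ext) simp
  ultimately show ?thesis by (simp only:)
qed

end

text \<open>The base \<open>s + 1\<close> makes powers increase with the exponent also at
  \<open>s = 0\<close>, so that bounds of different degrees can be added.\<close>

definition poly_bounded :: "(nat \<Rightarrow> nat) \<Rightarrow> bool" where
  "poly_bounded f \<longleftrightarrow> (\<exists>a d. \<forall>s. f s \<le> a * (s + 1) ^ d)"

lemma poly_bounded_const: "poly_bounded (\<lambda>s. c)"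
  unfolding poly_bounded_def by (intro exI[of _ c] exI[of _ 0]) simp

lemma poly_bounded_id: "poly_bounded (\<lambda>s. s)"
  unfolding poly_bounded_def by (intro exI[of _ 1] exI[of _ 1]) simp

lemma poly_bounded_mult: assumes "poly_bounded f" "poly_bounded g" shows "poly_bounded (\<lambda>s. f s * g s)"
proof -
  obtain a d b e where *: "\<And>s. f s \<le> a * (s + 1) ^ d" "\<And>s. g s \<le> b * (s + 1) ^ e"
    using assms unfolding poly_bounded_def by blast
  have "f s * g s \<le> (a * b) * (s + 1) ^ (d + e)" for s
    using mult_mono[OF *(1)[of s] *(2)[of s]] by (simp add: power_add mult_ac)
  then show ?thesis unfolding poly_bounded_def by blast
qed

lemma poly_bounded_add: assumes "poly_bounded f" "poly_bounded g" shows "poly_bounded (\<lambda>s. f s + g s)"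
proof -
  obtain a d b e where *: "\<And>s. f s \<le> a * (s + 1) ^ d" "\<And>s. g s \<le> b * (s + 1) ^ e"
    using assms unfolding poly_bounded_def by blast
  have "f s + g s \<le> (a + b) * (s + 1) ^ (d + e)" for s
  proof -
    have "a * (s + 1) ^ d \<le> a * (s + 1) ^ (d + e)" "b * (s + 1) ^ e \<le> b * (s + 1) ^ (d + e)"
      by (intro mult_left_mono power_increasing; simp)+
    then show ?thesis using *[of s] unfolding distrib_right by linarith
  qed
  then show ?thesis unfolding poly_bounded_def by blast
qed

lemma poly_bounded_power: "poly_bounded f \<Longrightarrow> poly_bounded (\<lambda>s. f s ^ m)"
proof (induction m)
  case 0
  show ?case using poly_bounded_const[of 1] by simp
next
  case (Suc m)
  then show ?case using poly_bounded_mult[of f "\<lambda>s. f s ^ m"] by simp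
qed

lemmas poly_bounded_intros = poly_bounded_const poly_bounded_id poly_bounded_mult poly_bounded_add poly_bounded_power

section \<open>LCD codes and their lattices\<close>

lemma mult_mat_vec_smult:
  fixes A :: "'a :: comm_semiring_0 mat"
  assumes "A \<in> carrier_mat nr nc" "v \<in> carrier_vec nc"
  shows "A *\<^sub>v (c \<cdot>\<^sub>v v) = c \<cdot>\<^sub>v (A *\<^sub>v v)"
  using assms by (intro eq_vecI) (auto simp: scalar_prod_def sum_distrib_left mult.left_commute intro!: sum.cong)

lemma vec_add_diff_cancel:
  fixes u v :: "'a :: ab_group_add vec"
  shows "u \<in> carrier_vec n \<Longrightarrow> v \<in> carrier_vec n \<Longrightarrow> u + v - u = v"
  by (intro eq_vecI) auto

lemma vec_mod_simps [simp]: "dim_vec (vec_mod k v) = dim_vec v"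
  "i < dim_vec v \<Longrightarrow> vec_mod k v $ i = v $ i mod int k"
  "vec_mod k v \<in> carrier_vec n \<longleftrightarrow> v \<in> carrier_vec n"
  by (auto simp: vec_mod_def)

lemma vec_mod_eqD:
  assumes "x \<in> carrier_vec n" "y \<in> carrier_vec n" "vec_mod k x = vec_mod k y"
  shows "\<exists>z\<in>carrier_vec n. x = y + int k \<cdot>\<^sub>v z"
proof (intro bexI[of _ "vec n (\<lambda>i. (x $ i - y $ i) div int k)"] eq_vecI)
  fix i assume "i < dim_vec (y + int k \<cdot>\<^sub>v vec n (\<lambda>i. (x $ i - y $ i) div int k))"
  then have i: "i < n" by simp
  have "x $ i mod int k = y $ i mod int k"
    using arg_cong[OF assms(3), of "\<lambda>v. v $ i"] i assms(1,2) by simp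
  then have "int k dvd x $ i - y $ i" by (simp add: mod_eq_dvd_iff)
  then show "x $ i = (y + int k \<cdot>\<^sub>v vec n (\<lambda>i. (x $ i - y $ i) div int k)) $ i"
    using i assms by simp
qed (use assms in auto)

lemma vec_mod_eqI:
  assumes "y \<in> carrier_vec n" "z \<in> carrier_vec n"
  shows "vec_mod k (y + int k \<cdot>\<^sub>v z) = vec_mod k y"
  using assms by (intro eq_vecI) auto

lemma vec_mod_idem [simp]: "vec_mod k (vec_mod k x) = vec_mod k x"
  by (intro eq_vecI) auto

lemma Zk_vec_iff: "0 < k \<Longrightarrow> v \<in> Zk_vec k n \<longleftrightarrow> v \<in> carrier_vec n \<and> vec_mod k v = v"
proof -
  assume k: "0 < k"
  have "v $ i \<in> {0..int k - 1} \<longleftrightarrow> v $ i mod int k = v $ i" for i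
  proof
    assume "v $ i mod int k = v $ i"
    then show "v $ i \<in> {0..int k - 1}"
      using pos_mod_bound[of "int k" "v $ i"] pos_mod_sign[of "int k" "v $ i"] k by auto
  qed (auto intro: mod_pos_pos_trivial)
  then show ?thesis
    by (auto simp: Zk_module_def residue_ring_def vec_mod_def vec_eq_iff)
qed

lemma vec_mod_Zk: "0 < k \<Longrightarrow> v \<in> carrier_vec n \<Longrightarrow> vec_mod k v \<in> Zk_vec k n"
  by (simp add: Zk_vec_iff)

text \<open>Finiteness is what turns injectivity of the Gram map into surjectivity in
  \<open>lcd_lattice_code\<close>.\<close>

lemma finite_Zk_vec: "finite (Zk_vec k n)"
proof -
  have "Zk_vec k n \<subseteq> vec_of_list ` {xs. set xs \<subseteq> {0..int k - 1} \<and> length xs = n}"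
  proof
    fix v assume v: "v \<in> Zk_vec k n"
    have "v = vec_of_list (list_of_vec v)" by (simp add: vec_list)
    moreover have "set (list_of_vec v) \<subseteq> {0..int k - 1}" "length (list_of_vec v) = n"
      using v by (auto simp: Zk_module_def residue_ring_def set_list_of_vec vec_set_def)
    ultimately show "v \<in> vec_of_list ` {xs. set xs \<subseteq> {0..int k - 1} \<and> length xs = n}" by blast
  qed
  then show ?thesis by (rule finite_subset) (intro finite_imageI finite_lists_length_eq, simp)
qed

text \<open>Construction A kept inside \<open>\<int>^n\<close>, where divisibility arguments take
  place; \<open>construction_A_eq\<close> gives its real copy.\<close>

definition code_lattice :: "nat \<Rightarrow> nat \<Rightarrow> int vec set \<Rightarrow> int vec set" where
  "code_lattice k n C = {x \<in> carrier_vec n. vec_mod k x \<in> C}"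

text \<open>\<open>radical\<close> says \<open>\<Lambda> \<inter> k \<Lambda>\<^sup>* = k \<int>\<^sup>n\<close>, which is the LCD property, and \<open>split\<close> says
  \<open>\<Lambda> + k \<Lambda>\<^sup>* = \<int>\<^sup>n\<close>, which follows because the Gram matrix of a free basis is then injective modulo \<open>k\<close>,
  hence bijective.\<close>

locale lcd_lattice =
  fixes n k :: nat and \<Lambda> :: "int vec set"
  assumes k_pos: "0 < k"
    and carrier: "x \<in> \<Lambda> \<Longrightarrow> x \<in> carrier_vec n"
    and add: "x \<in> \<Lambda> \<Longrightarrow> y \<in> \<Lambda> \<Longrightarrow> x + y \<in> \<Lambda>"
    and smult: "x \<in> \<Lambda> \<Longrightarrow> c \<cdot>\<^sub>v x \<in> \<Lambda>"
    and kmult: "x \<in> carrier_vec n \<Longrightarrow> int k \<cdot>\<^sub>v x \<in> \<Lambda>"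
    and radical: "x \<in> \<Lambda> \<Longrightarrow> (\<And>y. y \<in> \<Lambda> \<Longrightarrow> int k dvd x \<bullet> y) \<Longrightarrow> \<exists>z\<in>carrier_vec n. x = int k \<cdot>\<^sub>v z"
    and split: "z \<in> carrier_vec n \<Longrightarrow> \<exists>c\<in>\<Lambda>. \<forall>y\<in>\<Lambda>. int k dvd (z - c) \<bullet> y"

text \<open>Coefficient vectors may be arbitrary integral ones: replacing \<open>c\<close> by its
  residues changes the combination only by a multiple of \<open>k\<close>, which \<open>z\<close>
  absorbs.\<close>

lemma code_lattice_iff:
  assumes G: "generator_matrix k m n G C" and k: "0 < k"
  shows "x \<in> code_lattice k n C \<longleftrightarrow>
    (\<exists>c\<in>carrier_vec m. \<exists>z\<in>carrier_vec n. x = transpose_mat G *\<^sub>v c + int k \<cdot>\<^sub>v z)"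
proof
  have Gc: "G \<in> carrier_mat m n" and C: "C = {row_comb k c G | c. c \<in> Zk_vec k m}"
    using G by (auto simp: generator_matrix_def)
  let ?H = "transpose_mat G"
  have Hc: "?H \<in> carrier_mat n m" using Gc by simp
  note HL = mult_add_distrib_mat_vec[OF Hc] mult_mat_vec_smult[OF Hc]
  have [simp]: "?H *\<^sub>v v \<in> carrier_vec n" for v using carrier_matD[OF Gc] by (simp add: carrier_vecI)
  {
    assume x: "x \<in> code_lattice k n C"
    then obtain c where c: "c \<in> Zk_vec k m" "vec_mod k x = row_comb k c G"
      using C by (auto simp: code_lattice_def)
    then have c': "c \<in> carrier_vec m" using k by (simp add: Zk_vec_iff)
    show "\<exists>c\<in>carrier_vec m. \<exists>z\<in>carrier_vec n. x = transpose_mat G *\<^sub>v c + int k \<cdot>\<^sub>v z"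
      using vec_mod_eqD[of x n "transpose_mat G *\<^sub>v c" k] x c c'
      by (simp add: row_comb_def code_lattice_def) blast
  next
    assume "\<exists>c\<in>carrier_vec m. \<exists>z\<in>carrier_vec n. x = transpose_mat G *\<^sub>v c + int k \<cdot>\<^sub>v z"
    then obtain c z where c: "c \<in> carrier_vec m" and z: "z \<in> carrier_vec n"
      and x: "x = transpose_mat G *\<^sub>v c + int k \<cdot>\<^sub>v z" by blast
    obtain d where d: "d \<in> carrier_vec m" "c = vec_mod k c + int k \<cdot>\<^sub>v d"
      using vec_mod_eqD[of c m "vec_mod k c" k] c by auto
    have "transpose_mat G *\<^sub>v c = transpose_mat G *\<^sub>v vec_mod k c + int k \<cdot>\<^sub>v (transpose_mat G *\<^sub>v d)"
      using d(1) c by (subst d(2)) (simp only: HL vec_mod_simps(3) smult_carrier_vec)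
    then have "vec_mod k (transpose_mat G *\<^sub>v c) = row_comb k (vec_mod k c) G"
      unfolding row_comb_def using d c Gc by (simp add: vec_mod_eqI[of _ n])
    moreover have "vec_mod k x = vec_mod k (transpose_mat G *\<^sub>v c)"
      unfolding x using z c Gc by (simp add: vec_mod_eqI[of _ n])
    ultimately show "x \<in> code_lattice k n C"
      using C vec_mod_Zk[OF k c] x z c Gc by (auto simp: code_lattice_def)
  }
qed

lemma dvd_scalar_prod:
  fixes x y :: "int vec"
  assumes "x \<in> carrier_vec n" "y \<in> carrier_vec n" "\<And>i. i < n \<Longrightarrow> d dvd y $ i"
  shows "d dvd x \<bullet> y"
  unfolding scalar_prod_def using assms by (auto intro!: dvd_sum)

text \<open>Consider the Gram map sending \<open>c\<close> to \<open>G G^T c\<close> modulo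
  \<open>k\<close>. If \<open>c\<close> and \<open>c'\<close> have the same image, then
  \<open>G^T (c - c')\<close> is orthogonal modulo \<open>k\<close> to the whole lattice, so the LCD
  property makes it vanish modulo \<open>k\<close>, and independence of the rows gives
  \<open>c = c'\<close>. Being injective on a finite set, the map is surjective. Solving the normal
  equations \<open>G G^T c = G z\<close> modulo \<open>k\<close> then yields the lattice component
  \<open>G^T c\<close> of \<open>z\<close>.\<close>

lemma lcd_lattice_code:
  assumes free: "free_code k n C" and lcd: "LCD_code k n C" and k: "0 < k"
  shows "lcd_lattice n k (code_lattice k n C)"
proof -
  obtain m G where G: "generator_matrix k m n G C" "rows_independent k m n G"
    using free by (auto simp: free_code_def)
  have Gc [simp]: "G \<in> carrier_mat m n" and C: "C = {row_comb k c G | c. c \<in> Zk_vec k m}"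
    using G by (auto simp: generator_matrix_def)
  let ?\<Lambda> = "code_lattice k n C" and ?H = "transpose_mat G"
  note iff = code_lattice_iff[OF G(1) k]
  have Hc [simp]: "?H \<in> carrier_mat n m" by simp
  have Hv [simp]: "?H *\<^sub>v v \<in> carrier_vec n" for v using carrier_matD[OF Gc] by (simp add: carrier_vecI)
  have Gv [simp]: "G *\<^sub>v v \<in> carrier_vec m" for v using carrier_matD[OF Gc] by (simp add: carrier_vecI)
  note carrier_matD[OF Gc, simp]
  have H0 [simp]: "?H *\<^sub>v 0\<^sub>v m = 0\<^sub>v n" by (intro eq_vecI) auto
  have k0: "int k \<cdot>\<^sub>v 0\<^sub>v n = 0\<^sub>v n" by (intro eq_vecI) auto
  note L = mult_add_distrib_mat_vec[OF Hc] mult_mat_vec_smult[OF Hc] mult_minus_distrib_mat_vec[OF Hc]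
    mult_add_distrib_mat_vec[OF Gc] mult_mat_vec_smult[OF Gc] mult_minus_distrib_mat_vec[OF Gc]
  have carr: "x \<in> carrier_vec n" if "x \<in> ?\<Lambda>" for x using that by (simp add: code_lattice_def)
  have rad: "\<exists>z\<in>carrier_vec n. x = int k \<cdot>\<^sub>v z"
    if x: "x \<in> ?\<Lambda>" and dv: "\<And>y. y \<in> ?\<Lambda> \<Longrightarrow> int k dvd x \<bullet> y" for x
  proof -
    have xc: "x \<in> carrier_vec n" by (rule carr[OF x])
    obtain z where z: "z \<in> carrier_vec n" "x = vec_mod k x + int k \<cdot>\<^sub>v z"
      using vec_mod_eqD[of x n "vec_mod k x" k] xc by auto
    have "(vec_mod k x \<bullet> c) mod int k = 0" if c: "c \<in> C" for c
    proof -
      have cc: "c \<in> carrier_vec n" "c \<in> ?\<Lambda>"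
        using c C by (auto simp: code_lattice_def row_comb_def)
      have "x \<bullet> c = vec_mod k x \<bullet> c + int k * (z \<bullet> c)"
        using z(1) cc(1) xc by (subst z(2)) (simp add: add_scalar_prod_distrib[of _ n])
      then show ?thesis using dv[OF cc(2)] by (simp add: dvd_add_left_iff dvd_eq_mod_eq_0[symmetric])
    qed
    then have "vec_mod k x \<in> C \<inter> dual_code k n C"
      using x xc k by (auto simp: code_lattice_def dual_code_def vec_mod_Zk)
    then have "vec_mod k x = 0\<^sub>v n" using lcd by (auto simp: LCD_code_def)
    then show ?thesis using z by auto
  qed
  have pair: "(?H *\<^sub>v c) \<bullet> y = c \<bullet> (G *\<^sub>v y)" if "c \<in> carrier_vec m" "y \<in> carrier_vec n" for c y
    using transpose_vec_mult_scalar[OF Gc that(2,1)] .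
  have orth: "int k dvd x \<bullet> y"
    if x: "x \<in> carrier_vec n" and y: "y \<in> ?\<Lambda>" and dv: "\<And>i. i < m \<Longrightarrow> int k dvd (G *\<^sub>v x) $ i" for x y
  proof -
    obtain d w where d: "d \<in> carrier_vec m" "w \<in> carrier_vec n" "y = ?H *\<^sub>v d + int k \<cdot>\<^sub>v w"
      using y iff by blast
    have "x \<bullet> y = (?H *\<^sub>v d) \<bullet> x + int k * (x \<bullet> w)"
      unfolding d(3) using x d(1,2) comm_scalar_prod[of x n "?H *\<^sub>v d"]
      by (simp add: scalar_prod_add_distrib[of _ n])
    also have "(?H *\<^sub>v d) \<bullet> x = d \<bullet> (G *\<^sub>v x)" by (rule pair[OF d(1) x])
    finally show ?thesis using dvd_scalar_prod[of d m "G *\<^sub>v x" "int k"] d x dv by simp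
  qed
  define \<phi> where "\<phi> c = vec_mod k (G *\<^sub>v (?H *\<^sub>v c))" for c
  have "inj_on \<phi> (Zk_vec k m)"
  proof
    fix c c' assume c: "c \<in> Zk_vec k m" "c' \<in> Zk_vec k m" and eq: "\<phi> c = \<phi> c'"
    have cc [simp]: "c \<in> carrier_vec m" "c' \<in> carrier_vec m" using c k by (simp_all add: Zk_vec_iff)
    let ?x = "?H *\<^sub>v (c - c')"
    have "\<exists>z\<in>carrier_vec n. ?x = int k \<cdot>\<^sub>v z"
    proof (rule rad)
      show "?x \<in> ?\<Lambda>"
        unfolding iff using k0 by (intro bexI[of _ "c - c'"] bexI[of _ "0\<^sub>v n"]) simp_all
      fix y assume "y \<in> ?\<Lambda>"
      obtain z where z: "z \<in> carrier_vec m" "G *\<^sub>v (?H *\<^sub>v c) = G *\<^sub>v (?H *\<^sub>v c') + int k \<cdot>\<^sub>v z"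
        using vec_mod_eqD[of "G *\<^sub>v (?H *\<^sub>v c)" m "G *\<^sub>v (?H *\<^sub>v c')" k] eq by (simp add: \<phi>_def) blast
      have "G *\<^sub>v ?x = G *\<^sub>v (?H *\<^sub>v c) - G *\<^sub>v (?H *\<^sub>v c')"
        by (simp add: L)
      also have "\<dots> = int k \<cdot>\<^sub>v z" unfolding z(2) using z(1) by (intro vec_add_diff_cancel) auto
      finally show "int k dvd ?x \<bullet> y" using \<open>y \<in> ?\<Lambda>\<close> z(1) by (intro orth) simp_all
    qed
    then obtain z where z: "z \<in> carrier_vec n" "?x = int k \<cdot>\<^sub>v z" by blast
    \<comment> \<open>Independence of the rows speaks of reduced coefficient vectors only, so
      \<open>c - c'\<close> is replaced by its residue.\<close>
    let ?e = "vec_mod k (c - c')"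
    obtain w where w: "w \<in> carrier_vec m" "?e = (c - c') + int k \<cdot>\<^sub>v w"
      using vec_mod_eqD[of ?e m "c - c'" k] by auto
    have "?H *\<^sub>v ?e = ?x + int k \<cdot>\<^sub>v (?H *\<^sub>v w)"
      unfolding w(2) using w(1) by (simp add: L)
    also have "\<dots> = 0\<^sub>v n + int k \<cdot>\<^sub>v (z + ?H *\<^sub>v w)" unfolding z(2)
      using z(1) by (simp add: smult_add_distrib_vec[of _ n])
    finally have "row_comb k ?e G = vec_mod k (0\<^sub>v n)"
      unfolding row_comb_def using z(1) vec_mod_eqI[of "0\<^sub>v n" n "z + ?H *\<^sub>v w" k] Hv by (metis add_carrier_vec zero_carrier_vec)
    moreover have "vec_mod k (0\<^sub>v n) = 0\<^sub>v n" by (intro eq_vecI) auto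
    ultimately have "row_comb k ?e G = 0\<^sub>v n" by simp
    then have "?e = 0\<^sub>v m" using G(2) vec_mod_Zk[of k "c - c'" m] k by (simp add: rows_independent_def)
    then have "?e $ i = 0" if "i < m" for i using that by simp
    then have "(c $ i - c' $ i) mod int k = 0" if "i < m" for i
      using that cc by simp
    then have "c $ i mod int k = c' $ i mod int k" if "i < m" for i
      using that by (simp add: mod_eq_dvd_iff dvd_eq_mod_eq_0)
    moreover have "dim_vec c = m" "dim_vec c' = m" by (rule carrier_vecD[OF cc(1)], rule carrier_vecD[OF cc(2)])
    ultimately have "vec_mod k c = vec_mod k c'" by (intro eq_vecI) (simp_all only: vec_mod_simps)
    then show "c = c'" using c k by (simp add: Zk_vec_iff)
  qed
  moreover have "\<phi> ` Zk_vec k m \<subseteq> Zk_vec k m" using k by (auto simp: \<phi>_def Zk_vec_iff)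
  ultimately have surj: "\<phi> ` Zk_vec k m = Zk_vec k m" by (simp add: endo_inj_surj finite_Zk_vec)
  show ?thesis
  proof
    show "0 < k" by fact
    show "x \<in> carrier_vec n" if "x \<in> ?\<Lambda>" for x by (rule carr[OF that])
    show "x + y \<in> ?\<Lambda>" if xy: "x \<in> ?\<Lambda>" "y \<in> ?\<Lambda>" for x y
    proof -
      obtain c z d w where *: "c \<in> carrier_vec m" "z \<in> carrier_vec n" "x = ?H *\<^sub>v c + int k \<cdot>\<^sub>v z"
        "d \<in> carrier_vec m" "w \<in> carrier_vec n" "y = ?H *\<^sub>v d + int k \<cdot>\<^sub>v w"
        using xy iff by blast
      have "x + y = ?H *\<^sub>v (c + d) + int k \<cdot>\<^sub>v (z + w)"
        using *(1,2,4,5) unfolding *(3,6) L(1)[OF *(1,4)] by (intro eq_vecI) (auto simp: algebra_simps)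
      moreover have "c + d \<in> carrier_vec m" "z + w \<in> carrier_vec n" using * by simp_all
      ultimately show ?thesis unfolding iff by blast
    qed
    show "a \<cdot>\<^sub>v x \<in> ?\<Lambda>" if x: "x \<in> ?\<Lambda>" for a x
    proof -
      obtain c z where *: "c \<in> carrier_vec m" "z \<in> carrier_vec n" "x = ?H *\<^sub>v c + int k \<cdot>\<^sub>v z"
        using x iff by blast
      have "a \<cdot>\<^sub>v x = ?H *\<^sub>v (a \<cdot>\<^sub>v c) + int k \<cdot>\<^sub>v (a \<cdot>\<^sub>v z)"
        using *(1,2) unfolding *(3)
        by (simp add: L smult_add_distrib_vec[of _ n] smult_smult_assoc mult.commute)
      moreover have "a \<cdot>\<^sub>v c \<in> carrier_vec m" "a \<cdot>\<^sub>v z \<in> carrier_vec n" using * by simp_all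
      ultimately show ?thesis unfolding iff by blast
    qed
    show "int k \<cdot>\<^sub>v x \<in> ?\<Lambda>" if x: "x \<in> carrier_vec n" for x
      unfolding iff using x by (intro bexI[of _ "0\<^sub>v m"] bexI[of _ x]) simp_all
    show "\<exists>z\<in>carrier_vec n. x = int k \<cdot>\<^sub>v z"
      if "x \<in> ?\<Lambda>" "\<And>y. y \<in> ?\<Lambda> \<Longrightarrow> int k dvd x \<bullet> y" for x by (rule rad[OF that])
    show "\<exists>c\<in>?\<Lambda>. \<forall>y\<in>?\<Lambda>. int k dvd (z - c) \<bullet> y" if z: "z \<in> carrier_vec n" for z
    proof -
      have "vec_mod k (G *\<^sub>v z) \<in> \<phi> ` Zk_vec k m" unfolding surj using z by (intro vec_mod_Zk k) simp
      then obtain c where c: "c \<in> Zk_vec k m" "vec_mod k (G *\<^sub>v z) = \<phi> c" by blast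
      have cc: "c \<in> carrier_vec m" using c k by (simp add: Zk_vec_iff)
      obtain w where w: "w \<in> carrier_vec m" "G *\<^sub>v z = G *\<^sub>v (?H *\<^sub>v c) + int k \<cdot>\<^sub>v w"
        using vec_mod_eqD[of "G *\<^sub>v z" m "G *\<^sub>v (?H *\<^sub>v c)" k] c cc z by (simp add: \<phi>_def) blast
      have "?H *\<^sub>v c \<in> ?\<Lambda>" unfolding iff using k0 cc by (intro bexI[of _ c] bexI[of _ "0\<^sub>v n"]) simp_all
      moreover have "int k dvd (z - ?H *\<^sub>v c) \<bullet> y" if "y \<in> ?\<Lambda>" for y
      proof (rule orth[OF _ that])
        have "G *\<^sub>v (z - ?H *\<^sub>v c) = int k \<cdot>\<^sub>v w"
          using z cc w(1) vec_add_diff_cancel[of "G *\<^sub>v (?H *\<^sub>v c)" m "int k \<cdot>\<^sub>v w"] by (simp add: L w(2))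
        then show "\<And>i. i < m \<Longrightarrow> int k dvd (G *\<^sub>v (z - ?H *\<^sub>v c)) $ i" using w(1) by simp
      qed (use z cc in simp)
      ultimately show ?thesis by blast
    qed
  qed
qed

section \<open>Signed permutations and projectors modulo k\<close>

definition orth_int :: "nat \<Rightarrow> int mat \<Rightarrow> bool" where
  "orth_int n S \<longleftrightarrow> S \<in> carrier_mat n n \<and> transpose_mat S * S = 1\<^sub>m n"

text \<open>An integral column of norm 1 has a single nonzero entry, which is 1 or -1. Orthogonality
  of two columns forces these entries into different rows.\<close>

lemma orth_int_signed_permutation:
  assumes S: "orth_int n S"
  obtains \<sigma> \<epsilon> where "\<sigma> permutes {..<n}" "\<And>j. j < n \<Longrightarrow> \<epsilon> j = 1 \<or> \<epsilon> j = - (1 :: int)"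
    "\<And>i j. i < n \<Longrightarrow> j < n \<Longrightarrow> S $$ (i, j) = (if i = \<sigma> j then \<epsilon> j else 0)"
proof -
  have Sc: "S \<in> carrier_mat n n" using S by (simp add: orth_int_def)
  have ent: "(\<Sum>l<n. S $$ (l, i) * S $$ (l, j)) = (if i = j then 1 else 0)" if "i < n" "j < n" for i j
  proof -
    have "(transpose_mat S * S) $$ (i, j) = (\<Sum>l<n. S $$ (l, i) * S $$ (l, j))"
      using that Sc by (simp add: scalar_prod_def atLeast0LessThan)
    then show ?thesis using S that by (simp add: orth_int_def)
  qed
  have ex: "\<exists>i<n. (S $$ (i, j) = 1 \<or> S $$ (i, j) = - 1) \<and> (\<forall>l<n. l \<noteq> i \<longrightarrow> S $$ (l, j) = 0)"
    if j: "j < n" for j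
  proof -
    have sum1: "(\<Sum>l<n. (S $$ (l, j))\<^sup>2) = 1" using ent[OF j j] by (simp add: power2_eq_square)
    then obtain i where i: "i < n" "S $$ (i, j) \<noteq> 0"
      by (metis (no_types, lifting) lessThan_iff sum.neutral zero_neq_one zero_power2)
    have "1 = (S $$ (i, j))\<^sup>2 + (\<Sum>l\<in>{..<n} - {i}. (S $$ (l, j))\<^sup>2)"
      unfolding sum1[symmetric] using i by (intro sum.remove) auto
    moreover have "(S $$ (i, j))\<^sup>2 \<ge> 1" using i by (simp add: int_one_le_iff_zero_less)
    moreover have "(\<Sum>l\<in>{..<n} - {i}. (S $$ (l, j))\<^sup>2) \<ge> 0" by (intro sum_nonneg) simp
    ultimately have s: "(S $$ (i, j))\<^sup>2 = 1" "(\<Sum>l\<in>{..<n} - {i}. (S $$ (l, j))\<^sup>2) = 0" by linarith+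
    then have "\<forall>l\<in>{..<n} - {i}. (S $$ (l, j))\<^sup>2 = 0" by (simp add: sum_nonneg_eq_0_iff)
    then show ?thesis using i s(1) by (intro exI[of _ i]) (auto simp: power2_eq_1_iff)
  qed
  define \<sigma> where "\<sigma> j = (if j < n then (SOME i. i < n \<and> (S $$ (i, j) = 1 \<or> S $$ (i, j) = - 1) \<and>
     (\<forall>l<n. l \<noteq> i \<longrightarrow> S $$ (l, j) = 0)) else j)" for j
  have \<sigma>: "\<sigma> j < n \<and> (S $$ (\<sigma> j, j) = 1 \<or> S $$ (\<sigma> j, j) = - 1) \<and> (\<forall>l<n. l \<noteq> \<sigma> j \<longrightarrow> S $$ (l, j) = 0)"
    if j: "j < n" for j
    using someI_ex[OF ex[OF j]] j by (simp add: \<sigma>_def)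
  have "inj_on \<sigma> {..<n}"
  proof (rule inj_onI, rule ccontr)
    fix i j assume ij: "i \<in> {..<n}" "j \<in> {..<n}" "\<sigma> i = \<sigma> j" "i \<noteq> j"
    have "0 = (\<Sum>l<n. S $$ (l, i) * S $$ (l, j))" using ent ij by simp
    also have "\<dots> = (\<Sum>l<n. if l = \<sigma> i then S $$ (\<sigma> i, i) * S $$ (\<sigma> i, j) else 0)"
      using \<sigma>[of i] \<sigma>[of j] ij by (intro sum.cong) auto
    also have "\<dots> = S $$ (\<sigma> i, i) * S $$ (\<sigma> i, j)" using \<sigma>[of i] ij by simp
    finally show False using \<sigma>[of i] \<sigma>[of j] ij by auto
  qed
  moreover have "\<sigma> ` {..<n} \<subseteq> {..<n}" using \<sigma> by auto
  ultimately have "bij_betw \<sigma> {..<n} {..<n}" by (simp add: bij_betw_def endo_inj_surj)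
  then have "\<sigma> permutes {..<n}" by (intro bij_imp_permutes) (auto simp: \<sigma>_def)
  then show ?thesis by (rule that[of _ "\<lambda>j. S $$ (\<sigma> j, j)"]) (use \<sigma> in auto)
qed

text \<open>Passing to the reals, where a one-sided inverse of a square matrix is two-sided.\<close>

lemma left_inverse_int_mat:
  fixes A B :: "int mat"
  assumes A: "A \<in> carrier_mat n n" and B: "B \<in> carrier_mat n n" and AB: "A * B = 1\<^sub>m n"
  shows "B * A = 1\<^sub>m n"
proof -
  let ?h = "map_mat real_of_int"
  have "?h A * ?h B = 1\<^sub>m n"
    unfolding of_int_hom.mat_hom_mult[OF A B, symmetric] AB by (rule of_int_hom.mat_hom_one)
  then have "?h B * ?h A = 1\<^sub>m n"
    by (intro mat_mult_left_right_inverse[of "?h A" n "?h B"]) (use A B in simp_all)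
  then have "?h (B * A) = ?h (1\<^sub>m n)"
    unfolding of_int_hom.mat_hom_mult[OF B A] of_int_hom.mat_hom_one .
  then show ?thesis by (rule of_int_hom.mat_hom_inj)
qed

lemma orth_intD:
  assumes "orth_int n S"
  shows "S \<in> carrier_mat n n" "transpose_mat S * S = 1\<^sub>m n" "S * transpose_mat S = 1\<^sub>m n"
proof -
  show 1: "S \<in> carrier_mat n n" "transpose_mat S * S = 1\<^sub>m n" using assms by (auto simp: orth_int_def)
  show "S * transpose_mat S = 1\<^sub>m n"
    by (rule left_inverse_int_mat[OF _ 1(1) 1(2)]) (use 1 in simp)
qed

lemma orth_int_mult_vec:
  assumes "orth_int n S" "x \<in> carrier_vec n"
  shows "transpose_mat S *\<^sub>v (S *\<^sub>v x) = x" "S *\<^sub>v (transpose_mat S *\<^sub>v x) = x"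
proof -
  note S = orth_intD[OF assms(1)]
  have T: "transpose_mat S \<in> carrier_mat n n" using S(1) by simp
  show "transpose_mat S *\<^sub>v (S *\<^sub>v x) = x"
    unfolding assoc_mult_mat_vec[OF T S(1) assms(2), symmetric] S(2) by (rule one_mult_mat_vec[OF assms(2)])
  show "S *\<^sub>v (transpose_mat S *\<^sub>v x) = x"
    unfolding assoc_mult_mat_vec[OF S(1) T assms(2), symmetric] S(3) by (rule one_mult_mat_vec[OF assms(2)])
qed

lemma orth_int_transpose: "orth_int n S \<Longrightarrow> orth_int n (transpose_mat S)"
  using orth_intD(1,3)[of n S] unfolding orth_int_def by simp

lemma orth_int_mult: assumes "orth_int n S" "orth_int n T" shows "orth_int n (S * T)"
proof -
  note S = orth_intD[OF assms(1)] and T = orth_intD[OF assms(2)]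
  have "transpose_mat (S * T) * (S * T) = transpose_mat T * ((transpose_mat S * S) * T)"
    using S(1) T(1) by (simp add: transpose_mult[OF S(1) T(1)] assoc_mult_mat[of _ n n _ n _ n])
  then show ?thesis using S T by (simp add: orth_int_def)
qed

lemma orth_int_scalar_prod:
  assumes S: "orth_int n S" and x: "x \<in> carrier_vec n" "y \<in> carrier_vec n"
  shows "(S *\<^sub>v x) \<bullet> (S *\<^sub>v y) = x \<bullet> y"
proof -
  note Sc = orth_intD(1)[OF S]
  have "(transpose_mat (transpose_mat S) *\<^sub>v x) \<bullet> (S *\<^sub>v y) = x \<bullet> (transpose_mat S *\<^sub>v (S *\<^sub>v y))"
    by (rule transpose_vec_mult_scalar) (use Sc x in \<open>auto intro: mult_mat_vec_carrier\<close>)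
  then show ?thesis using orth_int_mult_vec[OF S x(2)] by simp
qed

text \<open>The oracle reveals the rotation only up to a signed permutation \<open>S\<close>, so the
  computation takes place in \<open>S \<Lambda>\<close> instead of \<open>\<Lambda>\<close>. The
  axioms survive because they involve \<open>\<Lambda>\<close> through scalar products, which
  \<open>S\<close> preserves.\<close>

lemma lcd_lattice_image:
  assumes \<Lambda>: "lcd_lattice n k \<Lambda>" and S: "orth_int n S"
  shows "lcd_lattice n k ((\<lambda>x. S *\<^sub>v x) ` \<Lambda>)"
proof -
  interpret lcd_lattice n k \<Lambda> by fact
  note Sc = orth_intD(1)[OF S]
  have Sv [simp]: "S *\<^sub>v v \<in> carrier_vec n" "transpose_mat S *\<^sub>v v \<in> carrier_vec n" for v
    using carrier_matD[OF Sc] by (simp_all add: carrier_vecI)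
  note L = mult_add_distrib_mat_vec[OF Sc] mult_mat_vec_smult[OF Sc] mult_minus_distrib_mat_vec[OF Sc]
  show ?thesis
  proof
    show "0 < k" by (rule k_pos)
    show "x \<in> carrier_vec n" if "x \<in> (\<lambda>x. S *\<^sub>v x) ` \<Lambda>" for x using that by auto
    show "x + y \<in> (\<lambda>x. S *\<^sub>v x) ` \<Lambda>" if xy: "x \<in> (\<lambda>x. S *\<^sub>v x) ` \<Lambda>" "y \<in> (\<lambda>x. S *\<^sub>v x) ` \<Lambda>" for x y
    proof -
      obtain x' y' where "x' \<in> \<Lambda>" "y' \<in> \<Lambda>" "x = S *\<^sub>v x'" "y = S *\<^sub>v y'" using xy by blast
      then show ?thesis by (intro image_eqI[of _ _ "x' + y'"]) (simp_all add: L carrier add)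
    qed
    show "c \<cdot>\<^sub>v x \<in> (\<lambda>x. S *\<^sub>v x) ` \<Lambda>" if x: "x \<in> (\<lambda>x. S *\<^sub>v x) ` \<Lambda>" for c x
    proof -
      obtain x' where "x' \<in> \<Lambda>" "x = S *\<^sub>v x'" using x by blast
      then show ?thesis by (intro image_eqI[of _ _ "c \<cdot>\<^sub>v x'"]) (simp_all add: L carrier smult)
    qed
    show "int k \<cdot>\<^sub>v x \<in> (\<lambda>x. S *\<^sub>v x) ` \<Lambda>" if x: "x \<in> carrier_vec n" for x
    proof -
      have "int k \<cdot>\<^sub>v x = S *\<^sub>v (int k \<cdot>\<^sub>v (transpose_mat S *\<^sub>v x))"
        using orth_int_mult_vec(2)[OF S x] by (simp add: L)
      then show ?thesis using kmult[of "transpose_mat S *\<^sub>v x"] by (metis Sv(2) image_eqI)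
    qed
    show "\<exists>z\<in>carrier_vec n. x = int k \<cdot>\<^sub>v z"
      if x: "x \<in> (\<lambda>x. S *\<^sub>v x) ` \<Lambda>" and dv: "\<And>y. y \<in> (\<lambda>x. S *\<^sub>v x) ` \<Lambda> \<Longrightarrow> int k dvd x \<bullet> y" for x
    proof -
      obtain x' where x': "x' \<in> \<Lambda>" "x = S *\<^sub>v x'" using x by blast
      have "int k dvd x' \<bullet> y" if "y \<in> \<Lambda>" for y
        using dv[of "S *\<^sub>v y"] orth_int_scalar_prod[OF S carrier carrier, OF x'(1) that] that x' by auto
      then obtain z where "z \<in> carrier_vec n" "x' = int k \<cdot>\<^sub>v z" using radical[OF x'(1)] by blast
      then show ?thesis using x'(2) L(2) Sv(1) by blast
    qed
    show "\<exists>c\<in>(\<lambda>x. S *\<^sub>v x) ` \<Lambda>. \<forall>y\<in>(\<lambda>x. S *\<^sub>v x) ` \<Lambda>. int k dvd (z - c) \<bullet> y" if z: "z \<in> carrier_vec n" for z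
    proof -
      obtain c where c: "c \<in> \<Lambda>" "\<And>y. y \<in> \<Lambda> \<Longrightarrow> int k dvd (transpose_mat S *\<^sub>v z - c) \<bullet> y"
        using split[of "transpose_mat S *\<^sub>v z"] by auto
      have "int k dvd (z - S *\<^sub>v c) \<bullet> (S *\<^sub>v y)" if "y \<in> \<Lambda>" for y
      proof -
        have "z - S *\<^sub>v c = S *\<^sub>v (transpose_mat S *\<^sub>v z - c)"
          using carrier[OF c(1)] orth_int_mult_vec(2)[OF S z] by (simp add: L)
        then have "(z - S *\<^sub>v c) \<bullet> (S *\<^sub>v y) = (transpose_mat S *\<^sub>v z - c) \<bullet> y"
          using carrier[OF c(1)] carrier[OF that] by (simp add: orth_int_scalar_prod[OF S])
        then show ?thesis using c(2)[OF that] by simp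
      qed
      then show ?thesis using c(1) by blast
    qed
  qed
qed

section \<open>Projectors modulo k\<close>

text \<open>Column \<open>j\<close> is the component in \<open>\<Lambda>\<close> of the \<open>j\<close>-th unit vector with respect to
  \<open>\<Lambda> + k \<Lambda>\<^sup>* = \<int>\<^sup>n\<close>; only its residues modulo \<open>k\<close> are determined.\<close>

definition projector :: "nat \<Rightarrow> nat \<Rightarrow> int vec set \<Rightarrow> int mat \<Rightarrow> bool" where
  "projector n k \<Lambda> P \<longleftrightarrow> P \<in> carrier_mat n n \<and>
     (\<forall>j<n. col P j \<in> \<Lambda> \<and> (\<forall>y\<in>\<Lambda>. int k dvd (unit_vec n j - col P j) \<bullet> y))"

context lcd_lattice
begin

lemma minus: "x \<in> \<Lambda> \<Longrightarrow> y \<in> \<Lambda> \<Longrightarrow> x - y \<in> \<Lambda>"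
proof -
  assume xy: "x \<in> \<Lambda>" "y \<in> \<Lambda>"
  then have "x - y = x + (- 1) \<cdot>\<^sub>v y" using carrier by (intro eq_vecI) auto
  then show ?thesis using xy add smult by simp
qed

lemma congruent_mem:
  assumes x: "x \<in> \<Lambda>" and y: "y \<in> carrier_vec n" and dv: "\<And>i. i < n \<Longrightarrow> int k dvd y $ i - x $ i"
  shows "y \<in> \<Lambda>"
proof -
  let ?z = "vec n (\<lambda>i. (y $ i - x $ i) div int k)"
  have "y = x + int k \<cdot>\<^sub>v ?z" using carrier[OF x] y dv by (intro eq_vecI) auto
  then show ?thesis using add[OF x kmult[of ?z]] by simp
qed

text \<open>The difference \<open>p - q\<close> lies in \<open>\<Lambda>\<close> and is orthogonal
  to it modulo \<open>k\<close>, so \<open>radical\<close> applies.\<close>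

lemma decomposition_unique:
  assumes p: "p \<in> \<Lambda>" "\<And>y. y \<in> \<Lambda> \<Longrightarrow> int k dvd (z - p) \<bullet> y"
    and q: "q \<in> \<Lambda>" "\<And>y. y \<in> \<Lambda> \<Longrightarrow> int k dvd (z - q) \<bullet> y"
    and z: "z \<in> carrier_vec n" and i: "i < n"
  shows "int k dvd p $ i - q $ i"
proof -
  have c: "p \<in> carrier_vec n" "q \<in> carrier_vec n" using carrier p q by auto
  have "int k dvd (p - q) \<bullet> y" if y: "y \<in> \<Lambda>" for y
  proof -
    have "(p - q) \<bullet> y = (z - q) \<bullet> y - (z - p) \<bullet> y"
      using c z carrier[OF y] by (simp add: minus_scalar_prod_distrib[of _ n])
    then show ?thesis using p(2)[OF y] q(2)[OF y] by simp
  qed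
  then obtain w where w: "w \<in> carrier_vec n" "p - q = int k \<cdot>\<^sub>v w"
    using radical[OF minus[OF p(1) q(1)]] by blast
  have "(p - q) $ i = int k * w $ i" unfolding w(2) using w(1) i by simp
  then have "p $ i - q $ i = int k * w $ i" using c i by simp
  then show ?thesis by simp
qed

text \<open>As for real orthogonal projections: modulo \<open>k\<close>, both
  \<open>e_j . p_i\<close> and \<open>e_i . p_j\<close> agree with \<open>p_j . p_i\<close>.\<close>

lemma projector_symmetric:
  assumes P: "projector n k \<Lambda> P" and ij: "i < n" "j < n"
  shows "int k dvd P $$ (i, j) - P $$ (j, i)"
proof -
  have Pc: "P \<in> carrier_mat n n" using P by (simp add: projector_def)
  let ?p = "col P"
  have c: "?p l \<in> carrier_vec n" for l using Pc by (simp add: carrier_vecI)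
  have "int k dvd (unit_vec n j - ?p j) \<bullet> ?p i" "int k dvd (unit_vec n i - ?p i) \<bullet> ?p j"
    using P ij by (auto simp: projector_def)
  moreover have "(unit_vec n j - ?p j) \<bullet> ?p i = P $$ (j, i) - ?p j \<bullet> ?p i"
    using ij c Pc by (simp add: minus_scalar_prod_distrib[of _ n])
  moreover have "(unit_vec n i - ?p i) \<bullet> ?p j = P $$ (i, j) - ?p j \<bullet> ?p i"
    using ij c Pc comm_scalar_prod[OF c c, of i j] by (simp add: minus_scalar_prod_distrib[of _ n])
  ultimately show ?thesis using dvd_diff[of "int k" "P $$ (i, j) - ?p j \<bullet> ?p i" "P $$ (j, i) - ?p j \<bullet> ?p i"] by simp
qed

lemma mat_vec_mem:
  assumes M: "M \<in> carrier_mat n m" and cols: "\<And>j. j < m \<Longrightarrow> col M j \<in> \<Lambda>" and x: "x \<in> carrier_vec m"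
  shows "M *\<^sub>v x \<in> \<Lambda>"
proof -
  have "vec n (\<lambda>i. \<Sum>j<t. M $$ (i, j) * x $ j) \<in> \<Lambda>" if "t \<le> m" for t
    using that
  proof (induction t)
    case 0
    have "vec n (\<lambda>i. \<Sum>j<0. M $$ (i, j) * x $ j) = int k \<cdot>\<^sub>v 0\<^sub>v n" by (intro eq_vecI) auto
    then show ?case using kmult[of "0\<^sub>v n"] by simp
  next
    case (Suc t)
    have "vec n (\<lambda>i. \<Sum>j<Suc t. M $$ (i, j) * x $ j) = vec n (\<lambda>i. \<Sum>j<t. M $$ (i, j) * x $ j) + x $ t \<cdot>\<^sub>v col M t"
      using Suc.prems M by (intro eq_vecI) auto
    then show ?case using Suc add smult cols by simp
  qed
  moreover have "M *\<^sub>v x = vec n (\<lambda>i. \<Sum>j<m. M $$ (i, j) * x $ j)"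
    using M x by (intro eq_vecI) (auto simp: scalar_prod_def atLeast0LessThan intro!: sum.cong)
  ultimately show ?thesis by simp
qed

text \<open>The lattice is the fixed space of its projector modulo \<open>k\<close>, which is why
  the projector determines it. If \<open>x\<close> is in \<open>\<Lambda>\<close>, then
  \<open>x\<close> and \<open>P x\<close> are both lattice components of \<open>x\<close> and agree
  modulo \<open>k\<close> by uniqueness; conversely \<open>P x\<close> lies in
  \<open>\<Lambda>\<close> and so does everything congruent to it.\<close>

lemma mem_iff_projector:
  assumes P: "projector n k \<Lambda> P" and x: "x \<in> carrier_vec n"
  shows "x \<in> \<Lambda> \<longleftrightarrow> (\<forall>i<n. int k dvd (\<Sum>j<n. P $$ (i, j) * x $ j) - x $ i)"
proof -
  have Pc: "P \<in> carrier_mat n n" and cols: "\<And>j. j < n \<Longrightarrow> col P j \<in> \<Lambda>" using P by (auto simp: projector_def)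
  let ?p = "P *\<^sub>v x"
  have Px: "?p \<in> \<Lambda>" by (rule mat_vec_mem[OF Pc cols x])
  have pi: "?p $ i = (\<Sum>j<n. P $$ (i, j) * x $ j)" if "i < n" for i
    using that Pc x by (auto simp: scalar_prod_def atLeast0LessThan intro!: sum.cong)
  show ?thesis
  proof
    assume xL: "x \<in> \<Lambda>"
    have "int k dvd (x - ?p) \<bullet> y" if y: "y \<in> \<Lambda>" for y
    proof -
      have yc: "y \<in> carrier_vec n" by (rule carrier[OF y])
      have "(x - ?p) \<bullet> y = x \<bullet> y - ?p \<bullet> y"
        using x carrier[OF Px] yc by (simp add: minus_scalar_prod_distrib[of _ n])
      also have "?p \<bullet> y = x \<bullet> (transpose_mat P *\<^sub>v y)"
        using transpose_vec_mult_scalar[of "transpose_mat P" n n y x] Pc x yc by simp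
      also have "x \<bullet> y - x \<bullet> (transpose_mat P *\<^sub>v y) = x \<bullet> (y - transpose_mat P *\<^sub>v y)"
        using x yc Pc by (subst scalar_prod_minus_distrib[of _ n]) auto
      also have "int k dvd \<dots>"
      proof (rule dvd_scalar_prod[OF x])
        show "y - transpose_mat P *\<^sub>v y \<in> carrier_vec n" 
          using yc Pc by (intro minus_carrier_vec mult_mat_vec_carrier[of _ n n]) simp_all
        fix i assume i: "i < n"
        have "(y - transpose_mat P *\<^sub>v y) $ i = (unit_vec n i - col P i) \<bullet> y"
          using i yc Pc carrier[OF cols[OF i]] by (simp add: minus_scalar_prod_distrib[of _ n])
        then show "int k dvd (y - transpose_mat P *\<^sub>v y) $ i" using P y i by (simp add: projector_def)
      qed
      finally show ?thesis .
    qed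
    moreover have "int k dvd (x - x) \<bullet> y" if "y \<in> \<Lambda>" for y
      using x carrier[OF that] by simp
    ultimately have "int k dvd ?p $ i - x $ i" if "i < n" for i
      using decomposition_unique[OF Px _ xL _ x that] by blast
    then show "\<forall>i<n. int k dvd (\<Sum>j<n. P $$ (i, j) * x $ j) - x $ i" using pi by simp
  next
    assume "\<forall>i<n. int k dvd (\<Sum>j<n. P $$ (i, j) * x $ j) - x $ i"
    then show "x \<in> \<Lambda>" using pi by (intro congruent_mem[OF Px x]) (simp add: dvd_diff_commute)
  qed
qed

end

text \<open>The matrix \<open>S\<close> carries decompositions to decompositions: since the unit
  vector at \<open>\<sigma> j\<close> is \<open>\<epsilon> j\<close> times the image of the unit
  vector at \<open>j\<close>, its lattice component is \<open>\<epsilon> j\<close> times the image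
  of column \<open>j\<close> of \<open>P\<close>.\<close>

lemma projector_signed_permutation:
  assumes \<Lambda>: "lcd_lattice n k \<Lambda>" and S: "orth_int n S"
    and P: "projector n k \<Lambda> P" and Q: "projector n k ((\<lambda>x. S *\<^sub>v x) ` \<Lambda>) Q"
    and \<sigma>: "\<sigma> permutes {..<n}" and \<epsilon>: "\<And>j. j < n \<Longrightarrow> \<epsilon> j = 1 \<or> \<epsilon> j = - (1 :: int)"
    and ent: "\<And>i j. i < n \<Longrightarrow> j < n \<Longrightarrow> S $$ (i, j) = (if i = \<sigma> j then \<epsilon> j else 0)"
    and ij: "i < n" "j < n"
  shows "int k dvd Q $$ (\<sigma> i, \<sigma> j) - \<epsilon> i * \<epsilon> j * P $$ (i, j)"
proof -
  interpret A: lcd_lattice n k \<Lambda> by fact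
  interpret B: lcd_lattice n k "(\<lambda>x. S *\<^sub>v x) ` \<Lambda>" by (rule lcd_lattice_image) fact+
  note Sc = orth_intD(1)[OF S]
  have \<sigma>n: "\<sigma> l < n" if "l < n" for l using permutes_in_image[OF \<sigma>, of l] that by simp
  have Pc: "P \<in> carrier_mat n n" and Qc: "Q \<in> carrier_mat n n" using P Q by (auto simp: projector_def)
  have Sx: "(S *\<^sub>v x) $ \<sigma> l = \<epsilon> l * x $ l" if "l < n" "x \<in> carrier_vec n" for x l
  proof -
    have "(S *\<^sub>v x) $ \<sigma> l = (\<Sum>b<n. S $$ (\<sigma> l, b) * x $ b)"
      using that Sc \<sigma>n by (auto simp: scalar_prod_def atLeast0LessThan intro!: sum.cong)
    also have "\<dots> = (\<Sum>b<n. if b = l then \<epsilon> l * x $ l else 0)"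
      using that \<sigma>n ent inj_onD[OF permutes_inj_on[OF \<sigma>, of UNIV]] by (intro sum.cong) auto
    finally show ?thesis using that by simp
  qed
  let ?p = "col P j" and ?q = "\<epsilon> j \<cdot>\<^sub>v (S *\<^sub>v col P j)"
  have p: "?p \<in> \<Lambda>" "\<And>y. y \<in> \<Lambda> \<Longrightarrow> int k dvd (unit_vec n j - ?p) \<bullet> y" using P ij by (auto simp: projector_def)
  have pc: "?p \<in> carrier_vec n" by (rule A.carrier[OF p(1)])
  have \<epsilon>2: "\<epsilon> j * \<epsilon> j = 1" using \<epsilon>[OF ij(2)] by auto
  have unit: "unit_vec n (\<sigma> j) = \<epsilon> j \<cdot>\<^sub>v (S *\<^sub>v unit_vec n j)"
    using ij \<sigma>n Sc ent \<epsilon>2 by (intro eq_vecI) auto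
  have "int k dvd (unit_vec n (\<sigma> j) - ?q) \<bullet> y" if y: "y \<in> (\<lambda>x. S *\<^sub>v x) ` \<Lambda>" for y
  proof -
    obtain y' where y': "y' \<in> \<Lambda>" "y = S *\<^sub>v y'" using y by blast
    have "unit_vec n (\<sigma> j) - ?q = \<epsilon> j \<cdot>\<^sub>v (S *\<^sub>v (unit_vec n j - ?p))"
      unfolding unit using Sc pc
      by (subst mult_minus_distrib_mat_vec[OF Sc]) (auto intro!: eq_vecI simp: algebra_simps)
    then have "(unit_vec n (\<sigma> j) - ?q) \<bullet> y = \<epsilon> j * ((S *\<^sub>v (unit_vec n j - ?p)) \<bullet> (S *\<^sub>v y'))"
      using Sc y' by (simp add: carrier_vecI)
    also have "(S *\<^sub>v (unit_vec n j - ?p)) \<bullet> (S *\<^sub>v y') = (unit_vec n j - ?p) \<bullet> y'"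
      by (rule orth_int_scalar_prod[OF S]) (use pc A.carrier[OF y'(1)] in auto)
    finally show ?thesis using p(2)[OF y'(1)] by simp
  qed
  moreover have "?q \<in> (\<lambda>x. S *\<^sub>v x) ` \<Lambda>" using B.smult p(1) by blast
  ultimately have "int k dvd col Q (\<sigma> j) $ \<sigma> i - ?q $ \<sigma> i"
    using Q \<sigma>n ij by (intro B.decomposition_unique[where z = "unit_vec n (\<sigma> j)"]) (auto simp: projector_def)
  moreover have "?q $ \<sigma> i = \<epsilon> i * \<epsilon> j * P $$ (i, j)"
    using Sx[OF ij(1) pc] Sc Pc \<sigma>n ij by simp
  ultimately show ?thesis using Qc \<sigma>n ij by simp
qed

text \<open>This direction lets an arbitrary signed permutation found by the graph oracle be used.
  The conjugation relation translates the fixed-point condition of \<open>mem_iff_projector\<close>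
  for \<open>x\<close> and \<open>P\<close> into the one for \<open>S x\<close> and
  \<open>Q\<close>.\<close>

lemma signed_permutation_lattice:
  assumes A: "lcd_lattice n k \<Lambda>1" and B: "lcd_lattice n k \<Lambda>2"
    and P: "projector n k \<Lambda>1 P" and Q: "projector n k \<Lambda>2 Q"
    and \<sigma>: "\<sigma> permutes {..<n}" and \<epsilon>: "\<And>j. j < n \<Longrightarrow> \<epsilon> j = 1 \<or> \<epsilon> j = - (1 :: int)"
    and S: "S = mat n n (\<lambda>(i, j). if i = \<sigma> j then \<epsilon> j else 0)"
    and eq: "\<And>i j. i < n \<Longrightarrow> j < n \<Longrightarrow> int k dvd Q $$ (\<sigma> i, \<sigma> j) - \<epsilon> i * \<epsilon> j * P $$ (i, j)"
  shows "orth_int n S" "x \<in> carrier_vec n \<Longrightarrow> S *\<^sub>v x \<in> \<Lambda>2 \<longleftrightarrow> x \<in> \<Lambda>1"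
proof -
  have \<sigma>n: "\<sigma> l < n" if "l < n" for l using permutes_in_image[OF \<sigma>, of l] that by simp
  have inj: "\<sigma> i = \<sigma> j \<longleftrightarrow> i = j" for i j using permutes_inj[OF \<sigma>] by (auto dest: injD)
  have \<epsilon>2: "\<epsilon> j * \<epsilon> j = 1" if "j < n" for j using \<epsilon>[OF that] by auto
  have Sc: "S \<in> carrier_mat n n" by (simp add: S)
  have ST: "(transpose_mat S * S) $$ (i, j) = 1\<^sub>m n $$ (i, j)" if "i < n" "j < n" for i j
  proof -
    have "(transpose_mat S * S) $$ (i, j) = (\<Sum>l<n. S $$ (l, i) * S $$ (l, j))"
      using that Sc by (simp add: scalar_prod_def atLeast0LessThan)
    also have "\<dots> = (\<Sum>l<n. if l = \<sigma> i then if i = j then 1 else 0 else 0)"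
      using that \<epsilon>2 by (intro sum.cong) (auto simp: S inj)
    finally show ?thesis using that \<sigma>n by simp
  qed
  show "orth_int n S" unfolding orth_int_def using Sc ST by (auto intro!: eq_matI)
  assume x: "x \<in> carrier_vec n"
  interpret A: lcd_lattice n k \<Lambda>1 by fact
  interpret B: lcd_lattice n k \<Lambda>2 by fact
  let ?y = "S *\<^sub>v x"
  have yc: "?y \<in> carrier_vec n" using Sc by (simp add: carrier_vecI)
  have y: "?y $ \<sigma> l = \<epsilon> l * x $ l" if "l < n" for l
  proof -
    have "?y $ \<sigma> l = (\<Sum>b<n. S $$ (\<sigma> l, b) * x $ b)"
      using that Sc x \<sigma>n by (auto simp: scalar_prod_def atLeast0LessThan intro!: sum.cong)
    also have "\<dots> = (\<Sum>b<n. if b = l then \<epsilon> l * x $ l else 0)"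
      using that \<sigma>n by (intro sum.cong) (auto simp: S inj)
    finally show ?thesis using that by simp
  qed
  \<comment> \<open>Modulo \<open>k\<close>, entry \<open>\<sigma> i\<close> of
    \<open>Q (S x)\<close> is \<open>\<epsilon> i\<close> times entry \<open>i\<close> of
    \<open>P x\<close>, after summing over \<open>\<sigma> j\<close> instead of
    \<open>j\<close>.\<close>
  have key: "int k dvd (\<Sum>j<n. Q $$ (\<sigma> i, j) * ?y $ j) - \<epsilon> i * (\<Sum>j<n. P $$ (i, j) * x $ j)" if i: "i < n" for i
  proof -
    have "(\<Sum>j<n. Q $$ (\<sigma> i, j) * ?y $ j) = (\<Sum>j<n. Q $$ (\<sigma> i, \<sigma> j) * ?y $ \<sigma> j)"
      using sum.permute[OF \<sigma>, of "\<lambda>j. Q $$ (\<sigma> i, j) * ?y $ j"] by (simp add: o_def)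
    also have "\<dots> - \<epsilon> i * (\<Sum>j<n. P $$ (i, j) * x $ j)
       = (\<Sum>j<n. (Q $$ (\<sigma> i, \<sigma> j) - \<epsilon> i * \<epsilon> j * P $$ (i, j)) * (\<epsilon> j * x $ j))"
      unfolding sum_distrib_left sum_subtractf[symmetric]
      by (intro sum.cong) (use \<epsilon>2 y in \<open>auto simp: algebra_simps\<close>)
    finally have "(\<Sum>j<n. Q $$ (\<sigma> i, j) * ?y $ j) - \<epsilon> i * (\<Sum>j<n. P $$ (i, j) * x $ j)
       = (\<Sum>j<n. (Q $$ (\<sigma> i, \<sigma> j) - \<epsilon> i * \<epsilon> j * P $$ (i, j)) * (\<epsilon> j * x $ j))" .
    moreover have "int k dvd (\<Sum>j<n. (Q $$ (\<sigma> i, \<sigma> j) - \<epsilon> i * \<epsilon> j * P $$ (i, j)) * (\<epsilon> j * x $ j))"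
      using eq[OF i] by (intro dvd_sum dvd_mult2) auto
    ultimately show ?thesis by simp
  qed
  have iff: "int k dvd (\<Sum>j<n. Q $$ (\<sigma> i, j) * ?y $ j) - ?y $ \<sigma> i \<longleftrightarrow>
      int k dvd (\<Sum>j<n. P $$ (i, j) * x $ j) - x $ i" if i: "i < n" for i
  proof -
    let ?a = "\<Sum>j<n. Q $$ (\<sigma> i, j) * ?y $ j" and ?b = "\<Sum>j<n. P $$ (i, j) * x $ j"
    have "?a - ?y $ \<sigma> i = (?a - \<epsilon> i * ?b) + \<epsilon> i * (?b - x $ i)" using y[OF i] by (simp add: algebra_simps)
    then have "int k dvd ?a - ?y $ \<sigma> i \<longleftrightarrow> int k dvd \<epsilon> i * (?b - x $ i)"
      using key[OF i] by (simp only: dvd_add_right_iff)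
    also have "\<dots> \<longleftrightarrow> int k dvd ?b - x $ i" using \<epsilon>[OF i] dvd_diff_commute[of "int k" ?b "x $ i"] by auto
    finally show ?thesis .
  qed
  have "?y \<in> \<Lambda>2 \<longleftrightarrow> (\<forall>i<n. int k dvd (\<Sum>j<n. Q $$ (i, j) * ?y $ j) - ?y $ i)"
    by (rule B.mem_iff_projector[OF Q yc])
  also have "\<dots> \<longleftrightarrow> (\<forall>i<n. int k dvd (\<Sum>j<n. Q $$ (\<sigma> i, j) * ?y $ j) - ?y $ \<sigma> i)"
  proof (intro iffI allI impI)
    fix i assume *: "\<forall>i<n. int k dvd (\<Sum>j<n. Q $$ (\<sigma> i, j) * ?y $ j) - ?y $ \<sigma> i" and i: "i < n"
    obtain l where "l < n" "i = \<sigma> l" using permutes_image[OF \<sigma>] i by (metis imageE lessThan_iff)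
    then show "int k dvd (\<Sum>j<n. Q $$ (i, j) * ?y $ j) - ?y $ i" using * by blast
  qed (use \<sigma>n in blast)
  also have "\<dots> \<longleftrightarrow> x \<in> \<Lambda>1" using iff A.mem_iff_projector[OF P x] by blast
  finally show "?y \<in> \<Lambda>2 \<longleftrightarrow> x \<in> \<Lambda>1" .
qed

section \<open>Real lattice bases\<close>

abbreviation "rm \<equiv> map_mat real_of_int"
abbreviation "rv \<equiv> map_vec real_of_int"

lemmas rm_mult = of_int_hom.mat_hom_mult[where 'a = real]
lemmas rm_mult_vec = of_int_hom.mult_mat_vec_hom[where 'a = real]

lemma smult_one_mult_mat:
  fixes A :: "'a :: comm_semiring_1 mat"
  assumes "A \<in> carrier_mat n m"
  shows "(c \<cdot>\<^sub>m 1\<^sub>m n) * A = c \<cdot>\<^sub>m A"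
  using mult_smult_assoc_mat[of "1\<^sub>m n" n n A m c] assms by simp

lemma construction_A_eq: "construction_A k n C = rv ` code_lattice k n C"
  by (auto simp: construction_A_def code_lattice_def)

lemma int_lattice_eq: "int_lattice n = rv ` carrier_vec n"
  by (auto simp: int_lattice_def)

lemma orthonormal_matD:
  assumes "orthonormal_mat n Q"
  shows "Q \<in> carrier_mat n n" "transpose_mat Q * Q = 1\<^sub>m n" "Q * transpose_mat Q = 1\<^sub>m n"
proof -
  show 1: "Q \<in> carrier_mat n n" "transpose_mat Q * Q = 1\<^sub>m n" using assms by (auto simp: orthonormal_mat_def)
  show "Q * transpose_mat Q = 1\<^sub>m n"
    by (rule mat_mult_left_right_inverse[OF _ 1(1) 1(2)]) (use 1 in simp)
qed

lemma orthonormal_mat_cancel: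
  assumes Q: "orthonormal_mat n Q" and x: "x \<in> carrier_vec n"
  shows "transpose_mat Q *\<^sub>v (Q *\<^sub>v x) = x"
proof -
  note D = orthonormal_matD[OF Q]
  have T: "transpose_mat Q \<in> carrier_mat n n" using D(1) by simp
  show ?thesis unfolding assoc_mult_mat_vec[OF T D(1) x, symmetric] D(2) by (rule one_mult_mat_vec[OF x])
qed

lemma orthonormal_mat_transpose: "orthonormal_mat n Q \<Longrightarrow> orthonormal_mat n (transpose_mat Q)"
  using orthonormal_matD(1,3)[of n Q] unfolding orthonormal_mat_def by simp

lemma orthonormal_mat_mult:
  assumes "orthonormal_mat n P" "orthonormal_mat n Q" shows "orthonormal_mat n (P * Q)"
proof -
  note P = orthonormal_matD[OF assms(1)] and Q = orthonormal_matD[OF assms(2)]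
  have "transpose_mat (P * Q) * (P * Q) = transpose_mat Q * ((transpose_mat P * P) * Q)"
    using P(1) Q(1) by (simp add: transpose_mult[OF P(1) Q(1)] assoc_mult_mat[of _ n n _ n _ n])
  then show ?thesis using P Q by (simp add: orthonormal_mat_def)
qed

lemma orthonormal_rm: "orth_int n S \<Longrightarrow> orthonormal_mat n (rm S)"
proof -
  assume "orth_int n S"
  note S = orth_intD[OF this]
  have "transpose_mat (rm S) * rm S = rm (transpose_mat S * S)"
    using rm_mult[of "transpose_mat S" n n S n] S(1) by (simp add: map_mat_transpose)
  then show ?thesis using S by (simp add: orthonormal_mat_def of_int_hom.mat_hom_one)
qed

lemma integral_columns:
  assumes B: "B \<in> carrier_mat n n" and Q: "Q \<in> carrier_mat n n" and X: "X \<subseteq> carrier_vec n"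
    and cols: "\<And>j. j < n \<Longrightarrow> col B j \<in> mat_image Q (rv ` X)"
  obtains H where "H \<in> carrier_mat n n" "B = Q * rm H" "\<And>j. j < n \<Longrightarrow> col H j \<in> X"
proof -
  have "\<forall>j<n. \<exists>x\<in>X. col B j = Q *\<^sub>v rv x" using cols by (auto simp: mat_image_def)
  then obtain h where h: "\<And>j. j < n \<Longrightarrow> h j \<in> X" "\<And>j. j < n \<Longrightarrow> col B j = Q *\<^sub>v rv (h j)" by metis
  define H where "H = mat n n (\<lambda>(i, j). h j $ i)"
  have Hc: "H \<in> carrier_mat n n" by (simp add: H_def)
  have colH: "col H j = h j" if "j < n" for j
    using h(1)[OF that] X that by (intro eq_vecI) (auto simp: H_def)
  have colrm: "col (rm H) j = rv (h j)" if "j < n" for j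
    using colH[OF that] that Hc by (metis col_map_mat carrier_matD(2))
  have "B = Q * rm H"
  proof (rule mat_col_eqI)
    fix j assume "j < dim_col (Q * rm H)"
    then have j: "j < n" using Hc by simp
    have "col (Q * rm H) j = Q *\<^sub>v col (rm H) j" by (rule col_mult2[OF Q _ j]) (use Hc in simp)
    then show "col B j = col (Q * rm H) j" using h(2)[OF j] colrm[OF j] by simp
  qed (use B Q Hc in auto)
  then show ?thesis using that[OF Hc] colH h(1) by simp
qed

lemma col_eq_mult_unit:
  fixes B :: "'a :: comm_semiring_1 mat"
  assumes "B \<in> carrier_mat nr n" "j < n"
  shows "col B j = B *\<^sub>v unit_vec n j"
  using assms by (intro eq_vecI) auto

lemma rv_unit: "rv (unit_vec n j) = unit_vec n j"
  by (intro eq_vecI) (auto simp: unit_vec_def)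

lemma rv_inj: "rv x = rv y \<Longrightarrow> x = y"
  by (rule of_int_hom.vec_hom_inj)

text \<open>The factorisation \<open>B = Q H\<close> belongs to the analysis; the program knows
  neither factor. Injectivity of \<open>Q\<close> lets the equality of rotated lattices descend to
  integral coordinates.\<close>

lemma column_lattice_image:
  assumes Q: "orthonormal_mat n Q" and X: "X \<subseteq> carrier_vec n" and B: "B \<in> carrier_mat n n"
    and eq: "column_lattice B = mat_image Q (rv ` X)"
  obtains H where "H \<in> carrier_mat n n" "B = Q * rm H" "X = {H *\<^sub>v z | z. z \<in> carrier_vec n}"
proof -
  note Qc = orthonormal_matD(1)[OF Q]
  have "col B j \<in> mat_image Q (rv ` X)" if j: "j < n" for j
  proof -
    have "col B j = B *\<^sub>v rv (unit_vec n j)" using col_eq_mult_unit[OF B j] by (simp add: rv_unit)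
    then show ?thesis unfolding eq[symmetric] column_lattice_def using B by auto
  qed
  then obtain H where H: "H \<in> carrier_mat n n" "B = Q * rm H" "\<And>j. j < n \<Longrightarrow> col H j \<in> X"
    using integral_columns[OF B Qc X] by blast
  have Bz: "B *\<^sub>v rv z = Q *\<^sub>v rv (H *\<^sub>v z)" if z: "z \<in> carrier_vec n" for z
  proof -
    have "B *\<^sub>v rv z = Q *\<^sub>v (rm H *\<^sub>v rv z)"
      unfolding H(2) by (rule assoc_mult_mat_vec[OF Qc]) (use H(1) z in simp_all)
    then show ?thesis using rm_mult_vec[OF H(1) z] by simp
  qed
  have inj: "x = y" if "Q *\<^sub>v rv x = Q *\<^sub>v rv y" "x \<in> carrier_vec n" "y \<in> carrier_vec n" for x y
  proof -
    have "rv x = transpose_mat Q *\<^sub>v (Q *\<^sub>v rv x)"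
      by (rule orthonormal_mat_cancel[OF Q, symmetric]) (use that(2) in simp)
    also have "\<dots> = rv y" unfolding that(1) by (rule orthonormal_mat_cancel[OF Q]) (use that(3) in simp)
    finally have "rv x = rv y" .
    then show ?thesis by (rule rv_inj)
  qed
  have Hz: "H *\<^sub>v z \<in> carrier_vec n" if "z \<in> carrier_vec n" for z using H(1) that by simp
  have "X = {H *\<^sub>v z | z. z \<in> carrier_vec n}"
  proof (intro equalityI subsetI)
    fix x assume x: "x \<in> X"
    then have "Q *\<^sub>v rv x \<in> column_lattice B" unfolding eq by (auto simp: mat_image_def)
    then obtain z where z: "z \<in> carrier_vec n" "Q *\<^sub>v rv x = B *\<^sub>v rv z" using B by (auto simp: column_lattice_def)
    then have "x = H *\<^sub>v z" using inj[of x "H *\<^sub>v z"] Bz[OF z(1)] Hz[OF z(1)] x X by auto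
    then show "x \<in> {H *\<^sub>v z | z. z \<in> carrier_vec n}" using z(1) by blast
  next
    fix x assume "x \<in> {H *\<^sub>v z | z. z \<in> carrier_vec n}"
    then obtain z where z: "z \<in> carrier_vec n" "x = H *\<^sub>v z" by blast
    have "B *\<^sub>v rv z \<in> mat_image Q (rv ` X)" unfolding eq[symmetric] column_lattice_def using B z by auto
    then obtain y where "y \<in> X" "Q *\<^sub>v rv x = Q *\<^sub>v rv y" using Bz[OF z(1)] z(2) by (auto simp: mat_image_def)
    then show "x \<in> X" using inj[of x y] X Hz[OF z(1)] z(2) by auto
  qed
  then show ?thesis using that[OF H(1,2)] by blast
qed

section \<open>Integral bases of LCD lattices\<close>

locale lcd_basis = lcd_lattice +
  fixes H :: "int mat"
  assumes H_carrier: "H \<in> carrier_mat n n"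
    and basis: "\<Lambda> = {H *\<^sub>v z | z. z \<in> carrier_vec n}"
begin

lemma Ht_carrier: "transpose_mat H \<in> carrier_mat n n"
  using H_carrier by simp

lemma H_mult_in: "z \<in> carrier_vec n \<Longrightarrow> H *\<^sub>v z \<in> \<Lambda>"
  using basis by blast

text \<open>As \<open>k \<int>^n\<close> is contained in the lattice, each column of
  \<open>k I\<close> is an integral combination of the columns of \<open>H\<close>.\<close>

lemma H_right_quotient: obtains E where "E \<in> carrier_mat n n" "H * E = int k \<cdot>\<^sub>m 1\<^sub>m n"
proof -
  have "\<forall>j<n. \<exists>z\<in>carrier_vec n. int k \<cdot>\<^sub>v unit_vec n j = H *\<^sub>v z"
    using kmult[of "unit_vec n _"] unfolding basis by fastforce
  then obtain e where e: "\<And>j. j < n \<Longrightarrow> e j \<in> carrier_vec n" "\<And>j. j < n \<Longrightarrow> int k \<cdot>\<^sub>v unit_vec n j = H *\<^sub>v e j"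
    by metis
  define E where "E = mat n n (\<lambda>(i, j). e j $ i)"
  have Ec: "E \<in> carrier_mat n n" by (simp add: E_def)
  have colE: "col E j = e j" if "j < n" for j using e(1)[OF that] that by (intro eq_vecI) (auto simp: E_def)
  have "H * E = int k \<cdot>\<^sub>m 1\<^sub>m n"
  proof (rule mat_col_eqI)
    fix j assume "j < dim_col (int k \<cdot>\<^sub>m 1\<^sub>m n)"
    then have j: "j < n" by simp
    have "col (H * E) j = int k \<cdot>\<^sub>v unit_vec n j"
      unfolding col_mult2[OF H_carrier Ec j] colE[OF j] e(2)[OF j] ..
    then show "col (H * E) j = col (int k \<cdot>\<^sub>m 1\<^sub>m n) j" using j by (intro eq_vecI) (auto simp: unit_vec_def)
  qed (use H_carrier Ec in auto)
  then show ?thesis using that Ec by blast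
qed

lemma det_H: "det H \<noteq> 0"
proof -
  obtain E where E: "E \<in> carrier_mat n n" "H * E = int k \<cdot>\<^sub>m 1\<^sub>m n" by (rule H_right_quotient)
  have "det H * det E = int k ^ n"
    unfolding det_mult[OF H_carrier E(1), symmetric] E(2) by (simp add: det_smult)
  then show ?thesis using k_pos by auto
qed

text \<open>From \<open>H E = k I\<close> follows \<open>H (E H) = k H\<close>. Multiplying by the
  adjugate of \<open>H\<close> and cancelling the nonzero determinant leaves
  \<open>E H = k I\<close> without division.\<close>

lemma H_left_quotient: obtains E where "E \<in> carrier_mat n n" "E * H = int k \<cdot>\<^sub>m 1\<^sub>m n"
proof -
  obtain E where E: "E \<in> carrier_mat n n" "H * E = int k \<cdot>\<^sub>m 1\<^sub>m n" by (rule H_right_quotient)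
  have "(E * H) $$ (i, j) = (int k \<cdot>\<^sub>m 1\<^sub>m n) $$ (i, j)" if ij: "i < n" "j < n" for i j
  proof -
    have "H * (E * H) = (H * E) * H" 
      by (rule assoc_mult_mat[OF H_carrier E(1) H_carrier, symmetric])
    also have "\<dots> = int k \<cdot>\<^sub>m H" unfolding E(2) by (rule smult_one_mult_mat[OF H_carrier])
    finally have eq: "H * (E * H) = int k \<cdot>\<^sub>m H" .
    have "adj_mat H * (H * (E * H)) = (adj_mat H * H) * (E * H)"
      using adj_mat(1)[OF H_carrier] H_carrier E by (simp add: assoc_mult_mat[of _ n n _ n _ n])
    also have "\<dots> = det H \<cdot>\<^sub>m (E * H)" 
      unfolding adj_mat(3)[OF H_carrier] by (rule smult_one_mult_mat[of _ n n]) (use H_carrier E in simp)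
    finally have "det H \<cdot>\<^sub>m (E * H) = int k \<cdot>\<^sub>m (det H \<cdot>\<^sub>m 1\<^sub>m n)"
      unfolding eq mult_smult_distrib[OF adj_mat(1)[OF H_carrier] H_carrier] adj_mat(3)[OF H_carrier] by simp
    then have "(det H \<cdot>\<^sub>m (E * H)) $$ (i, j) = (int k \<cdot>\<^sub>m (det H \<cdot>\<^sub>m 1\<^sub>m n)) $$ (i, j)" by simp
    then have "det H * (E * H) $$ (i, j) = det H * (int k \<cdot>\<^sub>m 1\<^sub>m n) $$ (i, j)"
      using ij H_carrier E by (simp add: mult.left_commute del: index_mult_mat(1) split: if_splits)
    then show ?thesis using det_H by simp
  qed
  then have "E * H = int k \<cdot>\<^sub>m 1\<^sub>m n" using H_carrier E by (intro eq_matI) auto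
  then show ?thesis using that E by blast
qed

text \<open>This is \<open>\<Lambda> + k \<Lambda>\<^sup>* = \<int>\<^sup>n\<close>, written in the basis dual to \<open>H\<close>.\<close>

lemma Ht_image:
  "{transpose_mat H *\<^sub>v z | z. z \<in> carrier_vec n} =
   {(transpose_mat H * H) *\<^sub>v a + int k \<cdot>\<^sub>v b | a b. a \<in> carrier_vec n \<and> b \<in> carrier_vec n}"
proof (intro equalityI subsetI)
  let ?T = "transpose_mat H"
  note L = mult_add_distrib_mat_vec[OF Ht_carrier] mult_mat_vec_smult[OF Ht_carrier] mult_minus_distrib_mat_vec[OF Ht_carrier]
  {
    fix x assume "x \<in> {?T *\<^sub>v z | z. z \<in> carrier_vec n}"
    then obtain z where z: "z \<in> carrier_vec n" "x = ?T *\<^sub>v z" by blast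
    obtain c where c: "c \<in> \<Lambda>" "\<And>y. y \<in> \<Lambda> \<Longrightarrow> int k dvd (z - c) \<bullet> y" using split[OF z(1)] by blast
    obtain a where a: "a \<in> carrier_vec n" "c = H *\<^sub>v a" using c(1) basis by blast
    have cc: "c \<in> carrier_vec n" by (rule carrier[OF c(1)])
    let ?b = "vec n (\<lambda>i. (?T *\<^sub>v (z - c)) $ i div int k)"
    have "?T *\<^sub>v (z - c) = int k \<cdot>\<^sub>v ?b"
    proof (rule eq_vecI)
      fix i assume "i < dim_vec (int k \<cdot>\<^sub>v ?b)"
      then have i: "i < n" by simp
      have "col H i \<in> \<Lambda>" using H_mult_in[of "unit_vec n i"] col_eq_mult_unit[OF H_carrier i] by simp
      moreover have "(?T *\<^sub>v (z - c)) $ i = (z - c) \<bullet> col H i"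
      proof -
        have "col H i \<in> carrier_vec n" using H_carrier by (metis carrier_matD(1) col_dim)
        then show ?thesis using i H_carrier comm_scalar_prod[of "col H i" n "z - c"] z(1) cc by simp
      qed
      ultimately have "int k dvd (?T *\<^sub>v (z - c)) $ i" using c(2) by simp
      then show "(?T *\<^sub>v (z - c)) $ i = (int k \<cdot>\<^sub>v ?b) $ i" using i by simp
    qed (use H_carrier in simp)
    moreover have "?T *\<^sub>v c = (?T * H) *\<^sub>v a"
      unfolding a(2) by (rule assoc_mult_mat_vec[OF Ht_carrier H_carrier a(1), symmetric])
    moreover have "x = ?T *\<^sub>v c + ?T *\<^sub>v (z - c)"
    proof -
      have "z = c + (z - c)" using z(1) cc by (intro eq_vecI) auto
      then show ?thesis using L(1)[of c "z - c"] z cc by simp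
    qed
    ultimately have "x = (?T * H) *\<^sub>v a + int k \<cdot>\<^sub>v ?b" by simp
    then show "x \<in> {(?T * H) *\<^sub>v a + int k \<cdot>\<^sub>v b | a b. a \<in> carrier_vec n \<and> b \<in> carrier_vec n}"
      using a(1) vec_carrier[of n] by blast
  next
    fix x assume "x \<in> {(?T * H) *\<^sub>v a + int k \<cdot>\<^sub>v b | a b. a \<in> carrier_vec n \<and> b \<in> carrier_vec n}"
    then obtain a b where ab: "a \<in> carrier_vec n" "b \<in> carrier_vec n" "x = (?T * H) *\<^sub>v a + int k \<cdot>\<^sub>v b" by blast
    \<comment> \<open>Transposing \<open>E H = k I\<close> shows that \<open>k \<int>^n\<close> is
      contained in \<open>H^T \<int>^n\<close>.\<close>
    obtain E where E: "E \<in> carrier_mat n n" "E * H = int k \<cdot>\<^sub>m 1\<^sub>m n" by (rule H_left_quotient)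
    have "?T * transpose_mat E = int k \<cdot>\<^sub>m 1\<^sub>m n"
      unfolding transpose_mult[OF E(1) H_carrier, symmetric] E(2) by (intro eq_matI) auto
    then have "int k \<cdot>\<^sub>v b = (?T * transpose_mat E) *\<^sub>v b" using ab by (intro eq_vecI) auto
    also have "\<dots> = ?T *\<^sub>v (transpose_mat E *\<^sub>v b)"
      by (rule assoc_mult_mat_vec[OF Ht_carrier _ ab(2)]) (use E in simp)
    finally have "x = ?T *\<^sub>v (H *\<^sub>v a) + ?T *\<^sub>v (transpose_mat E *\<^sub>v b)"
      using ab assoc_mult_mat_vec[OF Ht_carrier H_carrier ab(1)] by simp
    also have "\<dots> = ?T *\<^sub>v (H *\<^sub>v a + transpose_mat E *\<^sub>v b)"
      by (rule L(1)[symmetric]) (use ab E H_carrier in \<open>auto intro!: mult_mat_vec_carrier[of _ n n]\<close>)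
    finally have "x = ?T *\<^sub>v (H *\<^sub>v a + transpose_mat E *\<^sub>v b)" .
    moreover have "H *\<^sub>v a + transpose_mat E *\<^sub>v b \<in> carrier_vec n"
      using ab E H_carrier by (auto intro!: mult_mat_vec_carrier[of _ n n])
    ultimately show "x \<in> {?T *\<^sub>v z | z. z \<in> carrier_vec n}" by blast
  }
qed

text \<open>These are the normal equations of a projection, read modulo \<open>k\<close>: if
  \<open>H^T H z_j\<close> agrees with \<open>H^T e_j\<close>, then \<open>e_j - H z_j\<close> is
  orthogonal to all columns of \<open>H\<close>. The entry \<open>H $$ (j, i)\<close> is the
  \<open>i\<close>-th coordinate of \<open>H^T e_j\<close>.\<close>

lemma projectorI:
  assumes P: "P \<in> carrier_mat n n"
    and z: "\<And>j. j < n \<Longrightarrow> z j \<in> carrier_vec n"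
    and Az: "\<And>i j. i < n \<Longrightarrow> j < n \<Longrightarrow> int k dvd ((transpose_mat H * H) *\<^sub>v z j) $ i - H $$ (j, i)"
    and Pz: "\<And>i j. i < n \<Longrightarrow> j < n \<Longrightarrow> int k dvd P $$ (i, j) - (H *\<^sub>v z j) $ i"
  shows "projector n k \<Lambda> P"
  unfolding projector_def
proof (intro conjI allI impI ballI)
  fix j assume j: "j < n"
  have Hz: "H *\<^sub>v z j \<in> \<Lambda>" by (rule H_mult_in[OF z[OF j]])
  have Hzc: "H *\<^sub>v z j \<in> carrier_vec n" by (rule carrier[OF Hz])
  have Pc: "col P j \<in> carrier_vec n" using P by (simp add: carrier_vecI)
  show "col P j \<in> \<Lambda>"
    by (rule congruent_mem[OF Hz Pc]) (use Pz P j in simp)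
  fix y assume y: "y \<in> \<Lambda>"
  then obtain x where x: "x \<in> carrier_vec n" "y = H *\<^sub>v x" using basis by blast
  have yc: "y \<in> carrier_vec n" by (rule carrier[OF y])
  have uc: "unit_vec n j - H *\<^sub>v z j \<in> carrier_vec n" using Hzc by simp
  have "(unit_vec n j - col P j) \<bullet> y = (unit_vec n j - H *\<^sub>v z j) \<bullet> y - (col P j - H *\<^sub>v z j) \<bullet> y"
    using Pc Hzc yc by (simp add: minus_scalar_prod_distrib[of _ n])
  moreover have "int k dvd (col P j - H *\<^sub>v z j) \<bullet> y"
  proof -
    have dc: "col P j - H *\<^sub>v z j \<in> carrier_vec n" using Pc Hzc by (rule minus_carrier_vec)
    have "int k dvd (col P j - H *\<^sub>v z j) $ i" if "i < n" for i
      using Pz[OF that j] P j that H_carrier by simp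
    then show ?thesis unfolding comm_scalar_prod[OF dc yc] by (rule dvd_scalar_prod[OF yc dc])
  qed
  moreover have "int k dvd (unit_vec n j - H *\<^sub>v z j) \<bullet> y"
  proof -
    have "(unit_vec n j - H *\<^sub>v z j) \<bullet> y = x \<bullet> (transpose_mat H *\<^sub>v (unit_vec n j - H *\<^sub>v z j))"
      using transpose_vec_mult_scalar[OF H_carrier x(1) uc]
        comm_scalar_prod[OF mult_mat_vec_carrier[OF Ht_carrier uc] x(1)] x(2) by simp
    also have "int k dvd \<dots>"
    proof (rule dvd_scalar_prod[OF x(1)])
      show "transpose_mat H *\<^sub>v (unit_vec n j - H *\<^sub>v z j) \<in> carrier_vec n" by (rule mult_mat_vec_carrier[OF Ht_carrier uc])
      fix i assume i: "i < n"
      have "transpose_mat H *\<^sub>v (unit_vec n j - H *\<^sub>v z j) = transpose_mat H *\<^sub>v unit_vec n j - (transpose_mat H * H) *\<^sub>v z j"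
        using mult_minus_distrib_mat_vec[OF Ht_carrier unit_vec_carrier Hzc] assoc_mult_mat_vec[OF Ht_carrier H_carrier z[OF j]] by simp
      moreover have "(transpose_mat H *\<^sub>v unit_vec n j) $ i = H $$ (j, i)" using i j H_carrier by simp
      ultimately have "(transpose_mat H *\<^sub>v (unit_vec n j - H *\<^sub>v z j)) $ i = H $$ (j, i) - ((transpose_mat H * H) *\<^sub>v z j) $ i"
        using i H_carrier by simp
      then show "int k dvd (transpose_mat H *\<^sub>v (unit_vec n j - H *\<^sub>v z j)) $ i"
        using Az[OF i j] by (simp add: dvd_diff_commute)
    qed
    finally show ?thesis .
  qed
  ultimately show "int k dvd (unit_vec n j - col P j) \<bullet> y" by simp
qed (rule P)

end

lemma lcd_basis_image:
  assumes "lcd_basis n k \<Lambda> H" and S: "orth_int n S"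
  shows "lcd_basis n k ((\<lambda>x. S *\<^sub>v x) ` \<Lambda>) (S * H)"
proof -
  interpret lcd_basis n k \<Lambda> H by fact
  note Sc = orth_intD(1)[OF S]
  interpret I: lcd_lattice n k "(\<lambda>x. S *\<^sub>v x) ` \<Lambda>"
    by (rule lcd_lattice_image[OF _ S]) (rule lcd_lattice_axioms)
  show ?thesis
  proof
    show "S * H \<in> carrier_mat n n" using Sc H_carrier by simp
    have "(S * H) *\<^sub>v z = S *\<^sub>v (H *\<^sub>v z)" if "z \<in> carrier_vec n" for z
      by (rule assoc_mult_mat_vec[OF Sc H_carrier that])
    then have "{S * H *\<^sub>v z |z. z \<in> carrier_vec n} = {S *\<^sub>v (H *\<^sub>v z) |z. z \<in> carrier_vec n}"
      by (intro Collect_cong) metis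
    then show "(\<lambda>x. S *\<^sub>v x) ` \<Lambda> = {S * H *\<^sub>v z |z. z \<in> carrier_vec n}" unfolding basis by blast
  qed
qed

section \<open>Size bounds and dual bases of rotated lattices\<close>

lemma abs_det_le:
  fixes M :: "real mat"
  assumes M: "M \<in> carrier_mat n n" and b: "\<And>i j. i < n \<Longrightarrow> j < n \<Longrightarrow> \<bar>M $$ (i, j)\<bar> \<le> \<beta>"
  shows "\<bar>det M\<bar> \<le> fact n * \<beta> ^ n"
proof -
  have "\<bar>det M\<bar> \<le> (\<Sum>p | p permutes {0..<n}. \<bar>signof p * (\<Prod>i = 0..<n. M $$ (i, p i))\<bar>)"
    unfolding det_def'[OF M] by (rule sum_abs)
  also have "\<dots> \<le> (\<Sum>p | p permutes {0..<n}. \<beta> ^ n)"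
  proof (rule sum_mono)
    fix p assume "p \<in> {p. p permutes {0..<n}}"
    then have p: "p permutes {0..<n}" by simp
    have "\<bar>signof p * (\<Prod>i = 0..<n. M $$ (i, p i))\<bar> = (\<Prod>i = 0..<n. \<bar>M $$ (i, p i)\<bar>)"
      by (simp add: abs_mult abs_prod sign_def)
    also have "\<dots> \<le> (\<Prod>i = 0..<n. \<beta>)"
      using permutes_in_image[OF p] b by (intro prod_mono) auto
    finally show "\<bar>signof p * (\<Prod>i = 0..<n. M $$ (i, p i))\<bar> \<le> \<beta> ^ n" by simp
  qed
  also have "\<dots> = fact n * \<beta> ^ n" by (simp add: card_permutations)
  finally show ?thesis .
qed

text \<open>Cramer's rule: entries of the inverse are cofactors divided by the determinant, and a
  determinant of absolute value at least 1 cannot enlarge them. The bound has a polynomial number of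
  bits in \<open>n\<close> and the bit length of \<open>\<beta>\<close>, as required for the oracle
  query.\<close>

lemma abs_right_inverse_le:
  fixes M Y :: "real mat"
  assumes M: "M \<in> carrier_mat n n" and Y: "Y \<in> carrier_mat n n" and MY: "M * Y = 1\<^sub>m n"
    and b: "\<And>i j. i < n \<Longrightarrow> j < n \<Longrightarrow> \<bar>M $$ (i, j)\<bar> \<le> \<beta>" and \<beta>: "1 \<le> \<beta>" and d: "1 \<le> \<bar>det M\<bar>"
    and ij: "i < n" "j < n"
  shows "\<bar>Y $$ (i, j)\<bar> \<le> fact n * \<beta> ^ n"
proof -
  have "det M \<cdot>\<^sub>m Y = (adj_mat M * M) * Y" unfolding adj_mat(3)[OF M] by (rule smult_one_mult_mat[OF Y, symmetric])
  also have "\<dots> = adj_mat M" using adj_mat(1)[OF M] M Y MY by (simp add: assoc_mult_mat[of _ n n _ n _ n])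
  finally have "det M * Y $$ (i, j) = adj_mat M $$ (i, j)" using ij Y by (metis carrier_matD index_smult_mat(1))
  also have "\<dots> = (-1) ^ (j + i) * det (mat_delete M j i)"
    using ij M by (simp add: adj_mat_def cofactor_def)
  finally have "\<bar>det M\<bar> * \<bar>Y $$ (i, j)\<bar> = \<bar>det (mat_delete M j i)\<bar>" by (simp add: abs_mult flip: abs_mult[of "det M"])
  moreover have "\<bar>det (mat_delete M j i)\<bar> \<le> fact (n - 1) * \<beta> ^ (n - 1)"
  proof (rule abs_det_le)
    show "mat_delete M j i \<in> carrier_mat (n - 1) (n - 1)" using M by (rule mat_delete_carrier)
    show "\<bar>mat_delete M j i $$ (a, c)\<bar> \<le> \<beta>" if "a < n - 1" "c < n - 1" for a c
      using that M b by (auto simp: mat_delete_def)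
  qed
  moreover have "fact (n - 1) * \<beta> ^ (n - 1) \<le> fact n * \<beta> ^ n"
    using \<beta> by (intro mult_mono fact_mono power_increasing) auto
  moreover have "\<bar>Y $$ (i, j)\<bar> \<le> \<bar>det M\<bar> * \<bar>Y $$ (i, j)\<bar>" using mult_right_mono[OF d, of "\<bar>Y $$ (i, j)\<bar>"] by simp
  ultimately show ?thesis by linarith
qed

text \<open>The matrix \<open>X\<close> is the inverse Gram matrix computed by the program. Then
  \<open>B X\<close> is the inverse transpose of \<open>B\<close>, that is, the basis of the dual
  lattice.\<close>

locale lcd_real_basis = lcd_basis +
  fixes Q B X :: "real mat"
  assumes Q: "orthonormal_mat n Q" and B: "B = Q * rm H"
    and X_carrier: "X \<in> carrier_mat n n" and XA: "X * (transpose_mat B * B) = 1\<^sub>m n"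
begin

lemma B_carrier: "B \<in> carrier_mat n n"
  unfolding B using orthonormal_matD(1)[OF Q] H_carrier by simp

lemma B_inverse: "(B * X) * transpose_mat B = 1\<^sub>m n"
proof -
  have "(X * transpose_mat B) * B = 1\<^sub>m n"
    using XA X_carrier B_carrier by (simp add: assoc_mult_mat[of _ n n _ n _ n])
  then have "B * (X * transpose_mat B) = 1\<^sub>m n"
    using X_carrier B_carrier by (intro mat_mult_left_right_inverse[of "X * transpose_mat B" n B]) simp_all
  then show ?thesis using X_carrier B_carrier by (simp add: assoc_mult_mat[of _ n n _ n _ n])
qed

text \<open>From \<open>B^T = H^T Q^T\<close> and \<open>B X = (B^T)^-1\<close> one gets
  \<open>B X H^T = Q\<close>. So vectors of \<open>H^T \<int>^n\<close>, taken as coordinates in the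
  dual basis, give the rotated integral vectors.\<close>

lemma dual_basis:
  assumes z: "z \<in> carrier_vec n"
  shows "(B * X) *\<^sub>v rv (transpose_mat H *\<^sub>v z) = Q *\<^sub>v rv z"
proof -
  note Qc = orthonormal_matD[OF Q]
  have rH: "rm H \<in> carrier_mat n n" using H_carrier by simp
  have "transpose_mat B *\<^sub>v (Q *\<^sub>v rv z) = (transpose_mat (rm H) * (transpose_mat Q * Q)) *\<^sub>v rv z"
    unfolding B transpose_mult[OF Qc(1) rH] using Qc(1) rH z
    by (simp add: assoc_mult_mat[of _ n n _ n _ n] assoc_mult_mat_vec[of _ n n _ n])
  also have "\<dots> = rv (transpose_mat H *\<^sub>v z)"
    using Qc(2) rH z rm_mult_vec[OF Ht_carrier z] by (simp add: map_mat_transpose)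
  finally have "(B * X) *\<^sub>v rv (transpose_mat H *\<^sub>v z) = ((B * X) * transpose_mat B) *\<^sub>v (Q *\<^sub>v rv z)"
    using B_carrier X_carrier Qc(1) z assoc_mult_mat_vec[of "B * X" n n "transpose_mat B" n "Q *\<^sub>v rv z"] by simp
  then show ?thesis unfolding B_inverse using Qc(1) z by simp
qed

text \<open>By \<open>Ht_image\<close> the columns of \<open>T\<close> generate
  \<open>H^T \<int>^n\<close>, which \<open>dual_basis\<close> maps onto \<open>Q \<int>^n\<close>.
  The condition on \<open>T\<close> involves the Gram matrix and \<open>k\<close> only, so such a
  \<open>T\<close> is computable without knowing \<open>Q\<close> or \<open>H\<close>.\<close>

lemma rotated_int_lattice:
  assumes T: "T \<in> carrier_mat n n"
    and eq: "{T *\<^sub>v u | u. u \<in> carrier_vec n} =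
      {(transpose_mat H * H) *\<^sub>v a + int k \<cdot>\<^sub>v b | a b. a \<in> carrier_vec n \<and> b \<in> carrier_vec n}"
  shows "column_lattice ((B * X) * rm T) = mat_image Q (int_lattice n)"
proof -
  have BX: "B * X \<in> carrier_mat n n" using B_carrier X_carrier by simp
  have W: "((B * X) * rm T) *\<^sub>v rv u = (B * X) *\<^sub>v rv (T *\<^sub>v u)" if u: "u \<in> carrier_vec n" for u
    using assoc_mult_mat_vec[OF BX, of "rm T" n "rv u"] T u rm_mult_vec[OF T u] by simp
  have "column_lattice ((B * X) * rm T) = (\<lambda>y. (B * X) *\<^sub>v rv y) ` {T *\<^sub>v u | u. u \<in> carrier_vec n}"
    using T unfolding column_lattice_def by (auto simp: W intro!: image_eqI) (metis W)
  also have "\<dots> = (\<lambda>y. (B * X) *\<^sub>v rv y) ` {transpose_mat H *\<^sub>v z | z. z \<in> carrier_vec n}"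
    unfolding eq Ht_image ..
  also have "\<dots> = (\<lambda>z. (B * X) *\<^sub>v rv (transpose_mat H *\<^sub>v z)) ` carrier_vec n" by blast
  also have "\<dots> = (\<lambda>z. Q *\<^sub>v rv z) ` carrier_vec n" by (intro image_cong refl dual_basis)
  also have "\<dots> = mat_image Q (int_lattice n)" by (simp add: mat_image_def int_lattice_eq image_image)
  finally show ?thesis .
qed

text \<open>The matrix to be bounded is the inverse of \<open>B^T\<close>, and the determinant of
  \<open>B\<close> is, up to sign, the nonzero integer \<open>det H\<close>.\<close>

lemma abs_dual_basis_le:
  assumes b: "\<And>i j. i < n \<Longrightarrow> j < n \<Longrightarrow> \<bar>B $$ (i, j)\<bar> \<le> \<beta>" and \<beta>: "1 \<le> \<beta>" and ij: "i < n" "j < n"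
  shows "\<bar>(B * X) $$ (i, j)\<bar> \<le> fact n * \<beta> ^ n"
proof (rule abs_right_inverse_le[of "transpose_mat B"])
  note Qc = orthonormal_matD[OF Q]
  show "transpose_mat B * (B * X) = 1\<^sub>m n"
    by (rule mat_mult_left_right_inverse[OF _ _ B_inverse]) (use B_carrier X_carrier in auto)
  have "det (transpose_mat Q * Q) = 1" unfolding Qc(2) by simp
  then have "det Q * det Q = 1" using Qc(1) by (simp add: det_mult[of _ n] det_transpose)
  then have "\<bar>det Q\<bar> = 1" by (metis abs_mult_self_eq abs_one mult_cancel_left2 abs_square_eq_1 power2_eq_square)
  moreover have "det B = det Q * real_of_int (det H)"
    unfolding B using Qc(1) H_carrier by (simp add: det_mult[of _ n])
  moreover have "1 \<le> \<bar>real_of_int (det H)\<bar>" using det_H by linarith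
  ultimately show "1 \<le> \<bar>det (transpose_mat B)\<bar>" using B_carrier by (simp add: det_transpose abs_mult)
qed (use B_carrier X_carrier b \<beta> ij in auto)

end

text \<open>Columns of \<open>Q\<close> lie in the lattice of \<open>Q'\<close>, so
  \<open>Q = Q' S\<close> with \<open>S\<close> integral, and then \<open>S^T S = Q^T Q = I\<close>.
  Hence an answer to \<open>\<int>\<close>LIP is ambiguous only by a signed permutation.\<close>

lemma same_rotated_int_lattice:
  assumes Q: "orthonormal_mat n Q" and Q': "orthonormal_mat n Q'"
    and eq: "mat_image Q (int_lattice n) = mat_image Q' (int_lattice n)"
  obtains S where "orth_int n S" "Q = Q' * rm S"
proof -
  note Qc = orthonormal_matD[OF Q] and Qc' = orthonormal_matD[OF Q']
  have cols: "col Q j \<in> mat_image Q' (rv ` carrier_vec n)" if j: "j < n" for j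
  proof -
    have "col Q j = Q *\<^sub>v rv (unit_vec n j)" using col_eq_mult_unit[OF Qc(1) j] by (simp add: rv_unit)
    then have "col Q j \<in> mat_image Q (int_lattice n)" by (auto simp: mat_image_def int_lattice_eq)
    then have "col Q j \<in> mat_image Q' (int_lattice n)" unfolding eq .
    then show ?thesis unfolding int_lattice_eq .
  qed
  obtain S where S: "S \<in> carrier_mat n n" "Q = Q' * rm S"
    using integral_columns[OF Qc(1) Qc'(1) subset_refl cols] by blast
  have rS: "rm S \<in> carrier_mat n n" using S by simp
  have "rm (transpose_mat S * S) = transpose_mat (rm S) * ((transpose_mat Q' * Q') * rm S)"
    unfolding Qc'(2) using rm_mult[of "transpose_mat S" n n S n] S(1) by (simp add: map_mat_transpose)
  also have "\<dots> = transpose_mat Q * Q"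
    unfolding S(2) transpose_mult[OF Qc'(1) rS] using Qc'(1) rS by (simp add: assoc_mult_mat[of _ n n _ n _ n])
  also have "\<dots> = rm (1\<^sub>m n)" unfolding Qc(2) by (rule of_int_hom.mat_hom_one[symmetric])
  finally have "transpose_mat S * S = 1\<^sub>m n" by (rule of_int_hom.mat_hom_inj)
  then show ?thesis using that S by (simp add: orth_int_def)
qed

text \<open>The product returns from the second lattice to integral coordinates by
  \<open>Q2^T\<close>, moves \<open>\<Lambda>2\<close> to \<open>\<Lambda>1\<close> by
  \<open>S^T\<close>, the inverse of \<open>S\<close>, and rotates by \<open>Q1\<close>.\<close>

lemma LIP_solution_signed_permutation:
  assumes Q: "orthonormal_mat n Q1" "orthonormal_mat n Q2" and S: "orth_int n S"
    and \<Lambda>: "\<Lambda>1 \<subseteq> carrier_vec n" "\<Lambda>2 \<subseteq> carrier_vec n"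
    and iff: "\<And>x. x \<in> carrier_vec n \<Longrightarrow> S *\<^sub>v x \<in> \<Lambda>2 \<longleftrightarrow> x \<in> \<Lambda>1"
  shows "LIP_solution n (mat_image Q1 (rv ` \<Lambda>1)) (mat_image Q2 (rv ` \<Lambda>2)) ((Q1 * transpose_mat (rm S)) * transpose_mat Q2)"
proof -
  note Q1 = orthonormal_matD[OF Q(1)] and Q2 = orthonormal_matD[OF Q(2)] and Sc = orth_intD[OF S]
  let ?O = "(Q1 * transpose_mat (rm S)) * transpose_mat Q2"
  have St: "transpose_mat S \<in> carrier_mat n n" using Sc(1) by simp
  have O: "?O *\<^sub>v (Q2 *\<^sub>v rv y) = Q1 *\<^sub>v rv (transpose_mat S *\<^sub>v y)" if y: "y \<in> carrier_vec n" for y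
  proof -
    have "?O *\<^sub>v (Q2 *\<^sub>v rv y) = (Q1 * transpose_mat (rm S)) *\<^sub>v (transpose_mat Q2 *\<^sub>v (Q2 *\<^sub>v rv y))"
      by (rule assoc_mult_mat_vec[of _ n n _ n]) (use Q1(1) Q2(1) Sc(1) y in simp_all)
    also have "\<dots> = (Q1 * transpose_mat (rm S)) *\<^sub>v rv y"
      using orthonormal_mat_cancel[OF Q(2), of "rv y"] y by simp
    also have "\<dots> = Q1 *\<^sub>v (transpose_mat (rm S) *\<^sub>v rv y)"
      by (rule assoc_mult_mat_vec[of _ n n _ n]) (use Q1(1) Sc(1) y in simp_all)
    also have "transpose_mat (rm S) *\<^sub>v rv y = rv (transpose_mat S *\<^sub>v y)"
      using rm_mult_vec[OF St y] by (simp add: map_mat_transpose)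
    finally show ?thesis .
  qed
  have "mat_image ?O (mat_image Q2 (rv ` \<Lambda>2)) = (\<lambda>y. Q1 *\<^sub>v rv (transpose_mat S *\<^sub>v y)) ` \<Lambda>2"
    unfolding mat_image_def image_image using O \<Lambda>(2) by (intro image_cong refl) blast
  also have "\<dots> = (\<lambda>x. Q1 *\<^sub>v rv x) ` ((\<lambda>y. transpose_mat S *\<^sub>v y) ` \<Lambda>2)" by (simp add: image_image)
  also have "(\<lambda>y. transpose_mat S *\<^sub>v y) ` \<Lambda>2 = \<Lambda>1"
  proof (intro equalityI subsetI)
    fix x assume "x \<in> (\<lambda>y. transpose_mat S *\<^sub>v y) ` \<Lambda>2"
    then obtain y where y: "y \<in> \<Lambda>2" "x = transpose_mat S *\<^sub>v y" by blast
    then have yc: "y \<in> carrier_vec n" using \<Lambda> by blast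
    have "x \<in> carrier_vec n" unfolding y(2) using mult_mat_vec_carrier[OF St yc] .
    then show "x \<in> \<Lambda>1" using iff orth_int_mult_vec(2)[OF S yc] y by metis
  next
    fix x assume x: "x \<in> \<Lambda>1"
    then have xc: "x \<in> carrier_vec n" using \<Lambda> by blast
    show "x \<in> (\<lambda>y. transpose_mat S *\<^sub>v y) ` \<Lambda>2"
      using iff[OF xc] x orth_int_mult_vec(1)[OF S xc] by (metis image_eqI)
  qed
  finally have "mat_image Q1 (rv ` \<Lambda>1) = mat_image ?O (mat_image Q2 (rv ` \<Lambda>2))"
    by (simp add: mat_image_def image_image)
  moreover have "orthonormal_mat n ?O"
    by (intro orthonormal_mat_mult orthonormal_mat_transpose orthonormal_rm Q S)
  ultimately show ?thesis by (simp add: LIP_solution_def)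
qed

section \<open>Inverting a Gram matrix\<close>

definition kron :: "nat \<Rightarrow> nat \<Rightarrow> real" where
  "kron i j = (if i = j then 1 else 0)"

text \<open>\<open>X\<close> is the inverse of the leading \<open>i \<times> i\<close> block of \<open>A\<close>, padded with zeros.\<close>

definition leading_inverse :: "nat \<Rightarrow> (nat \<Rightarrow> nat \<Rightarrow> real) \<Rightarrow> nat \<Rightarrow> (nat \<Rightarrow> nat \<Rightarrow> real) \<Rightarrow> bool" where
  "leading_inverse n A i X \<longleftrightarrow> (\<forall>r<n. \<forall>s<n. X r s = X s r) \<and>
     (\<forall>r<n. \<forall>s<n. i \<le> r \<or> i \<le> s \<longrightarrow> X r s = 0) \<and>
     (\<forall>r<n. \<forall>j<i. (\<Sum>l<n. X r l * A l j) = kron r j)"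

lemma sum_kron [simp]: "i < n \<Longrightarrow> (\<Sum>l<n. kron l i * f l) = f i" "i < n \<Longrightarrow> (\<Sum>l<n. kron i l * f l) = f i"
  "i < n \<Longrightarrow> (\<Sum>l<n. f l * kron l i) = f i" "i < n \<Longrightarrow> (\<Sum>l<n. f l * kron i l) = f i"
  by (simp_all add: kron_def if_distrib[of "\<lambda>x. x * _"] if_distrib[of "\<lambda>x. _ * x"] sum.delta sum.delta' cong: if_cong)

text \<open>\<open>p\<close> is the \<open>i\<close>-th unit vector made \<open>A\<close>-orthogonal to the earlier ones.\<close>

lemma leading_inverse_Suc:
  fixes A X :: "nat \<Rightarrow> nat \<Rightarrow> real"
  assumes X: "leading_inverse n A i X" and i: "i < n"
    and sym: "\<And>r s. r < n \<Longrightarrow> s < n \<Longrightarrow> A r s = A s r"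
    and pos: "\<And>x. (\<exists>r<n. x r \<noteq> 0) \<Longrightarrow> 0 < (\<Sum>r<n. x r * (\<Sum>s<n. A r s * x s))"
    and p: "\<And>r. r < n \<Longrightarrow> p r = kron r i - (\<Sum>l<n. X r l * A l i)"
    and d: "d = (\<Sum>l<n. A i l * p l)"
    and X': "\<And>r s. r < n \<Longrightarrow> s < n \<Longrightarrow> X' r s = X r s + p r * p s / d"
  shows "leading_inverse n A (Suc i) X'"
proof -
  have Xs: "X r s = X s r" if "r < n" "s < n" for r s using X that by (auto simp: leading_inverse_def)
  have X0: "X r s = 0" if "r < n" "s < n" "i \<le> r \<or> i \<le> s" for r s using X that by (auto simp: leading_inverse_def)
  have XA: "(\<Sum>l<n. X r l * A l j) = kron r j" if "r < n" "j < i" for r j using X that by (auto simp: leading_inverse_def)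
  have p0: "p r = 0" if "i < r" "r < n" for r
    using that p[OF that(2)] X0 by (simp add: kron_def)
  have pi: "p i = 1" using p[OF i] X0 i by (simp add: kron_def)
  have Ap: "(\<Sum>l<n. A j l * p l) = 0" if j: "j < i" for j
  proof -
    have jn: "j < n" using j i by simp
    have "(\<Sum>l<n. A j l * p l) = (\<Sum>l<n. A j l * kron l i) - (\<Sum>l<n. \<Sum>m<n. A j l * (X l m * A m i))"
      using p by (simp add: right_diff_distrib sum_subtractf sum_distrib_left)
    also have "(\<Sum>l<n. \<Sum>m<n. A j l * (X l m * A m i)) = (\<Sum>m<n. (\<Sum>l<n. X m l * A l j) * A m i)"
      unfolding sum_distrib_right using Xs sym jn
      by (subst sum.swap) (auto intro!: sum.cong simp: mult_ac)
    also have "\<dots> = A j i" using XA j jn by simp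
    finally show ?thesis using i by simp
  qed
  \<comment> \<open>The vector \<open>A p\<close> vanishes before position \<open>i\<close> and
    \<open>p\<close> vanishes after it, where \<open>p i = 1\<close>. Hence
    \<open>p^T A p = d\<close>, and positive definiteness makes the pivot \<open>d\<close> nonzero,
    so no pivot search is needed.\<close>
  have "(\<Sum>r<n. p r * (\<Sum>s<n. A r s * p s)) = (\<Sum>r<n. if r = i then d else 0)"
  proof (rule sum.cong)
    fix r assume "r \<in> {..<n}"
    then show "p r * (\<Sum>s<n. A r s * p s) = (if r = i then d else 0)"
      using Ap[of r] p0[of r] pi d by (cases r i rule: linorder_cases) auto
  qed simp
  also have "\<dots> = d" using i by simp
  finally have "(\<Sum>r<n. p r * (\<Sum>s<n. A r s * p s)) = d" .
  moreover have "\<exists>r<n. p r \<noteq> 0" using pi i by (intro exI[of _ i]) simp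
  ultimately have d0: "0 < d" using pos[of p] by simp
  \<comment> \<open>Thus adding \<open>p p^T / d\<close> to \<open>X\<close> leaves the first
    \<open>i\<close> columns of \<open>X A\<close> alone and adds \<open>p\<close> to column
    \<open>i\<close>, which by definition of \<open>p\<close> was the unit vector minus
    \<open>p\<close>.\<close>
  have pA: "(\<Sum>l<n. p l * A l j) = (if j = i then d else 0)" if "j \<le> i" for j
  proof -
    have "(\<Sum>l<n. p l * A l j) = (\<Sum>l<n. A j l * p l)"
      using sym that i by (intro sum.cong) (auto simp: mult_ac)
    then show ?thesis using Ap[of j] that d by auto
  qed
  have "(\<Sum>l<n. X' r l * A l j) = kron r j" if "r < n" "j < Suc i" for r j
  proof -
    have "(\<Sum>l<n. X' r l * A l j) = (\<Sum>l<n. X r l * A l j) + p r / d * (\<Sum>l<n. p l * A l j)"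
      unfolding sum_distrib_left sum.distrib[symmetric]
      by (intro sum.cong) (use X' that in \<open>auto simp: algebra_simps\<close>)
    then show ?thesis using that pA[of j] XA[of r j] p[OF that(1)] d0 by (cases "j = i") auto
  qed
  moreover have "X' r s = X' s r" if "r < n" "s < n" for r s
    using X' Xs that by (simp add: mult.commute)
  moreover have "X' r s = 0" if "r < n" "s < n" "Suc i \<le> r \<or> Suc i \<le> s" for r s
    using X' X0 p0 that by auto
  ultimately show ?thesis by (simp add: leading_inverse_def)
qed

abbreviation "nn \<equiv> NVar ''n''"
abbreviation "rr \<equiv> NVar ''r''"
abbreviation "ss \<equiv> NVar ''s''"
abbreviation "ii \<equiv> NVar ''i''"
abbreviation "jj \<equiv> NVar ''j''"
abbreviation "N0 \<equiv> NConst 0"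

text \<open>Kronecker's delta, by truncated subtraction.\<close>

definition Kron :: "nexp \<Rightarrow> nexp \<Rightarrow> nexp" where
  "Kron a b = NSub (NSub (NConst 1) (NSub a b)) (NSub b a)"

lemma rval_Kron [simp]: "real (nval (Kron a b) \<nu>) = kron (nval a \<nu>) (nval b \<nu>)"
  by (auto simp: Kron_def kron_def)

text \<open>Column \<open>i\<close> of \<open>E = I - X A\<close> is the vector \<open>p\<close> of
  \<open>leading_inverse_Suc\<close>, and entry \<open>(i, i)\<close> of \<open>V = A E\<close> is
  its pivot \<open>d\<close>. Forming whole products, although one column suffices, allows
  \<open>MatMul\<close> to be reused.\<close>

definition InvPosDef :: com where
  "InvPosDef = Seq (Put ''X'' nn nn N0 N0 (RNat N0))
     (For ''i'' nn (Seq (MatMul ''U'' ''X'' ''A'')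
        (Seq (Put ''E'' nn nn N0 N0 (RSub (RNat (Kron rr ss)) (RCell ''U'' rr ss)))
        (Seq (MatMul ''V'' ''A'' ''E'')
          (Put ''X'' nn nn N0 N0 (RAdd (RCell ''X'' rr ss)
             (RDiv (RMul (RCell ''E'' rr ii) (RCell ''E'' ss ii)) (RCell ''V'' ii ii))))))))"

definition mult_time :: "nat \<Rightarrow> nat" where "mult_time N = N * (N * (N * 3 + 5) + 4) + 2"
definition put_time :: "nat \<Rightarrow> nat \<Rightarrow> nat" where "put_time N M = N * (M * 3 + 4) + 2"
text \<open>\<open>N\<close> and \<open>M\<close> bound the numbers of rows and columns,
  \<open>L\<close> the bit length of the values before reduction.\<close>

definition putmod_time :: "nat \<Rightarrow> nat \<Rightarrow> nat \<Rightarrow> nat" where "putmod_time L N M = N * (M * (6 * L + 20) + 4) + 2"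
definition inverse_time :: "nat \<Rightarrow> nat" where
  "inverse_time N = put_time N N + (N * ((mult_time N + (put_time N N + (mult_time N + put_time N N))) + 2) + 2)"

context
  fixes zo :: "real mat \<Rightarrow> real mat" and go :: "real mat \<Rightarrow> real mat \<Rightarrow> real mat option"
begin

text \<open>The continuation form of the rule: the effect appears as assumptions of
  \<open>post\<close>, so that proofs about sequences nest in program order with an arbitrary final
  postcondition.\<close>

lemma wp_MatMul:
  assumes n: "\<nu>0 ''n'' = n" "n \<le> N" and Z: "Z \<noteq> X" "Z \<noteq> Y"
    and post: "\<And>\<nu> \<rho>. eq_off LoopVars \<nu> \<nu>0 \<Longrightarrow> eq_off {Z} \<rho> \<rho>0 \<Longrightarrow>
       (\<And>x y. x < n \<Longrightarrow> y < n \<Longrightarrow> \<rho> Z x y = (\<Sum>l<n. \<rho>0 X x l * \<rho>0 Y l y)) \<Longrightarrow> Q (\<nu>, \<rho>)"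
  shows "runs zo go (MatMul Z X Y) (\<nu>0, \<rho>0) (mult_time N) Q"
  unfolding mult_time_def by (rule runs_conseq[OF runs_MatMul[where ?\<nu>0.0 = \<nu>0, OF n Z]]) (auto intro!: post split: if_splits)

lemma wp_Put:
  assumes dims: "\<And>\<nu>. eq_off LoopVars \<nu> \<nu>0 \<Longrightarrow> nval a \<nu> = a' \<and> nval b \<nu> = b' \<and> nval p \<nu> = p' \<and> nval q \<nu> = q'"
    and e: "\<And>i j \<nu> \<rho>. i < a' \<Longrightarrow> j < b' \<Longrightarrow> \<nu> ''r'' = i \<Longrightarrow> \<nu> ''s'' = j \<Longrightarrow>
        eq_off LoopVars \<nu> \<nu>0 \<Longrightarrow> eq_off {Z} \<rho> \<rho>0 \<Longrightarrow> \<rho> Z (p' + i) (q' + j) = \<rho>0 Z (p' + i) (q' + j) \<Longrightarrow>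
        (\<And>x y. \<not> (p' \<le> x \<and> x < p' + a' \<and> q' \<le> y \<and> y < q' + b') \<Longrightarrow> \<rho> Z x y = \<rho>0 Z x y) \<Longrightarrow>
        rval e (\<nu>, \<rho>) = val i j"
    and N: "a' \<le> N" "b' \<le> M"
    and post: "\<And>\<nu> \<rho>. eq_off LoopVars \<nu> \<nu>0 \<Longrightarrow> eq_off {Z} \<rho> \<rho>0 \<Longrightarrow>
      (\<And>i j. i < a' \<Longrightarrow> j < b' \<Longrightarrow> \<rho> Z (p' + i) (q' + j) = val i j) \<Longrightarrow>
      (\<And>x y. \<not> (p' \<le> x \<and> x < p' + a' \<and> q' \<le> y \<and> y < q' + b') \<Longrightarrow> \<rho> Z x y = \<rho>0 Z x y) \<Longrightarrow> Q (\<nu>, \<rho>)"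
  shows "runs zo go (Put Z a b p q e) (\<nu>0, \<rho>0) (put_time N M) Q"
  unfolding put_time_def
  by (rule runs_conseq[OF runs_Put[where val = val, OF dims e N]]) (auto intro!: post split: if_splits)

lemma wp_PutMod:
  assumes dims: "\<And>\<nu>. eq_off LoopVars \<nu> \<nu>0 \<Longrightarrow> nval a \<nu> = a' \<and> nval b \<nu> = b' \<and> nval p \<nu> = p' \<and> nval q \<nu> = q'"
    and e: "\<And>i j \<nu> \<rho>. i < a' \<Longrightarrow> j < b' \<Longrightarrow> \<nu> ''r'' = i \<Longrightarrow> \<nu> ''s'' = j \<Longrightarrow>
        eq_off LoopVars \<nu> \<nu>0 \<Longrightarrow> eq_off (insert Z FloorVars) \<rho> \<rho>0 \<Longrightarrow> \<rho> Z (p' + i) (q' + j) = \<rho>0 Z (p' + i) (q' + j) \<Longrightarrow>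
        (\<And>x y. \<not> (p' \<le> x \<and> x < p' + a' \<and> q' \<le> y \<and> y < q' + b') \<Longrightarrow> \<rho> Z x y = \<rho>0 Z x y) \<Longrightarrow>
        rval e (\<nu>, \<rho>) = of_int (val i j)"
    and L: "\<And>i j. i < a' \<Longrightarrow> j < b' \<Longrightarrow> \<bar>real_of_int (val i j)\<bar> \<le> 2 ^ L"
    and Z: "Z \<notin> FloorVars" and k: "\<nu>0 ''k'' = k" "0 < k"
    and N: "a' \<le> N" "b' \<le> M"
    and post: "\<And>\<nu> \<rho>. eq_off LoopVars \<nu> \<nu>0 \<Longrightarrow> eq_off (insert Z FloorVars) \<rho> \<rho>0 \<Longrightarrow>
      (\<And>i j. i < a' \<Longrightarrow> j < b' \<Longrightarrow> \<rho> Z (p' + i) (q' + j) = of_int (val i j mod int k)) \<Longrightarrow>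
      (\<And>x y. \<not> (p' \<le> x \<and> x < p' + a' \<and> q' \<le> y \<and> y < q' + b') \<Longrightarrow> \<rho> Z x y = \<rho>0 Z x y) \<Longrightarrow> Q (\<nu>, \<rho>)"
  shows "runs zo go (PutMod Z a b p q e) (\<nu>0, \<rho>0) (putmod_time L N M) Q"
  unfolding putmod_time_def
  by (rule runs_conseq[OF runs_PutMod[where ?\<nu>0.0 = \<nu>0 and val = val, OF dims e L Z k N]]) (auto intro!: post split: if_splits)

lemma wp_Transp:
  assumes n: "\<nu>0 ''n'' = n" "n \<le> N" and Z: "Z \<noteq> X"
    and post: "\<And>\<nu> \<rho>. eq_off LoopVars \<nu> \<nu>0 \<Longrightarrow> eq_off {Z} \<rho> \<rho>0 \<Longrightarrow>
       (\<And>x y. x < n \<Longrightarrow> y < n \<Longrightarrow> \<rho> Z x y = \<rho>0 X y x) \<Longrightarrow> Q (\<nu>, \<rho>)"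
  shows "runs zo go (Transp Z X) (\<nu>0, \<rho>0) (put_time N N) Q"
  unfolding put_time_def by (rule runs_conseq[OF runs_Transp[where ?\<nu>0.0 = \<nu>0, OF n Z]]) (auto intro!: post split: if_splits)

lemma runs_InvPosDef:
  assumes n: "\<nu>0 ''n'' = n" "n \<le> N"
    and sym: "\<And>r s. r < n \<Longrightarrow> s < n \<Longrightarrow> \<rho>0 ''A'' r s = \<rho>0 ''A'' s r"
    and pos: "\<And>x. (\<exists>r<n. x r \<noteq> 0) \<Longrightarrow> 0 < (\<Sum>r<n. x r * (\<Sum>s<n. \<rho>0 ''A'' r s * x s))"
  shows "runs zo go InvPosDef (\<nu>0, \<rho>0) (inverse_time N) (\<lambda>(\<nu>', \<rho>').
     eq_off (insert ''i'' LoopVars) \<nu>' \<nu>0 \<and> eq_off {''X'', ''U'', ''E'', ''V''} \<rho>' \<rho>0 \<and>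
     (\<forall>r<n. \<forall>j<n. (\<Sum>l<n. \<rho>' ''X'' r l * \<rho>0 ''A'' l j) = kron r j))"
proof -
  let ?A = "\<rho>0 ''A''" and ?F = "{''X'', ''U'', ''E'', ''V''}" and ?V = "insert ''i'' LoopVars"
  define I where "I = (\<lambda>i (\<nu> :: nstore) (\<rho> :: rstore). eq_off ?V \<nu> \<nu>0 \<and> eq_off ?F \<rho> \<rho>0 \<and> leading_inverse n ?A i (\<rho> ''X''))"
  have nV: "\<nu> ''n'' = n" if "eq_off ?V \<nu> \<nu>0" for \<nu> using eq_offD[OF that, of "''n''"] n by simp
  have sub: "eq_off ?V \<nu> \<nu>0" if "eq_off LoopVars \<nu> \<nu>1" "eq_off ?V \<nu>1 \<nu>0" for \<nu> \<nu>1 by (rule eq_off_trans[OF that]) auto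
  have A: "\<rho> ''A'' = ?A" if "eq_off ?F \<rho> \<rho>0" for \<rho> using eq_offD[OF that, of "''A''"] by simp
  have body: "runs zo go (Seq (MatMul ''U'' ''X'' ''A'')
        (Seq (Put ''E'' nn nn N0 N0 (RSub (RNat (Kron rr ss)) (RCell ''U'' rr ss)))
        (Seq (MatMul ''V'' ''A'' ''E'')
          (Put ''X'' nn nn N0 N0 (RAdd (RCell ''X'' rr ss)
             (RDiv (RMul (RCell ''E'' rr ii) (RCell ''E'' ss ii)) (RCell ''V'' ii ii)))))))
       (\<nu>, \<rho>) (mult_time N + (put_time N N + (mult_time N + put_time N N)))
       (\<lambda>(\<nu>', \<rho>'). \<nu>' ''i'' = i \<and> I (Suc i) (\<nu>'(''i'' := Suc i)) \<rho>')"
    if i: "i < n" "\<nu> ''i'' = i" "I i \<nu> \<rho>" for i \<nu> \<rho>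
  proof -
    have \<nu>: "eq_off ?V \<nu> \<nu>0" and \<rho>: "eq_off ?F \<rho> \<rho>0" and X: "leading_inverse n ?A i (\<rho> ''X'')" using i by (auto simp: I_def)
    define p where "p r = kron r i - (\<Sum>l<n. \<rho> ''X'' r l * ?A l i)" for r
    show ?thesis
    proof (rule runs_Seq, rule wp_MatMul[where n = n], goal_cases)
      case (5 \<nu>1 \<rho>1)
      have \<nu>1: "eq_off ?V \<nu>1 \<nu>0" "\<nu>1 ''i'' = i" using sub[OF 5(1) \<nu>] eq_offD[OF 5(1), of "''i''"] i by auto
      have \<rho>1: "eq_off ?F \<rho>1 \<rho>0" using eq_off_trans[OF 5(2) \<rho>, of ?F] by simp
      have X1: "\<rho>1 ''X'' = \<rho> ''X''" using eq_offD[OF 5(2), of "''X''"] by simp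
      note U = 5(3)[unfolded A[OF \<rho>]]
      show ?case
      proof (rule runs_Seq, rule wp_Put[where a' = n and b' = n and p' = 0 and q' = 0
          and val = "\<lambda>r s. kron r s - (\<Sum>l<n. \<rho> ''X'' r l * ?A l s)"], goal_cases)
        case (1 \<nu>2)
        then show ?case using nV[OF sub[OF 1 \<nu>1(1)]] by simp
      next
        case (2 r s \<nu>2 \<rho>2)
        have "\<rho>2 ''U'' = \<rho>1 ''U''" using eq_offD[OF 2(6), of "''U''"] by simp
        then show ?case using U 2 by simp
      next
        case (5 \<nu>2 \<rho>2)
        note E = 5(3)[unfolded add_0]
        have \<nu>2: "eq_off ?V \<nu>2 \<nu>0" "\<nu>2 ''i'' = i" using sub[OF 5(1) \<nu>1(1)] eq_offD[OF 5(1), of "''i''"] \<nu>1 by auto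
        have \<rho>2: "eq_off ?F \<rho>2 \<rho>0" using eq_off_trans[OF 5(2) \<rho>1, of ?F] by simp
        have X2: "\<rho>2 ''X'' = \<rho> ''X''" using eq_offD[OF 5(2), of "''X''"] X1 by simp
        show ?case
        proof (rule runs_Seq, rule wp_MatMul[where n = n], goal_cases)
          case (5 \<nu>3 \<rho>3)
          have \<nu>3: "eq_off ?V \<nu>3 \<nu>0" "\<nu>3 ''i'' = i" using sub[OF 5(1) \<nu>2(1)] eq_offD[OF 5(1), of "''i''"] \<nu>2 by auto
          have \<rho>3: "eq_off ?F \<rho>3 \<rho>0" using eq_off_trans[OF 5(2) \<rho>2, of ?F] by simp
          have X3: "\<rho>3 ''X'' = \<rho> ''X''" using eq_offD[OF 5(2), of "''X''"] X2 by simp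
          have E3: "\<rho>3 ''E'' x i = p x" if "x < n" for x
            using eq_offD[OF 5(2), of "''E''"] E[OF that i(1)] by (simp add: p_def)
          have V3: "\<rho>3 ''V'' i i = (\<Sum>l<n. ?A i l * p l)"
            using 5(3)[OF i(1) i(1)] E i(1) A[OF \<rho>2] by (simp add: p_def)
          show ?case
          proof (rule wp_Put[where a' = n and b' = n and p' = 0 and q' = 0
              and val = "\<lambda>r s. \<rho> ''X'' r s + p r * p s / (\<Sum>l<n. ?A i l * p l)"], goal_cases)
            case (1 \<nu>4)
            then show ?case using nV[OF sub[OF 1 \<nu>3(1)]] by simp
          next
            case (2 r s \<nu>4 \<rho>4)
            have "\<rho>4 ''E'' = \<rho>3 ''E''" "\<rho>4 ''V'' = \<rho>3 ''V''" "\<nu>4 ''i'' = i"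
              using eq_offD[OF 2(6), of "''E''"] eq_offD[OF 2(6), of "''V''"] eq_offD[OF 2(5), of "''i''"] \<nu>3 by auto
            then show ?case using 2 E3 V3 X3 by simp
          next
            case (5 \<nu>4 \<rho>4)
            have "leading_inverse n ?A (Suc i) (\<rho>4 ''X'')"
              by (rule leading_inverse_Suc[OF X i(1) sym pos p_def refl 5(3)[unfolded add_0]])
            moreover have "eq_off ?V \<nu>4 \<nu>0" "\<nu>4 ''i'' = i" using sub[OF 5(1) \<nu>3(1)] eq_offD[OF 5(1), of "''i''"] \<nu>3 by auto
            moreover have "eq_off ?F \<rho>4 \<rho>0" using eq_off_trans[OF 5(2) \<rho>3, of ?F] by simp
            ultimately show ?case by (simp add: I_def)
          qed (use n in auto)
        qed (use n nV[OF \<nu>2(1)] in auto)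
      qed (use n in auto)
    qed (use n nV[OF \<nu>] in auto)
  qed
  show ?thesis unfolding InvPosDef_def inverse_time_def
  proof (rule runs_Seq, rule wp_Put[where a' = n and b' = n and p' = 0 and q' = 0 and val = "\<lambda>r s. 0"], goal_cases)
    case (1 \<nu>2)
    then show ?case using eq_offD[OF 1, of "''n''"] n by simp
  next
    case (5 \<nu>1 \<rho>1)
    note s1 = 5(1,2) and X = 5(3)[unfolded add_0]
    show ?case
    proof (rule runs_For[where I = I and m = n], goal_cases)
      case 1
      have "eq_off ?V \<nu>1 \<nu>0" "eq_off ?F \<rho>1 \<rho>0" using eq_off_mono[OF s1(1), of ?V] eq_off_mono[OF s1(2), of ?F] by auto
      then show ?case using X by (simp add: I_def leading_inverse_def)
    next
      case (2 i \<nu> \<rho>)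
      then show ?case by (intro body) auto
    next
      case (3 i \<nu> \<rho>)
      then show ?case using nV by (simp add: I_def)
    next
      case (4 \<nu> \<rho>)
      then show ?case by (auto simp: I_def leading_inverse_def)
    qed (use n in auto)
  qed (use n in auto)
qed

end

section \<open>Triangular bases modulo k\<close>

definition int_subgroup :: "(nat \<Rightarrow> int) set \<Rightarrow> bool" where
  "int_subgroup H \<longleftrightarrow> (\<lambda>_. 0) \<in> H \<and> (\<forall>x\<in>H. \<forall>y\<in>H. (\<lambda>r. x r - y r) \<in> H)"

lemma int_subgroup_diff: "int_subgroup H \<Longrightarrow> x \<in> H \<Longrightarrow> y \<in> H \<Longrightarrow> (\<lambda>r. x r - y r) \<in> H"
  by (simp add: int_subgroup_def)

lemma int_subgroup_add: assumes "int_subgroup H" "x \<in> H" "y \<in> H" shows "(\<lambda>r. x r + y r) \<in> H"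
proof -
  have "(\<lambda>r. 0 - y r) \<in> H" using assms by (intro int_subgroup_diff) (auto simp: int_subgroup_def)
  from int_subgroup_diff[OF assms(1,2) this] show ?thesis by simp
qed

lemma int_subgroup_smult: assumes "int_subgroup H" "x \<in> H" shows "(\<lambda>r. c * x r) \<in> H"
proof (induction c rule: int_induct[of _ 0])
  case base
  then show ?case using assms by (simp add: int_subgroup_def)
next
  case (step1 c)
  then show ?case using int_subgroup_add[OF assms(1) step1(2) assms(2)] by (simp add: algebra_simps)
next
  case (step2 c)
  then show ?case using int_subgroup_diff[OF assms(1) step2(2) assms(2)] by (simp add: algebra_simps)
qed

lemma int_subgroup_sum:
  fixes f :: "nat \<Rightarrow> nat \<Rightarrow> int"
  assumes "int_subgroup H" "\<And>j. j < m \<Longrightarrow> f j \<in> H"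
  shows "(\<lambda>r. \<Sum>j<m. c j * f j r) \<in> H"
  using assms(2)
proof (induction m)
  case 0
  then show ?case using assms(1) by (simp add: int_subgroup_def)
next
  case (Suc m)
  have "(\<lambda>r. (\<Sum>j<m. c j * f j r) + c m * f m r) \<in> H"
    by (rule int_subgroup_add[OF assms(1) _ int_subgroup_smult[OF assms(1)]]) (use Suc in auto)
  then show ?case by simp
qed

definition int_span :: "(nat \<Rightarrow> int) set \<Rightarrow> (nat \<Rightarrow> int) set" where
  "int_span G = \<Inter>{H. int_subgroup H \<and> G \<subseteq> H}"

lemma int_subgroup_int_span: "int_subgroup (int_span G)"
  unfolding int_span_def int_subgroup_def by auto

lemma int_span_incl: "x \<in> G \<Longrightarrow> x \<in> int_span G"
  by (auto simp: int_span_def)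

lemma int_span_least: "int_subgroup H \<Longrightarrow> G \<subseteq> H \<Longrightarrow> int_span G \<subseteq> H"
  by (auto simp: int_span_def)

lemma int_span_mono: "G \<subseteq> G' \<Longrightarrow> int_span G \<subseteq> int_span G'"
  by (intro int_span_least int_subgroup_int_span) (auto intro: int_span_incl)

text \<open>Only the upper \<open>n\<close> rows, padded with zeros, take part in the lattice; the
  bookkeeping rows of a tableau are cut off.\<close>

definition col_fun :: "nat \<Rightarrow> (nat \<Rightarrow> nat \<Rightarrow> int) \<Rightarrow> nat \<Rightarrow> nat \<Rightarrow> int" where
  "col_fun n \<tau> c = (\<lambda>r. if r < n then \<tau> r c else 0)"

definition scaled_unit :: "nat \<Rightarrow> nat \<Rightarrow> nat \<Rightarrow> int" where
  "scaled_unit k r = (\<lambda>x. if x = r then int k else 0)"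

text \<open>Rows beyond \<open>i\<close> may be changed modulo \<open>k\<close>, because the
  subgroup contains the \<open>k\<close>-fold unit vectors needed to correct them; rows up to
  \<open>i\<close> must agree exactly.\<close>

lemma int_subgroup_congruent:
  assumes H: "int_subgroup H" and x: "x \<in> H" and k: "\<And>r. i < r \<Longrightarrow> r < n \<Longrightarrow> scaled_unit k r \<in> H"
    and lo: "\<And>r. r \<le> i \<or> n \<le> r \<Longrightarrow> y r = x r" and hi: "\<And>r. i < r \<Longrightarrow> r < n \<Longrightarrow> int k dvd y r - x r"
  shows "y \<in> H"
proof -
  define m where "m r = (if i < r then (y r - x r) div int k else 0)" for r
  have "(\<lambda>r. \<Sum>l<n. m l * (if i < l then scaled_unit k l r else 0)) \<in> H"
  proof (rule int_subgroup_sum[OF H])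
    fix l assume "l < n"
    then show "(\<lambda>r. if i < l then scaled_unit k l r else 0) \<in> H"
      using k[of l] H by (cases "i < l") (simp_all add: int_subgroup_def)
  qed
  from int_subgroup_add[OF H x this] have "(\<lambda>r. x r + (\<Sum>l<n. m l * (if i < l then scaled_unit k l r else 0))) \<in> H" .
  also have "(\<lambda>r. x r + (\<Sum>l<n. m l * (if i < l then scaled_unit k l r else 0))) = y"
  proof
    fix r
    have "(\<Sum>l<n. m l * (if i < l then scaled_unit k l r else 0)) = (\<Sum>l<n. if l = r then m r * int k else 0)"
      by (intro sum.cong) (auto simp: scaled_unit_def m_def)
    also have "\<dots> = (if r < n then m r * int k else 0)" by simp
    finally show "x r + (\<Sum>l<n. m l * (if i < l then scaled_unit k l r else 0)) = y r"
      using lo[of r] hi[of r] by (cases "i < r") (auto simp: m_def)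
  qed
  finally show ?thesis .
qed

lemma int_subgroup_congruent_all:
  assumes H: "int_subgroup H" and x: "x \<in> H" and k: "\<And>r. r < n \<Longrightarrow> scaled_unit k r \<in> H"
    and lo: "\<And>r. n \<le> r \<Longrightarrow> y r = x r" and hi: "\<And>r. r < n \<Longrightarrow> int k dvd y r - x r"
  shows "y \<in> H"
proof -
  define m where "m r = (y r - x r) div int k" for r
  have "(\<lambda>r. \<Sum>l<n. m l * scaled_unit k l r) \<in> H" by (rule int_subgroup_sum[OF H k])
  from int_subgroup_add[OF H x this] have "(\<lambda>r. x r + (\<Sum>l<n. m l * scaled_unit k l r)) \<in> H" .
  also have "(\<lambda>r. x r + (\<Sum>l<n. m l * scaled_unit k l r)) = y"
  proof
    fix r
    have "(\<Sum>l<n. m l * scaled_unit k l r) = (\<Sum>l<n. if l = r then m r * int k else 0)"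
      by (intro sum.cong) (auto simp: scaled_unit_def)
    also have "\<dots> = (if r < n then m r * int k else 0)" by simp
    finally show "x r + (\<Sum>l<n. m l * scaled_unit k l r) = y r"
      using lo[of r] hi[of r] by (cases "r < n") (auto simp: m_def)
  qed
  finally show ?thesis .
qed

text \<open>Column \<open>n\<close> is the vector being inserted; rows \<open>n, \<dots>, 2 n - 1\<close> record, modulo \<open>k\<close>, the
  coefficients with which the upper half of a column is a combination of the columns of \<open>A\<close>.
  Row \<open>i\<close> is being cleared.  Reducing entries below the diagonal modulo \<open>k\<close> does not change the
  lattice because the later columns alone generate the corresponding multiples of \<open>k\<close>.\<close>

definition hnf_inv :: "nat \<Rightarrow> nat \<Rightarrow> (nat \<Rightarrow> nat \<Rightarrow> int) \<Rightarrow> (nat \<Rightarrow> int) set \<Rightarrow> nat \<Rightarrow> (nat \<Rightarrow> nat \<Rightarrow> int) \<Rightarrow> bool" where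
  "hnf_inv n k A G i \<tau> \<longleftrightarrow>
     (\<forall>r<2 * n. \<forall>c\<le>n. 0 \<le> \<tau> r c \<and> \<tau> r c \<le> int k) \<and>
     (\<forall>c<n. 0 < \<tau> c c \<and> (\<forall>r<c. \<tau> r c = 0)) \<and>
     (\<forall>r<i. \<tau> r n = 0) \<and>
     (\<forall>r<n. \<forall>c\<le>n. int k dvd \<tau> r c - (\<Sum>l<n. A r l * \<tau> (n + l) c)) \<and>
     (\<forall>r<n. scaled_unit k r \<in> int_span (col_fun n \<tau> ` (if r \<le> i then {r..n} else {r..<n}))) \<and>
     (\<forall>g\<in>G. g \<in> int_span (col_fun n \<tau> ` {..n}))"

lemma hnf_invD:
  assumes "hnf_inv n k A G i \<tau>"
  shows "r < 2 * n \<Longrightarrow> c \<le> n \<Longrightarrow> 0 \<le> \<tau> r c" "r < 2 * n \<Longrightarrow> c \<le> n \<Longrightarrow> \<tau> r c \<le> int k"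
    "c < n \<Longrightarrow> 0 < \<tau> c c" "c < n \<Longrightarrow> r < c \<Longrightarrow> \<tau> r c = 0" "r < i \<Longrightarrow> \<tau> r n = 0"
    "r < n \<Longrightarrow> c \<le> n \<Longrightarrow> int k dvd \<tau> r c - (\<Sum>l<n. A r l * \<tau> (n + l) c)"
    "r < n \<Longrightarrow> r \<le> i \<Longrightarrow> scaled_unit k r \<in> int_span (col_fun n \<tau> ` {r..n})"
    "r < n \<Longrightarrow> i < r \<Longrightarrow> scaled_unit k r \<in> int_span (col_fun n \<tau> ` {r..<n})"
    "g \<in> G \<Longrightarrow> g \<in> int_span (col_fun n \<tau> ` {..n})"
proof -
  note 1 = assms[unfolded hnf_inv_def, THEN conjunct1]
    and 2 = assms[unfolded hnf_inv_def, THEN conjunct2, THEN conjunct1]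
    and 3 = assms[unfolded hnf_inv_def, THEN conjunct2, THEN conjunct2, THEN conjunct1]
    and 4 = assms[unfolded hnf_inv_def, THEN conjunct2, THEN conjunct2, THEN conjunct2, THEN conjunct1]
    and 56 = assms[unfolded hnf_inv_def, THEN conjunct2, THEN conjunct2, THEN conjunct2, THEN conjunct2]
  note 5 = conjunct1[OF 56] and 6 = conjunct2[OF 56]
  show "r < 2 * n \<Longrightarrow> c \<le> n \<Longrightarrow> 0 \<le> \<tau> r c" "r < 2 * n \<Longrightarrow> c \<le> n \<Longrightarrow> \<tau> r c \<le> int k"
    using 1 by simp_all
  show "c < n \<Longrightarrow> 0 < \<tau> c c" "c < n \<Longrightarrow> r < c \<Longrightarrow> \<tau> r c = 0"
    using 2 by simp_all
  show "r < i \<Longrightarrow> \<tau> r n = 0" using 3 by simp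
  show "r < n \<Longrightarrow> c \<le> n \<Longrightarrow> int k dvd \<tau> r c - (\<Sum>l<n. A r l * \<tau> (n + l) c)" using 4 by blast
  show "r < n \<Longrightarrow> r \<le> i \<Longrightarrow> scaled_unit k r \<in> int_span (col_fun n \<tau> ` {r..n})" using spec[OF 5, of r] by simp
  show "r < n \<Longrightarrow> i < r \<Longrightarrow> scaled_unit k r \<in> int_span (col_fun n \<tau> ` {r..<n})" using spec[OF 5, of r] by simp
  show "g \<in> G \<Longrightarrow> g \<in> int_span (col_fun n \<tau> ` {..n})" using 6 by blast
qed

text \<open>Reducing values and recorded coefficients separately is harmless: the relation between
  them is only a congruence. This is the bookkeeping step of every column operation.\<close>

lemma dvd_diff_mod_comb:
  fixes k :: int
  assumes "k dvd a - (\<Sum>l\<in>I. f l * x l)" "k dvd b - (\<Sum>l\<in>I. f l * y l)"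
  shows "k dvd (a - q * b) mod k - (\<Sum>l\<in>I. f l * ((x l - q * y l) mod k))"
proof -
  have "k dvd (a - q * b) mod k - (a - q * b)" by (simp add: mod_eq_dvd_iff[symmetric])
  moreover have "k dvd (\<Sum>l\<in>I. f l * (x l - q * y l)) - (\<Sum>l\<in>I. f l * ((x l - q * y l) mod k))"
    unfolding sum_subtractf[symmetric] right_diff_distrib[symmetric]
    by (intro dvd_sum dvd_mult) (simp add: mod_eq_dvd_iff[symmetric])
  moreover have "k dvd (a - q * b) - (\<Sum>l\<in>I. f l * (x l - q * y l))"
  proof -
    have "(a - q * b) - (\<Sum>l\<in>I. f l * (x l - q * y l)) =
        (a - (\<Sum>l\<in>I. f l * x l)) - q * (b - (\<Sum>l\<in>I. f l * y l))"
      by (simp add: right_diff_distrib sum_subtractf sum_distrib_left mult.left_commute[of _ q])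
    moreover have "k dvd (a - (\<Sum>l\<in>I. f l * x l)) - q * (b - (\<Sum>l\<in>I. f l * y l))"
      by (intro dvd_diff dvd_mult assms)
    ultimately show ?thesis by (simp only:)
  qed
  ultimately have "k dvd ((a - q * b) mod k - (a - q * b)) + ((a - q * b) - (\<Sum>l\<in>I. f l * (x l - q * y l)))
     + ((\<Sum>l\<in>I. f l * (x l - q * y l)) - (\<Sum>l\<in>I. f l * ((x l - q * y l) mod k)))"
    by (intro dvd_add)
  then show ?thesis by simp
qed

text \<open>A division step of Euclid's algorithm on the entries \<open>(i, i)\<close> and
  \<open>(i, n)\<close>, with the exchange of the two columns included.\<close>

definition hnf_step :: "nat \<Rightarrow> nat \<Rightarrow> nat \<Rightarrow> (nat \<Rightarrow> nat \<Rightarrow> int) \<Rightarrow> nat \<Rightarrow> nat \<Rightarrow> int" where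
  "hnf_step n k i \<tau> = (\<lambda>r c. if c = i then \<tau> r n
     else if c = n then (\<tau> r i - (\<tau> i i div \<tau> i n) * \<tau> r n) mod int k else \<tau> r c)"

text \<open>No lattice vector is lost: the old column \<open>i\<close> is the new column
  \<open>n\<close> plus the quotient times the new column \<open>i\<close>, up to multiples of
  \<open>k\<close> below row \<open>i\<close>. These multiples come from columns
  \<open>i + 1\<close> to \<open>n - 1\<close>, which are untouched.\<close>

lemma hnf_step_inv:
  assumes inv: "hnf_inv n k A G i \<tau>" and i: "i < n" and k: "0 < k" and v: "0 < \<tau> i n"
  shows "hnf_inv n k A G i (hnf_step n k i \<tau>)" "hnf_step n k i \<tau> i n = \<tau> i i mod \<tau> i n"
proof -
  let ?\<tau> = "hnf_step n k i \<tau>" and ?q = "\<tau> i i div \<tau> i n"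
  note D = hnf_invD[OF inv]
  have st: "?\<tau> r i = \<tau> r n" "?\<tau> r n = (\<tau> r i - ?q * \<tau> r n) mod int k"
    "c \<noteq> i \<Longrightarrow> c \<noteq> n \<Longrightarrow> ?\<tau> r c = \<tau> r c" for r c
    using i by (auto simp: hnf_step_def)
  have rem: "\<tau> i i - ?q * \<tau> i n = \<tau> i i mod \<tau> i n" by (simp add: minus_div_mult_eq_mod)
  \<comment> \<open>The divisor is at most \<open>k\<close>, so the remainder is already reduced and
    row \<open>i\<close> stays exact, as Euclid's algorithm requires.\<close>
  have "0 \<le> \<tau> i i mod \<tau> i n" "\<tau> i i mod \<tau> i n < int k"
    using v D(2)[of i n] i pos_mod_bound[OF v, of "\<tau> i i"] pos_mod_sign[OF v, of "\<tau> i i"] by linarith+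
  then show vi: "?\<tau> i n = \<tau> i i mod \<tau> i n" unfolding st(2) rem by simp
  have cols: "col_fun n ?\<tau> c = col_fun n \<tau> c" if "c \<noteq> i" "c \<noteq> n" for c
    using st(3)[OF that] by (auto simp: col_fun_def fun_eq_iff)
  have coli: "col_fun n ?\<tau> i = col_fun n \<tau> n" using st(1) by (auto simp: col_fun_def fun_eq_iff)
  have late: "scaled_unit k r \<in> int_span (col_fun n ?\<tau> ` {r..<n})" if r: "i < r" "r < n" for r
  proof -
    have "col_fun n ?\<tau> ` {r..<n} = col_fun n \<tau> ` {r..<n}" using cols r by (intro image_cong) auto
    then show ?thesis using D(8)[OF r(2,1)] by simp
  qed
  have oldi: "col_fun n \<tau> i \<in> int_span (col_fun n ?\<tau> ` {r..n})" if r: "r \<le> i" for r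
  proof (rule int_subgroup_congruent[OF int_subgroup_int_span])
    have "col_fun n ?\<tau> i \<in> int_span (col_fun n ?\<tau> ` {r..n})" "col_fun n ?\<tau> n \<in> int_span (col_fun n ?\<tau> ` {r..n})"
      using r i by (auto intro!: int_span_incl)
    then show "(\<lambda>x. col_fun n ?\<tau> n x + ?q * col_fun n ?\<tau> i x) \<in> int_span (col_fun n ?\<tau> ` {r..n})"
      by (intro int_subgroup_add int_subgroup_smult int_subgroup_int_span)
    show "scaled_unit k x \<in> int_span (col_fun n ?\<tau> ` {r..n})" if "i < x" "x < n" for x
    proof -
      have "{x..<n} \<subseteq> {r..n}" using that r by auto
      then show ?thesis using late[OF that] int_span_mono[OF image_mono, of "{x..<n}" "{r..n}" "col_fun n ?\<tau>"] by blast
    qed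
    show "col_fun n \<tau> i x = col_fun n ?\<tau> n x + ?q * col_fun n ?\<tau> i x" if "x \<le> i \<or> n \<le> x" for x
    proof (cases "x = i")
      case True
      then show ?thesis using vi rem i by (simp add: col_fun_def st(1))
    next
      case False
      then show ?thesis using that i D(4)[of i x] D(5)[of x] by (auto simp: col_fun_def st)
    qed
    show "int k dvd col_fun n \<tau> i x - (col_fun n ?\<tau> n x + ?q * col_fun n ?\<tau> i x)" if "i < x" "x < n" for x
    proof -
      have "int k dvd (\<tau> x i - ?q * \<tau> x n) - (\<tau> x i - ?q * \<tau> x n) mod int k"
        by (simp add: mod_eq_dvd_iff[symmetric])
      then show ?thesis using that by (simp add: col_fun_def st algebra_simps)
    qed
  qed
  have sub: "int_span (col_fun n \<tau> ` {r..n}) \<subseteq> int_span (col_fun n ?\<tau> ` {r..n})" if r: "r \<le> i" for r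
  proof (rule int_span_least[OF int_subgroup_int_span], rule image_subsetI)
    fix c assume c: "c \<in> {r..n}"
    show "col_fun n \<tau> c \<in> int_span (col_fun n ?\<tau> ` {r..n})"
    proof (cases "c = i \<or> c = n")
      case True
      have "col_fun n ?\<tau> i \<in> int_span (col_fun n ?\<tau> ` {r..n})" using r i by (intro int_span_incl imageI) simp
      then show ?thesis using True oldi[OF r] coli by auto
    next
      case False
      then have "col_fun n \<tau> c = col_fun n ?\<tau> c" using cols[of c] by simp
      then show ?thesis using int_span_incl[OF imageI[OF c, of "col_fun n ?\<tau>"]] by simp
    qed
  qed
  have "0 \<le> ?\<tau> r c \<and> ?\<tau> r c \<le> int k" if "r < 2 * n" "c \<le> n" for r c
    using that D(1,2)[of r c] D(1,2)[of r n] k pos_mod_bound[of "int k"] by (auto simp: hnf_step_def less_imp_le)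
  moreover have "0 < ?\<tau> c c \<and> (\<forall>r<c. ?\<tau> r c = 0)" if "c < n" for c
    using that D(3,4)[of c] D(5) v by (auto simp: hnf_step_def)
  moreover have "?\<tau> r n = 0" if "r < i" for r
    using that D(4)[of i r] D(5)[of r] i by (simp add: st)
  moreover have "int k dvd ?\<tau> r c - (\<Sum>l<n. A r l * ?\<tau> (n + l) c)" if "r < n" "c \<le> n" for r c
  proof -
    consider "c = i" | "c = n" | "c \<noteq> i" "c \<noteq> n" by blast
    then show ?thesis
    proof cases
      case 1
      then show ?thesis using D(6)[of r n] that by (simp add: st)
    next
      case 2
      then show ?thesis using dvd_diff_mod_comb[OF D(6)[of r i] D(6)[of r n], of ?q] that i by (simp add: st)
    next
      case 3
      then show ?thesis using D(6)[of r c] that by (simp add: st)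
    qed
  qed
  moreover have "scaled_unit k r \<in> int_span (col_fun n ?\<tau> ` (if r \<le> i then {r..n} else {r..<n}))" if "r < n" for r
    using late[of r] sub[of r] D(7)[of r] that by auto
  moreover have "g \<in> int_span (col_fun n ?\<tau> ` {..n})" if "g \<in> G" for g
    using sub[of 0] D(9)[OF that] by (auto simp: atMost_atLeast0)
  ultimately show "hnf_inv n k A G i ?\<tau>" unfolding hnf_inv_def by blast
qed

text \<open>Once row \<open>i\<close> of column \<open>n\<close> is cleared, the frontier may
  advance. The clause for row \<open>i + 1\<close> becomes weaker, since column \<open>n\<close>
  will be mixed with column \<open>i + 1\<close> next.\<close>

lemma hnf_inv_Suc:
  assumes inv: "hnf_inv n k A G i \<tau>" and v: "\<tau> i n = 0"
  shows "hnf_inv n k A G (Suc i) \<tau>"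
proof -
  note D = hnf_invD[OF inv]
  have "scaled_unit k r \<in> int_span (col_fun n \<tau> ` (if r \<le> Suc i then {r..n} else {r..<n}))" if "r < n" for r
  proof (cases "r = Suc i")
    case True
    have "int_span (col_fun n \<tau> ` {r..<n}) \<subseteq> int_span (col_fun n \<tau> ` {r..n})" by (intro int_span_mono image_mono) auto
    then show ?thesis using D(8)[of r] that True by auto
  next
    case False
    then show ?thesis using D(7,8)[of r] that by auto
  qed
  moreover have "\<tau> r n = 0" if "r < Suc i" for r using that v D(5) by (cases "r = i") auto
  ultimately show ?thesis using inv unfolding hnf_inv_def by blast
qed

lemma hnf_inv_last:
  assumes inv: "hnf_inv n k A G n \<tau>"
  shows "int_span (col_fun n \<tau> ` {r..n}) \<subseteq> int_span (col_fun n \<tau> ` {r..<n})"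
proof (rule int_span_least[OF int_subgroup_int_span], rule image_subsetI)
  fix c assume c: "c \<in> {r..n}"
  show "col_fun n \<tau> c \<in> int_span (col_fun n \<tau> ` {r..<n})"
  proof (cases "c = n")
    case True
    then have "col_fun n \<tau> c = (\<lambda>_. 0)" using hnf_invD(5)[OF inv] by (auto simp: col_fun_def)
    then show ?thesis using int_subgroup_int_span by (simp add: int_subgroup_def)
  next
    case False
    then show ?thesis using c by (auto intro!: int_span_incl)
  qed
qed

text \<open>Column \<open>n\<close> is free for the next generator because the first
  \<open>n\<close> columns alone already span the lattice. The inserted vector is column
  \<open>j\<close> of \<open>A\<close> itself, so its record is the \<open>j\<close>-th unit vector;
  both are stored as residues.\<close>

lemma hnf_inv_new_column:
  assumes inv: "hnf_inv n k A G n \<tau>" and j: "j < n" and k: "0 < k"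
    and \<tau>': "\<And>r c. c < n \<Longrightarrow> \<tau>' r c = \<tau> r c" "\<And>r. r < n \<Longrightarrow> \<tau>' r n = A r j mod int k"
      "\<And>r. r < n \<Longrightarrow> \<tau>' (n + r) n = (if r = j then 1 else 0) mod int k"
  shows "hnf_inv n k A (insert (col_fun n A j) G) 0 \<tau>'"
proof -
  note D = hnf_invD[OF inv]
  have colc: "col_fun n \<tau>' c = col_fun n \<tau> c" if "c < n" for c using \<tau>'(1)[OF that] by (auto simp: col_fun_def)
  have img: "col_fun n \<tau>' ` {r..<n} = col_fun n \<tau> ` {r..<n}" for r by (intro image_cong) (auto simp: colc)
  have old: "int_span (col_fun n \<tau> ` {r..n}) \<subseteq> int_span (col_fun n \<tau>' ` {r..<n})" for r
    using hnf_inv_last[OF inv, of r] by (simp add: img)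
  have mono: "int_span (col_fun n \<tau>' ` {r..<n}) \<subseteq> int_span (col_fun n \<tau>' ` {s..n})" if "s \<le> r" for r s
    using that by (intro int_span_mono image_mono) auto
  have ker: "scaled_unit k r \<in> int_span (col_fun n \<tau>' ` {r..<n})" if "r < n" for r
    using D(7)[of r] old[of r] that by auto
  have "0 \<le> \<tau>' r c \<and> \<tau>' r c \<le> int k" if r: "r < 2 * n" "c \<le> n" for r c
  proof (cases "c = n")
    case True
    then show ?thesis
      using r k \<tau>'(2)[of r] \<tau>'(3)[of "r - n"] pos_mod_bound[of "int k"] by (cases "r < n") (auto simp: less_imp_le)
  next
    case False
    then show ?thesis using D(1,2)[of r c] \<tau>'(1)[of c r] r by auto
  qed
  moreover have "0 < \<tau>' c c \<and> (\<forall>r<c. \<tau>' r c = 0)" if "c < n" for c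
    using D(3,4)[of c] \<tau>'(1)[OF that] that by simp
  moreover have "int k dvd \<tau>' r c - (\<Sum>l<n. A r l * \<tau>' (n + l) c)" if r: "r < n" "c \<le> n" for r c
  proof (cases "c = n")
    case True
    \<comment> \<open>The terms \<open>0 * 0\<close> bring the congruence into the form of
      \<open>dvd_diff_mod_comb\<close>, used with a zero second column.\<close>
    have "int k dvd (A r j - 0 * 0) mod int k - (\<Sum>l<n. A r l * (((if l = j then 1 else 0) - 0 * 0) mod int k))"
      by (rule dvd_diff_mod_comb[of _ "A r j" "A r" "\<lambda>l. if l = j then 1 else 0" _ 0 "\<lambda>_. 0"])
        (use j in \<open>simp_all add: if_distrib[of "\<lambda>x. _ * x"] sum.delta' cong: if_cong\<close>)
    then show ?thesis using \<tau>'(2,3) r True by simp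
  next
    case False
    then show ?thesis using D(6)[of r c] \<tau>'(1)[of c] r by simp
  qed
  moreover have "scaled_unit k r \<in> int_span (col_fun n \<tau>' ` (if r \<le> 0 then {r..n} else {r..<n}))" if "r < n" for r
    using ker[OF that] mono[of r r] by auto
  moreover have "g \<in> int_span (col_fun n \<tau>' ` {..n})" if g: "g \<in> insert (col_fun n A j) G" for g
  proof (cases "g \<in> G")
    case True
    then show ?thesis using D(9)[of g] old[of 0] mono[of 0 0] by (auto simp: atMost_atLeast0)
  next
    case False
    then have g: "g = col_fun n A j" using g by simp
    show ?thesis unfolding g
    proof (rule int_subgroup_congruent_all[OF int_subgroup_int_span])
      show "col_fun n \<tau>' n \<in> int_span (col_fun n \<tau>' ` {..n})" by (intro int_span_incl) auto
      show "scaled_unit k r \<in> int_span (col_fun n \<tau>' ` {..n})" if "r < n" for r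
        using ker[OF that] mono[of 0 r] by (auto simp: atMost_atLeast0)
      show "int k dvd col_fun n A j r - col_fun n \<tau>' n r" if "r < n" for r
        using that \<tau>'(2)[OF that] by (simp add: col_fun_def mod_eq_dvd_iff[symmetric])
    qed (simp add: col_fun_def)
  qed
  ultimately show ?thesis unfolding hnf_inv_def by blast
qed

text \<open>The start \<open>k I\<close> is the reason why entries are bounded by \<open>k\<close>
  non-strictly. Its columns vanish modulo \<open>k\<close>, so zero records are correct.\<close>

lemma hnf_inv_init:
  assumes k: "0 < k" and \<tau>: "\<And>r c. \<tau> r c = (if r = c \<and> c < n then int k else 0)"
  shows "hnf_inv n k A {} n \<tau>"
proof -
  have "scaled_unit k r \<in> int_span (col_fun n \<tau> ` {r..n})" if "r < n" for r
  proof -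
    have "scaled_unit k r = col_fun n \<tau> r" using that by (auto simp: \<tau> scaled_unit_def col_fun_def)
    then show ?thesis using that by (auto intro!: int_span_incl)
  qed
  moreover have "\<tau> (n + l) c = 0" for l c by (simp add: \<tau>)
  ultimately show ?thesis unfolding hnf_inv_def using k by (auto simp: \<tau>)
qed

definition col_lattice :: "nat \<Rightarrow> (nat \<Rightarrow> nat \<Rightarrow> int) \<Rightarrow> (nat \<Rightarrow> int) set" where
  "col_lattice n \<tau> = {f. \<exists>u. f = (\<lambda>r. if r < n then \<Sum>c<n. \<tau> r c * u c else 0)}"

lemma int_subgroup_col_lattice: "int_subgroup (col_lattice n \<tau>)"
  unfolding int_subgroup_def col_lattice_def
proof (intro conjI ballI)
  show "(\<lambda>_. 0) \<in> {f. \<exists>u. f = (\<lambda>r. if r < n then \<Sum>c<n. \<tau> r c * u c else 0)}"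
    by (intro CollectI exI[of _ "\<lambda>_. 0"]) auto
  fix x y assume "x \<in> {f. \<exists>u. f = (\<lambda>r. if r < n then \<Sum>c<n. \<tau> r c * u c else 0)}"
    "y \<in> {f. \<exists>u. f = (\<lambda>r. if r < n then \<Sum>c<n. \<tau> r c * u c else 0)}"
  then obtain u v where "x = (\<lambda>r. if r < n then \<Sum>c<n. \<tau> r c * u c else 0)"
    "y = (\<lambda>r. if r < n then \<Sum>c<n. \<tau> r c * v c else 0)" by blast
  then show "(\<lambda>r. x r - y r) \<in> {f. \<exists>u. f = (\<lambda>r. if r < n then \<Sum>c<n. \<tau> r c * u c else 0)}"
    by (intro CollectI exI[of _ "\<lambda>c. u c - v c"]) (auto simp: fun_eq_iff right_diff_distrib sum_subtractf)
qed

lemma col_fun_col_lattice: "c < n \<Longrightarrow> col_fun n \<tau> c \<in> col_lattice n \<tau>"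
  unfolding col_lattice_def col_fun_def
  by (intro CollectI exI[of _ "\<lambda>d. if d = c then 1 else 0"]) (auto simp: if_distrib cong: if_cong)

lemma hnf_col_lattice:
  assumes inv: "hnf_inv n k A G n \<tau>"
  shows "g \<in> G \<Longrightarrow> g \<in> col_lattice n \<tau>" "r < n \<Longrightarrow> scaled_unit k r \<in> col_lattice n \<tau>"
proof -
  have L: "int_span (col_fun n \<tau> ` {..<n}) \<subseteq> col_lattice n \<tau>" by (intro int_span_least int_subgroup_col_lattice) (auto intro: col_fun_col_lattice)
  show "g \<in> G \<Longrightarrow> g \<in> col_lattice n \<tau>"
    using L hnf_invD(9)[OF inv] hnf_inv_last[OF inv, of 0] by (auto simp: atMost_atLeast0 lessThan_atLeast0)
  assume r: "r < n"
  have "int_span (col_fun n \<tau> ` {r..<n}) \<subseteq> int_span (col_fun n \<tau> ` {..<n})" by (intro int_span_mono image_mono) auto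
  then show "scaled_unit k r \<in> col_lattice n \<tau>" using L hnf_invD(7)[OF inv r] hnf_inv_last[OF inv, of r] r by auto
qed

text \<open>The bookkeeping rows give one inclusion: modulo \<open>k\<close>, a combination
  \<open>u\<close> of the columns is \<open>A\<close> applied to the same combination of the
  records. For the other, the triangular lattice contains every inserted column and every
  \<open>k\<close>-fold unit vector.\<close>

lemma hnf_result:
  assumes inv: "hnf_inv n k (\<lambda>r c. A $$ (r, c)) (col_fun n (\<lambda>r c. A $$ (r, c)) ` {..<n}) n \<tau>" and A: "A \<in> carrier_mat n n"
  shows "{mat n n (\<lambda>(r, c). \<tau> r c) *\<^sub>v u | u. u \<in> carrier_vec n} =
    {A *\<^sub>v a + int k \<cdot>\<^sub>v b | a b. a \<in> carrier_vec n \<and> b \<in> carrier_vec n}"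
proof (intro equalityI subsetI)
  let ?T = "mat n n (\<lambda>(r, c). \<tau> r c)"
  {
    fix x assume "x \<in> {?T *\<^sub>v u | u. u \<in> carrier_vec n}"
    then obtain u where u: "u \<in> carrier_vec n" "x = ?T *\<^sub>v u" by blast
    let ?a = "vec n (\<lambda>l. \<Sum>c<n. \<tau> (n + l) c * u $ c)"
    let ?b = "vec n (\<lambda>r. (x $ r - (A *\<^sub>v ?a) $ r) div int k)"
    have "x = A *\<^sub>v ?a + int k \<cdot>\<^sub>v ?b"
    proof (rule eq_vecI)
      fix r assume "r < dim_vec (A *\<^sub>v ?a + int k \<cdot>\<^sub>v ?b)"
      then have r: "r < n" by simp
      have xr: "x $ r = (\<Sum>c<n. \<tau> r c * u $ c)"
        unfolding u(2) using r u(1) by (auto simp: scalar_prod_def atLeast0LessThan intro!: sum.cong)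
      have "(A *\<^sub>v ?a) $ r = (\<Sum>l<n. \<Sum>c<n. A $$ (r, l) * (\<tau> (n + l) c * u $ c))"
        using r A by (auto simp: scalar_prod_def atLeast0LessThan sum_distrib_left intro!: sum.cong)
      also have "\<dots> = (\<Sum>c<n. (\<Sum>l<n. A $$ (r, l) * \<tau> (n + l) c) * u $ c)"
        by (subst sum.swap) (simp add: sum_distrib_right sum_distrib_left mult_ac)
      finally have "x $ r - (A *\<^sub>v ?a) $ r = (\<Sum>c<n. (\<tau> r c - (\<Sum>l<n. A $$ (r, l) * \<tau> (n + l) c)) * u $ c)"
        unfolding xr by (simp add: left_diff_distrib sum_subtractf)
      moreover have "int k dvd \<dots>" using hnf_invD(6)[OF inv r] by (intro dvd_sum dvd_mult2) auto
      ultimately have "int k dvd x $ r - (A *\<^sub>v ?a) $ r" by simp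
      then show "x $ r = (A *\<^sub>v ?a + int k \<cdot>\<^sub>v ?b) $ r" using r A by simp
    qed (use u A in simp)
    then show "x \<in> {A *\<^sub>v a + int k \<cdot>\<^sub>v b | a b. a \<in> carrier_vec n \<and> b \<in> carrier_vec n}"
      by (metis (mono_tags, lifting) mem_Collect_eq vec_carrier)
  next
    fix x assume "x \<in> {A *\<^sub>v a + int k \<cdot>\<^sub>v b | a b. a \<in> carrier_vec n \<and> b \<in> carrier_vec n}"
    then obtain a b where ab: "a \<in> carrier_vec n" "b \<in> carrier_vec n" "x = A *\<^sub>v a + int k \<cdot>\<^sub>v b" by blast
    have "(\<lambda>r. (\<Sum>j<n. a $ j * col_fun n (\<lambda>r c. A $$ (r, c)) j r) + (\<Sum>j<n. b $ j * scaled_unit k j r)) \<in> col_lattice n \<tau>"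
      by (intro int_subgroup_add int_subgroup_sum int_subgroup_col_lattice hnf_col_lattice[OF inv]) auto
    then obtain u where u: "(\<lambda>r. (\<Sum>j<n. a $ j * col_fun n (\<lambda>r c. A $$ (r, c)) j r) + (\<Sum>j<n. b $ j * scaled_unit k j r))
       = (\<lambda>r. if r < n then \<Sum>c<n. \<tau> r c * u c else 0)" by (auto simp: col_lattice_def)
    have "x = ?T *\<^sub>v vec n u"
    proof (rule eq_vecI)
      fix r assume "r < dim_vec (?T *\<^sub>v vec n u)"
      then have r: "r < n" by simp
      have "(\<Sum>j<n. b $ j * scaled_unit k j r) = (\<Sum>j<n. if j = r then b $ r * int k else 0)"
        by (intro sum.cong) (auto simp: scaled_unit_def)
      also have "\<dots> = int k * b $ r" using r by simp
      finally have 1: "(\<Sum>j<n. b $ j * scaled_unit k j r) = int k * b $ r" .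
      have 2: "(\<Sum>j<n. a $ j * col_fun n (\<lambda>r c. A $$ (r, c)) j r) = (A *\<^sub>v a) $ r"
        using r A ab(1) by (auto simp: scalar_prod_def atLeast0LessThan col_fun_def intro!: sum.cong)
      have "x $ r = (\<Sum>c<n. \<tau> r c * u c)" using fun_cong[OF u, of r] r A ab 1 2 by simp
      also have "\<dots> = (?T *\<^sub>v vec n u) $ r"
        using r by (auto simp: scalar_prod_def atLeast0LessThan intro!: sum.cong)
      finally show "x $ r = (?T *\<^sub>v vec n u) $ r" .
    qed (use ab A in simp)
    then show "x \<in> {?T *\<^sub>v u | u. u \<in> carrier_vec n}" using vec_carrier[of n u] by blast
  }
qed

section \<open>Programs for column operations modulo k\<close>

abbreviation "n2 \<equiv> NAdd nn nn"
abbreviation "N1 \<equiv> NConst 1"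

text \<open>The operation covers all \<open>2 n\<close> rows, so the records follow the values. The
  quotient is saved in \<open>''q''\<close> because every reduction in \<open>PutMod\<close> calls
  \<open>Floor\<close> and overwrites \<open>''f''\<close>.\<close>

definition SubCol :: "nexp \<Rightarrow> nexp \<Rightarrow> nexp \<Rightarrow> com" where
  "SubCol a b i = Seq (RAssign ''x'' N0 N0 (RDiv (RCell ''T'' i a) (RCell ''T'' i b)))
     (Seq Floor (Seq (RAssign ''q'' N0 N0 (RCell ''f'' N0 N0))
       (PutMod ''T'' n2 N1 N0 a (RSub (RCell ''T'' rr a) (RMul (RCell ''q'' N0 N0) (RCell ''T'' rr b))))))"

definition Swap :: com where
  "Swap = Seq (Put ''w'' n2 N1 N0 N0 (RCell ''T'' rr ii))
     (Seq (Put ''T'' n2 N1 N0 ii (RCell ''T'' rr nn)) (Put ''T'' n2 N1 N0 nn (RCell ''w'' rr N0)))"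

definition ClearRow :: com where
  "ClearRow = Loop (RLess (RNat N0) (RCell ''T'' ii nn)) (Seq (SubCol ii nn ii) Swap)"

definition HermiteForm :: com where
  "HermiteForm = Seq (Put ''T'' n2 nn N0 N0 (RMul (RNat (NVar ''k'')) (RNat (Kron rr ss))))
     (For ''j'' nn (Seq (PutMod ''T'' nn N1 N0 nn (RCell ''A'' rr jj))
       (Seq (PutMod ''T'' nn N1 nn nn (RNat (Kron rr jj))) (For ''i'' nn ClearRow))))"

text \<open>Column \<open>n\<close> starts as a column of \<open>R\<close> with zero records and is
  cleared by forward substitution. When its upper half is zero, the records express minus the
  original column through \<open>A\<close>, hence the sign in the last assignment.\<close>

definition Solve :: com where
  "Solve = For ''j'' nn (Seq (PutMod ''T'' nn N1 N0 nn (RCell ''R'' rr jj))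
       (Seq (PutMod ''T'' nn N1 nn nn (RNat N0))
       (Seq (For ''i'' nn (SubCol nn ii ii))
         (Put ''Z'' nn N1 N0 jj (RSub (RNat N0) (RCell ''T'' (NAdd nn rr) nn))))))"

definition subcol_time :: "nat \<Rightarrow> nat \<Rightarrow> nat" where
  "subcol_time L N = 1 + ((6 * L + 15) + (1 + putmod_time L (N + N) 1))"
definition swap_time :: "nat \<Rightarrow> nat" where
  "swap_time N = put_time (N + N) 1 + (put_time (N + N) 1 + put_time (N + N) 1)"
definition clear_row_time :: "nat \<Rightarrow> nat \<Rightarrow> nat" where
  "clear_row_time L N = (L + 2) * ((subcol_time L N + swap_time N) + 1) + 1"
definition hermite_time :: "nat \<Rightarrow> nat \<Rightarrow> nat" where
  "hermite_time L N = put_time (N + N) N + (N * ((putmod_time L N 1 + (putmod_time L N 1 + (N * (clear_row_time L N + 2) + 2))) + 2) + 2)"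
definition solve_time :: "nat \<Rightarrow> nat \<Rightarrow> nat" where
  "solve_time L N = N * ((putmod_time L N 1 + (putmod_time L N 1 + ((N * (subcol_time L N + 2) + 2) + put_time N 1))) + 2) + 2"

definition tableau :: "nat \<Rightarrow> (nat \<Rightarrow> nat \<Rightarrow> real) \<Rightarrow> (nat \<Rightarrow> nat \<Rightarrow> int) \<Rightarrow> bool" where
  "tableau n a \<tau> \<longleftrightarrow> (\<forall>r<n + n. \<forall>c\<le>n. a r c = of_int (\<tau> r c))"

lemma tableauD: "tableau n a \<tau> \<Longrightarrow> r < n + n \<Longrightarrow> c \<le> n \<Longrightarrow> a r c = of_int (\<tau> r c)"
  by (simp add: tableau_def)

lemma eq_off_trans_same: "eq_off V f g \<Longrightarrow> eq_off V g h \<Longrightarrow> eq_off V f h"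
  by (rule eq_off_trans) auto

abbreviation "HermiteVars \<equiv> {''T'', ''x'', ''f'', ''c'', ''q'', ''w''}"

context
  fixes zo :: "real mat \<Rightarrow> real mat" and go :: "real mat \<Rightarrow> real mat \<Rightarrow> real mat option"
    and n k N L :: nat
  assumes nN: "n \<le> N" and k0: "0 < k" and kL: "k * k + k \<le> 2 ^ L"
begin

text \<open>Quotient and entries are at most \<open>k\<close>, so the values before reduction are at
  most \<open>k * k + k\<close> in absolute value; this is where the condition on \<open>L\<close>
  comes from.\<close>

lemma wp_SubCol:
  assumes n: "\<nu>0 ''n'' = n" "\<nu>0 ''k'' = k"
    and abi: "\<And>\<nu>. eq_off LoopVars \<nu> \<nu>0 \<Longrightarrow> nval a \<nu> = a' \<and> nval b \<nu> = b'" "nval i \<nu>0 = i'"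
    and bnd: "a' \<le> n" "b' \<le> n" "i' < n" "a' \<noteq> b'"
    and T: "tableau n (\<rho>0 ''T'') \<tau>"
    and rng: "\<And>r c. r < n + n \<Longrightarrow> c \<le> n \<Longrightarrow> 0 \<le> \<tau> r c \<and> \<tau> r c \<le> int k" and pos: "0 < \<tau> i' b'"
    and post: "\<And>\<nu> \<rho>. eq_off LoopVars \<nu> \<nu>0 \<Longrightarrow> eq_off HermiteVars \<rho> \<rho>0 \<Longrightarrow>
       tableau n (\<rho> ''T'') (\<lambda>r c. if c = a' then (\<tau> r a' - (\<tau> i' a' div \<tau> i' b') * \<tau> r b') mod int k else \<tau> r c) \<Longrightarrow> Q (\<nu>, \<rho>)"
  shows "runs zo go (SubCol a b i) (\<nu>0, \<rho>0) (subcol_time L N) Q"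
proof -
  let ?q = "\<tau> i' a' div \<tau> i' b'" and ?x = "real_of_int (\<tau> i' a') / real_of_int (\<tau> i' b')"
  have ra: "0 \<le> \<tau> i' a'" "\<tau> i' a' \<le> int k" using rng[of i' a'] bnd by auto
  have q: "0 \<le> ?q" "?q \<le> int k"
  proof -
    show "0 \<le> ?q" using ra pos by (simp add: pos_imp_zdiv_nonneg_iff)
    have "?q \<le> \<tau> i' a'" using zdiv_mono2[of "\<tau> i' a'" 1 "\<tau> i' b'"] ra pos by simp
    then show "?q \<le> int k" using ra by simp
  qed
  have kL': "int k * int k + int k \<le> 2 ^ L" using kL by (metis of_nat_add of_nat_mult of_nat_le_iff of_nat_numeral of_nat_power)
  have "\<bar>?x\<bar> \<le> real_of_int (\<tau> i' a')"
    using ra pos mult_left_mono[of 1 "real_of_int (\<tau> i' b')" "real_of_int (\<tau> i' a')"] by (simp add: abs_divide pos_divide_le_eq)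
  also have "\<dots> \<le> real_of_int (2 ^ L)"
  proof (rule of_int_le_iff[THEN iffD2])
    have "0 \<le> int k * int k" by simp
    then show "\<tau> i' a' \<le> 2 ^ L" using ra kL' by linarith
  qed
  finally have xL: "\<bar>?x\<bar> \<le> 2 ^ L" by simp
  have val: "\<bar>real_of_int (\<tau> r a' - ?q * \<tau> r b')\<bar> \<le> 2 ^ L" if r: "r < n + n" for r
  proof -
    have "0 \<le> ?q * \<tau> r b'" "?q * \<tau> r b' \<le> int k * int k"
      using q rng[OF r bnd(2)] by (auto intro: mult_mono)
    then have "\<bar>\<tau> r a' - ?q * \<tau> r b'\<bar> \<le> 2 ^ L" using rng[OF r bnd(1)] kL' by linarith
    then have "real_of_int \<bar>\<tau> r a' - ?q * \<tau> r b'\<bar> \<le> real_of_int (2 ^ L)" by (rule of_int_le_iff[THEN iffD2])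
    then show ?thesis by simp
  qed
  note n0 = abi(1)[OF eq_off_refl]
  let ?\<rho>1 = "\<rho>0(''x'' := (\<rho>0 ''x'')(0 := (\<rho>0 ''x'' 0)(0 := ?x)))"
  show ?thesis unfolding SubCol_def subcol_time_def
  proof (rule runs_Seq, rule runs_RAssign, rule runs_Seq, rule runs_conseq[OF runs_Floor[OF _ xL] order_refl], goal_cases)
    case 1
    show ?case using tableauD[OF T, of i' a'] tableauD[OF T, of i' b'] bnd n0 abi(2) by simp
  next
    case (2 s)
    have x1: "real_of_int (\<tau> i' a') / real_of_int (\<tau> i' b') = rval (RDiv (RCell ''T'' i a) (RCell ''T'' i b)) (\<nu>0, \<rho>0)"
      using tableauD[OF T, of i' a'] tableauD[OF T, of i' b'] bnd n0 abi(2) by simp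
    obtain \<rho>2 where s: "s = (\<nu>0, \<rho>2)" and e: "eq_off {''f'', ''c''} \<rho>2 ?\<rho>1" and f: "\<rho>2 ''f'' 0 0 = real_of_int ?q"
      using 2 unfolding x1[symmetric] by (cases s) (auto simp: floor_divide_of_int_eq)
    have T2: "\<rho>2 ''T'' = \<rho>0 ''T''" using eq_offD[OF e, of "''T''"] by simp
    let ?\<rho>3 = "\<rho>2(''q'' := (\<rho>2 ''q'')(0 := (\<rho>2 ''q'' 0)(0 := real_of_int ?q)))"
    have e2: "eq_off HermiteVars \<rho>2 \<rho>0" using eq_off_trans[OF e, of HermiteVars \<rho>0 HermiteVars] by simp
    show ?case unfolding s
    proof (rule runs_Seq, rule runs_RAssign, rule wp_PutMod[where a' = "n + n" and b' = 1 and p' = 0 and q' = a'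
        and k = k and val = "\<lambda>r s. \<tau> r a' - ?q * \<tau> r b'"], goal_cases)
      case (1 \<nu>)
      then show ?case using abi(1)[of \<nu>] eq_offD[OF 1, of "''n''"] n by simp
    next
      case (2 r s \<nu> \<rho>)
      have "\<rho> ''q'' 0 0 = real_of_int ?q" using eq_offD[OF 2(6), of "''q''"] f by simp
      moreover have "\<rho> ''T'' r a' = real_of_int (\<tau> r a')" using 2(7) 2(1,2) T2 tableauD[OF T, of r a'] bnd by simp
      moreover have "\<rho> ''T'' r b' = real_of_int (\<tau> r b')" using 2(8)[of r b'] 2(1,2) T2 tableauD[OF T, of r b'] bnd by auto
      ultimately show ?case using abi(1)[OF 2(5)] 2(3) by simp
    next
      case (3 r s)
      then show ?case using val by simp
    next
      case (9 \<nu> \<rho>)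
      have "eq_off HermiteVars \<rho> \<rho>0"
        by (rule eq_off_trans[OF 9(2), of HermiteVars _ HermiteVars]) (use e2 in auto)
      moreover have "tableau n (\<rho> ''T'') (\<lambda>r c. if c = a' then (\<tau> r a' - ?q * \<tau> r b') mod int k else \<tau> r c)"
        unfolding tableau_def
      proof (intro allI impI)
        fix r c assume rc: "r < n + n" "c \<le> n"
        show "\<rho> ''T'' r c = real_of_int (if c = a' then (\<tau> r a' - ?q * \<tau> r b') mod int k else \<tau> r c)"
          using 9(3)[of r 0] 9(4)[of r c] rc T2 tableauD[OF T rc] by (cases "c = a'") auto
      qed
      ultimately show ?case using post[OF 9(1)] by simp
    qed (use n nN k0 in auto)
  qed
qed

lemma wp_Swap:
  assumes n: "\<nu>0 ''n'' = n" and i: "\<nu>0 ''i'' = i" "i < n"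
    and T: "tableau n (\<rho>0 ''T'') \<tau>"
    and post: "\<And>\<nu> \<rho>. eq_off LoopVars \<nu> \<nu>0 \<Longrightarrow> eq_off HermiteVars \<rho> \<rho>0 \<Longrightarrow>
       tableau n (\<rho> ''T'') (\<lambda>r c. if c = i then \<tau> r n else if c = n then \<tau> r i else \<tau> r c) \<Longrightarrow> Q (\<nu>, \<rho>)"
  shows "runs zo go Swap (\<nu>0, \<rho>0) (swap_time N) Q"
proof -
  have ni: "\<nu> ''n'' = n \<and> \<nu> ''i'' = i" if "eq_off LoopVars \<nu> \<nu>0" for \<nu>
    using eq_offD[OF that, of "''n''"] eq_offD[OF that, of "''i''"] n i by simp
  show ?thesis unfolding Swap_def swap_time_def
  proof (rule runs_Seq, rule wp_Put[where a' = "n + n" and b' = 1 and p' = 0 and q' = 0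
      and val = "\<lambda>r s. of_int (\<tau> r i)"], goal_cases)
    case (2 r s \<nu> \<rho>)
    then show ?case using ni[OF 2(5)] eq_offD[OF 2(6), of "''T''"] tableauD[OF T, of r i] i by simp
  next
    case (5 \<nu>1 \<rho>1)
    have w1: "\<rho>1 ''w'' r 0 = of_int (\<tau> r i)" if "r < n + n" for r using 5(3)[OF that, of 0] by simp
    have T1: "\<rho>1 ''T'' = \<rho>0 ''T''" using eq_offD[OF 5(2), of "''T''"] by simp
    note e1 = 5(1,2)
    show ?case
    proof (rule runs_Seq, rule wp_Put[where a' = "n + n" and b' = 1 and p' = 0 and q' = i
        and val = "\<lambda>r s. of_int (\<tau> r n)"], goal_cases)
      case (1 \<nu>)
      then show ?case using ni[OF eq_off_trans[OF 1 e1(1)]] by simp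
    next
      case (2 r s \<nu> \<rho>)
      have "\<rho> ''T'' r n = \<rho>1 ''T'' r n" using 2(8)[of r n] i by auto
      then show ?case using 2(1-4) ni[OF eq_off_trans[OF 2(5) e1(1)]] T1 tableauD[OF T, of r n] by simp
    next
      case (5 \<nu>2 \<rho>2)
      have w2: "\<rho>2 ''w'' r 0 = of_int (\<tau> r i)" if "r < n + n" for r using w1[OF that] eq_offD[OF 5(2), of "''w''"] by simp
      have T2: "\<rho>2 ''T'' r c = of_int (if c = i then \<tau> r n else \<tau> r c)" if "r < n + n" "c \<le> n" for r c
        using 5(3)[of r 0] 5(4)[of r c] that T1 tableauD[OF T that] by (cases "c = i") auto
      have e2: "eq_off LoopVars \<nu>2 \<nu>0" "eq_off HermiteVars \<rho>2 \<rho>0"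
        using eq_off_trans[OF 5(1) e1(1)] eq_off_trans[OF 5(2) e1(2), of HermiteVars] by auto
      show ?case
      proof (rule wp_Put[where a' = "n + n" and b' = 1 and p' = 0 and q' = n
        and val = "\<lambda>r s. of_int (\<tau> r i)"], goal_cases)
        case (1 \<nu>)
        then show ?case using ni[OF eq_off_trans[OF 1 e2(1)]] by simp
      next
        case (2 r s \<nu> \<rho>)
        then show ?case using eq_offD[OF 2(6), of "''w''"] w2[OF 2(1)] by simp
      next
        case (5 \<nu>3 \<rho>3)
        show ?case
        proof (rule post)
          show "eq_off LoopVars \<nu>3 \<nu>0" by (rule eq_off_trans[OF 5(1) e2(1)]) simp
          show "eq_off HermiteVars \<rho>3 \<rho>0" by (rule eq_off_trans[OF 5(2) e2(2)]) simp
          show "tableau n (\<rho>3 ''T'') (\<lambda>r c. if c = i then \<tau> r n else if c = n then \<tau> r i else \<tau> r c)"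
            unfolding tableau_def
          proof (intro allI impI)
            fix r c assume rc: "r < n + n" "c \<le> n"
            show "\<rho>3 ''T'' r c = real_of_int (if c = i then \<tau> r n else if c = n then \<tau> r i else \<tau> r c)"
              using 5(3)[of r 0] 5(4)[of r c] T2[OF rc] rc i by (cases "c = n") auto
          qed
        qed
      qed (use nN in auto)
    qed (use nN in auto)
  qed (use ni nN in auto)
qed

lemma wp_ClearRow:
  assumes n: "\<nu>0 ''n'' = n" "\<nu>0 ''k'' = k" "\<nu>0 ''i'' = i" "i < n"
    and T: "tableau n (\<rho>0 ''T'') \<tau>" and inv: "hnf_inv n k A G i \<tau>"
    and post: "\<And>\<nu> \<rho> \<tau>'. eq_off LoopVars \<nu> \<nu>0 \<Longrightarrow> eq_off HermiteVars \<rho> \<rho>0 \<Longrightarrow>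
       tableau n (\<rho> ''T'') \<tau>' \<Longrightarrow> hnf_inv n k A G (Suc i) \<tau>' \<Longrightarrow> Q (\<nu>, \<rho>)"
  shows "runs zo go ClearRow (\<nu>0, \<rho>0) (clear_row_time L N) Q"
  unfolding ClearRow_def clear_row_time_def
proof -
  \<comment> \<open>The potential is the product of the two entries of row \<open>i\<close>, doubled
    as long as they are in the wrong order. A division step on an ordered pair at least halves the
    product, and on an unordered pair it removes the factor 2. Starting from at most
    \<open>2 * k * k\<close>, this permits \<open>L + 2\<close> rounds.\<close>
  define I where "I = (\<lambda>m (s :: state). \<exists>\<tau>. eq_off LoopVars (fst s) \<nu>0 \<and> eq_off HermiteVars (snd s) \<rho>0 \<and> tableau n (snd s ''T'') \<tau> \<and>
     hnf_inv n k A G i \<tau> \<and> (if \<tau> i n < \<tau> i i then \<tau> i i * \<tau> i n < 2 ^ m else 2 * \<tau> i i * \<tau> i n < 2 ^ m))"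
  show "runs zo go (Loop (RLess (RNat N0) (RCell ''T'' ii nn)) (Seq (SubCol ii nn ii) Swap)) (\<nu>0, \<rho>0)
     ((L + 2) * (subcol_time L N + swap_time N + 1) + 1) Q"
  proof (rule runs_Loop[where I = I], goal_cases)
    case 1
    note D = hnf_invD(1,2)[OF inv, of i i] hnf_invD(1,2)[OF inv, of i n]
    have kL': "int k * int k + int k \<le> 2 ^ L" using kL by (metis of_nat_add of_nat_mult of_nat_le_iff of_nat_numeral of_nat_power)
    have "0 \<le> \<tau> i i * \<tau> i n" "\<tau> i i * \<tau> i n \<le> int k * int k" using D n by (auto intro: mult_mono)
    then have "\<tau> i i * \<tau> i n < 2 ^ (L + 2)" "2 * \<tau> i i * \<tau> i n < 2 ^ (L + 2)"
      using kL' k0 by (simp_all add: power_add mult.assoc)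
    then show ?case using T inv unfolding I_def by (intro exI[of _ \<tau>]) auto
  next
    case (2 m s)
    obtain \<nu> \<rho> where s: "s = (\<nu>, \<rho>)" by force
    from 2(1) obtain \<tau> where e: "eq_off LoopVars \<nu> \<nu>0" "eq_off HermiteVars \<rho> \<rho>0" and T: "tableau n (\<rho> ''T'') \<tau>"
      and inv: "hnf_inv n k A G i \<tau>"
      and m: "if \<tau> i n < \<tau> i i then \<tau> i i * \<tau> i n < 2 ^ m else 2 * \<tau> i i * \<tau> i n < 2 ^ m"
      by (auto simp: I_def s)
    have ni: "\<nu> ''n'' = n" "\<nu> ''i'' = i" "\<nu> ''k'' = k"
      using eq_offD[OF e(1), of "''n''"] eq_offD[OF e(1), of "''i''"] eq_offD[OF e(1), of "''k''"] n by simp_all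
    have v: "0 < \<tau> i n" using 2(2) tableauD[OF T, of i n] n(4) by (simp add: s ni)
    have d: "0 < \<tau> i i" using hnf_invD(3)[OF inv n(4)] .
    have p: "1 \<le> \<tau> i i * \<tau> i n" using v d by (metis int_one_le_iff_zero_less mult_pos_pos)
    have "m \<noteq> 0" using m p by (intro notI) (auto split: if_splits)
    then obtain m' where m': "m = Suc m'" by (cases m) auto
    have new: "hnf_step n k i \<tau> i i = \<tau> i n" "hnf_step n k i \<tau> i n = \<tau> i i mod \<tau> i n"
      using hnf_step_inv(2)[OF inv n(4) k0 v] by (auto simp: hnf_step_def)
    have modlt: "\<tau> i i mod \<tau> i n < \<tau> i n" "0 \<le> \<tau> i i mod \<tau> i n" using v by auto
    have dec: "\<tau> i n * (\<tau> i i mod \<tau> i n) < 2 ^ m'"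
    proof (cases "\<tau> i n < \<tau> i i")
      case True
      \<comment> \<open>The quotient is at least 1 here, so divisor plus remainder fit into the
        dividend, and the remainder is at most half of it.\<close>
      have "\<tau> i n + \<tau> i i mod \<tau> i n \<le> \<tau> i i"
      proof -
        have "1 \<le> \<tau> i i div \<tau> i n" using True v by (metis int_one_le_iff_zero_less less_imp_le pos_imp_zdiv_pos_iff)
        then have "\<tau> i n * 1 \<le> \<tau> i n * (\<tau> i i div \<tau> i n)" using v by (intro mult_left_mono) auto
        then show ?thesis using mult_div_mod_eq[of "\<tau> i n" "\<tau> i i"] by linarith
      qed
      then have "2 * (\<tau> i i mod \<tau> i n) \<le> \<tau> i i" using modlt by linarith
      then have "\<tau> i n * (2 * (\<tau> i i mod \<tau> i n)) \<le> \<tau> i n * \<tau> i i" using v by (intro mult_left_mono) auto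
      then show ?thesis using m True m' by (simp add: mult_ac)
    next
      case False
      have "\<tau> i i mod \<tau> i n \<le> \<tau> i i" using d v by (simp add: zmod_le_nonneg_dividend)
      then have "\<tau> i n * (\<tau> i i mod \<tau> i n) \<le> \<tau> i n * \<tau> i i" using v by (intro mult_left_mono) auto
      then show ?thesis using m False m' by (simp add: mult_ac)
    qed
    have "runs zo go (Seq (SubCol ii nn ii) Swap) (\<nu>, \<rho>) (subcol_time L N + swap_time N) (I m')"
    proof (rule runs_Seq, rule wp_SubCol[where a' = i and b' = n and i' = i and \<tau> = \<tau>], goal_cases)
      case (3 \<nu>1)
      then show ?case using eq_offD[OF 3, of "''n''"] eq_offD[OF 3, of "''i''"] ni by simp
    next
      case (12 \<nu>1 \<rho>1)
      have ni1: "\<nu>1 ''n'' = n" "\<nu>1 ''i'' = i" using eq_offD[OF 12(1), of "''n''"] eq_offD[OF 12(1), of "''i''"] ni by auto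
      show ?case
      proof (rule wp_Swap[where ?\<nu>0.0 = \<nu>1 and ?\<rho>0.0 = \<rho>1, OF ni1 n(4) 12(3)], goal_cases)
        case (1 \<nu>2 \<rho>2)
        have "eq_off LoopVars \<nu>2 \<nu>0" "eq_off HermiteVars \<rho>2 \<rho>0"
          by (rule eq_off_trans_same[OF 1(1) eq_off_trans_same[OF 12(1) e(1)]],
              rule eq_off_trans_same[OF 1(2) eq_off_trans_same[OF 12(2) e(2)]])
        \<comment> \<open>Subtraction followed by the exchange of columns is one
          \<open>hnf_step\<close>.\<close>
        moreover have "(\<lambda>r c. if c = i then if n = i then (\<tau> r i - \<tau> i i div \<tau> i n * \<tau> r n) mod int k else \<tau> r n
               else if c = n then if i = i then (\<tau> r i - \<tau> i i div \<tau> i n * \<tau> r n) mod int k else \<tau> r i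
                    else if c = i then (\<tau> r i - \<tau> i i div \<tau> i n * \<tau> r n) mod int k else \<tau> r c) = hnf_step n k i \<tau>"
          using n(4) by (auto simp: hnf_step_def fun_eq_iff)
        ultimately show ?case
          using 1(3) hnf_step_inv(1)[OF inv n(4) k0 v] dec new modlt unfolding I_def
          by (intro exI[of _ "hnf_step n k i \<tau>"]) simp
      qed
    qed (use ni n T v hnf_invD(1,2)[OF inv] in auto)
    then show ?case using m' s by blast
  next
    case (3 m s)
    obtain \<nu> \<rho> where s: "s = (\<nu>, \<rho>)" by force
    from 3(1) obtain \<tau> where e: "eq_off LoopVars \<nu> \<nu>0" "eq_off HermiteVars \<rho> \<rho>0" and T: "tableau n (\<rho> ''T'') \<tau>"
      and inv: "hnf_inv n k A G i \<tau>" by (auto simp: I_def s)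
    have ni: "\<nu> ''n'' = n" "\<nu> ''i'' = i" using eq_offD[OF e(1), of "''n''"] eq_offD[OF e(1), of "''i''"] n by simp_all
    have "\<not> 0 < \<tau> i n" using 3(2) tableauD[OF T, of i n] n(4) by (simp add: s ni)
    then have "\<tau> i n = 0" using hnf_invD(1)[OF inv, of i n] n(4) by simp
    then show ?case unfolding s by (intro post[OF e T] hnf_inv_Suc[OF inv])
  qed
qed

lemma wp_HermiteForm:
  assumes n: "\<nu>0 ''n'' = n" "\<nu>0 ''k'' = k"
    and A: "\<And>r j. r < n \<Longrightarrow> j < n \<Longrightarrow> \<rho>0 ''A'' r j = of_int (A r j)"
    and AL: "\<And>r j. r < n \<Longrightarrow> j < n \<Longrightarrow> \<bar>real_of_int (A r j)\<bar> \<le> 2 ^ L"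
    and post: "\<And>\<nu> \<rho> \<tau>. eq_off ({''i'', ''j''} \<union> LoopVars) \<nu> \<nu>0 \<Longrightarrow> eq_off HermiteVars \<rho> \<rho>0 \<Longrightarrow>
       (\<And>r c. r < n + n \<Longrightarrow> c < n \<Longrightarrow> \<rho> ''T'' r c = of_int (\<tau> r c)) \<Longrightarrow>
       hnf_inv n k A (col_fun n A ` {..<n}) n \<tau> \<Longrightarrow> Q (\<nu>, \<rho>)"
  shows "runs zo go HermiteForm (\<nu>0, \<rho>0) (hermite_time L N) Q"
proof -
  let ?V = "{''i'', ''j''} \<union> LoopVars" and ?Vj = "{''i''} \<union> LoopVars"
  define I where "I = (\<lambda>j (\<nu> :: nstore) (\<rho> :: rstore). \<exists>\<tau>. eq_off ?V \<nu> \<nu>0 \<and> eq_off HermiteVars \<rho> \<rho>0 \<and>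
     (\<forall>r<n + n. \<forall>c<n. \<rho> ''T'' r c = of_int (\<tau> r c)) \<and> hnf_inv n k A (col_fun n A ` {..<j}) n \<tau>)"
  have nk: "\<nu> ''n'' = n \<and> \<nu> ''k'' = k" if "eq_off ?V \<nu> \<nu>0" for \<nu>
    using eq_offD[OF that, of "''n''"] eq_offD[OF that, of "''k''"] n by simp
  have LVV: "eq_off ?V \<nu> \<nu>0" if "eq_off LoopVars \<nu> \<nu>1" "eq_off ?V \<nu>1 \<nu>0" for \<nu> \<nu>1 by (rule eq_off_trans[OF that]) auto
  show ?thesis unfolding HermiteForm_def hermite_time_def
  proof (rule runs_Seq, rule wp_Put[where a' = "n + n" and b' = n and p' = 0 and q' = 0
      and val = "\<lambda>r s. of_int (if r = s \<and> s < n then int k else 0)"], goal_cases)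
    case (1 \<nu>)
    then show ?case using eq_offD[OF 1, of "''n''"] n by simp
  next
    case (2 r s \<nu> \<rho>)
    then show ?case using eq_offD[OF 2(5), of "''k''"] n by (simp add: kron_def)
  next
    case (5 \<nu>1 \<rho>1)
    show ?case
    proof (rule runs_For[where I = I and m = n], goal_cases)
      case 1
      show ?case unfolding I_def
      proof (intro exI[of _ "\<lambda>r c. if r = c \<and> c < n then int k else 0"] conjI)
        show "eq_off ?V (\<nu>1(''j'' := 0)) \<nu>0" using eq_off_mono[OF 5(1), of ?V] by simp
        show "eq_off HermiteVars \<rho>1 \<rho>0" using eq_off_mono[OF 5(2), of HermiteVars] by simp
        show "\<forall>r<n + n. \<forall>c<n. \<rho>1 ''T'' r c = real_of_int (if r = c \<and> c < n then int k else 0)"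
          using 5(3) by simp
        show "hnf_inv n k A (col_fun n A ` {..<0}) n (\<lambda>r c. if r = c \<and> c < n then int k else 0)"
          using hnf_inv_init[OF k0, of "\<lambda>r c. if r = c \<and> c < n then int k else 0" n A] by simp
      qed
    next
      case (2 j \<nu> \<rho>)
      then obtain \<tau> where e: "eq_off ?V \<nu> \<nu>0" "eq_off HermiteVars \<rho> \<rho>0"
        and T: "\<And>r c. r < n + n \<Longrightarrow> c < n \<Longrightarrow> \<rho> ''T'' r c = of_int (\<tau> r c)"
        and inv: "hnf_inv n k A (col_fun n A ` {..<j}) n \<tau>" by (auto simp: I_def)
      note j = 2(1,2)
      have A2: "\<rho> ''A'' = \<rho>0 ''A''" using eq_offD[OF e(2), of "''A''"] by simp
      show ?case
      proof (rule runs_Seq, rule wp_PutMod[where a' = n and b' = 1 and p' = 0 and q' = n and k = k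
          and val = "\<lambda>r s. A r j"], goal_cases)
        case (1 \<nu>)
        then show ?case using nk[OF LVV[OF 1 e(1)]] by simp
      next
        case (2 r s \<nu>2 \<rho>2)
        then show ?case using A[OF 2(1) j(1)] A2 eq_offD[OF 2(6), of "''A''"] eq_offD[OF 2(5), of "''j''"] j by simp
      next
        case (9 \<nu>2 \<rho>2)
        have T2: "\<rho>2 ''T'' r n = of_int (A r j mod int k)" if "r < n" for r using 9(3)[OF that, of 0] by simp
        have T2': "\<rho>2 ''T'' r c = of_int (\<tau> r c)" if "r < n + n" "c < n" for r c
          using 9(4)[of r c] T[OF that] that by simp
        have e2: "eq_off ?V \<nu>2 \<nu>0" "eq_off HermiteVars \<rho>2 \<rho>0" "\<nu>2 ''j'' = j"
          using LVV[OF 9(1) e(1)] eq_off_trans[OF 9(2) e(2), of HermiteVars] eq_offD[OF 9(1), of "''j''"] j by auto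
        show ?case
        proof (rule runs_Seq, rule wp_PutMod[where a' = n and b' = 1 and p' = n and q' = n and k = k
          and val = "\<lambda>r s. if r = j then 1 else 0"], goal_cases)
          case (1 \<nu>)
          then show ?case using nk[OF LVV[OF 1 e2(1)]] by simp
        next
          case (2 r s \<nu>3 \<rho>3)
          then show ?case using eq_offD[OF 2(5), of "''j''"] e2(3) by (simp add: kron_def)
        next
          case (9 \<nu>3 \<rho>3)
          define \<tau>' where "\<tau>' = (\<lambda>r c. if c < n then \<tau> r c else if r < n then A r j mod int k else (if r - n = j then 1 else 0) mod int k)"
          have T3: "tableau n (\<rho>3 ''T'') \<tau>'" unfolding tableau_def
          proof (intro allI impI)
            fix r c assume rc: "r < n + n" "c \<le> n"
            consider "c < n" | "c = n" "r < n" | "c = n" "n \<le> r" using rc by linarith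
            then show "\<rho>3 ''T'' r c = of_int (\<tau>' r c)"
            proof cases
              case 1
              then show ?thesis using 9(4)[of r c] T2'[of r c] rc by (simp add: \<tau>'_def)
            next
              case 2
              then show ?thesis using 9(4)[of r c] T2[of r] by (simp add: \<tau>'_def)
            next
              case 3
              then show ?thesis using 9(3)[of "r - n" 0] rc by (simp add: \<tau>'_def)
            qed
          qed
          have inv3: "hnf_inv n k A (col_fun n A ` {..<Suc j}) 0 \<tau>'"
            using hnf_inv_new_column[OF inv j(1) k0, of \<tau>'] by (simp add: \<tau>'_def lessThan_Suc)
          have e3: "eq_off ?V \<nu>3 \<nu>0" "eq_off HermiteVars \<rho>3 \<rho>0" "\<nu>3 ''j'' = j"
            using LVV[OF 9(1) e2(1)] eq_off_trans[OF 9(2) e2(2), of HermiteVars] eq_offD[OF 9(1), of "''j''"] e2 by auto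
          show ?case
          proof (rule runs_For[where m = n and I = "\<lambda>i \<nu> \<rho>. eq_off ?V \<nu> \<nu>0 \<and> eq_off HermiteVars \<rho> \<rho>0 \<and> \<nu> ''j'' = j \<and>
              (\<exists>\<tau>. tableau n (\<rho> ''T'') \<tau> \<and> hnf_inv n k A (col_fun n A ` {..<Suc j}) i \<tau>)"], goal_cases)
            case 1
            show ?case using e3 T3 inv3 by auto
          next
            case (2 i \<nu>4 \<rho>4)
            then obtain \<tau>4 where e4: "eq_off ?V \<nu>4 \<nu>0" "eq_off HermiteVars \<rho>4 \<rho>0" "\<nu>4 ''j'' = j"
              and T4: "tableau n (\<rho>4 ''T'') \<tau>4" and inv4: "hnf_inv n k A (col_fun n A ` {..<Suc j}) i \<tau>4" by blast
            have nk4: "\<nu>4 ''n'' = n" "\<nu>4 ''k'' = k" using nk[OF e4(1)] by auto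
            show ?case
            proof (rule wp_ClearRow[where ?\<nu>0.0 = \<nu>4 and ?\<rho>0.0 = \<rho>4, OF nk4 2(2,1) T4 inv4], goal_cases)
              case (1 \<nu>5 \<rho>5 \<tau>5)
              have "eq_off ?V \<nu>5 \<nu>0" "eq_off HermiteVars \<rho>5 \<rho>0" "\<nu>5 ''j'' = j" "\<nu>5 ''i'' = i"
                using LVV[OF 1(1) e4(1)] eq_off_trans[OF 1(2) e4(2), of HermiteVars] eq_offD[OF 1(1), of "''j''"] eq_offD[OF 1(1), of "''i''"] e4 2(2) by auto
              then show ?case using 1(3,4) by auto
            qed
          next
            case (3 i \<nu>4 \<rho>4)
            then show ?case using nk by simp
          next
            case (4 \<nu>4 \<rho>4)
            then obtain \<tau>4 where e4: "eq_off ?V \<nu>4 \<nu>0" "eq_off HermiteVars \<rho>4 \<rho>0" "\<nu>4 ''j'' = j"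
              and T4: "tableau n (\<rho>4 ''T'') \<tau>4" and inv4: "hnf_inv n k A (col_fun n A ` {..<Suc j}) n \<tau>4" by blast
            then show ?case using tableauD[OF T4] unfolding I_def by (auto intro!: exI[of _ \<tau>4])
          qed (use nN in auto)
        qed (use nk[OF e2(1)] nN k0 in auto)
      qed (use nk[OF e(1)] nN k0 AL[OF _ j(1)] in auto)
    next
      case (3 j \<nu> \<rho>)
      then show ?case using nk by (auto simp: I_def)
    next
      case (4 \<nu> \<rho>)
      then show ?case unfolding I_def using post by blast
    qed (use nN in auto)
  qed (use nN in auto)
qed

end

section \<open>Linear systems modulo k by forward substitution\<close>

definition sol_inv :: "nat \<Rightarrow> nat \<Rightarrow> (nat \<Rightarrow> nat \<Rightarrow> int) \<Rightarrow> (nat \<Rightarrow> nat \<Rightarrow> int) \<Rightarrow> (nat \<Rightarrow> int) \<Rightarrow> nat \<Rightarrow> (nat \<Rightarrow> int) \<Rightarrow> bool" where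
  "sol_inv n k A \<tau> R i v \<longleftrightarrow> (\<forall>r<n + n. 0 \<le> v r \<and> v r \<le> int k) \<and> (\<forall>r<i. v r = 0) \<and>
     (\<forall>r<n. int k dvd v r - R r - (\<Sum>l<n. A r l * v (n + l))) \<and>
     (\<lambda>r. if r < n then v r else 0) \<in> col_lattice n \<tau>"

text \<open>In a lattice with triangular basis, leading zeros of a vector force the corresponding
  coefficients to vanish, so its next entry is a multiple of the pivot. Divisions in the elimination
  are therefore exact, although pivots need not be units modulo \<open>k\<close>.\<close>

lemma triangular_col_lattice:
  assumes v: "(\<lambda>r. if r < n then v r else 0) \<in> col_lattice n \<tau>" and i: "i < n" and z: "\<And>r. r < i \<Longrightarrow> v r = 0"
    and tri: "\<And>c. c < n \<Longrightarrow> 0 < \<tau> c c" "\<And>r c. c < n \<Longrightarrow> r < c \<Longrightarrow> \<tau> r c = 0"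
  shows "\<tau> i i dvd v i"
proof -
  obtain u where u: "(\<lambda>r. if r < n then v r else 0) = (\<lambda>r. if r < n then \<Sum>c<n. \<tau> r c * u c else 0)"
    using v by (auto simp: col_lattice_def)
  have vr: "v r = (\<Sum>c<n. \<tau> r c * u c)" if "r < n" for r using fun_cong[OF u, of r] that by simp
  have diag: "v r = \<tau> r r * u r" if r: "r < n" "\<forall>c<r. u c = 0" for r
  proof -
    have "v r = (\<Sum>c<n. if c = r then \<tau> r r * u r else 0)" unfolding vr[OF r(1)]
    proof (rule sum.cong)
      fix c assume "c \<in> {..<n}"
      then show "\<tau> r c * u c = (if c = r then \<tau> r r * u r else 0)"
        using r tri(2)[of c r] by (cases c r rule: linorder_cases) auto
    qed simp
    then show ?thesis using r by simp
  qed
  have "u c = 0" if "c < i" for c using that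
  proof (induction c rule: less_induct)
    case (less c)
    have "v c = \<tau> c c * u c" using less i by (intro diag) auto
    then show ?case using z[OF less.prems] tri(1)[of c] less.prems i by auto
  qed
  then show ?thesis using diag[OF i] by simp
qed

text \<open>Exact divisibility by the pivot clears row \<open>i\<close>. The vector stays in the
  lattice because column \<open>i\<close> and the \<open>k\<close>-fold unit vectors belong to
  it.\<close>

lemma sol_inv_step:
  assumes sol: "sol_inv n k A \<tau> R i v" and i: "i < n" and k: "0 < k" and inv: "hnf_inv n k A G n \<tau>"
  shows "sol_inv n k A \<tau> R (Suc i) (\<lambda>r. (v r - (v i div \<tau> i i) * \<tau> r i) mod int k)"
proof -
  let ?q = "v i div \<tau> i i"
  note D = hnf_invD[OF inv]
  have z: "v r = 0" if "r < i" for r using sol that by (simp add: sol_inv_def)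
  have lat: "(\<lambda>r. if r < n then v r else 0) \<in> col_lattice n \<tau>" using sol by (simp add: sol_inv_def)
  have "\<tau> i i dvd v i" by (rule triangular_col_lattice[OF lat i z D(3,4)])
  then have vi: "v i - ?q * \<tau> i i = 0" by simp
  have "0 \<le> (v r - ?q * \<tau> r i) mod int k \<and> (v r - ?q * \<tau> r i) mod int k \<le> int k" for r
    using k pos_mod_bound[of "int k"] by (simp add: less_imp_le)
  moreover have "(v r - ?q * \<tau> r i) mod int k = 0" if "r < Suc i" for r
    using that vi z[of r] D(4)[OF i, of r] by (cases "r = i") auto
  moreover have "int k dvd (v r - ?q * \<tau> r i) mod int k - R r - (\<Sum>l<n. A r l * ((v (n + l) - ?q * \<tau> (n + l) i) mod int k))"
    if r: "r < n" for r
  proof -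
    have "int k dvd (v r - R r) - (\<Sum>l<n. A r l * v (n + l))" using sol r by (simp add: sol_inv_def)
    from dvd_diff_mod_comb[OF this D(6)[OF r, of i], of ?q] i
    have 1: "int k dvd (v r - R r - ?q * \<tau> r i) mod int k - (\<Sum>l<n. A r l * ((v (n + l) - ?q * \<tau> (n + l) i) mod int k))"
      by simp
    \<comment> \<open>The preceding congruence treats \<open>v r - R r\<close> as the value;
      \<open>R r\<close> is now taken out of the reduced term.\<close>
    have 2: "int k dvd (v r - ?q * \<tau> r i) mod int k - R r - (v r - R r - ?q * \<tau> r i) mod int k"
      by (simp add: mod_eq_dvd_iff[symmetric] mod_simps algebra_simps)
    show ?thesis using dvd_add[OF 1 2] by (simp add: algebra_simps)
  qed
  moreover have "(\<lambda>r. if r < n then (v r - ?q * \<tau> r i) mod int k else 0) \<in> col_lattice n \<tau>"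
  proof (rule int_subgroup_congruent_all[OF int_subgroup_col_lattice _ hnf_col_lattice(2)[OF inv]])
    show "(\<lambda>r. (if r < n then v r else 0) - ?q * col_fun n \<tau> i r) \<in> col_lattice n \<tau>"
      by (intro int_subgroup_diff[OF int_subgroup_col_lattice lat] int_subgroup_smult int_subgroup_col_lattice col_fun_col_lattice i)
  qed (auto simp: col_fun_def mod_eq_dvd_iff[symmetric])
  ultimately show ?thesis unfolding sol_inv_def by blast
qed

context
  fixes zo :: "real mat \<Rightarrow> real mat" and go :: "real mat \<Rightarrow> real mat \<Rightarrow> real mat option"
    and n k N L :: nat
  assumes nN: "n \<le> N" and k0: "0 < k" and kL: "k * k + k \<le> 2 ^ L"
begin

text \<open>Solvability of \<open>A z = R\<close> modulo \<open>k\<close> is expressed by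
  \<open>lat\<close> as membership of the columns of \<open>R\<close> in the triangular lattice,
  which is \<open>A \<int>^n + k \<int>^n\<close>.\<close>

lemma wp_Solve:
  assumes n: "\<nu>0 ''n'' = n" "\<nu>0 ''k'' = k"
    and T: "\<And>r c. r < n + n \<Longrightarrow> c < n \<Longrightarrow> \<rho>0 ''T'' r c = of_int (\<tau> r c)"
    and inv: "hnf_inv n k A G n \<tau>"
    and R: "\<And>r j. r < n \<Longrightarrow> j < n \<Longrightarrow> \<rho>0 ''R'' r j = of_int (R r j)"
    and RL: "\<And>r j. r < n \<Longrightarrow> j < n \<Longrightarrow> \<bar>real_of_int (R r j)\<bar> \<le> 2 ^ L"
    and lat: "\<And>j. j < n \<Longrightarrow> col_fun n R j \<in> col_lattice n \<tau>"
    and post: "\<And>\<nu> \<rho> z. eq_off ({''i'', ''j''} \<union> LoopVars) \<nu> \<nu>0 \<Longrightarrow> eq_off (insert ''Z'' HermiteVars) \<rho> \<rho>0 \<Longrightarrow>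
       (\<And>r j. r < n \<Longrightarrow> j < n \<Longrightarrow> \<rho> ''Z'' r j = of_int (z r j)) \<Longrightarrow>
       (\<And>r j. r < n \<Longrightarrow> j < n \<Longrightarrow> \<bar>z r j\<bar> \<le> int k) \<Longrightarrow>
       (\<And>i j. i < n \<Longrightarrow> j < n \<Longrightarrow> int k dvd (\<Sum>l<n. A i l * z l j) - R i j) \<Longrightarrow> Q (\<nu>, \<rho>)"
  shows "runs zo go Solve (\<nu>0, \<rho>0) (solve_time L N) Q"
proof -
  let ?V = "{''i'', ''j''} \<union> LoopVars" and ?F = "insert ''Z'' HermiteVars"
  note D = hnf_invD[OF inv]
  define Good where "Good = (\<lambda>j z. (\<forall>r<n. \<bar>z r j\<bar> \<le> int k) \<and> (\<forall>i<n. int k dvd (\<Sum>l<n. A i l * z l j) - R i j))"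
  define I where "I = (\<lambda>j (\<nu> :: nstore) (\<rho> :: rstore). eq_off ?V \<nu> \<nu>0 \<and> eq_off ?F \<rho> \<rho>0 \<and>
     (\<forall>r<n + n. \<forall>c<n. \<rho> ''T'' r c = of_int (\<tau> r c)) \<and>
     (\<exists>z. \<forall>j'<j. Good j' z \<and> (\<forall>r<n. \<rho> ''Z'' r j' = of_int (z r j'))))"
  have nk: "\<nu> ''n'' = n \<and> \<nu> ''k'' = k" if "eq_off ?V \<nu> \<nu>0" for \<nu>
    using eq_offD[OF that, of "''n''"] eq_offD[OF that, of "''k''"] n by simp
  have LVV: "eq_off ?V \<nu> \<nu>0" if "eq_off LoopVars \<nu> \<nu>1" "eq_off ?V \<nu>1 \<nu>0" for \<nu> \<nu>1 by (rule eq_off_trans[OF that]) auto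
  show ?thesis unfolding Solve_def solve_time_def
  proof (rule runs_For[where I = I and m = n], goal_cases)
    case 1
    show ?case using T by (simp add: I_def)
  next
    case (2 j \<nu> \<rho>)
    obtain z where e: "eq_off ?V \<nu> \<nu>0" "eq_off ?F \<rho> \<rho>0"
      and T: "\<And>r c. r < n + n \<Longrightarrow> c < n \<Longrightarrow> \<rho> ''T'' r c = of_int (\<tau> r c)"
      and z: "\<And>j'. j' < j \<Longrightarrow> Good j' z" "\<And>j' r. j' < j \<Longrightarrow> r < n \<Longrightarrow> \<rho> ''Z'' r j' = of_int (z r j')"
      using 2(3) unfolding I_def by blast
    note j = 2(1,2)
    have R2: "\<rho> ''R'' = \<rho>0 ''R''" using eq_offD[OF e(2), of "''R''"] by simp
    show ?case
    proof (rule runs_Seq, rule wp_PutMod[where a' = n and b' = 1 and p' = 0 and q' = n and k = k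
        and val = "\<lambda>r s. R r j"], goal_cases)
      case (1 \<nu>)
      then show ?case using nk[OF LVV[OF 1 e(1)]] by simp
    next
      case (2 r s \<nu>2 \<rho>2)
      then show ?case using R[OF 2(1) j(1)] R2 eq_offD[OF 2(6), of "''R''"] eq_offD[OF 2(5), of "''j''"] j by simp
    next
      case (9 \<nu>2 \<rho>2)
      have T2: "\<rho>2 ''T'' r n = of_int (R r j mod int k)" if "r < n" for r using 9(3)[OF that, of 0] by simp
      have T2': "\<rho>2 ''T'' r c = of_int (\<tau> r c)" if "r < n + n" "c < n" for r c
        using 9(4)[of r c] T[OF that] that by simp
      have e2: "eq_off ?V \<nu>2 \<nu>0" "eq_off ?F \<rho>2 \<rho>0" "\<nu>2 ''j'' = j" "\<rho>2 ''Z'' = \<rho> ''Z''"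
        using LVV[OF 9(1) e(1)] eq_off_trans[OF 9(2) e(2), of ?F] eq_offD[OF 9(1), of "''j''"] eq_offD[OF 9(2), of "''Z''"] j by auto
      show ?case
      proof (rule runs_Seq, rule wp_PutMod[where a' = n and b' = 1 and p' = n and q' = n and k = k
        and val = "\<lambda>r s. 0"], goal_cases)
        case (1 \<nu>)
        then show ?case using nk[OF LVV[OF 1 e2(1)]] by simp
      next
        case (9 \<nu>3 \<rho>3)
        define ext where "ext v = (\<lambda>r c. if c < n then \<tau> r c else (v r :: int))" for v
        define v where "v = (\<lambda>r. if r < n then R r j mod int k else 0)"
        have T3: "tableau n (\<rho>3 ''T'') (ext v)" unfolding tableau_def
        proof (intro allI impI)
          fix r c assume rc: "r < n + n" "c \<le> n"
          consider "c < n" | "c = n" "r < n" | "c = n" "n \<le> r" using rc by linarith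
          then show "\<rho>3 ''T'' r c = of_int (ext v r c)"
          proof cases
            case 1
            then show ?thesis using 9(4)[of r c] T2'[of r c] rc by (simp add: ext_def)
          next
            case 2
            then show ?thesis using 9(4)[of r c] T2[of r] by (simp add: ext_def v_def)
          next
            case 3
            then show ?thesis using 9(3)[of "r - n" 0] rc by (simp add: ext_def v_def)
          qed
        qed
        have sol: "sol_inv n k A \<tau> (\<lambda>r. R r j) 0 v" unfolding sol_inv_def
        proof (intro conjI allI impI)
          fix r assume "r < n + n"
          show "0 \<le> v r" "v r \<le> int k" using k0 pos_mod_bound[of "int k"] by (auto simp: v_def less_imp_le)
        next
          fix r assume "r < n"
          then show "int k dvd v r - R r j - (\<Sum>l<n. A r l * v (n + l))"
            by (simp add: v_def mod_eq_dvd_iff[symmetric])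
        next
          show "(\<lambda>r. if r < n then v r else 0) \<in> col_lattice n \<tau>"
            by (rule int_subgroup_congruent_all[OF int_subgroup_col_lattice lat[OF j(1)] hnf_col_lattice(2)[OF inv]])
              (auto simp: col_fun_def v_def mod_eq_dvd_iff[symmetric])
        qed simp
        have e3: "eq_off ?V \<nu>3 \<nu>0" "eq_off ?F \<rho>3 \<rho>0" "\<nu>3 ''j'' = j" "\<rho>3 ''Z'' = \<rho> ''Z''"
          using LVV[OF 9(1) e2(1)] eq_off_trans[OF 9(2) e2(2), of ?F] eq_offD[OF 9(1), of "''j''"] eq_offD[OF 9(2), of "''Z''"] e2 by auto
        show ?case
        proof (rule runs_Seq, rule runs_For[where m = n and I = "\<lambda>i \<nu> \<rho>'. eq_off ?V \<nu> \<nu>0 \<and> eq_off ?F \<rho>' \<rho>0 \<and> \<nu> ''j'' = j \<and>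
            \<rho>' ''Z'' = \<rho> ''Z'' \<and> (\<exists>v. tableau n (\<rho>' ''T'') (ext v) \<and> sol_inv n k A \<tau> (\<lambda>r. R r j) i v)"], goal_cases)
          case 1
          show ?case using e3 T3 sol by auto
        next
          case (2 i \<nu>4 \<rho>4)
          then obtain v4 where e4: "eq_off ?V \<nu>4 \<nu>0" "eq_off ?F \<rho>4 \<rho>0" "\<nu>4 ''j'' = j" "\<rho>4 ''Z'' = \<rho> ''Z''"
            and T4: "tableau n (\<rho>4 ''T'') (ext v4)" and sol4: "sol_inv n k A \<tau> (\<lambda>r. R r j) i v4" by blast
          have nk4: "\<nu>4 ''n'' = n" "\<nu>4 ''k'' = k" using nk[OF e4(1)] by auto
          show ?case
          proof (rule wp_SubCol[OF nN k0 kL, where a' = n and b' = i and i' = i and \<tau> = "ext v4"], goal_cases)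
            case (3 \<nu>5)
            then show ?case using eq_offD[OF 3, of "''n''"] eq_offD[OF 3, of "''i''"] nk4 2(2) by simp
          next
            case (10 r c)
            then show ?case using D(1,2)[of r c] sol4 by (auto simp: ext_def sol_inv_def)
          next
            case (11)
            then show ?case using D(3)[OF 2(1)] 2(1) by (simp add: ext_def)
          next
            case (12 \<nu>5 \<rho>5)
            let ?v = "\<lambda>r. (v4 r - (v4 i div \<tau> i i) * \<tau> r i) mod int k"
            have ext: "tableau n (\<rho>5 ''T'') (ext ?v)"
              unfolding tableau_def using 12(3) 2(1) by (auto simp: tableau_def ext_def)
            have s: "sol_inv n k A \<tau> (\<lambda>r. R r j) (Suc i) ?v" by (rule sol_inv_step[OF sol4 2(1) k0 inv])
            have "eq_off ?V \<nu>5 \<nu>0" "eq_off ?F \<rho>5 \<rho>0" "\<nu>5 ''j'' = j" "\<nu>5 ''i'' = i" "\<rho>5 ''Z'' = \<rho> ''Z''"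
              using LVV[OF 12(1) e4(1)] eq_off_trans[OF 12(2) e4(2), of ?F] eq_offD[OF 12(1), of "''j''"]
                eq_offD[OF 12(1), of "''i''"] eq_offD[OF 12(2), of "''Z''"] e4 2(2) by auto
            then show ?case using ext s by auto
          qed (use nk4 2 T4 in auto)
        next
          case (3 i \<nu>4 \<rho>4)
          then show ?case using nk by simp
        next
          case (4 \<nu>4 \<rho>4)
          then obtain v4 where e4: "eq_off ?V \<nu>4 \<nu>0" "eq_off ?F \<rho>4 \<rho>0" "\<nu>4 ''j'' = j" "\<rho>4 ''Z'' = \<rho> ''Z''"
            and T4: "tableau n (\<rho>4 ''T'') (ext v4)" and sol4: "sol_inv n k A \<tau> (\<lambda>r. R r j) n v4" by blast
          show ?case
          proof (rule wp_Put[where a' = n and b' = 1 and p' = 0 and q' = j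
              and val = "\<lambda>r s. of_int (- v4 (n + r))"], goal_cases)
            case (1 \<nu>)
            then show ?case using nk[OF LVV[OF 1 e4(1)]] eq_offD[OF 1, of "''j''"] e4(3) by simp
          next
            case (2 r s \<nu>5 \<rho>5)
            then show ?case using nk[OF LVV[OF 2(5) e4(1)]] eq_offD[OF 2(6), of "''T''"] tableauD[OF T4, of "n + r" n]
              by (simp add: ext_def)
          next
            case (5 \<nu>5 \<rho>5)
            define z' where "z' = (\<lambda>r c. if c = j then - v4 (n + r) else z r c)"
            have "Good j z'" unfolding Good_def
            proof (intro conjI allI impI)
              fix r assume "r < n"
              then show "\<bar>z' r j\<bar> \<le> int k" using sol4 by (simp add: sol_inv_def z'_def)
            next
              fix i assume i: "i < n"
              have "int k dvd v4 i - R i j - (\<Sum>l<n. A i l * v4 (n + l))" "v4 i = 0" using sol4 i by (auto simp: sol_inv_def)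
              then show "int k dvd (\<Sum>l<n. A i l * z' l j) - R i j"
                by (simp add: z'_def sum_negf) (metis diff_minus_eq_add dvd_minus_iff minus_add_distrib uminus_add_conv_diff add.commute)
            qed
            moreover have "Good j' z'" if "j' < j" for j' using z(1)[OF that] that by (simp add: Good_def z'_def)
            moreover have "\<rho>5 ''Z'' r j' = of_int (z' r j')" if "r < n" "j' < Suc j" for r j'
            proof (cases "j' = j")
              case True
              then show ?thesis using 5(3)[of r 0] that by (simp add: z'_def)
            next
              case False
              then show ?thesis using 5(4)[of r j'] z(2)[of j' r] that e4(4) by (simp add: z'_def)
            qed
            moreover have "\<rho>5 ''T'' r c = of_int (\<tau> r c)" if "r < n + n" "c < n" for r c
              using eq_offD[OF 5(2), of "''T''"] tableauD[OF T4, of r c] that by (simp add: ext_def)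
            moreover have "eq_off ?V \<nu>5 \<nu>0" "eq_off ?F \<rho>5 \<rho>0" "\<nu>5 ''j'' = j"
              using LVV[OF 5(1) e4(1)] eq_off_trans[OF 5(2) e4(2), of ?F] eq_offD[OF 5(1), of "''j''"] e4 by auto
            ultimately show ?case unfolding I_def by (auto simp: less_Suc_eq intro!: exI[of _ z'])
          qed (use nN in auto)
        qed (use nN in auto)
      qed (use nk[OF e2(1)] nN k0 in auto)
    qed (use nk[OF e(1)] nN k0 RL[OF _ j(1)] in auto)
  next
    case (3 j \<nu> \<rho>)
    then show ?case using nk by (auto simp: I_def)
  next
    case (4 \<nu> \<rho>)
    then obtain z where e: "eq_off ?V \<nu> \<nu>0" "eq_off ?F \<rho> \<rho>0"
      and z: "\<And>j. j < n \<Longrightarrow> Good j z" "\<And>j r. j < n \<Longrightarrow> r < n \<Longrightarrow> \<rho> ''Z'' r j = of_int (z r j)"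
      unfolding I_def by blast
    show ?case by (rule post[of \<nu> \<rho> z]) (use e z in \<open>auto simp: Good_def\<close>)
  qed (use nN in auto)
qed

end

section \<open>Reducing one input basis\<close>

text \<open>Let \<open>B = O H\<close> with \<open>H\<close> integral and \<open>A = H\<^sup>T H\<close>.  Then \<open>T\<close> is a basis of
  \<open>A \<int>\<^sup>n + k \<int>\<^sup>n = H\<^sup>T \<int>\<^sup>n\<close>, so \<open>W = B A\<^sup>-\<^sup>1 T\<close> is a basis of \<open>O \<int>\<^sup>n\<close>.  With \<open>O = Q S\<close> one has
  \<open>R = B\<^sup>T Q = (S H)\<^sup>T\<close>, and \<open>P = S H Z\<close> where \<open>A Z = R\<close> modulo \<open>k\<close>.\<close>

definition ReduceBasis :: "string \<Rightarrow> string \<Rightarrow> string \<Rightarrow> com" where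
  "ReduceBasis B Q P = Seq (Transp ''Bt'' B) (Seq (MatMul ''A'' ''Bt'' B) (Seq InvPosDef (Seq HermiteForm
     (Seq (MatMul ''Y'' B ''X'') (Seq (MatMul ''W'' ''Y'' ''T'') (Seq (ZLIP_Call Q ''W'' nn)
     (Seq (MatMul ''R'' ''Bt'' Q) (Seq Solve (Seq (Transp ''H'' ''R'') (Seq (MatMul P ''H'' ''Z'')
       (PutMod P nn nn N0 N0 (RCell P rr ss))))))))))))"

text \<open>The query has at most \<open>N * N\<close> entries, each of absolute value at most
  \<open>2 ^ (2 * N * N + 2 * N)\<close>; the summand 2 comes from \<open>mat_size_le\<close>, and
  the last 1 is the base cost of the call.\<close>

definition zlip_time :: "nat \<Rightarrow> nat" where "zlip_time N = N * N * (2 * N * N + 2 * N + 2) + 1"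

text \<open>\<open>5 * N\<close> is a common bound for the bit lengths of all values to be reduced:
  Gram entries need \<open>3 * N\<close>, entries of the unreduced projector \<open>4 * N\<close>,
  and \<open>k * k + k\<close> needs \<open>2 * N + 1\<close>.\<close>

definition reduce_time :: "nat \<Rightarrow> nat" where
  "reduce_time N = put_time N N + (mult_time N + (inverse_time N + (hermite_time (5 * N) N + (mult_time N + (mult_time N + (zlip_time N +
     (mult_time N + (solve_time (5 * N) N + (put_time N N + (mult_time N + putmod_time (5 * N) N N))))))))))"

definition holds :: "nat \<Rightarrow> (nat \<Rightarrow> nat \<Rightarrow> real) \<Rightarrow> real mat \<Rightarrow> bool" where
  "holds n a M \<longleftrightarrow> (\<forall>i<n. \<forall>j<n. a i j = M $$ (i, j))"

lemma holdsD: "holds n a M \<Longrightarrow> i < n \<Longrightarrow> j < n \<Longrightarrow> a i j = M $$ (i, j)"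
  by (simp add: holds_def)

lemma mult_index:
  fixes A B :: "'a :: comm_semiring_0 mat"
  assumes "A \<in> carrier_mat n n" "B \<in> carrier_mat n n" "i < n" "j < n"
  shows "(A * B) $$ (i, j) = (\<Sum>l<n. A $$ (i, l) * B $$ (l, j))"
  using assms by (auto simp: scalar_prod_def atLeast0LessThan intro!: sum.cong)

lemma rm_index: "M \<in> carrier_mat n n \<Longrightarrow> i < n \<Longrightarrow> j < n \<Longrightarrow> rm M $$ (i, j) = real_of_int (M $$ (i, j))"
  by simp

lemma transpose_index: "M \<in> carrier_mat n n \<Longrightarrow> i < n \<Longrightarrow> j < n \<Longrightarrow> transpose_mat M $$ (i, j) = M $$ (j, i)"
  by simp

lemma mult_col_index:
  "A \<in> carrier_mat n n \<Longrightarrow> B \<in> carrier_mat n n \<Longrightarrow> i < n \<Longrightarrow> j < n \<Longrightarrow> (A *\<^sub>v col B j) $ i = (A * B) $$ (i, j)"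
  by simp

lemma holds_mult:
  assumes "holds n a A" "holds n b B" "A \<in> carrier_mat n n" "B \<in> carrier_mat n n"
    and "\<And>x y. x < n \<Longrightarrow> y < n \<Longrightarrow> c x y = (\<Sum>l<n. a x l * b l y)"
  shows "holds n c (A * B)"
  unfolding holds_def using assms(5) holdsD[OF assms(1)] holdsD[OF assms(2)] mult_index[OF assms(3,4)] by simp

lemma holds_transpose:
  assumes "holds n a A" "A \<in> carrier_mat n n" and "\<And>x y. x < n \<Longrightarrow> y < n \<Longrightarrow> c x y = a y x"
  shows "holds n c (transpose_mat A)"
  unfolding holds_def using assms by (simp add: holds_def)

lemma holds_read: "holds n a M \<Longrightarrow> M \<in> carrier_mat n n \<Longrightarrow> read_mat n a = M"
  by (intro eq_matI) (auto simp: read_mat_def holds_def)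

lemma mat_size_le:
  assumes M: "M \<in> carrier_mat n n" and b: "\<And>i j. i < n \<Longrightarrow> j < n \<Longrightarrow> \<bar>M $$ (i, j)\<bar> \<le> 2 ^ m"
  shows "mat_size M \<le> real (n * n * (m + 2))"
proof -
  have e: "1 + log 2 (1 + \<bar>M $$ (i, j)\<bar>) \<le> real (m + 2)" if "i < n" "j < n" for i j
  proof -
    have "(1 :: real) \<le> 2 ^ m" by simp
    moreover have "(2 :: real) ^ (m + 1) = 2 ^ m + 2 ^ m" by simp
    ultimately have "1 + \<bar>M $$ (i, j)\<bar> \<le> 2 ^ (m + 1)" using b[OF that] by linarith
    then have "log 2 (1 + \<bar>M $$ (i, j)\<bar>) \<le> log 2 (2 ^ (m + 1))" by (intro log_mono) auto
    also have "\<dots> = real (m + 1)" by (subst log_nat_power) auto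
    finally show ?thesis by simp
  qed
  have "mat_size M = (\<Sum>i<n. \<Sum>j<n. 1 + log 2 (1 + \<bar>M $$ (i, j)\<bar>))" using M by (simp add: mat_size_def)
  also have "\<dots> \<le> (\<Sum>i<n. \<Sum>j<n. real (m + 2))" using e by (intro sum_mono) auto
  also have "\<dots> = real (n * n * (m + 2))" by (simp add: algebra_simps)
  finally show ?thesis .
qed

lemma abs_sum_mult_le:
  fixes f g :: "nat \<Rightarrow> real"
  assumes "\<And>l. l < n \<Longrightarrow> \<bar>f l\<bar> \<le> a" "\<And>l. l < n \<Longrightarrow> \<bar>g l\<bar> \<le> b" "0 \<le> a"
  shows "\<bar>\<Sum>l<n. f l * g l\<bar> \<le> real n * (a * b)"
proof -
  have "\<bar>\<Sum>l<n. f l * g l\<bar> \<le> (\<Sum>l<n. \<bar>f l * g l\<bar>)" by (rule sum_abs)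
  also have "\<dots> \<le> (\<Sum>l<n. a * b)" unfolding abs_mult using assms by (intro sum_mono mult_mono) auto
  finally show ?thesis by simp
qed

text \<open>Columns have norm 1. This bounds the matrix returned by the oracle without further
  assumptions on its answer.\<close>

lemma orthonormal_abs_le_1:
  assumes Q: "orthonormal_mat n Q" and ij: "i < n" "j < n"
  shows "\<bar>Q $$ (i, j)\<bar> \<le> 1"
proof -
  note D = orthonormal_matD[OF Q]
  have "(\<Sum>l<n. (Q $$ (l, j))\<^sup>2) = (transpose_mat Q * Q) $$ (j, j)"
    using mult_index[of "transpose_mat Q" n Q j j] D(1) ij by (simp add: power2_eq_square del: index_mult_mat(1))
  then have "(\<Sum>l<n. (Q $$ (l, j))\<^sup>2) = 1" unfolding D(2) using ij by simp
  moreover have "(Q $$ (i, j))\<^sup>2 \<le> (\<Sum>l<n. (Q $$ (l, j))\<^sup>2)"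
    using ij by (intro member_le_sum) auto
  ultimately show ?thesis using abs_square_le_1[of "Q $$ (i, j)"] by simp
qed

text \<open>The quadratic form is the squared norm of \<open>B x\<close>, and \<open>B\<close> is
  injective.\<close>

lemma gram_positive:
  fixes B :: "real mat"
  assumes B: "B \<in> carrier_mat n n" and d: "det B \<noteq> 0" and x: "\<exists>r<n. x r \<noteq> 0"
  shows "0 < (\<Sum>r<n. x r * (\<Sum>s<n. (transpose_mat B * B) $$ (r, s) * x s))"
proof -
  let ?y = "\<lambda>l. \<Sum>s<n. B $$ (l, s) * x s"
  have "(\<Sum>r<n. x r * (\<Sum>s<n. (transpose_mat B * B) $$ (r, s) * x s)) =
      (\<Sum>r<n. \<Sum>s<n. \<Sum>l<n. (B $$ (l, r) * x r) * (B $$ (l, s) * x s))"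
  proof (rule sum.cong)
    fix r assume r: "r \<in> {..<n}"
    have "x r * (\<Sum>s<n. (transpose_mat B * B) $$ (r, s) * x s) =
        x r * (\<Sum>s<n. (\<Sum>l<n. B $$ (l, r) * B $$ (l, s)) * x s)"
      using mult_index[of "transpose_mat B" n B r] B r by (simp del: index_mult_mat(1))
    then show "x r * (\<Sum>s<n. (transpose_mat B * B) $$ (r, s) * x s) =
        (\<Sum>s<n. \<Sum>l<n. (B $$ (l, r) * x r) * (B $$ (l, s) * x s))"
      by (simp add: sum_distrib_left sum_distrib_right mult_ac)
  qed simp
  also have "\<dots> = (\<Sum>r<n. \<Sum>l<n. \<Sum>s<n. (B $$ (l, r) * x r) * (B $$ (l, s) * x s))"
    by (intro sum.cong refl sum.swap)
  also have "\<dots> = (\<Sum>l<n. \<Sum>r<n. \<Sum>s<n. (B $$ (l, r) * x r) * (B $$ (l, s) * x s))" by (rule sum.swap)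
  also have "\<dots> = (\<Sum>l<n. ?y l * ?y l)" by (simp add: sum_product)
  finally have eq: "(\<Sum>r<n. x r * (\<Sum>s<n. (transpose_mat B * B) $$ (r, s) * x s)) = (\<Sum>l<n. ?y l * ?y l)" .
  have "\<exists>l<n. ?y l \<noteq> 0"
  proof (rule ccontr)
    assume "\<not> (\<exists>l<n. ?y l \<noteq> 0)"
    then have "B *\<^sub>v vec n x = 0\<^sub>v n" using B
      by (intro eq_vecI) (auto simp: scalar_prod_def atLeast0LessThan)
    moreover have "vec n x \<noteq> 0\<^sub>v n" using x by (auto simp: vec_eq_iff)
    ultimately show False using det_0_iff_vec_prod_zero_field[OF B] d vec_carrier[of n x] by blast
  qed
  then obtain l where l: "l < n" "?y l \<noteq> 0" by blast
  have "0 < ?y l * ?y l" using l(2) by (metis not_real_square_gt_zero)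
  also have "\<dots> \<le> (\<Sum>l<n. ?y l * ?y l)" using l(1) by (intro member_le_sum) auto
  finally show ?thesis unfolding eq .
qed

lemma real_of_nat_le_power2: "n \<le> N \<Longrightarrow> real n \<le> 2 ^ N"
  by (meson less_exp le_trans less_imp_le of_nat_le_numeral_power_cancel_iff)

lemma wp_InvPosDef:
  assumes n: "\<nu>0 ''n'' = n" "n \<le> N"
    and sym: "\<And>r s. r < n \<Longrightarrow> s < n \<Longrightarrow> \<rho>0 ''A'' r s = \<rho>0 ''A'' s r"
    and pos: "\<And>x. (\<exists>r<n. x r \<noteq> 0) \<Longrightarrow> 0 < (\<Sum>r<n. x r * (\<Sum>s<n. \<rho>0 ''A'' r s * x s))"
    and post: "\<And>\<nu> \<rho>. eq_off (insert ''i'' LoopVars) \<nu> \<nu>0 \<Longrightarrow> eq_off {''X'', ''U'', ''E'', ''V''} \<rho> \<rho>0 \<Longrightarrow>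
     (\<And>r j. r < n \<Longrightarrow> j < n \<Longrightarrow> (\<Sum>l<n. \<rho> ''X'' r l * \<rho>0 ''A'' l j) = kron r j) \<Longrightarrow> Q (\<nu>, \<rho>)"
  shows "runs zo go InvPosDef (\<nu>0, \<rho>0) (inverse_time N) Q"
  by (rule runs_conseq[OF runs_InvPosDef[where ?\<nu>0.0 = \<nu>0 and ?\<rho>0.0 = \<rho>0 and n = n and N = N]])
    (use n sym pos post in auto)

context lcd_basis
begin

text \<open>The rotation cancels, so a matrix computed from real data is integral and may be reduced
  modulo \<open>k\<close>.\<close>

lemma gram:
  assumes Q: "orthonormal_mat n Q" and B: "B = Q * rm H"
  shows "transpose_mat B * B = rm (transpose_mat H * H)"
proof -
  note Qc = orthonormal_matD[OF Q]
  have rH: "rm H \<in> carrier_mat n n" using H_carrier by simp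
  have "transpose_mat B * B = transpose_mat (rm H) * ((transpose_mat Q * Q) * rm H)"
    unfolding B transpose_mult[OF Qc(1) rH] using Qc(1) rH
    by (simp add: assoc_mult_mat[of _ n n _ n _ n])
  then show ?thesis using Qc(2) rH rm_mult[OF Ht_carrier H_carrier] by (simp add: map_mat_transpose)
qed

lemma real_basis_det:
  assumes Q: "orthonormal_mat n Q" and B: "B = Q * rm H"
  shows "B \<in> carrier_mat n n" "det B \<noteq> 0"
proof -
  note Qc = orthonormal_matD[OF Q]
  show Bc: "B \<in> carrier_mat n n" unfolding B using Qc(1) H_carrier by simp
  have "det (transpose_mat Q * Q) = 1" unfolding Qc(2) by simp
  then have "det Q \<noteq> 0" using Qc(1) by (auto simp: det_mult[of _ n] det_transpose)
  moreover have "det B = det Q * real_of_int (det H)"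
    unfolding B using Qc(1) H_carrier by (simp add: det_mult[of _ n])
  ultimately show "det B \<noteq> 0" using det_H by simp
qed

end

abbreviation "ReduceVars \<equiv> {''Bt'', ''A'', ''X'', ''U'', ''E'', ''V'', ''Y'', ''W'', ''R'', ''Z'', ''H''} \<union> HermiteVars"
abbreviation "ReduceIdx \<equiv> {''i'', ''j''} \<union> LoopVars"

text \<open>The matrix \<open>S\<close> exists only in the analysis; the outputs are
  \<open>Q'\<close> and the projector of the lattice rotated by \<open>S\<close>. Scratch arrays may
  have arbitrary initial contents, which allows a second run after the first.\<close>

lemma wp_ReduceBasis:
  assumes zo: "ZLIP_oracle n zo" and k: "0 < k" and nN: "n \<le> N" "1 \<le> N" "k \<le> 2 ^ N"
    and n: "\<nu>0 ''n'' = n" "\<nu>0 ''k'' = k"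
    and names: "Bn \<notin> ReduceVars" "Qn \<notin> ReduceVars" "Pn \<notin> ReduceVars" "Qn \<noteq> Bn" "Pn \<noteq> Bn" "Pn \<noteq> Qn"
    and basis: "lcd_basis n k \<Lambda> H" and Q: "orthonormal_mat n Q" and B: "B = Q * rm H"
    and hB: "holds n (\<rho>0 Bn) B" and Bb: "\<And>i j. i < n \<Longrightarrow> j < n \<Longrightarrow> \<bar>B $$ (i, j)\<bar> \<le> 2 ^ N"
    and post: "\<And>\<nu> \<rho> Q' S P. eq_off ReduceIdx \<nu> \<nu>0 \<Longrightarrow> eq_off ({Qn, Pn} \<union> ReduceVars) \<rho> \<rho>0 \<Longrightarrow>
       orthonormal_mat n Q' \<Longrightarrow> holds n (\<rho> Qn) Q' \<Longrightarrow> orth_int n S \<Longrightarrow> Q = Q' * rm S \<Longrightarrow>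
       projector n k ((\<lambda>x. S *\<^sub>v x) ` \<Lambda>) P \<Longrightarrow>
       (\<And>i j. i < n \<Longrightarrow> j < n \<Longrightarrow> \<rho> Pn i j = of_int (P $$ (i, j)) \<and> 0 \<le> P $$ (i, j) \<and> P $$ (i, j) < int k) \<Longrightarrow> R (\<nu>, \<rho>)"
  shows "runs zo go (ReduceBasis Bn Qn Pn) (\<nu>0, \<rho>0) (reduce_time N) R"
proof -
  interpret lcd_basis n k \<Lambda> H by fact
  note Bc = real_basis_det[OF Q B]
  note Qc = orthonormal_matD[OF Q]
  let ?L = "5 * N" and ?F = "{Qn, Pn} \<union> ReduceVars"
  let ?Ai = "transpose_mat H * H"
  note gram = gram[OF Q B]
  have Aic: "?Ai \<in> carrier_mat n n" using H_carrier by simp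
  have pow: "(2 :: real) ^ a \<le> 2 ^ b" if "a \<le> b" for a b :: nat using that by (rule power_increasing) simp
  have n2: "real n \<le> 2 ^ N" by (rule real_of_nat_le_power2[OF nN(1)])
  have k2: "real k \<le> 2 ^ N" using nN(3) by (metis of_nat_le_numeral_power_cancel_iff)
  have kL: "k * k + k \<le> 2 ^ ?L"
  proof -
    have "k * k \<le> 2 ^ N * 2 ^ N" using nN(3) by (intro mult_le_mono)
    then have "k * k \<le> 2 ^ (2 * N)" by (simp add: power_add[symmetric] mult_2)
    moreover have "k \<le> 2 ^ (2 * N)" by (rule order_trans[OF nN(3)]) (intro power_increasing, auto)
    ultimately have "k * k + k \<le> 2 ^ (2 * N + 1)" by simp
    also have "\<dots> \<le> 2 ^ ?L" using nN(2) by (intro power_increasing) auto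
    finally show ?thesis .
  qed
  have V1: "eq_off ReduceIdx \<nu> \<nu>0" if "eq_off LoopVars \<nu> \<nu>1" "eq_off ReduceIdx \<nu>1 \<nu>0" for \<nu> \<nu>1 by (rule eq_off_trans[OF that]) auto
  have V2: "eq_off ReduceIdx \<nu> \<nu>0" if "eq_off (insert ''i'' LoopVars) \<nu> \<nu>1" "eq_off ReduceIdx \<nu>1 \<nu>0" for \<nu> \<nu>1 by (rule eq_off_trans[OF that]) auto
  have nk: "\<nu> ''n'' = n" "\<nu> ''k'' = k" if "eq_off ReduceIdx \<nu> \<nu>0" for \<nu>
    using eq_offD[OF that, of "''n''"] eq_offD[OF that, of "''k''"] n by auto
  have Bt: "transpose_mat B \<in> carrier_mat n n" using Bc by simp
  have sub: "eq_off ?F \<rho> \<rho>0" if "eq_off G \<rho> \<rho>1" "eq_off ?F \<rho>1 \<rho>0" "G \<subseteq> ?F" for \<rho> \<rho>1 :: rstore and G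
    by (rule eq_off_trans[OF that(1,2)]) (use that(3) in auto)
  have hB': "holds n (\<rho> Bn) B" if "eq_off ?F \<rho> \<rho>0" for \<rho> using eq_offD[OF that, of Bn] names hB by auto
  have keep: "\<rho> x = \<rho>1 x" if "eq_off G \<rho> \<rho>1" "x \<notin> G" for \<rho> \<rho>1 :: rstore and G x by (rule eq_offD[OF that])
  show ?thesis unfolding ReduceBasis_def reduce_time_def
  proof (rule runs_Seq, rule wp_Transp[where ?\<nu>0.0 = \<nu>0, OF n(1) nN(1)], goal_cases)
    case 1
    then show ?case using names by auto
  next
    case (2 \<nu>1 \<rho>1)
    have e1: "eq_off ReduceIdx \<nu>1 \<nu>0" by (rule eq_off_mono[OF 2(1)]) auto
    have f1: "eq_off ?F \<rho>1 \<rho>0" by (rule eq_off_mono[OF 2(2)]) auto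
    have h1: "holds n (\<rho>1 ''Bt'') (transpose_mat B)" by (rule holds_transpose[OF hB Bc(1) 2(3)])
    show ?case
    proof (rule runs_Seq, rule wp_MatMul[where ?\<nu>0.0 = \<nu>1, OF nk(1)[OF e1] nN(1)], goal_cases)
      case 2
      show ?case using names by auto
    next
      case (3 \<nu>2 \<rho>2)
      have e2: "eq_off ReduceIdx \<nu>2 \<nu>0" by (rule V1[OF 3(1) e1])
      have f2: "eq_off ?F \<rho>2 \<rho>0" by (rule sub[OF 3(2) f1]) auto
      have hA: "holds n (\<rho>2 ''A'') (rm ?Ai)"
        unfolding gram[symmetric] by (rule holds_mult[OF h1 hB'[OF f1] Bt Bc(1) 3(3)])
      have hBt2: "\<rho>2 ''Bt'' = \<rho>1 ''Bt''" by (rule keep[OF 3(2)]) simp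
      have sym: "\<rho>2 ''A'' r s = \<rho>2 ''A'' s r" if "r < n" "s < n" for r s
        using holdsD[OF hA] that H_carrier mult_index[OF Ht_carrier H_carrier, of r s] mult_index[OF Ht_carrier H_carrier, of s r]
        by (simp add: mult.commute)
      have pos: "0 < (\<Sum>r<n. x r * (\<Sum>s<n. \<rho>2 ''A'' r s * x s))" if "\<exists>r<n. x r \<noteq> 0" for x
        using gram_positive[OF Bc that] holdsD[OF hA[folded gram]] by simp
      show ?case
      proof (rule runs_Seq, rule wp_InvPosDef[where ?\<nu>0.0 = \<nu>2 and ?\<rho>0.0 = \<rho>2, OF nk(1)[OF e2] nN(1)], goal_cases)
        case (1 r s)
        then show ?case by (rule sym)
      next
        case (2 x)
        then show ?case by (rule pos)
      next
        case (3 \<nu>3 \<rho>3)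
        note X = 3(3)
        define Xm where "Xm = mat n n (\<lambda>(i, j). \<rho>3 ''X'' i j)"
        have Xc: "Xm \<in> carrier_mat n n" by (simp add: Xm_def)
        have hX: "holds n (\<rho>3 ''X'') Xm" by (simp add: holds_def Xm_def)
        have XA: "Xm * (transpose_mat B * B) = 1\<^sub>m n"
        proof (rule eq_matI)
          fix i j assume "i < dim_row (1\<^sub>m n :: real mat)" "j < dim_col (1\<^sub>m n :: real mat)"
          then have ij: "i < n" "j < n" by auto
          have "(Xm * rm ?Ai) $$ (i, j) = (\<Sum>l<n. Xm $$ (i, l) * rm ?Ai $$ (l, j))"
            by (rule mult_index[OF Xc _ ij]) (use Aic in simp)
          also have "\<dots> = (\<Sum>l<n. \<rho>3 ''X'' i l * \<rho>2 ''A'' l j)"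
            using holdsD[OF hA] holdsD[OF hX] ij by (intro sum.cong) auto
          finally show "(Xm * (transpose_mat B * B)) $$ (i, j) = 1\<^sub>m n $$ (i, j)"
            unfolding gram using X[OF ij] ij by (simp add: kron_def)
        qed (use Xc Bc in auto)
        interpret RB: lcd_real_basis n k \<Lambda> H Q B Xm by unfold_locales (use Q B Xc XA in auto)
        have e3: "eq_off ReduceIdx \<nu>3 \<nu>0" by (rule V2[OF 3(1) e2])
        have f3: "eq_off ?F \<rho>3 \<rho>0" by (rule sub[OF 3(2) f2]) auto
        have A3: "\<rho>3 ''A'' = \<rho>2 ''A''" and Bt3: "\<rho>3 ''Bt'' = \<rho>1 ''Bt''"
          using keep[OF 3(2), of "''A''"] keep[OF 3(2), of "''Bt''"] hBt2 by auto
        have Ab: "\<bar>real_of_int (?Ai $$ (r, j))\<bar> \<le> 2 ^ ?L" if "r < n" "j < n" for r j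
        proof -
          have "real_of_int (?Ai $$ (r, j)) = (transpose_mat B * B) $$ (r, j)"
            unfolding gram using that Aic by (metis carrier_matD index_map_mat(1))
          also have "\<dots> = (\<Sum>l<n. B $$ (l, r) * B $$ (l, j))"
            using mult_index[OF Bt Bc(1) that] Bc(1) that by simp
          finally have "\<bar>real_of_int (?Ai $$ (r, j))\<bar> \<le> real n * (2 ^ N * 2 ^ N)"
            using abs_sum_mult_le[of n "\<lambda>l. B $$ (l, r)" "2 ^ N" "\<lambda>l. B $$ (l, j)" "2 ^ N"] Bb that by simp
          also have "\<dots> \<le> 2 ^ N * (2 ^ N * 2 ^ N)" using n2 by (intro mult_right_mono) auto
          also have "\<dots> = 2 ^ (3 * N)" by (simp add: power_add[symmetric])
          also have "\<dots> \<le> 2 ^ ?L" by (rule pow) simp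
          finally show ?thesis .
        qed
        show ?case
        proof (rule runs_Seq, rule wp_HermiteForm[where ?\<nu>0.0 = \<nu>3 and A = "\<lambda>r j. ?Ai $$ (r, j)", OF nN(1) k kL nk[OF e3]], goal_cases)
          case (1 r j)
          then show ?case unfolding A3 rm_index[OF Aic 1, symmetric] by (intro holdsD[OF hA])
        next
          case (2 r j)
          then show ?case by (rule Ab)
        next
          case (3 \<nu>4 \<rho>4 \<tau>)
          note inv = 3(4)
          have e4: "eq_off ReduceIdx \<nu>4 \<nu>0" by (rule eq_off_trans_same[OF 3(1) e3])
          have f4: "eq_off ?F \<rho>4 \<rho>0" by (rule sub[OF 3(2) f3]) auto
          have k4: "\<rho>4 ''X'' = \<rho>3 ''X''" "\<rho>4 ''Bt'' = \<rho>1 ''Bt''" using keep[OF 3(2)] Bt3 by auto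
          define T where "T = mat n n (\<lambda>(r, c). \<tau> r c)"
          have Tc: "T \<in> carrier_mat n n" by (simp add: T_def)
          have Teq: "{T *\<^sub>v u | u. u \<in> carrier_vec n} =
              {?Ai *\<^sub>v a + int k \<cdot>\<^sub>v b | a b. a \<in> carrier_vec n \<and> b \<in> carrier_vec n}"
            unfolding T_def by (rule hnf_result[OF inv Aic])
          have T4: "\<rho>4 ''T'' r c = of_int (\<tau> r c)" if "r < n + n" "c < n" for r c by (rule 3(3)[OF that])
          have hT: "holds n (\<rho>4 ''T'') (rm T)" using T4 by (simp add: holds_def T_def)
          show ?case
          proof (rule runs_Seq, rule wp_MatMul[where ?\<nu>0.0 = \<nu>4, OF nk(1)[OF e4] nN(1)], goal_cases)
            case 1
            show ?case using names by auto
          next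
            case (3 \<nu>5 \<rho>5)
            have e5: "eq_off ReduceIdx \<nu>5 \<nu>0" by (rule V1[OF 3(1) e4])
            have f5: "eq_off ?F \<rho>5 \<rho>0" by (rule sub[OF 3(2) f4]) auto
            have hY: "holds n (\<rho>5 ''Y'') (B * Xm)"
              by (rule holds_mult[OF hB'[OF f4] _ Bc(1) Xc 3(3)]) (use hX k4 in simp)
            have k5: "\<rho>5 ''T'' = \<rho>4 ''T''" "\<rho>5 ''Bt'' = \<rho>1 ''Bt''" using keep[OF 3(2)] k4 by auto
            show ?case
            proof (rule runs_Seq, rule wp_MatMul[where ?\<nu>0.0 = \<nu>5, OF nk(1)[OF e5] nN(1)], goal_cases)
              case (3 \<nu>6 \<rho>6)
              let ?W = "(B * Xm) * rm T"
              have e6: "eq_off ReduceIdx \<nu>6 \<nu>0" by (rule V1[OF 3(1) e5])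
              have f6: "eq_off ?F \<rho>6 \<rho>0" by (rule sub[OF 3(2) f5]) auto
              have BX: "B * Xm \<in> carrier_mat n n" using Bc Xc by simp
              have Wc: "?W \<in> carrier_mat n n" using BX Tc by simp
              have hW: "holds n (\<rho>6 ''W'') ?W"
                by (rule holds_mult[OF hY _ BX _ 3(3)]) (use hT k5 Tc in auto)
              have k6: "\<rho>6 ''T'' = \<rho>4 ''T''" "\<rho>6 ''Bt'' = \<rho>1 ''Bt''" using keep[OF 3(2)] k5 by auto
              have rW: "read_mat n (\<rho>6 ''W'') = ?W" by (rule holds_read[OF hW Wc])
              have lat: "column_lattice ?W = mat_image Q (int_lattice n)" by (rule RB.rotated_int_lattice[OF Tc Teq])
              define Q' where "Q' = zo ?W"
              \<comment> \<open>The query meets the promise of the oracle: its lattice is the image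
                of the integral one under \<open>Q\<close>.\<close>
              have "LIP_solution n (column_lattice ?W) (int_lattice n) Q'"
              proof -
                have "lattice_isomorphic n (column_lattice ?W) (int_lattice n)"
                  unfolding lattice_isomorphic_def LIP_solution_def using lat Q by blast
                then show ?thesis using zo Wc unfolding ZLIP_oracle_def Q'_def by blast
              qed
              then have Q': "orthonormal_mat n Q'" and eqQ: "mat_image Q (int_lattice n) = mat_image Q' (int_lattice n)"
                using lat by (auto simp: LIP_solution_def)
              obtain S where S: "orth_int n S" "Q = Q' * rm S"
                using same_rotated_int_lattice[OF Q Q' eqQ] by blast
              note Qc' = orthonormal_matD[OF Q'] and Sc = orth_intD[OF S(1)]
              interpret I: lcd_basis n k "(\<lambda>x. S *\<^sub>v x) ` \<Lambda>" "S * H"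
                by (rule lcd_basis_image[OF lcd_basis_axioms S(1)])
              let ?H' = "S * H"
              \<comment> \<open>The signed permutation leaves the Gram matrix unchanged, so the
                triangular basis found before the oracle call also serves for
                \<open>S H\<close>.\<close>
              have SH: "transpose_mat ?H' * ?H' = ?Ai"
              proof -
                have "transpose_mat ?H' * ?H' = transpose_mat H * ((transpose_mat S * S) * H)"
                  unfolding transpose_mult[OF Sc(1) H_carrier]
                  using Sc(1) H_carrier by (simp add: assoc_mult_mat[of _ n n _ n _ n])
                then show ?thesis using Sc H_carrier by simp
              qed
              \<comment> \<open>Although \<open>S\<close> and \<open>H\<close> are unknown, the
                integral basis \<open>S H\<close> becomes computable from \<open>B\<close> and the
                oracle's answer.\<close>
              have BQ': "transpose_mat B * Q' = rm (transpose_mat ?H')"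
              proof -
                have rSH: "rm ?H' \<in> carrier_mat n n" using I.H_carrier by simp
                have rS: "rm S \<in> carrier_mat n n" and rH: "rm H \<in> carrier_mat n n" using Sc(1) H_carrier by auto
                have "B = Q' * rm ?H'"
                  unfolding B S(2) rm_mult[OF Sc(1) H_carrier] by (rule assoc_mult_mat[OF Qc'(1) rS rH])
                then have "transpose_mat B * Q' = transpose_mat (rm ?H') * (transpose_mat Q' * Q')"
                  using transpose_mult[OF Qc'(1) rSH] Qc'(1) rSH by (simp add: assoc_mult_mat[of _ n n _ n _ n])
                also have "\<dots> = transpose_mat (rm ?H')"
                  unfolding Qc'(2) by (rule right_mult_one_mat) (use rSH in simp)
                finally show ?thesis by (simp only: map_mat_transpose)
              qed
              \<comment> \<open>With \<open>n\<close> and \<open>k\<close> at most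
                \<open>2 ^ N\<close>, entries of \<open>B X\<close> are at most
                \<open>n! * 2 ^ (N * n)\<close>, hence at most \<open>2 ^ (2 * N * N)\<close>;
                multiplication by \<open>T\<close> and summation cost a factor \<open>2 ^ N\<close>
                each.\<close>
              have Wb: "\<bar>?W $$ (i, j)\<bar> \<le> 2 ^ (2 * N * N + 2 * N)" if ij: "i < n" "j < n" for i j
              proof -
                have fact2: "fact n * (2 ^ N) ^ n \<le> (2 :: real) ^ (2 * N * N)"
                proof -
                  have "(fact n :: real) \<le> real n ^ n" using fact_le_power[of n, where 'a = real] by simp
                  also have "\<dots> \<le> (2 ^ N) ^ n" using n2 by (intro power_mono) auto
                  also have "\<dots> \<le> 2 ^ (N * N)" unfolding power_mult[symmetric] using nN(1) by (intro pow) simp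
                  finally have "fact n * (2 ^ N) ^ n \<le> (2 :: real) ^ (N * N) * 2 ^ (N * N)"
                    using pow[of "N * n" "N * N"] nN(1) by (intro mult_mono) (auto simp: power_mult)
                  also have "\<dots> = 2 ^ (2 * N * N)" by (simp add: power_add[symmetric])
                  finally show ?thesis .
                qed
                have BXb: "\<bar>(B * Xm) $$ (i, l)\<bar> \<le> 2 ^ (2 * N * N)" if "l < n" for l
                  using RB.abs_dual_basis_le[OF Bb _ ij(1) that] fact2 by force
                have Tb: "\<bar>rm T $$ (l, j)\<bar> \<le> 2 ^ N" if "l < n" for l
                proof -
                  have "0 \<le> \<tau> l j" "\<tau> l j \<le> int k" using hnf_invD(1,2)[OF inv, of l j] that ij by auto
                  then have "\<bar>real_of_int (\<tau> l j)\<bar> \<le> real k" by linarith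
                  from order_trans[OF this k2] show ?thesis using that ij by (simp add: T_def)
                qed
                have "?W $$ (i, j) = (\<Sum>l<n. (B * Xm) $$ (i, l) * rm T $$ (l, j))"
                  by (rule mult_index[OF BX _ ij]) (use Tc in simp)
                then have "\<bar>?W $$ (i, j)\<bar> \<le> real n * (2 ^ (2 * N * N) * 2 ^ N)"
                  using abs_sum_mult_le[of n "\<lambda>l. (B * Xm) $$ (i, l)" _ "\<lambda>l. rm T $$ (l, j)", OF BXb Tb] by simp
                also have "\<dots> \<le> 2 ^ N * (2 ^ (2 * N * N) * 2 ^ N)" using n2 by (intro mult_right_mono) auto
                also have "\<dots> = 2 ^ (2 * N * N + 2 * N)" by (simp add: power_add[symmetric] algebra_simps)
                finally show ?thesis .
              qed
              have zt: "nat \<lceil>mat_size ?W\<rceil> + 1 \<le> zlip_time N"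
              proof -
                have "mat_size ?W \<le> real (n * n * (2 * N * N + 2 * N + 2))" by (rule mat_size_le[OF Wc Wb])
                also have "\<dots> \<le> real (N * N * (2 * N * N + 2 * N + 2))"
                  using nN(1) by (intro of_nat_mono mult_le_mono) auto
                finally have "\<lceil>mat_size ?W\<rceil> \<le> int (N * N * (2 * N * N + 2 * N + 2))" by (simp add: ceiling_le_iff)
                then show ?thesis unfolding zlip_time_def by linarith
              qed
              let ?\<rho>7 = "\<rho>6(Qn := write_mat n Q' (\<rho>6 Qn))"
              have f7: "eq_off ?F ?\<rho>7 \<rho>0" using f6 by simp
              have hQ: "holds n (?\<rho>7 Qn) Q'" by (simp add: holds_def write_mat_def)
              have k7: "?\<rho>7 ''T'' = \<rho>4 ''T''" "?\<rho>7 ''Bt'' = \<rho>1 ''Bt''" using k6 names by auto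
              have post7: "runs zo go (Seq (MatMul ''R'' ''Bt'' Qn) (Seq Solve (Seq (Transp ''H'' ''R'') (Seq (MatMul Pn ''H'' ''Z'')
                 (PutMod Pn nn nn N0 N0 (RCell Pn rr ss)))))) (\<nu>6, ?\<rho>7)
                 (mult_time N + (solve_time ?L N + (put_time N N + (mult_time N + putmod_time ?L N N)))) R"
              proof (rule runs_Seq, rule wp_MatMul[where ?\<nu>0.0 = \<nu>6, OF nk(1)[OF e6] nN(1)], goal_cases)
                case 2
                show ?case using names by auto
              next
                case (3 \<nu>8 \<rho>8)
                have e8: "eq_off ReduceIdx \<nu>8 \<nu>0" by (rule V1[OF 3(1) e6])
                have f8: "eq_off ?F \<rho>8 \<rho>0" by (rule sub[OF 3(2) f7]) auto
                have k8: "\<rho>8 ''T'' = \<rho>4 ''T''" "\<rho>8 Qn = ?\<rho>7 Qn"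
                  using keep[OF 3(2), of "''T''"] keep[OF 3(2), of Qn] k7 names by auto
                have Ht'c: "transpose_mat ?H' \<in> carrier_mat n n" by (rule I.Ht_carrier)
                have hR: "holds n (\<rho>8 ''R'') (rm (transpose_mat ?H'))"
                  unfolding BQ'[symmetric] by (rule holds_mult[OF _ hQ Bt Qc'(1) 3(3)]) (use h1 k7 in simp)
                have Rb: "\<bar>real_of_int (transpose_mat ?H' $$ (r, j))\<bar> \<le> 2 ^ (2 * N)" if "r < n" "j < n" for r j
                proof -
                  have "real_of_int (transpose_mat ?H' $$ (r, j)) = rm (transpose_mat ?H') $$ (r, j)"
                    by (rule rm_index[OF Ht'c that, symmetric])
                  also have "\<dots> = (transpose_mat B * Q') $$ (r, j)" unfolding BQ' ..
                  also have "\<dots> = (\<Sum>l<n. B $$ (l, r) * Q' $$ (l, j))"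
                    using mult_index[OF Bt Qc'(1) that] Bc(1) that by simp
                  finally have "\<bar>real_of_int (transpose_mat ?H' $$ (r, j))\<bar> \<le> real n * (2 ^ N * 1)"
                    using abs_sum_mult_le[of n "\<lambda>l. B $$ (l, r)" "2 ^ N" "\<lambda>l. Q' $$ (l, j)" 1] Bb that orthonormal_abs_le_1[OF Q'] by simp
                  also have "\<dots> \<le> 2 ^ N * (2 ^ N * 1)" using n2 by (intro mult_right_mono) auto
                  also have "\<dots> = 2 ^ (2 * N)" by (simp add: power_add[symmetric] mult_2)
                  finally show ?thesis .
                qed
                show ?case
                proof (rule runs_Seq, rule wp_Solve[where ?\<nu>0.0 = \<nu>8 and \<tau> = \<tau> and A = "\<lambda>r j. ?Ai $$ (r, j)"
                    and R = "\<lambda>r j. transpose_mat ?H' $$ (r, j)", OF nN(1) k kL nk[OF e8] _ inv], goal_cases)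
                  case (1 r c)
                  then show ?case using T4 k8 by simp
                next
                  case (2 r j)
                  then show ?case unfolding rm_index[OF Ht'c 2, symmetric] by (intro holdsD[OF hR])
                next
                  case (3 r j)
                  show ?case by (rule order_trans[OF Rb[OF 3] pow]) simp
                next
                  case (4 j)
                  \<comment> \<open>By \<open>Ht_image\<close> for the rotated lattice, the columns
                    of \<open>(S H)^T\<close> lie in the lattice of \<open>T\<close>, so the systems
                    are solvable.\<close>
                  have "transpose_mat ?H' *\<^sub>v unit_vec n j \<in> {transpose_mat ?H' *\<^sub>v z | z. z \<in> carrier_vec n}" by auto
                  then obtain u where u: "u \<in> carrier_vec n" "transpose_mat ?H' *\<^sub>v unit_vec n j = T *\<^sub>v u"
                    unfolding I.Ht_image SH Teq[symmetric] by blast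
                  show ?case unfolding col_lattice_def
                  proof (intro CollectI exI[of _ "\<lambda>c. u $ c"] ext)
                    fix r
                    show "col_fun n (\<lambda>r j. transpose_mat ?H' $$ (r, j)) j r = (if r < n then \<Sum>c<n. \<tau> r c * u $ c else 0)"
                    proof (cases "r < n")
                      case True
                      have "(transpose_mat ?H' *\<^sub>v unit_vec n j) $ r = transpose_mat ?H' $$ (r, j)"
                        using col_eq_mult_unit[OF Ht'c 4] True 4 Ht'c by (metis carrier_matD index_col)
                      moreover have "(T *\<^sub>v u) $ r = (\<Sum>c<n. \<tau> r c * u $ c)"
                        using True u(1) by (auto simp: T_def scalar_prod_def atLeast0LessThan intro!: sum.cong)
                      ultimately show ?thesis using True u(2) by (simp add: col_fun_def)
                    qed (simp add: col_fun_def)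
                  qed
                next
                  case (5 \<nu>9 \<rho>9 z)
                  have e9: "eq_off ReduceIdx \<nu>9 \<nu>0" by (rule eq_off_trans_same[OF 5(1) e8])
                  have f9: "eq_off ?F \<rho>9 \<rho>0" by (rule sub[OF 5(2) f8]) auto
                  have k9: "\<rho>9 ''R'' = \<rho>8 ''R''" "\<rho>9 Qn = ?\<rho>7 Qn"
                    using keep[OF 5(2), of "''R''"] keep[OF 5(2), of Qn] k8 names by auto
                  define Zm where "Zm = mat n n (\<lambda>(i, j). z i j)"
                  have Zc: "Zm \<in> carrier_mat n n" by (simp add: Zm_def)
                  have hZ: "holds n (\<rho>9 ''Z'') (rm Zm)" using 5(3) by (simp add: holds_def Zm_def)
                  note zb = 5(4) and zd = 5(5)
                  show ?case
                  proof (rule runs_Seq, rule wp_Transp[where ?\<nu>0.0 = \<nu>9, OF nk(1)[OF e9] nN(1)], goal_cases)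
                    case (2 \<nu>10 \<rho>10)
                    have e10: "eq_off ReduceIdx \<nu>10 \<nu>0" by (rule V1[OF 2(1) e9])
                    have f10: "eq_off ?F \<rho>10 \<rho>0" by (rule sub[OF 2(2) f9]) auto
                    have k10: "\<rho>10 ''Z'' = \<rho>9 ''Z''" "\<rho>10 Qn = ?\<rho>7 Qn"
                      using keep[OF 2(2), of "''Z''"] keep[OF 2(2), of Qn] k9 names by auto
                    have hH: "holds n (\<rho>10 ''H'') (rm ?H')"
                    proof -
                      have "holds n (\<rho>10 ''H'') (transpose_mat (rm (transpose_mat ?H')))"
                        by (rule holds_transpose[OF _ _ 2(3)]) (use hR k9 Ht'c in auto)
                      then show ?thesis by (simp add: map_mat_transpose)
                    qed
                    show ?case
                    proof (rule runs_Seq, rule wp_MatMul[where ?\<nu>0.0 = \<nu>10, OF nk(1)[OF e10] nN(1)], goal_cases)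
                      case 1
                      show ?case using names by auto
                    next
                      case 2
                      show ?case using names by auto
                    next
                      case (3 \<nu>11 \<rho>11)
                      have e11: "eq_off ReduceIdx \<nu>11 \<nu>0" by (rule V1[OF 3(1) e10])
                      have f11: "eq_off ?F \<rho>11 \<rho>0" by (rule sub[OF 3(2) f10]) auto
                      have k11: "\<rho>11 Qn = ?\<rho>7 Qn" using keep[OF 3(2), of Qn] k10 names by auto
                      have HZ: "?H' * Zm \<in> carrier_mat n n" using I.H_carrier Zc by simp
                      have hP: "holds n (\<rho>11 Pn) (rm (?H' * Zm))"
                        unfolding rm_mult[OF I.H_carrier Zc]
                        by (rule holds_mult[OF hH _ _ _ 3(3)]) (use hZ k10 I.H_carrier Zc in auto)
                      have Pb: "\<bar>real_of_int ((?H' * Zm) $$ (i, j))\<bar> \<le> 2 ^ ?L" if ij: "i < n" "j < n" for i j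
                      proof -
                        have "\<bar>real_of_int (?H' $$ (i, l))\<bar> \<le> 2 ^ (2 * N)" if "l < n" for l
                          using Rb[OF that ij(1)] unfolding transpose_index[OF I.H_carrier that ij(1)] .
                        moreover have "\<bar>real_of_int (Zm $$ (l, j))\<bar> \<le> 2 ^ N" if "l < n" for l
                        proof -
                          have "\<bar>real_of_int (z l j)\<bar> \<le> real k" using zb[OF that ij(2)] by linarith
                          from order_trans[OF this k2] show ?thesis using that ij by (simp add: Zm_def)
                        qed
                        ultimately have "\<bar>\<Sum>l<n. real_of_int (?H' $$ (i, l)) * real_of_int (Zm $$ (l, j))\<bar> \<le> real n * (2 ^ (2 * N) * 2 ^ N)"
                          by (intro abs_sum_mult_le) auto
                        also have "\<dots> \<le> 2 ^ N * (2 ^ (2 * N) * 2 ^ N)" using n2 by (intro mult_right_mono) auto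
                        also have "\<dots> = 2 ^ (4 * N)" by (simp add: power_add[symmetric])
                        also have "\<dots> \<le> 2 ^ ?L" by (rule pow) simp
                        finally show ?thesis using mult_index[OF I.H_carrier Zc ij] by simp
                      qed
                      show ?case
                      proof (rule wp_PutMod[where a' = n and b' = n and p' = 0 and q' = 0 and k = k
                          and val = "\<lambda>i j. (?H' * Zm) $$ (i, j)"], goal_cases)
                        case (1 \<nu>)
                        then show ?case using nk(1)[OF V1[OF 1 e11]] by simp
                      next
                        case (2 i j \<nu> \<rho>)
                        have "rm (?H' * Zm) $$ (i, j) = real_of_int ((?H' * Zm) $$ (i, j))"
                          by (rule index_map_mat) (use HZ 2 in auto)
                        then show ?case using 2(3,4,7) holdsD[OF hP 2(1,2)] by simp
                      next
                        case (3 i j)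
                        then show ?case by (rule Pb)
                      next
                        case 4
                        show ?case using names by auto
                      next
                        case (9 \<nu>12 \<rho>12)
                        define P where "P = mat n n (\<lambda>(i, j). (?H' * Zm) $$ (i, j) mod int k)"
                        have "projector n k ((\<lambda>x. S *\<^sub>v x) ` \<Lambda>) P"
                        proof (rule I.projectorI[where z = "\<lambda>j. col Zm j"])
                          show "P \<in> carrier_mat n n" by (simp add: P_def)
                          show "col Zm j \<in> carrier_vec n" for j using Zc by (metis carrier_matD(1) col_dim)
                          fix i j assume ij: "i < n" "j < n"
                          have "((transpose_mat ?H' * ?H') *\<^sub>v col Zm j) $ i = (\<Sum>l<n. ?Ai $$ (i, l) * z l j)"
                            unfolding SH using ij Aic
                            by (auto simp: scalar_prod_def atLeast0LessThan Zm_def simp del: index_mult_mat(1) intro!: sum.cong)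
                          then show "int k dvd ((transpose_mat ?H' * ?H') *\<^sub>v col Zm j) $ i - ?H' $$ (j, i)"
                            using zd[OF ij] unfolding transpose_index[OF I.H_carrier ij] by simp
                          have "(?H' *\<^sub>v col Zm j) $ i = (?H' * Zm) $$ (i, j)"
                            by (rule mult_col_index[OF I.H_carrier Zc ij])
                          then show "int k dvd P $$ (i, j) - (?H' *\<^sub>v col Zm j) $ i"
                            using ij by (simp add: P_def mod_eq_dvd_iff[symmetric] del: index_mult_mat(1))
                        qed
                        moreover have "eq_off ReduceIdx \<nu>12 \<nu>0" by (rule V1[OF 9(1) e11])
                        moreover have "eq_off ?F \<rho>12 \<rho>0" by (rule sub[OF 9(2) f11]) auto
                        moreover have "\<rho>12 Qn = ?\<rho>7 Qn" using keep[OF 9(2), of Qn] k11 names by auto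
                        moreover have "\<rho>12 Pn i j = of_int (P $$ (i, j)) \<and> 0 \<le> P $$ (i, j) \<and> P $$ (i, j) < int k"
                          if "i < n" "j < n" for i j
                          using 9(3)[OF that] that k by (simp add: P_def)
                        ultimately show ?case using hQ by (intro post[OF _ _ Q' _ S, where P = P]) auto
                      qed (use nk(2)[OF e11] k nN in auto)
                    qed
                  qed simp
                qed
              qed simp
              have "exec zo go (ZLIP_Call Qn ''W'' nn) (\<nu>6, \<rho>6) (nat \<lceil>mat_size ?W\<rceil> + 1) (\<nu>6, ?\<rho>7)"
                unfolding Q'_def by (rule exec_ZLIP) (use rW nk(1)[OF e6] in simp_all)
              then have "runs zo go (ZLIP_Call Qn ''W'' nn) (\<nu>6, \<rho>6) (zlip_time N) (\<lambda>s. s = (\<nu>6, ?\<rho>7))"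
                unfolding runs_def using zt by blast
              then show ?case
                by (rule runs_Seq_post) (use post7 in simp)
            qed auto
          qed simp
        qed
      qed
    qed simp
  qed
qed

section \<open>The graph of a projector\<close>

definition vertex_idx :: "nat \<Rightarrow> nat \<Rightarrow> nat" where "vertex_idx n u = (if u < n then u else u - n)"
definition vertex_sgn :: "nat \<Rightarrow> nat \<Rightarrow> int" where "vertex_sgn n u = (if u < n then 1 else - 1)"

text \<open>Vertices \<open>i\<close> and \<open>n + i\<close> stand for \<open>e\<^sub>i\<close> and \<open>- e\<^sub>i\<close>; the vertices from \<open>2 n\<close> on are isolated.
  A weight is at least \<open>k\<close> exactly on the pairs \<open>{e\<^sub>i, - e\<^sub>i}\<close>, so isomorphisms permute these pairs.\<close>

definition graph_weight :: "nat \<Rightarrow> nat \<Rightarrow> int mat \<Rightarrow> nat \<Rightarrow> nat \<Rightarrow> int" where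
  "graph_weight n k P u v = (if u < n + n \<and> v < n + n \<and> u \<noteq> v then
      if vertex_idx n u = vertex_idx n v then int k + P $$ (vertex_idx n u, vertex_idx n v)
      else (vertex_sgn n u * vertex_sgn n v * P $$ (vertex_idx n u, vertex_idx n v)) mod int k
    else 0)"

text \<open>Graph isomorphism compares weights exactly, so congruences have to become equalities of
  canonical residues. Exact symmetry makes the weights functions of unordered pairs.\<close>

definition reduced_mat :: "nat \<Rightarrow> nat \<Rightarrow> int mat \<Rightarrow> bool" where
  "reduced_mat n k P \<longleftrightarrow> (\<forall>i<n. \<forall>j<n. 0 \<le> P $$ (i, j) \<and> P $$ (i, j) < int k \<and> P $$ (i, j) = P $$ (j, i))"

lemma reduced_matD:
  assumes "reduced_mat n k P" "i < n" "j < n"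
  shows "0 \<le> P $$ (i, j)" "P $$ (i, j) < int k" "P $$ (i, j) = P $$ (j, i)"
  using assms by (auto simp: reduced_mat_def)

lemma residue_unique: "int k dvd x - y \<Longrightarrow> 0 \<le> x \<Longrightarrow> x < int k \<Longrightarrow> 0 \<le> y \<Longrightarrow> y < int k \<Longrightarrow> x = y"
  by (metis mod_eq_dvd_iff mod_pos_pos_trivial)

lemma vertex_idx_less: "u < n + n \<Longrightarrow> vertex_idx n u < n"
  by (auto simp: vertex_idx_def)

lemma vertex_sgn_cases: "vertex_sgn n u = 1 \<or> vertex_sgn n u = - 1"
  by (simp add: vertex_sgn_def)

lemma vertex_eqI: "u < n + n \<Longrightarrow> v < n + n \<Longrightarrow> vertex_idx n u = vertex_idx n v \<Longrightarrow> vertex_sgn n u = vertex_sgn n v \<Longrightarrow> u = v"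
  by (auto simp: vertex_idx_def vertex_sgn_def split: if_splits)

lemma graph_weight_sym: "reduced_mat n k P \<Longrightarrow> graph_weight n k P u v = graph_weight n k P v u"
  using reduced_matD(3)[of n k P "vertex_idx n u" "vertex_idx n v"] by (auto simp: graph_weight_def vertex_idx_less mult_ac)

lemma graph_weight_bounds:
  assumes "reduced_mat n k P" "0 < k"
  shows "0 \<le> graph_weight n k P u v" "graph_weight n k P u v \<le> 2 * int k"
proof -
  define x where "x = (vertex_sgn n u * vertex_sgn n v * P $$ (vertex_idx n u, vertex_idx n v)) mod int k"
  have "0 \<le> x" "x < int k" using assms(2) by (simp_all add: x_def)
  then show "0 \<le> graph_weight n k P u v" "graph_weight n k P u v \<le> 2 * int k"
    using reduced_matD(1,2)[OF assms(1), of "vertex_idx n u" "vertex_idx n v"] vertex_idx_less[of u n] vertex_idx_less[of v n]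
    unfolding graph_weight_def x_def[symmetric] by auto
qed

lemma graph_weight_mate_iff:
  assumes P: "reduced_mat n k P" and k: "0 < k"
  shows "int k \<le> graph_weight n k P u v \<longleftrightarrow> u < n + n \<and> v < n + n \<and> u \<noteq> v \<and> vertex_idx n u = vertex_idx n v"
proof -
  have "(vertex_sgn n u * vertex_sgn n v * P $$ (vertex_idx n u, vertex_idx n v)) mod int k < int k" using k by simp
  then show ?thesis
    using reduced_matD(1)[OF P, of "vertex_idx n u" "vertex_idx n v"] k vertex_idx_less[of u n] vertex_idx_less[of v n]
    unfolding graph_weight_def by (smt (verit) of_nat_0_less_iff)
qed

text \<open>The vertices act as signed unit vectors: the index moves by \<open>\<sigma>\<close>, the
  sign is multiplied by \<open>\<epsilon>\<close>, and padding vertices stay fixed. The factors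
  \<open>\<epsilon>\<close> in the weights cancel because their squares are 1.\<close>

lemma graph_iso_of_signed_permutation:
  assumes P: "reduced_mat n k P" and Q: "reduced_mat n k Q"
    and \<sigma>: "\<sigma> permutes {..<n}" and \<epsilon>: "\<And>j. j < n \<Longrightarrow> \<epsilon> j = 1 \<or> \<epsilon> j = - (1 :: int)"
    and eq: "\<And>i j. i < n \<Longrightarrow> j < n \<Longrightarrow> int k dvd Q $$ (\<sigma> i, \<sigma> j) - \<epsilon> i * \<epsilon> j * P $$ (i, j)"
  obtains \<pi> where "\<pi> permutes {0..<3 * n}" "\<And>u v. graph_weight n k P u v = graph_weight n k Q (\<pi> u) (\<pi> v)"
proof -
  have \<sigma>n: "\<sigma> l < n" if "l < n" for l using permutes_in_image[OF \<sigma>, of l] that by simp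
  have inj: "\<sigma> i = \<sigma> j \<longleftrightarrow> i = j" for i j using permutes_inj[OF \<sigma>] by (auto dest: injD)
  define \<pi> where "\<pi> v = (if v < n + n then if vertex_sgn n v * \<epsilon> (vertex_idx n v) = 1 then \<sigma> (vertex_idx n v) else n + \<sigma> (vertex_idx n v) else v)" for v
  have \<pi>: "\<pi> v < n + n" "vertex_idx n (\<pi> v) = \<sigma> (vertex_idx n v)" "vertex_sgn n (\<pi> v) = vertex_sgn n v * \<epsilon> (vertex_idx n v)" if v: "v < n + n" for v
    using \<sigma>n[OF vertex_idx_less[OF v]] \<epsilon>[OF vertex_idx_less[OF v]] vertex_sgn_cases[of n v] v
    by (auto simp: \<pi>_def vertex_idx_def[of n "\<sigma> _"] vertex_idx_def[of n "n + _"] vertex_sgn_def[of n "\<sigma> _"] vertex_sgn_def[of n "n + _"])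
  have \<pi>': "\<pi> v = v" if "\<not> v < n + n" for v using that by (simp add: \<pi>_def)
  have \<pi>lt: "\<pi> v < n + n \<longleftrightarrow> v < n + n" for v using \<pi>(1)[of v] \<pi>'[of v] by (cases "v < n + n") simp_all
  have \<pi>inj: "u = v" if "\<pi> u = \<pi> v" for u v
  proof (cases "u < n + n")
    case True
    then have v: "v < n + n" using \<pi>lt that by metis
    have i: "vertex_idx n u = vertex_idx n v" using \<pi>(2)[OF True] \<pi>(2)[OF v] that inj by simp
    have "vertex_sgn n u * \<epsilon> (vertex_idx n u) = vertex_sgn n v * \<epsilon> (vertex_idx n u)" using \<pi>(3)[OF True] \<pi>(3)[OF v] that i by metis
    moreover have "\<epsilon> (vertex_idx n u) \<noteq> 0" using \<epsilon>[OF vertex_idx_less[OF True]] by auto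
    ultimately have "vertex_sgn n u = vertex_sgn n v" by (simp only: mult_cancel_right) simp
    then show ?thesis using vertex_eqI[OF True v i] by simp
  next
    case False
    then have "\<not> v < n + n" using \<pi>lt that by metis
    then show ?thesis using False \<pi>' that by simp
  qed
  have "\<pi> permutes {0..<3 * n}"
  proof (rule bij_imp_permutes)
    have "inj_on \<pi> {0..<3 * n}" using \<pi>inj by (auto simp: inj_on_def)
    moreover have "\<pi> ` {0..<3 * n} \<subseteq> {0..<3 * n}"
    proof (rule image_subsetI)
      fix v assume "v \<in> {0..<3 * n}"
      then show "\<pi> v \<in> {0..<3 * n}" using \<pi>(1)[of v] \<pi>'[of v] by (cases "v < n + n") auto
    qed
    ultimately show "bij_betw \<pi> {0..<3 * n} {0..<3 * n}" by (simp add: bij_betw_def endo_inj_surj)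
  qed (use \<pi>' in auto)
  moreover have "graph_weight n k P u v = graph_weight n k Q (\<pi> u) (\<pi> v)" for u v
  proof (cases "u < n + n \<and> v < n + n \<and> u \<noteq> v")
    case False
    then show ?thesis using \<pi>lt by (auto simp: graph_weight_def)
  next
    case True
    then have uv: "u < n + n" "v < n + n" "u \<noteq> v" by auto
    let ?i = "vertex_idx n u" and ?j = "vertex_idx n v"
    have ij: "?i < n" "?j < n" using uv vertex_idx_less by auto
    have ne: "\<pi> u \<noteq> \<pi> v" using \<pi>inj uv by blast
    note d = eq[OF ij]
    show ?thesis
    proof (cases "?i = ?j")
      case True
      have "\<epsilon> ?j * \<epsilon> ?j = 1" using \<epsilon>[OF ij(2)] by auto
      then have "int k dvd Q $$ (\<sigma> ?j, \<sigma> ?j) - P $$ (?j, ?j)" using d True by simp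
      then have "Q $$ (\<sigma> ?j, \<sigma> ?j) = P $$ (?j, ?j)"
        using reduced_matD[OF Q \<sigma>n \<sigma>n] reduced_matD[OF P] ij by (intro residue_unique[of k]) auto
      then show ?thesis using uv \<pi>(1,2)[OF uv(1)] \<pi>(1,2)[OF uv(2)] ne True by (simp add: graph_weight_def)
    next
      case False
      have "(vertex_sgn n (\<pi> u) * vertex_sgn n (\<pi> v) * Q $$ (\<sigma> ?i, \<sigma> ?j)) mod int k = (vertex_sgn n u * vertex_sgn n v * P $$ (?i, ?j)) mod int k"
      proof -
        let ?s = "vertex_sgn n u * vertex_sgn n v" and ?e = "\<epsilon> ?i * \<epsilon> ?j"
        have e2: "?e * ?e = 1" using \<epsilon>[OF ij(1)] \<epsilon>[OF ij(2)] by auto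
        have "int k dvd ?s * ?e * (Q $$ (\<sigma> ?i, \<sigma> ?j) - ?e * P $$ (?i, ?j))" using d by (rule dvd_mult)
        also have "?s * ?e * (Q $$ (\<sigma> ?i, \<sigma> ?j) - ?e * P $$ (?i, ?j)) =
            ?s * ?e * Q $$ (\<sigma> ?i, \<sigma> ?j) - ?s * (?e * ?e) * P $$ (?i, ?j)" by (simp add: algebra_simps)
        finally have "(?s * ?e * Q $$ (\<sigma> ?i, \<sigma> ?j)) mod int k = (?s * P $$ (?i, ?j)) mod int k"
          unfolding e2 by (simp add: mod_eq_dvd_iff)
        then show ?thesis using \<pi>(3)[OF uv(1)] \<pi>(3)[OF uv(2)] by (simp add: mult_ac)
      qed
      then show ?thesis using uv \<pi>(1,2)[OF uv(1)] \<pi>(1,2)[OF uv(2)] ne False inj by (simp add: graph_weight_def)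
    qed
  qed
  ultimately show ?thesis by (rule that)
qed

text \<open>Weights of at least \<open>k\<close> identify opposite vertices, so every isomorphism
  respects these pairs and is determined on the nonisolated vertices by the image of each
  \<open>e_j\<close>. The index and sign of that image define \<open>\<sigma>\<close> and
  \<open>\<epsilon>\<close>. The last conclusion is the formula by which the program reads the
  signed permutation from the permutation matrix.\<close>

lemma signed_permutation_of_graph_iso:
  assumes P: "reduced_mat n k P" and Q: "reduced_mat n k Q" and k: "0 < k"
    and \<pi>: "\<pi> permutes {0..<3 * n}"
    and eq: "\<And>u v. u < 3 * n \<Longrightarrow> v < 3 * n \<Longrightarrow> graph_weight n k P u v = graph_weight n k Q (\<pi> u) (\<pi> v)"
  obtains \<sigma> \<epsilon> where "\<sigma> permutes {..<n}" "\<And>j. j < n \<Longrightarrow> \<epsilon> j = 1 \<or> \<epsilon> j = - (1 :: int)"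
    "\<And>i j. i < n \<Longrightarrow> j < n \<Longrightarrow> int k dvd Q $$ (\<sigma> i, \<sigma> j) - \<epsilon> i * \<epsilon> j * P $$ (i, j)"
    "\<And>i j. i < n \<Longrightarrow> j < n \<Longrightarrow> (if i = \<sigma> j then \<epsilon> j else 0) = (if i = \<pi> j then 1 else 0) - (if n + i = \<pi> j then 1 else 0)"
proof -
  have mate: "\<pi> u < n + n \<and> \<pi> v < n + n \<and> \<pi> u \<noteq> \<pi> v \<and> vertex_idx n (\<pi> u) = vertex_idx n (\<pi> v)
     \<longleftrightarrow> u < n + n \<and> v < n + n \<and> u \<noteq> v \<and> vertex_idx n u = vertex_idx n v" if "u < 3 * n" "v < 3 * n" for u v
    using graph_weight_mate_iff[OF P k, of u v] graph_weight_mate_iff[OF Q k, of "\<pi> u" "\<pi> v"] eq[OF that] by simp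
  \<comment> \<open>A vertex and its opposite are joined by a heavy edge; so are their images, which
    therefore cannot be padding vertices.\<close>
  have m: "\<pi> i < n + n" "\<pi> (n + i) < n + n" "vertex_idx n (\<pi> (n + i)) = vertex_idx n (\<pi> i)" "\<pi> i \<noteq> \<pi> (n + i)" if "i < n" for i
    using mate[of i "n + i"] that by (auto simp: vertex_idx_def[of n i] vertex_idx_def[of n "n + i"])
  have \<pi>inj: "\<pi> u = \<pi> v \<longleftrightarrow> u = v" for u v using permutes_inj[OF \<pi>] by (auto dest: injD)
  define \<sigma> where "\<sigma> i = (if i < n then vertex_idx n (\<pi> i) else i)" for i
  define \<epsilon> where "\<epsilon> i = vertex_sgn n (\<pi> i)" for i
  have \<sigma>n: "\<sigma> i < n" if "i < n" for i using vertex_idx_less[OF m(1)[OF that]] that by (simp add: \<sigma>_def)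
  have "inj_on \<sigma> {..<n}"
  proof (rule inj_onI, rule ccontr)
    fix i j assume ij: "i \<in> {..<n}" "j \<in> {..<n}" "\<sigma> i = \<sigma> j" "i \<noteq> j"
    then have "vertex_idx n (\<pi> i) = vertex_idx n (\<pi> j)" "\<pi> i \<noteq> \<pi> j" using \<pi>inj by (auto simp: \<sigma>_def)
    then have "vertex_idx n i = vertex_idx n j" using mate[of i j] m(1)[of i] m(1)[of j] ij by auto
    then show False using ij by (simp add: vertex_idx_def)
  qed
  moreover have "\<sigma> ` {..<n} \<subseteq> {..<n}" using \<sigma>n by auto
  ultimately have "bij_betw \<sigma> {..<n} {..<n}" by (simp add: bij_betw_def endo_inj_surj)
  then have \<sigma>: "\<sigma> permutes {..<n}" by (intro bij_imp_permutes) (auto simp: \<sigma>_def)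
  have \<epsilon>: "\<epsilon> j = 1 \<or> \<epsilon> j = - 1" for j using vertex_sgn_cases by (simp add: \<epsilon>_def)
  have d: "int k dvd Q $$ (\<sigma> i, \<sigma> j) - \<epsilon> i * \<epsilon> j * P $$ (i, j)" if ij: "i < n" "j < n" for i j
  proof (cases "i = j")
    case True
    \<comment> \<open>There are no loops in the graph, so the diagonal of the projector is stored in
      the heavy weights and recovered from them.\<close>
    have "int k + P $$ (i, i) = graph_weight n k P i (n + i)" using ij by (simp add: graph_weight_def vertex_idx_def)
    also have "\<dots> = graph_weight n k Q (\<pi> i) (\<pi> (n + i))" using ij by (intro eq) auto
    also have "\<dots> = int k + Q $$ (\<sigma> i, \<sigma> i)" using m[OF ij(1)] ij by (simp add: graph_weight_def \<sigma>_def)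
    finally have "Q $$ (\<sigma> i, \<sigma> i) = P $$ (i, i)" by simp
    moreover have "\<epsilon> i * \<epsilon> i = 1" using \<epsilon>[of i] by auto
    ultimately show ?thesis using True by simp
  next
    case False
    have ne: "\<pi> i \<noteq> \<pi> j" using False \<pi>inj by simp
    have "vertex_idx n (\<pi> i) \<noteq> vertex_idx n (\<pi> j)" using mate[of i j] m(1)[of i] m(1)[of j] ij ne False by (auto simp: vertex_idx_def[of n i] vertex_idx_def[of n j])
    then have 1: "graph_weight n k Q (\<pi> i) (\<pi> j) = (\<epsilon> i * \<epsilon> j * Q $$ (\<sigma> i, \<sigma> j)) mod int k"
      using ne m(1)[OF ij(1)] m(1)[OF ij(2)] ij by (simp add: graph_weight_def \<sigma>_def \<epsilon>_def)
    have 2: "graph_weight n k P i j = P $$ (i, j) mod int k" using ij False by (simp add: graph_weight_def vertex_idx_def vertex_sgn_def)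
    have "int k dvd \<epsilon> i * \<epsilon> j * Q $$ (\<sigma> i, \<sigma> j) - P $$ (i, j)"
      using eq[of i j] ij 1 2 by (simp add: mod_eq_dvd_iff dvd_diff_commute)
    then have "int k dvd \<epsilon> i * \<epsilon> j * (\<epsilon> i * \<epsilon> j * Q $$ (\<sigma> i, \<sigma> j) - P $$ (i, j))" by (rule dvd_mult)
    moreover have "\<epsilon> i * \<epsilon> j * (\<epsilon> i * \<epsilon> j * Q $$ (\<sigma> i, \<sigma> j) - P $$ (i, j)) = Q $$ (\<sigma> i, \<sigma> j) - \<epsilon> i * \<epsilon> j * P $$ (i, j)"
      using \<epsilon>[of i] \<epsilon>[of j] by auto
    ultimately show ?thesis by simp
  qed
  have "(if i = \<sigma> j then \<epsilon> j else 0) = (if i = \<pi> j then 1 else 0) - (if n + i = \<pi> j then 1 else 0)"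
    if "i < n" "j < n" for i j
    using m(1)[OF that(2)] that by (auto simp: \<sigma>_def \<epsilon>_def vertex_idx_def vertex_sgn_def)
  then show ?thesis using that[OF \<sigma> \<epsilon> d] by blast
qed

definition graph_weight_mat :: "nat \<Rightarrow> nat \<Rightarrow> int mat \<Rightarrow> real mat" where
  "graph_weight_mat n k P = mat (3 * n) (3 * n) (\<lambda>(u, v). real_of_int (graph_weight n k P u v))"

text \<open>The complete graph serves as edge set, since an edge of weight 0 and a missing edge give
  the same matrix entry. \<open>Min\<close> and \<open>Max\<close> order an unordered pair; by
  symmetry of the weights the order is immaterial.\<close>

lemma graph_weight_mat_adjacency:
  assumes "reduced_mat n k P"
  obtains E w where "is_graph {0..<3 * n} E" "graph_weight_mat n k P = adjacency_mat (3 * n) E w"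
proof (rule that)
  let ?E = "{e. e \<subseteq> {0..<3 * n} \<and> card e = 2}" and ?w = "\<lambda>e. real_of_int (graph_weight n k P (Min e) (Max e))"
  show "is_graph {0..<3 * n} ?E" by (simp add: is_graph_def)
  show "graph_weight_mat n k P = adjacency_mat (3 * n) ?E ?w"
  proof (rule eq_matI)
    fix u v assume "u < dim_row (adjacency_mat (3 * n) ?E ?w)" "v < dim_col (adjacency_mat (3 * n) ?E ?w)"
    then have uv: "u < 3 * n" "v < 3 * n" by (auto simp: adjacency_mat_def)
    show "graph_weight_mat n k P $$ (u, v) = adjacency_mat (3 * n) ?E ?w $$ (u, v)"
    proof (cases "u = v")
      case True
      then show ?thesis using uv by (simp add: graph_weight_mat_def adjacency_mat_def graph_weight_def)
    next
      case False
      have "graph_weight n k P (min u v) (max u v) = graph_weight n k P u v" using graph_weight_sym[OF assms, of u v] by (simp add: min_def max_def)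
      then show ?thesis using uv False by (simp add: graph_weight_mat_def adjacency_mat_def)
    qed
  qed (auto simp: graph_weight_mat_def adjacency_mat_def)
qed

lemma permutation_mat_conj:
  assumes \<pi>: "\<pi> permutes {0..<N}" and A: "(A :: real mat) \<in> carrier_mat N N"
    and P: "P = mat N N (\<lambda>(i, j). if i = \<pi> j then 1 else 0)" and ij: "i < N" "j < N"
  shows "(transpose_mat P * A * P) $$ (i, j) = A $$ (\<pi> i, \<pi> j)"
proof -
  have \<pi>N: "\<pi> l < N" if "l < N" for l using permutes_in_image[OF \<pi>, of l] that by simp
  have Pc: "P \<in> carrier_mat N N" by (simp add: P)
  have TA: "(transpose_mat P * A) $$ (i, b) = A $$ (\<pi> i, b)" if "b < N" for b
  proof -
    have "(transpose_mat P * A) $$ (i, b) = (\<Sum>a<N. transpose_mat P $$ (i, a) * A $$ (a, b))"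
      by (rule mult_index) (use Pc A ij that in auto)
    also have "\<dots> = (\<Sum>a<N. if a = \<pi> i then A $$ (\<pi> i, b) else 0)" using ij by (intro sum.cong) (auto simp: P)
    finally show ?thesis using \<pi>N[OF ij(1)] by simp
  qed
  have "(transpose_mat P * A * P) $$ (i, j) = (\<Sum>b<N. (transpose_mat P * A) $$ (i, b) * P $$ (b, j))"
    by (rule mult_index) (use Pc A ij in auto)
  also have "\<dots> = (\<Sum>b<N. if b = \<pi> j then A $$ (\<pi> i, \<pi> j) else 0)"
    using ij TA by (intro sum.cong) (auto simp: P simp del: index_mult_mat(1))
  finally show ?thesis using \<pi>N[OF ij(2)] by simp
qed

abbreviation "n3 \<equiv> NAdd n2 nn"

text \<open>Blocks of vertices with equal signs use \<open>e1\<close>, blocks with opposite signs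
  \<open>e2\<close>, where \<open>''C''\<close> holds the residues of \<open>-P\<close>. The factors
  \<open>Kron\<close> and \<open>1 - Kron\<close> replace a case distinction on the diagonal.
  Filling with zeros first takes care of the padding vertices.\<close>

definition BuildGraph :: "string \<Rightarrow> string \<Rightarrow> com" where
  "BuildGraph G P = (let e1 = RMul (RCell P rr ss) (RSub (RNat N1) (RNat (Kron rr ss)));
       e2 = RAdd (RMul (RCell ''C'' rr ss) (RSub (RNat N1) (RNat (Kron rr ss))))
         (RMul (RNat (Kron rr ss)) (RAdd (RNat (NVar ''k'')) (RCell P rr ss)))
     in Seq (PutMod ''C'' nn nn N0 N0 (RSub (RNat N0) (RCell P rr ss)))
       (Seq (Put G n3 n3 N0 N0 (RNat N0)) (Seq (Put G nn nn N0 N0 e1) (Seq (Put G nn nn nn nn e1)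
       (Seq (Put G nn nn N0 nn e2) (Put G nn nn nn N0 e2))))))"

definition build_time :: "nat \<Rightarrow> nat" where
  "build_time N = putmod_time N N N + (put_time (3 * N) (3 * N) + (put_time N N + (put_time N N + (put_time N N + put_time N N))))"

lemma wp_BuildGraph:
  assumes n: "\<nu>0 ''n'' = n" "\<nu>0 ''k'' = k" and nN: "n \<le> N" "0 < k" "k \<le> 2 ^ N"
    and names: "G \<notin> {''C'', ''x'', ''f'', ''c''}" "P \<notin> {''C'', ''x'', ''f'', ''c''}" "G \<noteq> P"
    and red: "reduced_mat n k M" and hP: "\<And>i j. i < n \<Longrightarrow> j < n \<Longrightarrow> \<rho>0 P i j = of_int (M $$ (i, j))"
    and post: "\<And>\<nu> \<rho>. eq_off LoopVars \<nu> \<nu>0 \<Longrightarrow> eq_off {G, ''C'', ''x'', ''f'', ''c''} \<rho> \<rho>0 \<Longrightarrow>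
       read_mat (3 * n) (\<rho> G) = graph_weight_mat n k M \<Longrightarrow> Q (\<nu>, \<rho>)"
  shows "runs zo go (BuildGraph G P) (\<nu>0, \<rho>0) (build_time N) Q"
proof -
  let ?F = "{G, ''C'', ''x'', ''f'', ''c''}"
  note red' = reduced_matD[OF red]
  have nk: "\<nu> ''n'' = n" "\<nu> ''k'' = k" if "eq_off LoopVars \<nu> \<nu>0" for \<nu>
    using eq_offD[OF that, of "''n''"] eq_offD[OF that, of "''k''"] n by auto
  have k2: "real k \<le> 2 ^ N" using nN(3) by (metis of_nat_le_numeral_power_cancel_iff)
  have sub: "eq_off ?F \<rho> \<rho>0" if "eq_off G' \<rho> \<rho>1" "eq_off ?F \<rho>1 \<rho>0" "G' \<subseteq> ?F" for \<rho> \<rho>1 :: rstore and G'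
    by (rule eq_off_trans[OF that(1,2)]) (use that(3) in auto)
  have PF: "\<rho> P = \<rho>0 P" if "eq_off ?F \<rho> \<rho>0" for \<rho> using eq_offD[OF that, of P] names by auto
  let ?a = "\<lambda>r s. real_of_int (if r = s then 0 else M $$ (r, s))"
  let ?b = "\<lambda>r s. real_of_int (if r = s then int k + M $$ (r, s) else (- M $$ (r, s)) mod int k)"
  have e1: "rval (RMul (RCell P rr ss) (RSub (RNat N1) (RNat (Kron rr ss)))) (\<nu>, \<rho>) = ?a i j"
    if "i < n" "j < n" "\<nu> ''r'' = i" "\<nu> ''s'' = j" "eq_off {G} \<rho> \<rho>1" "\<rho>1 P = \<rho>0 P" for i j \<nu> and \<rho> \<rho>1 :: rstore
  proof -
    have "\<rho> P = \<rho>0 P" using eq_offD[OF that(5), of P] that(6) names by auto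
    then show ?thesis using that hP by (simp add: kron_def)
  qed
  have e2: "rval (RAdd (RMul (RCell ''C'' rr ss) (RSub (RNat N1) (RNat (Kron rr ss))))
         (RMul (RNat (Kron rr ss)) (RAdd (RNat (NVar ''k'')) (RCell P rr ss)))) (\<nu>, \<rho>) = ?b i j"
    if "i < n" "j < n" "\<nu> ''r'' = i" "\<nu> ''s'' = j" "eq_off {G} \<rho> \<rho>1" "\<rho>1 P = \<rho>0 P" "\<nu> ''k'' = k"
      "\<And>i j. i < n \<Longrightarrow> j < n \<Longrightarrow> \<rho>1 ''C'' i j = of_int ((- M $$ (i, j)) mod int k)" for i j \<nu> and \<rho> \<rho>1 :: rstore
  proof -
    have "\<rho> P = \<rho>0 P" "\<rho> ''C'' = \<rho>1 ''C''"
      using eq_offD[OF that(5), of P] eq_offD[OF that(5), of "''C''"] that(6) names by auto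
    then show ?thesis using that hP by (simp add: kron_def)
  qed
  show ?thesis unfolding BuildGraph_def build_time_def Let_def
  proof (rule runs_Seq, rule wp_PutMod[where a' = n and b' = n and p' = 0 and q' = 0 and k = k
      and val = "\<lambda>i j. - M $$ (i, j)"], goal_cases)
    case (1 \<nu>)
    then show ?case using nk[OF 1] by simp
  next
    case (2 i j \<nu> \<rho>)
    then show ?case using hP[OF 2(1,2)] eq_offD[OF 2(6), of P] names by auto
  next
    case (3 i j)
    have "\<bar>real_of_int (- M $$ (i, j))\<bar> \<le> real k" using red'(1,2)[OF 3] by linarith
    then show ?case using k2 by linarith
  next
    case (9 \<nu>1 \<rho>1)
    have f1: "eq_off ?F \<rho>1 \<rho>0" by (rule eq_off_mono[OF 9(2)]) auto
    note C1 = 9(3)[unfolded add_0]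
    note v1 = 9(1)
    show ?case
    proof (rule runs_Seq, rule wp_Put[where a' = "3 * n" and b' = "3 * n" and p' = 0 and q' = 0
       and val = "\<lambda>i j. 0"], goal_cases)
      case (1 \<nu>)
      then show ?case using nk[OF eq_off_trans_same[OF 1 v1]] by simp
    next
      case (5 \<nu>2 \<rho>2)
      have f2: "eq_off ?F \<rho>2 \<rho>0" by (rule sub[OF 5(2) f1]) auto
      have v2: "eq_off LoopVars \<nu>2 \<nu>0" by (rule eq_off_trans_same[OF 5(1) v1])
      have C2: "\<rho>2 ''C'' = \<rho>1 ''C''" using eq_offD[OF 5(2), of "''C''"] names by auto
      note G2 = 5(3)[unfolded add_0]
      show ?case
      proof (rule runs_Seq, rule wp_Put[where a' = n and b' = n and p' = 0 and q' = 0 and val = ?a], goal_cases)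
        case (1 \<nu>)
        then show ?case using nk[OF eq_off_trans_same[OF 1 v2]] by simp
      next
        case (2 i j \<nu> \<rho>)
        then show ?case by (intro e1[OF 2(1-4) 2(6) PF[OF f2]])
      next
        case (5 \<nu>3 \<rho>3)
        have f3: "eq_off ?F \<rho>3 \<rho>0" by (rule sub[OF 5(2) f2]) auto
        have v3: "eq_off LoopVars \<nu>3 \<nu>0" by (rule eq_off_trans_same[OF 5(1) v2])
        have C3: "\<rho>3 ''C'' = \<rho>1 ''C''" using eq_offD[OF 5(2), of "''C''"] names C2 by auto
        note G3 = 5(3)[unfolded add_0] 5(4)[unfolded add_0]
        show ?case
        proof (rule runs_Seq, rule wp_Put[where a' = n and b' = n and p' = n and q' = n and val = ?a], goal_cases)
          case (1 \<nu>)
          then show ?case using nk[OF eq_off_trans_same[OF 1 v3]] by simp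
        next
          case (2 i j \<nu> \<rho>)
          then show ?case by (intro e1[OF 2(1-4) 2(6) PF[OF f3]])
        next
          case (5 \<nu>4 \<rho>4)
          have f4: "eq_off ?F \<rho>4 \<rho>0" by (rule sub[OF 5(2) f3]) auto
          have v4: "eq_off LoopVars \<nu>4 \<nu>0" by (rule eq_off_trans_same[OF 5(1) v3])
          have C4: "\<rho>4 ''C'' = \<rho>1 ''C''" using eq_offD[OF 5(2), of "''C''"] names C3 by auto
          note G4 = 5(3) 5(4)
          show ?case
          proof (rule runs_Seq, rule wp_Put[where a' = n and b' = n and p' = 0 and q' = n and val = ?b], goal_cases)
            case (1 \<nu>)
            then show ?case using nk[OF eq_off_trans_same[OF 1 v4]] by simp
          next
            case (2 i j \<nu> \<rho>)
            show ?case
              by (rule e2[OF 2(1-4) 2(6) PF[OF f4] nk(2)[OF eq_off_trans_same[OF 2(5) v4]]]) (use C1 C4 in simp)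
          next
            case (5 \<nu>5 \<rho>5)
            have f5: "eq_off ?F \<rho>5 \<rho>0" by (rule sub[OF 5(2) f4]) auto
            have v5: "eq_off LoopVars \<nu>5 \<nu>0" by (rule eq_off_trans_same[OF 5(1) v4])
            have C5: "\<rho>5 ''C'' = \<rho>1 ''C''" using eq_offD[OF 5(2), of "''C''"] names C4 by auto
            note G5 = 5(3)[unfolded add_0] 5(4)[unfolded add_0]
            show ?case
            proof (rule wp_Put[where a' = n and b' = n and p' = n and q' = 0 and val = ?b], goal_cases)
              case (1 \<nu>)
              then show ?case using nk[OF eq_off_trans_same[OF 1 v5]] by simp
            next
              case (2 i j \<nu> \<rho>)
              show ?case
                by (rule e2[OF 2(1-4) 2(6) PF[OF f5] nk(2)[OF eq_off_trans_same[OF 2(5) v5]]]) (use C1 C5 in simp)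
            next
              case (5 \<nu>6 \<rho>6)
              note G6 = 5(3)[unfolded add_0] 5(4)[unfolded add_0]
              have "\<rho>6 G u v = real_of_int (graph_weight n k M u v)" if uv: "u < 3 * n" "v < 3 * n" for u v
              proof -
                have out: "\<rho>6 G u v = 0" if o: "\<not> (u < n + n \<and> v < n + n)"
                proof -
                  have "\<rho>6 G u v = \<rho>5 G u v" by (rule G6(2)) (use o in auto)
                  also have "\<dots> = \<rho>4 G u v" by (rule G5(2)) (use o in auto)
                  also have "\<dots> = \<rho>3 G u v" by (rule G4(2)) (use o in auto)
                  also have "\<dots> = \<rho>2 G u v" by (rule G3(2)) (use o in auto)
                  also have "\<dots> = 0" by (rule G2[OF uv])
                  finally show ?thesis .
                qed
                consider "u < n" "v < n" | "n \<le> u" "u < n + n" "n \<le> v" "v < n + n" | "u < n" "n \<le> v" "v < n + n"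
                  | "n \<le> u" "u < n + n" "v < n" | "\<not> (u < n + n \<and> v < n + n)" by linarith
                then show ?thesis
                proof cases
                  case 1
                  have "\<rho>6 G u v = \<rho>5 G u v" by (rule G6(2)) (use 1 in auto)
                  also have "\<dots> = \<rho>4 G u v" by (rule G5(2)) (use 1 in auto)
                  also have "\<dots> = \<rho>3 G u v" by (rule G4(2)) (use 1 in auto)
                  also have "\<dots> = ?a u v" by (rule G3(1)[OF 1])
                  finally show ?thesis using 1 red'(1,2)[OF 1] by (auto simp: graph_weight_def vertex_idx_def vertex_sgn_def)
                next
                  case 2
                  then have ab: "u - n < n" "v - n < n" by auto
                  have "\<rho>6 G u v = \<rho>5 G u v" by (rule G6(2)) (use 2 in auto)
                  also have "\<dots> = \<rho>4 G u v" by (rule G5(2)) (use 2 in auto)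
                  also have "\<dots> = ?a (u - n) (v - n)" using G4(1)[OF ab] 2 by simp
                  finally show ?thesis using 2 red'(1,2)[OF ab] by (auto simp: graph_weight_def vertex_idx_def vertex_sgn_def)
                next
                  case 3
                  then have b: "v - n < n" by auto
                  have "\<rho>6 G u v = \<rho>5 G u v" by (rule G6(2)) (use 3 in auto)
                  also have "\<dots> = ?b u (v - n)" using G5(1)[OF 3(1) b] 3 by simp
                  finally show ?thesis using 3 by (auto simp: graph_weight_def vertex_idx_def vertex_sgn_def)
                next
                  case 4
                  then have a: "u - n < n" by auto
                  have "\<rho>6 G u v = ?b (u - n) v" using G6(1)[OF a 4(3)] 4 by simp
                  then show ?thesis using 4 by (auto simp: graph_weight_def vertex_idx_def vertex_sgn_def)
                next
                  case 5
                  then show ?thesis using out by (auto simp: graph_weight_def)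
                qed
              qed
              then have "read_mat (3 * n) (\<rho>6 G) = graph_weight_mat n k M" by (intro eq_matI) (auto simp: read_mat_def graph_weight_mat_def)
              moreover have "eq_off ?F \<rho>6 \<rho>0" by (rule sub[OF 5(2) f5]) auto
              moreover have "eq_off LoopVars \<nu>6 \<nu>0" by (rule eq_off_trans_same[OF 5(1) v5])
              ultimately show ?case using post by blast
            qed (use nN in auto)
          qed (use nN in auto)
        qed (use nN in auto)
      qed (use nN in auto)
    qed (use nN in auto)
  qed (use nk[OF eq_off_refl] nN names in auto)
qed

section \<open>The reduction\<close>

text \<open>The isomorphism \<open>\<pi>\<close> returned by the oracle sends \<open>e\<^sub>s\<close> to \<open>e\<^sub>r\<close> or \<open>- e\<^sub>r\<close>, so \<open>M\<close> is the signed
  permutation matrix underlying \<open>\<pi>\<close>.\<close>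

definition ReduceLIP :: com where
  "ReduceLIP = Seq (ReduceBasis ''B1'' ''Q1'' ''P1'') (Seq (ReduceBasis ''B2'' ''Q2'' ''P2'')
     (Seq (BuildGraph ''G1'' ''P1'') (Seq (BuildGraph ''G2'' ''P2'')
     (Seq (GI_Call ''g'' ''S'' ''G1'' ''G2'' n3)
     (Seq (Put ''M'' nn nn N0 N0 (RSub (RCell ''S'' rr ss) (RCell ''S'' (NAdd nn rr) ss)))
     (Seq (Transp ''Mt'' ''M'') (Seq (MatMul ''U'' ''Q1'' ''Mt'') (Seq (Transp ''Qt'' ''Q2'') (MatMul ''O'' ''U'' ''Qt'')))))))))"

text \<open>There are two matrices of dimension at most \<open>3 * N\<close> with entries at most
  \<open>2 ^ (N + 1)\<close>, which \<open>mat_size_le\<close> turns into \<open>N + 3\<close> per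
  entry.\<close>

definition gi_time :: "nat \<Rightarrow> nat" where "gi_time N = 2 * (3 * N * (3 * N) * (N + 3)) + 1"

definition main_time :: "nat \<Rightarrow> nat" where
  "main_time N = reduce_time N + (reduce_time N + (build_time N + (build_time N + (gi_time N + (put_time N N + (put_time N N + (mult_time N + (put_time N N + mult_time N))))))))"

lemma poly_bounded_main_time: "poly_bounded main_time"
proof -
  have "poly_bounded (\<lambda>N. main_time N)"
    unfolding main_time_def reduce_time_def build_time_def gi_time_def put_time_def mult_time_def putmod_time_def inverse_time_def hermite_time_def solve_time_def
      clear_row_time_def subcol_time_def swap_time_def zlip_time_def
    by (intro poly_bounded_intros)
  then show ?thesis by simp
qed

lemma mat_image_change_basis:
  assumes Q': "Q' \<in> carrier_mat n n" and S: "S \<in> carrier_mat n n" and Q: "Q = Q' * rm S"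
    and \<Lambda>: "\<Lambda> \<subseteq> carrier_vec n"
  shows "mat_image Q (rv ` \<Lambda>) = mat_image Q' (rv ` ((\<lambda>x. S *\<^sub>v x) ` \<Lambda>))"
proof -
  have "Q *\<^sub>v rv x = Q' *\<^sub>v rv (S *\<^sub>v x)" if "x \<in> \<Lambda>" for x
  proof -
    have x: "x \<in> carrier_vec n" using that \<Lambda> by blast
    have "Q *\<^sub>v rv x = Q' *\<^sub>v (rm S *\<^sub>v rv x)"
      unfolding Q by (rule assoc_mult_mat_vec[OF Q' _]) (use S x in auto)
    then show ?thesis using rm_mult_vec[OF S x] by simp
  qed
  then show ?thesis unfolding mat_image_def image_image by (intro image_cong refl) auto
qed

lemma graph_weight_mat_size:
  assumes P: "reduced_mat n k P" and k: "0 < k" "k \<le> 2 ^ N" and n: "n \<le> N"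
  shows "mat_size (graph_weight_mat n k P) \<le> real (3 * N * (3 * N) * (N + 3))"
proof -
  have "mat_size (graph_weight_mat n k P) \<le> real (3 * n * (3 * n) * ((N + 1) + 2))"
  proof (rule mat_size_le)
    show "graph_weight_mat n k P \<in> carrier_mat (3 * n) (3 * n)" by (simp add: graph_weight_mat_def)
    fix i j assume ij: "i < 3 * n" "j < 3 * n"
    have "real k \<le> 2 ^ N" using k(2) by (metis of_nat_le_numeral_power_cancel_iff)
    moreover have "\<bar>real_of_int (graph_weight n k P i j)\<bar> \<le> 2 * real k" using graph_weight_bounds[OF P k(1), of i j] by linarith
    ultimately have "\<bar>real_of_int (graph_weight n k P i j)\<bar> \<le> 2 * 2 ^ N" by linarith
    then show "\<bar>graph_weight_mat n k P $$ (i, j)\<bar> \<le> 2 ^ (N + 1)" using ij by (simp add: graph_weight_mat_def)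
  qed
  also have "\<dots> \<le> real (3 * N * (3 * N) * (N + 3))"
    using n by (intro of_nat_mono mult_le_mono) auto
  finally show ?thesis .
qed

lemma projector_reduced:
  assumes \<Lambda>: "lcd_lattice n k \<Lambda>" and P: "projector n k \<Lambda> P"
    and b: "\<And>i j. i < n \<Longrightarrow> j < n \<Longrightarrow> 0 \<le> P $$ (i, j) \<and> P $$ (i, j) < int k"
  shows "reduced_mat n k P"
  unfolding reduced_mat_def
  using b residue_unique[OF lcd_lattice.projector_symmetric[OF \<Lambda> P]] by blast

text \<open>Since an isomorphism exists, \<open>None\<close> is not a correct answer. The
  permutation \<open>\<pi>'\<close> that is returned may differ from \<open>\<pi>\<close>, so only
  its compatibility with the weights is recorded.\<close>

lemma GI_oracle_graph_weight_mat:
  assumes go: "GI_oracle (3 * n) go" and P: "reduced_mat n k P" and Q: "reduced_mat n k Q"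
    and \<pi>: "\<pi> permutes {0..<3 * n}" and eq: "\<And>u v. graph_weight n k P u v = graph_weight n k Q (\<pi> u) (\<pi> v)"
  obtains M \<pi>' where "go (graph_weight_mat n k P) (graph_weight_mat n k Q) = Some M" "\<pi>' permutes {0..<3 * n}"
    "M = mat (3 * n) (3 * n) (\<lambda>(i, j). if i = \<pi>' j then 1 else 0)"
    "\<And>u v. u < 3 * n \<Longrightarrow> v < 3 * n \<Longrightarrow> graph_weight n k P u v = graph_weight n k Q (\<pi>' u) (\<pi>' v)"
proof -
  let ?A = "graph_weight_mat n k P" and ?B = "graph_weight_mat n k Q"
  obtain E1 w1 where 1: "is_graph {0..<3 * n} E1" "?A = adjacency_mat (3 * n) E1 w1" by (rule graph_weight_mat_adjacency[OF P])
  obtain E2 w2 where 2: "is_graph {0..<3 * n} E2" "?B = adjacency_mat (3 * n) E2 w2" by (rule graph_weight_mat_adjacency[OF Q])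
  have Bc: "?B \<in> carrier_mat (3 * n) (3 * n)" by (simp add: graph_weight_mat_def)
  have ent: "graph_weight_mat n k R $$ (u, v) = real_of_int (graph_weight n k R u v)" if "u < 3 * n" "v < 3 * n" for R u v
    using that by (simp add: graph_weight_mat_def)
  let ?P = "mat (3 * n) (3 * n) (\<lambda>(i, j). if i = \<pi> j then 1 else (0 :: real))"
  have "?A = transpose_mat ?P * ?B * ?P"
  proof (rule eq_matI)
    fix u v assume "u < dim_row (transpose_mat ?P * ?B * ?P)" "v < dim_col (transpose_mat ?P * ?B * ?P)"
    then have uv: "u < 3 * n" "v < 3 * n" by auto
    have "\<pi> u < 3 * n" "\<pi> v < 3 * n" using permutes_in_image[OF \<pi>] uv by auto
    then show "?A $$ (u, v) = (transpose_mat ?P * ?B * ?P) $$ (u, v)"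
      unfolding permutation_mat_conj[OF \<pi> Bc refl uv] using ent uv eq by simp
  qed (auto simp: graph_weight_mat_def)
  then have iso: "graph_iso_by (3 * n) ?A ?B ?P" using \<pi> by (auto simp: graph_iso_by_def permutation_mat_def)
  have go': "case go ?A ?B of None \<Rightarrow> \<not> (\<exists>P. graph_iso_by (3 * n) ?A ?B P) | Some P \<Rightarrow> graph_iso_by (3 * n) ?A ?B P"
    using go 1 2 unfolding GI_oracle_def Let_def by metis
  then obtain M where M: "go ?A ?B = Some M" "graph_iso_by (3 * n) ?A ?B M"
    using iso by (cases "go ?A ?B") auto
  then obtain \<pi>' where \<pi>': "\<pi>' permutes {0..<3 * n}" "M = mat (3 * n) (3 * n) (\<lambda>(i, j). if i = \<pi>' j then 1 else 0)"
    "?A = transpose_mat M * ?B * M" by (auto simp: graph_iso_by_def permutation_mat_def)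
  have "graph_weight n k P u v = graph_weight n k Q (\<pi>' u) (\<pi>' v)" if uv: "u < 3 * n" "v < 3 * n" for u v
  proof -
    have "\<pi>' u < 3 * n" "\<pi>' v < 3 * n" using permutes_in_image[OF \<pi>'(1)] uv by auto
    moreover have "?A $$ (u, v) = ?B $$ (\<pi>' u, \<pi>' v)"
      by (subst \<pi>'(3)) (rule permutation_mat_conj[OF \<pi>'(1) Bc \<pi>'(2) uv])
    ultimately show ?thesis using ent uv by simp
  qed
  then show ?thesis by (rule that[OF M(1) \<pi>'(1,2)])
qed

lemma runs_ReduceLIP:
  assumes zo: "ZLIP_oracle n zo" and go: "GI_oracle (3 * n) go" and k: "0 < k" and nN: "n \<le> N" "1 \<le> N" "k \<le> 2 ^ N"
    and \<Lambda>: "lcd_lattice n k \<Lambda>" and O: "orthonormal_mat n O1" "orthonormal_mat n O2"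
    and B1: "B1 \<in> carrier_mat n n" "column_lattice B1 = mat_image O1 (rv ` \<Lambda>)"
      "\<And>i j. i < n \<Longrightarrow> j < n \<Longrightarrow> \<bar>B1 $$ (i, j)\<bar> \<le> 2 ^ N"
    and B2: "B2 \<in> carrier_mat n n" "column_lattice B2 = mat_image O2 (rv ` \<Lambda>)"
      "\<And>i j. i < n \<Longrightarrow> j < n \<Longrightarrow> \<bar>B2 $$ (i, j)\<bar> \<le> 2 ^ N"
  shows "runs zo go ReduceLIP (init_state n k B1 B2) (main_time N)
     (\<lambda>s. LIP_solution n (mat_image O1 (rv ` \<Lambda>)) (mat_image O2 (rv ` \<Lambda>)) (result_mat n s))"
proof -
  interpret lcd_lattice n k \<Lambda> by fact
  have \<Lambda>c: "\<Lambda> \<subseteq> carrier_vec n" using carrier by blast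
  obtain H1 where H1: "H1 \<in> carrier_mat n n" "B1 = O1 * rm H1" "\<Lambda> = {H1 *\<^sub>v z | z. z \<in> carrier_vec n}"
    by (rule column_lattice_image[OF O(1) \<Lambda>c B1(1,2)])
  obtain H2 where H2: "H2 \<in> carrier_mat n n" "B2 = O2 * rm H2" "\<Lambda> = {H2 *\<^sub>v z | z. z \<in> carrier_vec n}"
    by (rule column_lattice_image[OF O(2) \<Lambda>c B2(1,2)])
  have bas1: "lcd_basis n k \<Lambda> H1" by unfold_locales (rule H1)+
  have bas2: "lcd_basis n k \<Lambda> H2" by unfold_locales (rule H2)+
  define \<nu>0 where "\<nu>0 = ((\<lambda>x. 0)(''n'' := n, ''k'' := k) :: nstore)"
  define \<rho>0 where "\<rho>0 = ((\<lambda>X i j. 0)(''B1'' := write_mat n B1 (\<lambda>i j. 0), ''B2'' := write_mat n B2 (\<lambda>i j. 0)) :: rstore)"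
  have init: "init_state n k B1 B2 = (\<nu>0, \<rho>0)" by (simp add: init_state_def \<nu>0_def \<rho>0_def)
  have n0: "\<nu>0 ''n'' = n" "\<nu>0 ''k'' = k" by (simp_all add: \<nu>0_def)
  have hB1: "holds n (\<rho>0 ''B1'') B1" and hB2: "holds n (\<rho>0 ''B2'') B2"
    by (simp_all add: \<rho>0_def holds_def write_mat_def)
  have nk: "\<nu> ''n'' = n" "\<nu> ''k'' = k" if "eq_off ReduceIdx \<nu> \<nu>0" for \<nu>
    using eq_offD[OF that, of "''n''"] eq_offD[OF that, of "''k''"] n0 by auto
  have V: "eq_off ReduceIdx \<nu> \<nu>0" if "eq_off LoopVars \<nu> \<nu>1" "eq_off ReduceIdx \<nu>1 \<nu>0" for \<nu> \<nu>1 by (rule eq_off_trans[OF that]) auto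
  have keep: "\<rho> x = \<rho>1 x" if "eq_off G \<rho> \<rho>1" "x \<notin> G" for \<rho> \<rho>1 :: rstore and G x by (rule eq_offD[OF that])
  show ?thesis unfolding init ReduceLIP_def main_time_def
  proof (rule runs_Seq, rule wp_ReduceBasis[OF zo k nN, where ?\<nu>0.0 = \<nu>0 and ?\<rho>0.0 = \<rho>0 and \<Lambda> = \<Lambda> and H = H1 and Q = O1 and B = B1], goal_cases)
    case (14 \<nu>1 \<rho>1 Q1 S1 P1)
    note e1 = 14(1) and Q1 = 14(3) and hQ1 = 14(4) and S1 = 14(5,6) and pr1 = 14(7) and hP1 = 14(8)
    have hB2': "holds n (\<rho>1 ''B2'') B2" using keep[OF 14(2), of "''B2''"] hB2 by simp
    let ?\<Lambda>1 = "(\<lambda>x. S1 *\<^sub>v x) ` \<Lambda>"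
    have \<Lambda>1: "lcd_lattice n k ?\<Lambda>1" by (rule lcd_lattice_image[OF \<Lambda> S1(1)])
    have red1: "reduced_mat n k P1" by (rule projector_reduced[OF \<Lambda>1 pr1]) (use hP1 in blast)
    show ?case
    proof (rule runs_Seq, rule wp_ReduceBasis[OF zo k nN, where ?\<nu>0.0 = \<nu>1 and ?\<rho>0.0 = \<rho>1 and \<Lambda> = \<Lambda> and H = H2 and Q = O2 and B = B2], goal_cases)
      case (14 \<nu>2 \<rho>2 Q2 S2 P2)
      note e2 = eq_off_trans_same[OF 14(1) e1] and Q2 = 14(3) and hQ2 = 14(4) and S2 = 14(5,6) and pr2 = 14(7) and hP2 = 14(8)
      have k2: "\<rho>2 ''Q1'' = \<rho>1 ''Q1''" "\<rho>2 ''P1'' = \<rho>1 ''P1''" using keep[OF 14(2)] by simp_all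
      let ?\<Lambda>2 = "(\<lambda>x. S2 *\<^sub>v x) ` \<Lambda>"
      have \<Lambda>2: "lcd_lattice n k ?\<Lambda>2" by (rule lcd_lattice_image[OF \<Lambda> S2(1)])
      have red2: "reduced_mat n k P2" by (rule projector_reduced[OF \<Lambda>2 pr2]) (use hP2 in blast)
      show ?case
      proof (rule runs_Seq, rule wp_BuildGraph[where ?\<nu>0.0 = \<nu>2 and M = P1, OF nk[OF e2] nN(1) k nN(3)], goal_cases)
        case 4
        show ?case by (rule red1)
      next
        case (5 i j)
        then show ?case using hP1 k2 by simp
      next
        case (6 \<nu>3 \<rho>3)
        note G1 = 6(3) and e3 = V[OF 6(1) e2]
        have k3: "\<rho>3 ''Q1'' = \<rho>1 ''Q1''" "\<rho>3 ''Q2'' = \<rho>2 ''Q2''" "\<rho>3 ''P2'' = \<rho>2 ''P2''" using keep[OF 6(2)] k2 by simp_all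
        show ?case
        proof (rule runs_Seq, rule wp_BuildGraph[where ?\<nu>0.0 = \<nu>3 and M = P2, OF nk[OF e3] nN(1) k nN(3)], goal_cases)
          case 4
          show ?case by (rule red2)
        next
          case (5 i j)
          then show ?case using hP2 k3 by simp
        next
          case (6 \<nu>4 \<rho>4)
          note G2 = 6(3) and e4 = V[OF 6(1) e3]
          have k4: "\<rho>4 ''Q1'' = \<rho>1 ''Q1''" "\<rho>4 ''Q2'' = \<rho>2 ''Q2''" "\<rho>4 ''G1'' = \<rho>3 ''G1''" using keep[OF 6(2)] k3 by simp_all
          \<comment> \<open>Both integral lattices are images of the same \<open>\<Lambda>\<close>,
            so \<open>S2 S1^T\<close> maps one to the other. It serves only to show that the graphs
            are isomorphic.\<close>
          let ?T = "S2 * transpose_mat S1"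
          note S1c = orth_intD(1)[OF S1(1)] and S2c = orth_intD(1)[OF S2(1)]
          have T: "orth_int n ?T" by (intro orth_int_mult orth_int_transpose S1(1) S2(1))
          have T12: "(\<lambda>x. ?T *\<^sub>v x) ` ?\<Lambda>1 = ?\<Lambda>2"
          proof -
            have "?T *\<^sub>v (S1 *\<^sub>v x) = S2 *\<^sub>v x" if "x \<in> \<Lambda>" for x
            proof -
              have x: "x \<in> carrier_vec n" using carrier[OF that] .
              have "?T *\<^sub>v (S1 *\<^sub>v x) = S2 *\<^sub>v (transpose_mat S1 *\<^sub>v (S1 *\<^sub>v x))"
                by (rule assoc_mult_mat_vec[OF S2c]) (use S1c x in auto)
              then show ?thesis using orth_int_mult_vec(1)[OF S1(1) x] by simp
            qed
            then show ?thesis unfolding image_image by (intro image_cong refl) auto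
          qed
          obtain \<sigma> \<epsilon> where \<sigma>: "\<sigma> permutes {..<n}" "\<And>j. j < n \<Longrightarrow> \<epsilon> j = 1 \<or> \<epsilon> j = - (1 :: int)"
            "\<And>i j. i < n \<Longrightarrow> j < n \<Longrightarrow> ?T $$ (i, j) = (if i = \<sigma> j then \<epsilon> j else 0)"
            using orth_int_signed_permutation[OF T] by blast
          have rel: "int k dvd P2 $$ (\<sigma> i, \<sigma> j) - \<epsilon> i * \<epsilon> j * P1 $$ (i, j)" if "i < n" "j < n" for i j
            by (rule projector_signed_permutation[OF \<Lambda>1 T pr1 _ \<sigma> that]) (use pr2 T12 in simp_all)
          obtain \<pi> where \<pi>: "\<pi> permutes {0..<3 * n}" "\<And>u v. graph_weight n k P1 u v = graph_weight n k P2 (\<pi> u) (\<pi> v)"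
            using graph_iso_of_signed_permutation[OF red1 red2 \<sigma>(1,2) rel] by blast
          obtain Pm \<pi>' where go': "go (graph_weight_mat n k P1) (graph_weight_mat n k P2) = Some Pm" and \<pi>': "\<pi>' permutes {0..<3 * n}"
            and Pm: "Pm = mat (3 * n) (3 * n) (\<lambda>(i, j). if i = \<pi>' j then 1 else 0)"
            and eq': "\<And>u v. u < 3 * n \<Longrightarrow> v < 3 * n \<Longrightarrow> graph_weight n k P1 u v = graph_weight n k P2 (\<pi>' u) (\<pi>' v)"
            using GI_oracle_graph_weight_mat[OF go red1 red2 \<pi>] by blast
          obtain \<sigma>' \<epsilon>' where \<sigma>': "\<sigma>' permutes {..<n}" "\<And>j. j < n \<Longrightarrow> \<epsilon>' j = 1 \<or> \<epsilon>' j = - (1 :: int)"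
            "\<And>i j. i < n \<Longrightarrow> j < n \<Longrightarrow> int k dvd P2 $$ (\<sigma>' i, \<sigma>' j) - \<epsilon>' i * \<epsilon>' j * P1 $$ (i, j)"
            and ent: "\<And>i j. i < n \<Longrightarrow> j < n \<Longrightarrow> (if i = \<sigma>' j then \<epsilon>' j else 0) = (if i = \<pi>' j then 1 else 0) - (if n + i = \<pi>' j then 1 else 0)"
            by (rule signed_permutation_of_graph_iso[OF red1 red2 k \<pi>' eq']) blast+
          \<comment> \<open>The signed permutation read from the oracle's answer, in general
            different from \<open>S2 S1^T\<close>; \<open>signed_permutation_lattice\<close> shows
            that it relates the lattices as well.\<close>
          define Sg where "Sg = mat n n (\<lambda>(i, j). if i = \<sigma>' j then \<epsilon>' j else 0)"
          have Sg: "orth_int n Sg" "\<And>x. x \<in> carrier_vec n \<Longrightarrow> Sg *\<^sub>v x \<in> ?\<Lambda>2 \<longleftrightarrow> x \<in> ?\<Lambda>1"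
            using signed_permutation_lattice[OF \<Lambda>1 \<Lambda>2 pr1 pr2 \<sigma>'(1,2) Sg_def \<sigma>'(3)] by auto
          have Sgc: "Sg \<in> carrier_mat n n" by (simp add: Sg_def)
          let ?\<rho>5 = "\<rho>4(''S'' := write_mat (3 * n) Pm (\<rho>4 ''S''))" and ?\<nu>5 = "\<nu>4(''g'' := 1)"
          have e5: "?\<nu>5 ''n'' = n" using nk[OF e4] by simp
          have "exec zo go (GI_Call ''g'' ''S'' ''G1'' ''G2'' n3) (\<nu>4, \<rho>4)
              (nat \<lceil>mat_size (graph_weight_mat n k P1) + mat_size (graph_weight_mat n k P2)\<rceil> + 1) (?\<nu>5, ?\<rho>5)"
            by (rule exec_GI_Some[where go = go, OF _ _ _ go']) (use G1 G2 k4 nk[OF e4] in \<open>auto simp: mult.commute numeral_3_eq_3\<close>)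
          moreover have "nat \<lceil>mat_size (graph_weight_mat n k P1) + mat_size (graph_weight_mat n k P2)\<rceil> + 1 \<le> gi_time N"
          proof -
            have "mat_size (graph_weight_mat n k P1) + mat_size (graph_weight_mat n k P2) \<le> real (2 * (3 * N * (3 * N) * (N + 3)))"
              using graph_weight_mat_size[OF red1 k nN(3,1)] graph_weight_mat_size[OF red2 k nN(3,1)] by simp
            then have "\<lceil>mat_size (graph_weight_mat n k P1) + mat_size (graph_weight_mat n k P2)\<rceil> \<le> int (2 * (3 * N * (3 * N) * (N + 3)))"
              by (simp add: ceiling_le_iff)
            then show ?thesis unfolding gi_time_def by linarith
          qed
          ultimately have gi: "runs zo go (GI_Call ''g'' ''S'' ''G1'' ''G2'' n3) (\<nu>4, \<rho>4) (gi_time N) (\<lambda>s. s = (?\<nu>5, ?\<rho>5))"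
            unfolding runs_def by blast
          have hQ1': "holds n (?\<rho>5 ''Q1'') Q1" and hQ2': "holds n (?\<rho>5 ''Q2'') Q2" using k4 hQ1 hQ2 by simp_all
          have S5: "?\<rho>5 ''S'' u v = Pm $$ (u, v)" if "u < 3 * n" "v < 3 * n" for u v using that by (simp add: write_mat_def)
          note Q1c = orthonormal_matD(1)[OF Q1] and Q2c = orthonormal_matD(1)[OF Q2]
          have nl: "\<nu> ''n'' = n" if "eq_off LoopVars \<nu> \<nu>'" "\<nu>' ''n'' = n" for \<nu> \<nu>' using eq_offD[OF that(1), of "''n''"] that(2) by simp
          have rest: "runs zo go (Seq (Put ''M'' nn nn N0 N0 (RSub (RCell ''S'' rr ss) (RCell ''S'' (NAdd nn rr) ss)))
              (Seq (Transp ''Mt'' ''M'') (Seq (MatMul ''U'' ''Q1'' ''Mt'') (Seq (Transp ''Qt'' ''Q2'') (MatMul ''O'' ''U'' ''Qt''))))) (?\<nu>5, ?\<rho>5)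
              (put_time N N + (put_time N N + (mult_time N + (put_time N N + mult_time N))))
              (\<lambda>s. LIP_solution n (mat_image O1 (rv ` \<Lambda>)) (mat_image O2 (rv ` \<Lambda>)) (result_mat n s))"
          proof (rule runs_Seq, rule wp_Put[where a' = n and b' = n and p' = 0 and q' = 0 and val = "\<lambda>i j. real_of_int (Sg $$ (i, j))"], goal_cases)
            case (1 \<nu>)
            then show ?case using nl[OF 1 e5] by simp
          next
            case (2 i j \<nu> \<rho>)
            have "\<rho> ''S'' = ?\<rho>5 ''S''" using keep[OF 2(6), of "''S''"] by simp
            then have "rval (RSub (RCell ''S'' rr ss) (RCell ''S'' (NAdd nn rr) ss)) (\<nu>, \<rho>) = Pm $$ (i, j) - Pm $$ (n + i, j)"
              using 2(1-4) nl[OF 2(5) e5] S5[of i j] S5[of "n + i" j] by simp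
            also have "\<dots> = real_of_int ((if i = \<pi>' j then 1 else 0) - (if n + i = \<pi>' j then 1 else 0))"
              using 2(1,2) by (simp add: Pm)
            also have "\<dots> = real_of_int (Sg $$ (i, j))" unfolding ent[OF 2(1,2), symmetric] using 2(1,2) by (simp add: Sg_def)
            finally show ?case .
          next
            case (5 \<nu>6 \<rho>6)
            have n6: "\<nu>6 ''n'' = n" by (rule nl[OF 5(1) e5])
            have hM: "holds n (\<rho>6 ''M'') (rm Sg)" using 5(3) Sgc by (simp add: holds_def)
            have k6: "\<rho>6 ''Q1'' = ?\<rho>5 ''Q1''" "\<rho>6 ''Q2'' = ?\<rho>5 ''Q2''" using keep[OF 5(2)] by simp_all
            show ?case
            proof (rule runs_Seq, rule wp_Transp[where ?\<nu>0.0 = \<nu>6, OF n6 nN(1)], goal_cases)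
              case (2 \<nu>7 \<rho>7)
              have n7: "\<nu>7 ''n'' = n" by (rule nl[OF 2(1) n6])
              have hMt: "holds n (\<rho>7 ''Mt'') (transpose_mat (rm Sg))"
                by (rule holds_transpose[OF hM _ 2(3)]) (use Sgc in simp)
              have k7: "\<rho>7 ''Q1'' = ?\<rho>5 ''Q1''" "\<rho>7 ''Q2'' = ?\<rho>5 ''Q2''" using keep[OF 2(2)] k6 by simp_all
              show ?case
              proof (rule runs_Seq, rule wp_MatMul[where ?\<nu>0.0 = \<nu>7, OF n7 nN(1)], goal_cases)
                case (3 \<nu>8 \<rho>8)
                have n8: "\<nu>8 ''n'' = n" by (rule nl[OF 3(1) n7])
                have hU: "holds n (\<rho>8 ''U'') (Q1 * transpose_mat (rm Sg))"
                  by (rule holds_mult[OF _ hMt Q1c _ 3(3)]) (use hQ1' k7 Sgc in auto)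
                have k8: "\<rho>8 ''Q2'' = ?\<rho>5 ''Q2''" using keep[OF 3(2)] k7 by simp
                show ?case
                proof (rule runs_Seq, rule wp_Transp[where ?\<nu>0.0 = \<nu>8, OF n8 nN(1)], goal_cases)
                  case (2 \<nu>9 \<rho>9)
                  have n9: "\<nu>9 ''n'' = n" by (rule nl[OF 2(1) n8])
                  have hQt: "holds n (\<rho>9 ''Qt'') (transpose_mat Q2)"
                    by (rule holds_transpose[OF _ Q2c 2(3)]) (use hQ2' k8 in simp)
                  have k9: "\<rho>9 ''U'' = \<rho>8 ''U''" using keep[OF 2(2)] by simp
                  show ?case
                  proof (rule wp_MatMul[where ?\<nu>0.0 = \<nu>9, OF n9 nN(1)], goal_cases)
                    case (3 \<nu>10 \<rho>10)
                    let ?O = "(Q1 * transpose_mat (rm Sg)) * transpose_mat Q2"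
                    have hO: "holds n (\<rho>10 ''O'') ?O"
                      by (rule holds_mult[OF _ hQt _ _ 3(3)]) (use hU k9 Q1c Q2c Sgc in auto)
                    have "result_mat n (\<nu>10, \<rho>10) = ?O"
                      unfolding result_mat_def using holds_read[OF hO] Q1c Q2c Sgc by simp
                    moreover have "LIP_solution n (mat_image Q1 (rv ` ?\<Lambda>1)) (mat_image Q2 (rv ` ?\<Lambda>2)) ?O"
                      by (rule LIP_solution_signed_permutation[OF Q1 Q2 Sg(1) _ _ Sg(2)])
                        (use lcd_lattice.carrier[OF \<Lambda>1] lcd_lattice.carrier[OF \<Lambda>2] in blast)+
                    ultimately show ?case
                      using mat_image_change_basis[OF Q1c S1c S1(2) \<Lambda>c] mat_image_change_basis[OF Q2c S2c S2(2) \<Lambda>c] by simp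
                  qed simp_all
                qed simp
              qed simp_all
            qed simp
          qed (use nN in auto)
          show ?case by (rule runs_Seq_post[OF gi]) (use rest in simp)
        qed simp_all
      qed simp_all
    qed (use nk[OF e1] bas2 O H2 B2 hB2' in simp_all)
  qed (use n0 bas1 O H1 B1 hB1 in simp_all)
qed

text \<open>The summand 1 for each entry makes the size at least \<open>n * n\<close>, so the
  dimension is bounded as well; the logarithm bounds the entries themselves.\<close>

lemma mat_size_entry:
  assumes M: "M \<in> carrier_mat n n" and ij: "i < n" "j < n" and N: "mat_size M \<le> real N"
  shows "\<bar>M $$ (i, j)\<bar> \<le> 2 ^ N" "n \<le> N"
proof -
  have pos: "0 \<le> log 2 (1 + \<bar>M $$ (a, b)\<bar>)" for a b by (intro zero_le_log_cancel_iff[THEN iffD2]) auto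
  have ms: "mat_size M = (\<Sum>i<n. \<Sum>j<n. 1 + log 2 (1 + \<bar>M $$ (i, j)\<bar>))" using M by (simp add: mat_size_def)
  have "1 + log 2 (1 + \<bar>M $$ (i, j)\<bar>) \<le> (\<Sum>j<n. 1 + log 2 (1 + \<bar>M $$ (i, j)\<bar>))"
    using ij pos by (intro member_le_sum) (auto intro: add_nonneg_nonneg)
  also have "\<dots> \<le> mat_size M"
    unfolding ms using ij pos
    by (intro member_le_sum[of i _ "\<lambda>i. \<Sum>j<n. 1 + log 2 (1 + \<bar>M $$ (i, j)\<bar>)"]) (auto intro!: sum_nonneg add_nonneg_nonneg)
  finally have "log 2 (1 + \<bar>M $$ (i, j)\<bar>) \<le> real N" using N by linarith
  then have "1 + \<bar>M $$ (i, j)\<bar> \<le> 2 powr real N" by (subst (asm) log_le_iff) auto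
  then show "\<bar>M $$ (i, j)\<bar> \<le> 2 ^ N" by (simp add: powr_realpow)
  have "real n * 1 \<le> real n * real n" using ij by (intro mult_left_mono) auto
  also have "\<dots> = (\<Sum>i<n. \<Sum>j<n. (1 :: real))" by simp
  also have "\<dots> \<le> mat_size M" unfolding ms using pos by (intro sum_mono) auto
  finally show "n \<le> N" using N by linarith
qed

theorem theorem4p14:
  shows "\<exists>(prog :: com) (a :: real) (d :: nat).
    \<forall>(k :: nat) (n :: nat) (C :: int vec set) (O1 :: real mat) (O2 :: real mat)
      (L1 :: real vec set) (L2 :: real vec set) (B1 :: real mat) (B2 :: real mat)
      (zo :: real mat \<Rightarrow> real mat) (go :: real mat \<Rightarrow> real mat \<Rightarrow> real mat option).
      even k \<longrightarrow> \<not> 4 dvd k \<longrightarrow>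
      free_code k n C \<longrightarrow> LCD_code k n C \<longrightarrow>
      orthonormal_mat n O1 \<longrightarrow> orthonormal_mat n O2 \<longrightarrow>
      L1 = mat_image O1 (construction_A k n C) \<longrightarrow>
      L2 = mat_image O2 (construction_A k n C) \<longrightarrow>
      B1 \<in> carrier_mat n n \<longrightarrow> column_lattice B1 = L1 \<longrightarrow>
      B2 \<in> carrier_mat n n \<longrightarrow> column_lattice B2 = L2 \<longrightarrow>
      ZLIP_oracle n zo \<longrightarrow> GI_oracle (3 * n) go \<longrightarrow>
      (\<exists>t s. exec zo go prog (init_state n k B1 B2) t s \<and>
             real t \<le> a * input_size k B1 B2 ^ d \<and>
             LIP_solution n L1 L2 (result_mat n s))"
proof -
  obtain a d where ad: "\<And>s. main_time s \<le> a * (s + 1) ^ d" using poly_bounded_main_time unfolding poly_bounded_def by blast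
  \<comment> \<open>The factor \<open>3 ^ d\<close> passes from \<open>N\<close>, the input size
    \<open>I\<close> rounded up, back to \<open>I\<close>: since \<open>I\<close> is at least
    \<open>log 2 k\<close> and thus at least 1,
    \<open>N + 1 \<le> I + 2 \<le> 3 * I\<close>.\<close>
  show ?thesis
  proof (rule exI[of _ ReduceLIP], rule exI[of _ "real a * 3 ^ d"], rule exI[of _ d], intro allI impI)
    fix k n C O1 O2 L1 L2 B1 B2 zo go
    assume k: "even k" "\<not> 4 dvd k" and C: "free_code k n C" "LCD_code k n C"
      and O: "orthonormal_mat n O1" "orthonormal_mat n O2"
      and L: "L1 = mat_image O1 (construction_A k n C)" "L2 = mat_image O2 (construction_A k n C)"
      and B1: "B1 \<in> carrier_mat n n" "column_lattice B1 = L1"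
      and B2: "B2 \<in> carrier_mat n n" "column_lattice B2 = L2"
      and orc: "ZLIP_oracle n zo" "GI_oracle (3 * n) go"
    \<comment> \<open>The value \<open>k = 0\<close> is excluded because 4 divides 0.\<close>
    have k2: "2 \<le> k" using k by (cases "k = 0") (auto elim!: evenE)
    have k0: "0 < k" using k2 by simp
    have nonneg: "0 \<le> mat_size M" for M
      unfolding mat_size_def by (intro sum_nonneg add_nonneg_nonneg zero_le_log_cancel_iff[THEN iffD2]) auto
    let ?I = "input_size k B1 B2"
    have logk: "1 \<le> log 2 (real k)" using k2 by (subst le_log_iff) auto
    have I: "log 2 (real k) \<le> ?I" "mat_size B1 \<le> ?I" "mat_size B2 \<le> ?I"
      unfolding input_size_def using nonneg[of B1] nonneg[of B2] logk by linarith+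
    define N where "N = nat \<lceil>?I\<rceil>"
    have IN: "?I \<le> real N" "real N \<le> ?I + 1" using I(1) logk unfolding N_def by linarith+
    have N1: "1 \<le> N" using IN I logk by linarith
    have "real k \<le> 2 powr real N" using I(1) IN k0 by (subst (asm) log_le_iff) (auto intro: order_trans[of _ "2 powr ?I"])
    then have kN: "k \<le> 2 ^ N" by (simp add: powr_realpow)
    \<comment> \<open>\<open>mat_size_entry\<close> needs an entry to start from, so dimension 0 is
      treated separately.\<close>
    have nN: "n \<le> N"
    proof (cases n)
      case (Suc m)
      then show ?thesis using mat_size_entry(2)[OF B1(1), of 0 0 N] I IN by simp
    qed simp
    have b1: "\<bar>B1 $$ (i, j)\<bar> \<le> 2 ^ N" if "i < n" "j < n" for i j
      using mat_size_entry(1)[OF B1(1) that, of N] I IN by linarith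
    have b2: "\<bar>B2 $$ (i, j)\<bar> \<le> 2 ^ N" if "i < n" "j < n" for i j
      using mat_size_entry(1)[OF B2(1) that, of N] I IN by linarith
    have "runs zo go ReduceLIP (init_state n k B1 B2) (main_time N) (\<lambda>s. LIP_solution n L1 L2 (result_mat n s))"
      unfolding L construction_A_eq
      by (rule runs_ReduceLIP[OF orc k0 nN N1 kN lcd_lattice_code[OF C k0] O B1(1) _ b1 B2(1) _ b2])
        (use B1 B2 L in \<open>simp_all add: construction_A_eq\<close>)
    then obtain t s where ts: "exec zo go ReduceLIP (init_state n k B1 B2) t s" "t \<le> main_time N" "LIP_solution n L1 L2 (result_mat n s)"
      unfolding runs_def by blast
    have "t \<le> a * (N + 1) ^ d" using ts(2) ad[of N] by linarith
    then have "real t \<le> real (a * (N + 1) ^ d)" by (rule of_nat_mono)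
    also have "\<dots> = real a * (real N + 1) ^ d" by (simp add: add.commute)
    also have "\<dots> \<le> real a * (3 * ?I) ^ d"
      using IN I(1) logk by (intro mult_left_mono power_mono) auto
    also have "\<dots> = real a * 3 ^ d * ?I ^ d" by (simp add: power_mult_distrib)
    finally show "\<exists>t s. exec zo go ReduceLIP (init_state n k B1 B2) t s \<and>
             real t \<le> real a * 3 ^ d * input_size k B1 B2 ^ d \<and> LIP_solution n L1 L2 (result_mat n s)"
      using ts by blast
  qed
qed

end
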